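(* Let $\mathsf{k}$ be a field of characteristic zero and let $X=\{P_1,\dots,P_s\}$ be a set of $s$ distinct ($\mathsf{k}$-rational) points in $\mathbb{P}^2_{\mathsf{k}}$. Let $L_i$ be the linear form dual to $P_i$, and let $A$ be any Artinian Gorenstein quotient of $A(X)$ with dual generator $F=\sum_{i=1}^s\alpha_iL_i^d$, where $\alpha_i\in\mathsf{k}$ and $d\geq 2\tau(X)$. Suppose that the first difference $\Delta h_A$, taken in degrees $0,\dots,\lfloor d/2\rfloor$ and with trailing zeros omitted, is equal to one of the following vectors for some $m\geq 2$: $$(1,2,\underbrace{1,\dots,1}_m),\quad (1,2,2,\underbrace{1,\dots,1}_m),\quad (1,2,3,\underbrace{1,\dots,1}_m),\quad (1,\underbrace{2,\dots,2}_m),\quad (1,2,3,\underbrace{2,\dots,2}_m).$$ Then $A$ satisfies the strong Lefschetz property.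
   Context: Let $S=\mathsf{k}[x_0,x_1,x_2]$ (standard grading) act on $R=\mathsf{k}[X_0,X_1,X_2]$ by letting $x_i$ act as $\partial/\partial X_i$; the action is denoted $\circ$. For $F\in R$ homogeneous of degree $d$, $F\ne 0$, the algebra with Macaulay dual generator $F$ is $A=S/\mathrm{Ann}_S(F)$, $\mathrm{Ann}_S(F)=\{g\in S: g\circ F=0\}$; it is Artinian Gorenstein of socle degree $d$. Its Hilbert function is $h_A(i)=\dim_{\mathsf{k}}A_i$, and $\Delta h_A(0)=h_A(0)$, $\Delta h_A(i)=h_A(i)-h_A(i-1)$ for $i\ge 1$. For a finite set $X$ of $s$ distinct points in $\mathbb{P}^2_{\mathsf{k}}$, $I(X)\subset S$ is the homogeneous ideal generated by forms vanishing on $X$, $A(X)=S/I(X)$, $h_{A(X)}(i)=\dim_{\mathsf{k}}A(X)_i$, and $\tau(X)=\min\{i: h_{A(X)}(i)=s\}$. For $P=(a_0:a_1:a_2)$ (with a fixed choice of coordinates) the dual linear form is $L=a_0X_0+a_1X_1+a_2X_2\in R$. If $F=\sum_i\alpha_iL_i^d$ with the $L_i$ dual to the points $P_i\in X$, then $I(X)\subseteq\mathrm{Ann}_S(F)$, so $S/\mathrm{Ann}_S(F)$ is a quotient of $A(X)$. A graded Artinian algebra $A$ satisfies the strong Lefschetz property (SLP) if there is a linear form $\ell\in A_1$ such that $\times\ell^j:A_i\to A_{i+j}$ has maximal rank for all $i,j\geq 0$. *)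

theory Defs
  imports
    "HOL-Library.Poly_Mapping"
    "HOL-Library.Numeral_Type"
    "HOL-Library.More_List"
    "HOL-Algebra.QuotRing"
    "HOL-Algebra.Embedded_Algebras"
    "HOL-Decision_Procs.Algebra_Aux"
begin

section \<open>Polynomials in three variables\<close>

text \<open>
  Both \<open>S = k[x\<^sub>0,x\<^sub>1,x\<^sub>2]\<close> and \<open>R = k[X\<^sub>0,X\<^sub>1,X\<^sub>2]\<close> are represented by the following type;
  the variables are indexed by the three elements \<open>0, 1, 2\<close> of the numeral type \<open>3\<close>.
\<close>

type_synonym expo = "3 \<Rightarrow>\<^sub>0 nat"
type_synonym 'k poly3 = "expo \<Rightarrow>\<^sub>0 'k"

abbreviation S_ring :: "'k::field poly3 ring"
  where "S_ring \<equiv> cring_class_ops"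

definition const :: "'k::field \<Rightarrow> 'k poly3"
  where "const c = Poly_Mapping.single 0 c"

definition var :: "3 \<Rightarrow> 'k::field poly3"
  where "var i = Poly_Mapping.single (Poly_Mapping.single i 1) 1"

definition expo_deg :: "expo \<Rightarrow> nat"
  where "expo_deg a = (\<Sum>i\<in>UNIV. Poly_Mapping.lookup a i)"

text \<open>The graded component of degree \<open>n\<close>, which contains \<open>0\<close>.\<close>

definition forms :: "nat \<Rightarrow> 'k::field poly3 set"
  where "forms n = {f. \<forall>a\<in>Poly_Mapping.keys f. expo_deg a = n}"

definition eval_poly :: "'k::field poly3 \<Rightarrow> (3 \<Rightarrow> 'k) \<Rightarrow> 'k"
  where "eval_poly f v =
    (\<Sum>a\<in>Poly_Mapping.keys f.
       Poly_Mapping.lookup f a * (\<Prod>i\<in>UNIV. v i ^ Poly_Mapping.lookup a i))"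


section \<open>The differentiation action and Macaulay dual generators\<close>

text \<open>
  The subtraction of exponents truncates, but only in terms whose coefficient vanishes.
\<close>

definition partial_deriv :: "3 \<Rightarrow> 'k::field poly3 \<Rightarrow> 'k poly3"
  where "partial_deriv i F =
    (\<Sum>a\<in>Poly_Mapping.keys F.
       Poly_Mapping.single (a - Poly_Mapping.single i 1)
         (of_nat (Poly_Mapping.lookup a i) * Poly_Mapping.lookup F a))"

definition diff_action :: "'k::field poly3 \<Rightarrow> 'k poly3 \<Rightarrow> 'k poly3"
  where "diff_action g F =
    (\<Sum>a\<in>Poly_Mapping.keys g.
       const (Poly_Mapping.lookup g a) *
         (partial_deriv 0 ^^ Poly_Mapping.lookup a 0)
           ((partial_deriv 1 ^^ Poly_Mapping.lookup a 1)
             ((partial_deriv 2 ^^ Poly_Mapping.lookup a 2) F)))"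

definition Ann :: "'k::field poly3 \<Rightarrow> 'k poly3 set"
  where "Ann F = {g. diff_action g F = 0}"


section \<open>Graded quotients of \<open>S\<close>\<close>

definition quot_alg :: "'k::field poly3 set \<Rightarrow> 'k poly3 set ring"
  where "quot_alg I = S_ring Quot I"

definition quot_piece :: "'k::field poly3 set \<Rightarrow> nat \<Rightarrow> 'k poly3 set set"
  where "quot_piece I n = (\<lambda>f. I +>\<^bsub>S_ring\<^esub> f) ` forms n"

text \<open>
  The copy of the ground field inside \<open>S / I\<close> (a subfield as soon as \<open>I\<close> is a proper ideal),
  over which dimensions in \<open>S / I\<close> are taken.
\<close>

definition quot_scalars :: "'k::field poly3 set \<Rightarrow> 'k poly3 set set"
  where "quot_scalars I = (\<lambda>c. I +>\<^bsub>S_ring\<^esub> const c) ` UNIV"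

definition hilbert_fun :: "'k::field poly3 set \<Rightarrow> nat \<Rightarrow> nat"
  where "hilbert_fun I n = ring.dim (quot_alg I) (quot_scalars I) (quot_piece I n)"

definition first_diff :: "(nat \<Rightarrow> nat) \<Rightarrow> nat \<Rightarrow> int"
  where "first_diff h n = (if n = 0 then int (h 0) else int (h n) - int (h (n - 1)))"

text \<open>
  A graded algebra is given by its ring \<open>A\<close>, the subfield \<open>K\<close> of scalars and the family \<open>G\<close> of
  its homogeneous components. A linear map \<open>V \<rightarrow> W\<close> has maximal rank if the dimension of its image
  is \<open>min (dim V) (dim W)\<close>.
\<close>

definition strong_Lefschetz :: "'a ring \<Rightarrow> 'a set \<Rightarrow> (nat \<Rightarrow> 'a set) \<Rightarrow> bool"
  where "strong_Lefschetz A K G \<longleftrightarrow>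
    (\<exists>l\<in>G 1. \<forall>i j.
       ring.dim A K ((\<lambda>a. (l [^]\<^bsub>A\<^esub> (j::nat)) \<otimes>\<^bsub>A\<^esub> a) ` G i) =
         min (ring.dim A K (G i)) (ring.dim A K (G (i + j))))"


section \<open>Points in the projective plane\<close>

text \<open>
  The point with homogeneous coordinates \<open>v\<close> (\<open>v \<noteq> 0\<close>), as the set of all its coordinate vectors.
\<close>

definition proj_point :: "(3 \<Rightarrow> 'k::field) \<Rightarrow> (3 \<Rightarrow> 'k) set"
  where "proj_point v = {(\<lambda>i. c * v i) | c. c \<noteq> 0}"

definition vanishing_ideal :: "(3 \<Rightarrow> 'k::field) set set \<Rightarrow> 'k poly3 set"
  where "vanishing_ideal X =
    Idl\<^bsub>S_ring\<^esub> {f. (\<exists>n. f \<in> forms n) \<and> (\<forall>P\<in>X. \<forall>v\<in>P. eval_poly f v = 0)}"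

definition tau :: "(3 \<Rightarrow> 'k::field) set set \<Rightarrow> nat"
  where "tau X = (LEAST n. hilbert_fun (vanishing_ideal X) n = card X)"

definition dual_linear_form :: "(3 \<Rightarrow> 'k::field) \<Rightarrow> 'k poly3"
  where "dual_linear_form v = (\<Sum>i\<in>UNIV. const (v i) * var i)"

end

theory Submission
  imports Defs "HOL-Library.Function_Algebras" "HOL-Computational_Algebra.Polynomial"
    "Jordan_Normal_Form.Determinant"
begin

text \<open>
  Restrict to the points \<open>v\<close> that occur in \<open>F = (\<Sum>v\<in>P. w v L\<^sub>v\<^sup>d)\<close> with nonzero weight. By Gorenstein duality,
  \<open>l\<close> is a strong Lefschetz element iff each bilinear form
  \<open>(f, g) \<mapsto> (\<Sum>v\<in>P. w v l(v)\<^sup>d\<^sup>-\<^sup>2\<^sup>i f(v) g(v))\<close> on forms of degree \<open>i \<le> d div 2\<close> (a higher Hessian of \<open>F\<close>)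
  has no kernel besides the forms vanishing on \<open>P\<close>. This is an open condition on \<open>l\<close>, so every \<open>i\<close> can be
  treated separately. For \<open>i \<ge> t\<close>, where \<open>t\<close> is the least degree in which forms separate \<open>P\<close>, any \<open>l\<close> that
  vanishes nowhere on \<open>P\<close> works.

  For \<open>i < t\<close> the vector \<open>\<Delta>\<close> forces almost all points onto a line (tail \<open>1, 1\<close>) or onto a conic (tail
  \<open>2, 2\<close>). Parametrising that curve turns nondegeneracy into a statement about polynomials in one variable,
  with \<open>l\<close> restricting to \<open>x - y\<close> or its square for generic \<open>y\<close>; the few remaining points are split off by
  forms of degree \<open>i\<close> that vanish on the curve. A conic and one more point in degree \<open>i = 1\<close> admit no such
  form; this case follows from degree \<open>2\<close>: if the first Hessian vanished identically, differentiating its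
  kernel along lines would give a kernel of the second one.
\<close>

text \<open>Genericity in one variable comes from Wronskians. If \<open>f\<close> is a kernel
  element for \<open>l = x - y\<close>, then \<open>(x - y)^e f\<close> lies in a space of dimension
  at most \<open>e\<close> that does not depend on \<open>y\<close>; in characteristic zero such a
  space has a nonzero element vanishing to order \<open>e\<close> at \<open>y\<close> for finitely
  many \<open>y\<close> only. The dimension bound needs between \<open>i + 1\<close> and
  \<open>e + i + 1\<close> points. For the \<open>t + 1\<close> points of a line, with
  \<open>e = d - 2 i\<close> and \<open>i < t\<close>, this is where \<open>d \<ge> 2 t\<close>
  enters.

  For \<open>(1,2,...,2)\<close> the conic exists by dimension. Otherwise the curve is found through
  the linear relations between the evaluations at \<open>P\<close>: the tail of
  \<open>\<Delta>\<close> counts them in degrees \<open>t - 1\<close> and \<open>t - 2\<close>, and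
  products of relations with linear forms reveal the curve that supports them.

  The conic may split. Its two lines have no common parametrisation; a form restricts to a pair of
  polynomials that agree at the common point. Eliminating one line only changes the weight of that
  point on the other, possibly to zero, so the point counts leave it out.\<close>

section \<open>Polynomials in one variable: Wronskians and weighted pairings\<close>

lemma pderiv_sum: "pderiv (sum f A) = (\<Sum>x\<in>A. pderiv (f x))"
  by (induction A rule: infinite_finite_induct) (simp_all add: pderiv_add)

text \<open>A vanishing Wronskian. Its leading term carries the factor
  \<open>degree r - degree h\<close>, nonzero in characteristic zero unless the degrees agree.
  Subtracting from \<open>g\<close> the multiple of \<open>h\<close> that cancels the coefficient at
  \<open>degree h\<close> keeps the Wronskian zero and rules out equal degrees, so nothing
  remains.\<close>

lemma pderiv_proportional:
  fixes g h :: "'k::field_char_0 poly"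
  assumes eq: "pderiv g * h = g * pderiv h" and h: "h \<noteq> 0"
  shows "\<exists>c. g = smult c h"
proof -
  define c where "c = coeff g (degree h) / lead_coeff h"
  define r where "r = g - smult c h"
  have r: "pderiv r * h = r * pderiv h"
    using eq by (simp add: r_def pderiv_diff pderiv_smult algebra_simps)
  have c0: "coeff r (degree h) = 0"
    using h by (simp add: r_def c_def)
  have "r = 0"
  proof (rule ccontr)
    assume r0: "r \<noteq> 0"
    have "of_nat (degree r) * (lead_coeff r * lead_coeff h) = of_nat (degree h) * (lead_coeff r * lead_coeff h)"
    proof -
      have "lead_coeff (pderiv r) = of_nat (degree r) * lead_coeff r" for r :: "'k poly"
      proof (cases "degree r")
        case 0
        then show ?thesis by (simp add: pderiv_eq_0_iff[THEN iffD2])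
      next
        case (Suc n)
        then show ?thesis by (simp add: degree_pderiv coeff_pderiv)
      qed
      then show ?thesis
        using arg_cong[OF r, of lead_coeff] by (simp add: lead_coeff_mult algebra_simps)
    qed
    then have "degree r = degree h"
      using r0 h by simp
    then have "lead_coeff r = 0" using c0 by simp
    then show False using r0 by simp
  qed
  then show ?thesis by (auto simp: r_def)
qed

lemma linear_power_dvd_pderiv:
  fixes g :: "'k::idom poly"
  assumes "[:-y, 1:] ^ Suc e dvd g"
  shows "[:-y, 1:] ^ e dvd pderiv g"
proof -
  obtain q where q: "g = [:-y, 1:] ^ Suc e * q" using assms by (auto elim: dvdE)
  have "pderiv g = [:-y, 1:] ^ Suc e * pderiv q + q * smult (of_nat (Suc e)) ([:-y, 1:] ^ e)"
    unfolding q by (subst pderiv_mult, subst pderiv_power_Suc) (simp add: pderiv_pCons)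
  also have "[:-y, 1:] ^ e dvd \<dots>"
    by (intro dvd_add dvd_mult dvd_mult2 dvd_smult dvd_refl le_imp_power_dvd) simp
  finally show ?thesis .
qed

text \<open>The exceptional \<open>y\<close> would be zeros of the Wronskian determinant of the
  \<open>h k\<close>. The determinant is avoided by reducing the order: dividing by one generator
  and differentiating lowers both the number of generators and the order of vanishing by
  one.\<close>

lemma finite_high_order_points:
  fixes h :: "nat \<Rightarrow> 'k::field_char_0 poly"
  shows "finite {y. \<exists>c. (\<Sum>k<e. smult (c k) (h k)) \<noteq> 0 \<and> [:-y, 1:] ^ e dvd (\<Sum>k<e. smult (c k) (h k))}"
proof (induction e arbitrary: h)
  case 0
  then show ?case by simp
next
  case (Suc e)
  show ?case
  proof (cases "h e = 0")
    case True
    have "{y. \<exists>c. (\<Sum>k<Suc e. smult (c k) (h k)) \<noteq> 0 \<and> [:-y, 1:] ^ Suc e dvd (\<Sum>k<Suc e. smult (c k) (h k))}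
      \<subseteq> {y. \<exists>c. (\<Sum>k<e. smult (c k) (h k)) \<noteq> 0 \<and> [:-y, 1:] ^ e dvd (\<Sum>k<e. smult (c k) (h k))}"
    proof clarify
      fix y c
      assume c: "(\<Sum>k<Suc e. smult (c k) (h k)) \<noteq> 0" "[:-y, 1:] ^ Suc e dvd (\<Sum>k<Suc e. smult (c k) (h k))"
      have eq: "(\<Sum>k<Suc e. smult (c k) (h k)) = (\<Sum>k<e. smult (c k) (h k))" using True by simp
      have "[:-y, 1:] ^ e dvd (\<Sum>k<e. smult (c k) (h k))"
        using c(2) unfolding eq by (rule power_le_dvd) simp
      with c(1) show "\<exists>c. (\<Sum>k<e. smult (c k) (h k)) \<noteq> 0 \<and> [:-y, 1:] ^ e dvd (\<Sum>k<e. smult (c k) (h k))"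
        unfolding eq by blast
    qed
    then show ?thesis using Suc.IH finite_subset by blast
  next
    case False
    \<comment> \<open>The numerator of the derivative of \<open>g / h e\<close>. It kills
      \<open>h e\<close>, so only \<open>e\<close> generators survive, and an element it annihilates
      is a multiple of \<open>h e\<close>, whose zeros are finite in number.\<close>
    define D where "D g = pderiv g * h e - g * pderiv (h e)" for g
    have D_sum: "D (\<Sum>k<Suc e. smult (c k) (h k)) = (\<Sum>k<e. smult (c k) (D (h k)))" for c
    proof -
      have "D (\<Sum>k<Suc e. smult (c k) (h k)) = (\<Sum>k<Suc e. smult (c k) (D (h k)))"
        unfolding D_def pderiv_sum sum_distrib_right sum_subtractf[symmetric]
        by (simp add: pderiv_smult smult_diff_right)
      then show ?thesis by (simp add: D_def)
    qed
    have "{y. \<exists>c. (\<Sum>k<Suc e. smult (c k) (h k)) \<noteq> 0 \<and> [:-y, 1:] ^ Suc e dvd (\<Sum>k<Suc e. smult (c k) (h k))}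
      \<subseteq> {y. poly (h e) y = 0} \<union>
        {y. \<exists>c. (\<Sum>k<e. smult (c k) (D (h k))) \<noteq> 0 \<and> [:-y, 1:] ^ e dvd (\<Sum>k<e. smult (c k) (D (h k)))}"
    proof clarify
      fix y c
      define g where "g = (\<Sum>k<Suc e. smult (c k) (h k))"
      assume g0: "(\<Sum>k<Suc e. smult (c k) (h k)) \<noteq> 0"
        and dv: "[:-y, 1:] ^ Suc e dvd (\<Sum>k<Suc e. smult (c k) (h k))"
        and notin: "\<nexists>c. (\<Sum>k<e. smult (c k) (D (h k))) \<noteq> 0 \<and> [:-y, 1:] ^ e dvd (\<Sum>k<e. smult (c k) (D (h k)))"
      have dvg: "[:-y, 1:] ^ Suc e dvd g" using dv by (simp only: g_def)
      have "[:-y, 1:] ^ e dvd D g"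
        unfolding D_def
        by (intro dvd_diff dvd_mult2 linear_power_dvd_pderiv[OF dvg] power_le_dvd[OF dvg]) simp
      then have "D g = 0" using notin D_sum[of c] unfolding g_def by metis
      then obtain a where a: "g = smult a (h e)"
        using pderiv_proportional[of g "h e"] False by (auto simp: D_def)
      with g0 have "a \<noteq> 0" by (auto simp: g_def)
      moreover have "poly g y = 0"
        using dvd_trans[OF dvd_power[of "Suc e" "[:-y, 1:]"] dvg] by (simp add: poly_eq_0_iff_dvd)
      ultimately show "poly (h e) y = 0" using a by simp
    qed
    moreover have "finite {y. poly (h e) y = 0}" using False by (simp add: poly_roots_finite)
    ultimately show ?thesis using Suc.IH[of "\<lambda>k. D (h k)"] finite_subset by blast
  qed
qed

text \<open>Jointly injective evaluations at \<open>card G\<close> points bound the dimension by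
  \<open>card G\<close>. The conclusion is a spanning family rather than a basis, which is the shape
  \<open>finite_high_order_points\<close> consumes.\<close>

lemma spanned_by_evaluation:
  fixes W :: "'k::field poly set"
  assumes "finite G"
    and "\<And>g h. g \<in> W \<Longrightarrow> h \<in> W \<Longrightarrow> g + h \<in> W" and "\<And>a h. h \<in> W \<Longrightarrow> smult a h \<in> W"
    and "\<And>h. h \<in> W \<Longrightarrow> (\<And>x. x \<in> G \<Longrightarrow> poly h x = 0) \<Longrightarrow> h = 0"
  shows "\<exists>b :: nat \<Rightarrow> 'k poly. \<forall>h\<in>W. \<exists>c. h = (\<Sum>k<card G. smult (c k) (b k))"
  using assms
proof (induction G arbitrary: W rule: finite_induct)
  case empty
  then show ?case by force
next
  case (insert x G)
  define W0 where "W0 = {h\<in>W. poly h x = 0}"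
  have "\<exists>b :: nat \<Rightarrow> 'k poly. \<forall>h\<in>W0. \<exists>c. h = (\<Sum>k<card G. smult (c k) (b k))"
  proof (rule insert.IH)
    show "h = 0" if "h \<in> W0" "\<And>y. y \<in> G \<Longrightarrow> poly h y = 0" for h
      using insert.prems(3)[of h] that by (auto simp: W0_def)
  qed (use insert.prems(1,2) in \<open>auto simp: W0_def\<close>)
  then obtain b :: "nat \<Rightarrow> 'k poly" where b: "\<forall>h\<in>W0. \<exists>c. h = (\<Sum>k<card G. smult (c k) (b k))" ..
  show ?case
  proof (cases "W0 = W")
    case True
    \<comment> \<open>All of \<open>W\<close> vanishes at \<open>x\<close>; the additional generator
      is padded by \<open>0\<close>.\<close>
    have "\<exists>c. h = (\<Sum>k<card (insert x G). smult (c k) ((b (card G := 0)) k))" if "h \<in> W" for h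
    proof -
      have "h \<in> W0" using that True by simp
      then obtain c where "h = (\<Sum>k<card G. smult (c k) (b k))" using b by blast
      then have "h = (\<Sum>k<card (insert x G). smult (c k) ((b (card G := 0)) k))"
        using insert.hyps by simp
      then show ?thesis by (rule exI[of _ c])
    qed
    then show ?thesis by (intro exI[of _ "b (card G := 0)"] ballI)
  next
    case False
    then obtain h0 where h0: "h0 \<in> W" "poly h0 x \<noteq> 0" by (auto simp: W0_def)
    have "\<exists>c. h = (\<Sum>k<card (insert x G). smult (c k) ((b (card G := h0)) k))" if "h \<in> W" for h
    proof -
      define a where "a = poly h x / poly h0 x"
      have "h + smult (-a) h0 \<in> W0"
        using insert.prems(1)[OF that insert.prems(2)[OF h0(1), of "-a"]] h0(2)
        by (simp add: W0_def a_def del: smult_minus_left)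
      then obtain c where c: "h + smult (-a) h0 = (\<Sum>k<card G. smult (c k) (b k))" using b by blast
      have "h = (\<Sum>k<card (insert x G). smult ((c (card G := a)) k) ((b (card G := h0)) k))"
        using insert.hyps c by (simp add: algebra_simps)
      then show ?thesis by (rule exI[of _ "c (card G := a)"])
    qed
    then show ?thesis by (intro exI[of _ "b (card G := h0)"] ballI)
  qed
qed

lemma poly_eq_0_of_many_zeros:
  fixes h :: "'k::idom poly"
  assumes "\<And>x. x \<in> A \<Longrightarrow> poly h x = 0" "finite A" "degree h < card A"
  shows "h = 0"
proof (rule ccontr)
  assume "h \<noteq> 0"
  then have "card A \<le> card {x. poly h x = 0}"
    by (intro card_mono) (auto simp: assms poly_roots_finite)
  also have "\<dots> \<le> degree h" using \<open>h \<noteq> 0\<close> by (rule card_poly_roots_bound)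
  finally show False using assms(3) by simp
qed

lemma lagrange_basis:
  fixes S :: "'k::field set"
  assumes "finite S" "x \<in> S"
  obtains g where "degree g < card S" "poly g x = 1" "\<And>y. y \<in> S \<Longrightarrow> y \<noteq> x \<Longrightarrow> poly g y = 0"
proof -
  define q where "q = (\<Prod>y\<in>S - {x}. [:-y, 1:])"
  have q0: "poly q x \<noteq> 0" using assms by (auto simp: q_def poly_prod)
  have "degree q = card (S - {x})" unfolding q_def by (subst degree_prod_eq_sum_degree) auto
  then have dq: "degree q < card S" using assms by (metis card_Diff1_less)
  show ?thesis
  proof (rule that[of "smult (1 / poly q x) q"])
    show "degree (smult (1 / poly q x) q) < card S" using dq by (meson degree_smult_le le_less_trans)
  qed (use q0 assms in \<open>auto simp: q_def poly_prod\<close>)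
qed

text \<open>\<open>W\<close> contains \<open>(x - y)^e f\<close> for each kernel element
  \<open>f\<close>, whatever \<open>y\<close> is. An element of \<open>W\<close> that vanishes at
  the \<open>e\<close> points of \<open>G\<close> is zero: orthogonality to a Lagrange basis on
  \<open>S0\<close> gives the remaining points of \<open>S\<close>, and then there are
  \<open>e + i + 1\<close> zeros for degree at most \<open>e + i\<close>.\<close>

lemma finite_degenerate:
  fixes S :: "'k::field_char_0 set"
  assumes S: "finite S" and w: "\<And>x. x \<in> S \<Longrightarrow> w x \<noteq> 0"
    and lo: "i + 1 \<le> card S" and hi: "card S \<le> e + i + 1"
  shows "finite {y. \<exists>f. degree f \<le> i \<and> f \<noteq> 0 \<and>
    (\<forall>g. degree g \<le> i \<longrightarrow> (\<Sum>x\<in>S. w x * (x - y) ^ e * poly f x * poly g x) = 0)}"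
proof -
  define W where "W = {h. degree h \<le> e + i \<and> (\<forall>g. degree g \<le> i \<longrightarrow> (\<Sum>x\<in>S. w x * poly h x * poly g x) = 0)}"
  \<comment> \<open>As many points as polynomials of degree \<open>i\<close> can
    interpolate.\<close>
  obtain S0 where S0: "S0 \<subseteq> S" "card S0 = i + 1" using lo obtain_subset_with_card_n by metis
  have fS0: "finite S0" using S S0 finite_subset by blast
  \<comment> \<open>Auxiliary points outside \<open>S\<close> that fill the number of zeros up to
    \<open>e + i + 1\<close>.\<close>
  have "\<exists>E :: 'k set. finite E \<and> card E = e + i + 1 - card S \<and> E \<inter> S = {}"
  proof -
    have "infinite (UNIV - S)" using S infinite_UNIV_char_0 by simp
    then obtain E where "finite E" "card E = e + i + 1 - card S" "E \<subseteq> UNIV - S"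
      using infinite_arbitrarily_large by blast
    then show ?thesis by blast
  qed
  then obtain E :: "'k set" where E: "finite E" "card E = e + i + 1 - card S" "E \<inter> S = {}" by blast
  define G where "G = (S - S0) \<union> E"
  have cG: "card G = e"
  proof -
    have "card (S - S0) = card S - (i + 1)" using S0 fS0 by (simp add: card_Diff_subset)
    moreover have "card G = card (S - S0) + card E"
      unfolding G_def using E S by (intro card_Un_disjoint) auto
    ultimately show ?thesis using E lo hi by simp
  qed
  have inj: "h = 0" if h: "h \<in> W" and z: "\<And>x. x \<in> G \<Longrightarrow> poly h x = 0" for h
  proof -
    have hS: "poly h x = 0" if x: "x \<in> S" for x
    proof (cases "x \<in> S0")
      case True
      obtain g where g: "degree g < card S0" "poly g x = 1" "\<And>y. y \<in> S0 \<Longrightarrow> y \<noteq> x \<Longrightarrow> poly g y = 0"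
        using lagrange_basis[OF fS0 True] by blast
      have "(\<Sum>x\<in>S. w x * poly h x * poly g x) = 0" using h g S0 by (auto simp: W_def)
      also have "(\<Sum>x\<in>S. w x * poly h x * poly g x) = (\<Sum>u\<in>S. if u = x then w x * poly h x else 0)"
      proof (rule sum.cong)
        fix u assume "u \<in> S"
        then show "w u * poly h u * poly g u = (if u = x then w x * poly h x else 0)"
          using g z[of u] by (cases "u \<in> S0") (auto simp: G_def)
      qed simp
      also have "\<dots> = w x * poly h x" using x S by simp
      finally show ?thesis using w x by simp
    next
      case False
      then show ?thesis using x z by (simp add: G_def)
    qed
    show "h = 0"
    proof (rule poly_eq_0_of_many_zeros[of "S \<union> E"])
      show "degree h < card (S \<union> E)"
        using h E S hi by (subst card_Un_disjoint) (auto simp: W_def)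
    qed (use S E hS z in \<open>auto simp: G_def\<close>)
  qed
  have "\<exists>b :: nat \<Rightarrow> 'k poly. \<forall>h\<in>W. \<exists>c. h = (\<Sum>k<card G. smult (c k) (b k))"
  proof (rule spanned_by_evaluation)
    show "finite G" using S E by (simp add: G_def)
    show "g + h \<in> W" if "g \<in> W" "h \<in> W" for g h
      using that by (auto simp: W_def degree_add_le algebra_simps sum.distrib)
    show "smult a h \<in> W" if "h \<in> W" for a h
    proof -
      have "(\<Sum>x\<in>S. w x * poly (smult a h) x * poly g x) = a * (\<Sum>x\<in>S. w x * poly h x * poly g x)" for g
        by (simp add: sum_distrib_left algebra_simps)
      then show ?thesis using that by (auto simp: W_def intro: order_trans[OF degree_smult_le])
    qed
  qed (use inj in blast)
  then obtain b :: "nat \<Rightarrow> 'k poly" where b: "\<forall>h\<in>W. \<exists>c. h = (\<Sum>k<e. smult (c k) (b k))"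
    unfolding cG by blast
  have "{y. \<exists>f. degree f \<le> i \<and> f \<noteq> 0 \<and>
      (\<forall>g. degree g \<le> i \<longrightarrow> (\<Sum>x\<in>S. w x * (x - y) ^ e * poly f x * poly g x) = 0)}
    \<subseteq> {y. \<exists>c. (\<Sum>k<e. smult (c k) (b k)) \<noteq> 0 \<and> [:-y, 1:] ^ e dvd (\<Sum>k<e. smult (c k) (b k))}"
  proof clarify
    fix y and f :: "'k poly" assume f: "degree f \<le> i" "f \<noteq> 0"
      "\<forall>g. degree g \<le> i \<longrightarrow> (\<Sum>x\<in>S. w x * (x - y) ^ e * poly f x * poly g x) = 0"
    define h where "h = [:-y, 1:] ^ e * f"
    have "degree h \<le> e + i"
      unfolding h_def using f(1) by (intro order_trans[OF degree_mult_le]) (simp add: degree_linear_power)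
    then have "h \<in> W" using f(3) by (simp add: W_def h_def algebra_simps)
    then obtain c where c: "h = (\<Sum>k<e. smult (c k) (b k))" using b by blast
    moreover have "h \<noteq> 0" "[:-y, 1:] ^ e dvd h" using f(2) by (auto simp: h_def)
    ultimately show "\<exists>c. (\<Sum>k<e. smult (c k) (b k)) \<noteq> 0 \<and> [:-y, 1:] ^ e dvd (\<Sum>k<e. smult (c k) (b k))"
      by metis
  qed
  then show ?thesis using finite_high_order_points finite_subset by blast
qed


section \<open>Coordinates in three-space and vector spaces of functions\<close>

lemma UNIV_3: "(UNIV :: 3 set) = {0, 1, 2}"
proof -
  have "i = 0 \<or> i = 1 \<or> i = 2" for i :: 3
  proof (cases i)
    case (of_int z)
    then have "z = 0 \<or> z = 1 \<or> z = 2" by auto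
    then show ?thesis using of_int by auto
  qed
  then show ?thesis by auto
qed

lemma three_distinct [simp]: "(0::3) \<noteq> 1" "(0::3) \<noteq> 2" "(1::3) \<noteq> 2" "(1::3) \<noteq> 0" "(2::3) \<noteq> 0" "(2::3) \<noteq> 1"
  by (simp_all)

lemma sum_UNIV_3: "(\<Sum>i\<in>(UNIV::3 set). f i) = f 0 + f 1 + (f 2 :: 'a::comm_monoid_add)"
  unfolding UNIV_3 by (simp add: add.assoc)

lemma prod_UNIV_3: "(\<Prod>i\<in>(UNIV::3 set). f i) = f 0 * f 1 * (f 2 :: 'a::comm_monoid_mult)"
  unfolding UNIV_3 by (simp add: mult.assoc)

lemma all_3: "(\<forall>i::3. P i) \<longleftrightarrow> P 0 \<and> P 1 \<and> P 2"
  using UNIV_3 by (metis UNIV_I insertE singletonD)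

lemma vec3_eq_iff: "(u :: 3 \<Rightarrow> 'k) = v \<longleftrightarrow> u 0 = v 0 \<and> u 1 = v 1 \<and> u 2 = v 2"
  by (simp add: fun_eq_iff all_3)

text \<open>Coordinate vectors, forms and functionals are all functions into the field, so one
  scalar multiplication and one interpretation \<open>fs\<close> serve for all of them.\<close>

definition scl :: "'k::field \<Rightarrow> ('a \<Rightarrow> 'k) \<Rightarrow> 'a \<Rightarrow> 'k"
  where "scl c f = (\<lambda>x. c * f x)"

lemma scl_apply [simp]: "scl c f x = c * f x"
  by (simp add: scl_def)

interpretation fs: vector_space "scl :: 'k::field \<Rightarrow> ('a \<Rightarrow> 'k) \<Rightarrow> 'a \<Rightarrow> 'k"
  by unfold_locales (simp_all add: scl_def fun_eq_iff algebra_simps)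

lemma sum_fun_apply: "(\<Sum>k\<in>A. F k) x = (\<Sum>k\<in>A. (F k x :: 'k::comm_monoid_add))"
  by (induction A rule: infinite_finite_induct) simp_all

subsection \<open>Linear forms on three-space\<close>

definition dot :: "(3 \<Rightarrow> 'k::field) \<Rightarrow> (3 \<Rightarrow> 'k) \<Rightarrow> 'k"
  where "dot a v = (\<Sum>i\<in>UNIV. a i * v i)"

text \<open>In homogeneous coordinates: the line through two points, and dually the common point of
  two lines. For nonzero vectors it vanishes exactly when they represent the same point.\<close>

definition cross :: "(3 \<Rightarrow> 'k::field) \<Rightarrow> (3 \<Rightarrow> 'k) \<Rightarrow> 3 \<Rightarrow> 'k"
  where "cross a b = (\<lambda>i. if i = 0 then a 1 * b 2 - a 2 * b 1
    else if i = 1 then a 2 * b 0 - a 0 * b 2 else a 0 * b 1 - a 1 * b 0)"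

lemma dot_eq: "dot a v = a 0 * v 0 + a 1 * v 1 + a 2 * v 2"
  by (simp add: dot_def sum_UNIV_3)

lemma cross_simps [simp]:
  "cross a b 0 = a 1 * b 2 - a 2 * b 1" "cross a b 1 = a 2 * b 0 - a 0 * b 2" "cross a b 2 = a 0 * b 1 - a 1 * b 0"
  by (simp_all add: cross_def)

lemma dot_add_left: "dot (a + b) v = dot a v + dot b v"
  and dot_add_right: "dot a (u + v) = dot a u + dot a v"
  and dot_diff_left: "dot (a - b) v = dot a v - dot b v"
  and dot_diff_right: "dot a (u - v) = dot a u - dot a v"
  and dot_scl_left [simp]: "dot (scl c a) v = c * dot a v"
  and dot_scl_right [simp]: "dot a (scl c v) = c * dot a v"
  and dot_zero_left [simp]: "dot 0 v = 0" and dot_zero_right [simp]: "dot a 0 = 0"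
  by (simp_all add: dot_eq algebra_simps)

lemma dot_commute: "dot a b = dot b a"
  by (simp add: dot_eq algebra_simps)

lemma dot_cross_self [simp]: "dot a (cross a b) = 0" "dot b (cross a b) = 0" "dot (cross a b) a = 0" "dot (cross a b) b = 0"
  by (simp_all add: dot_eq algebra_simps)

lemma cross_self [simp]: "cross a a = 0" by (simp add: vec3_eq_iff)

lemma cross_scl_self [simp]: "cross v (scl c v) = 0" by (simp add: vec3_eq_iff)

lemma cross_add_right: "cross a (b + c) = cross a b + cross a c"
  and cross_scl_right: "cross a (scl x b) = scl x (cross a b)"
  and cross_add_left: "cross (b + c) a = cross b a + cross c a"
  and cross_scl_left: "cross (scl x b) a = scl x (cross b a)"
  by (simp_all add: vec3_eq_iff algebra_simps)

lemma dot_cross_rotate: "dot a (cross b c) = dot b (cross c a)"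
  by (simp add: dot_eq algebra_simps)

lemma cross_cross: "cross a (cross b c) = scl (dot a c) b + scl (- dot a b) c"
  by (simp add: vec3_eq_iff dot_eq algebra_simps)

lemma dot_all_zero: "(\<And>v. dot a v = 0) \<Longrightarrow> a = 0"
proof -
  assume h: "\<And>v. dot a v = 0"
  have "dot a (\<lambda>i. if i = 0 then 1 else 0) = 0" "dot a (\<lambda>i. if i = 1 then 1 else 0) = 0" "dot a (\<lambda>i. if i = 2 then 1 else 0) = 0"
    using h by blast+
  then show "a = 0" by (simp add: dot_eq vec3_eq_iff)
qed

lemma parallel_of_cross_zero:
  assumes "cross a b = 0" "a \<noteq> 0"
  shows "\<exists>c. b = scl c a"
proof -
  have e: "a 1 * b 2 = a 2 * b 1" "a 2 * b 0 = a 0 * b 2" "a 0 * b 1 = a 1 * b 0"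
    using assms(1) by (simp_all add: vec3_eq_iff)
  consider "a 0 \<noteq> 0" | "a 1 \<noteq> 0" | "a 2 \<noteq> 0" using assms(2) by (auto simp: vec3_eq_iff)
  then show ?thesis
  proof cases
    case 1
    then show ?thesis using e by (intro exI[of _ "b 0 / a 0"]) (simp add: vec3_eq_iff field_simps)
  next
    case 2
    then show ?thesis using e by (intro exI[of _ "b 1 / a 1"]) (simp add: vec3_eq_iff field_simps)
  next
    case 3
    then show ?thesis using e by (intro exI[of _ "b 2 / a 2"]) (simp add: vec3_eq_iff field_simps)
  qed
qed

lemma orthogonal_to_both:
  assumes "dot a v = 0" "dot b v = 0" "cross a b \<noteq> 0"
  shows "\<exists>c. v = scl c (cross a b)"
proof (rule parallel_of_cross_zero)
  have "cross v (cross a b) = 0"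
    using assms(1,2) by (simp add: cross_cross dot_commute[of v] vec3_eq_iff)
  then show "cross (cross a b) v = 0" by (simp add: vec3_eq_iff algebra_simps)
qed (use assms in simp)

text \<open>\<open>dot A (cross B C)\<close> is the determinant of the three vectors. Its being
  nonzero is how linear independence, or noncollinearity of three points, is expressed from here
  on.\<close>

lemma cramer3:
  "scl (dot A (cross B C)) v = scl (dot v (cross B C)) A + scl (dot v (cross C A)) B + scl (dot v (cross A B)) C"
  by (simp add: vec3_eq_iff dot_eq algebra_simps)

lemma basis_expansion:
  assumes "dot A (cross B C) \<noteq> 0"
  shows "v = scl (dot v (cross B C) / dot A (cross B C)) A + scl (dot v (cross C A) / dot A (cross B C)) B
    + scl (dot v (cross A B) / dot A (cross B C)) C"
proof -
  have "v = scl (inverse (dot A (cross B C))) (scl (dot A (cross B C)) v)" using assms by (simp add: fun_eq_iff)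
  also have "\<dots> = scl (dot v (cross B C) / dot A (cross B C)) A + scl (dot v (cross C A) / dot A (cross B C)) B
    + scl (dot v (cross A B) / dot A (cross B C)) C"
    by (subst cramer3, rule ext) (simp add: divide_inverse distrib_left mult_ac)
  finally show ?thesis .
qed

lemma linear_form_with_values:
  assumes "dot A (cross B C) \<noteq> 0"
  shows "\<exists>l. dot l A = x \<and> dot l B = y \<and> dot l C = z"
proof -
  let ?d = "dot A (cross B C)"
  define l where "l = scl (x / ?d) (cross B C) + scl (y / ?d) (cross C A) + scl (z / ?d) (cross A B)"
  have r: "dot (cross C A) B = ?d" "dot (cross A B) C = ?d" "dot (cross B C) A = ?d"
    by (simp_all add: dot_eq algebra_simps)
  have "dot l A = x" "dot l B = y" "dot l C = z"
    using assms by (simp_all add: l_def dot_add_left r)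
  then show ?thesis by blast
qed

lemma form_vanishing_nonvanishing:
  assumes "cross u v \<noteq> 0"
  obtains a where "dot a u = 0" "dot a v \<noteq> (0::'k::field)"
proof -
  have "\<exists>x. dot x (cross u v) \<noteq> 0"
    using assms dot_all_zero by (metis dot_commute)
  then obtain x where x: "dot x (cross u v) \<noteq> 0" ..
  show ?thesis
    by (rule that[of "cross x u"]) (use x in \<open>simp_all add: dot_commute[of "cross x u"] dot_cross_rotate[of v] dot_cross_rotate[of x]\<close>)
qed

lemma form_nonvanishing:
  assumes "v \<noteq> 0"
  obtains a where "dot a v = (1::'k::field)"
proof -
  obtain x where "dot x v \<noteq> 0" using assms dot_all_zero by (metis dot_commute)
  then show ?thesis by (intro that[of "scl (1 / dot x v) x"]) simp
qed

subsection \<open>Homogeneous polynomial functions\<close>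

text \<open>Forms as functions, so that values, relations and dimensions live in \<open>fs\<close>;
  \<open>eval_forms\<close> identifies them with the values of formal forms. The recursion splits
  off one variable, with components that need not be unique, and so allows induction on the degree
  without monomials.\<close>

primrec hp :: "nat \<Rightarrow> ((3 \<Rightarrow> 'k::field) \<Rightarrow> 'k) set" where
  "hp 0 = {f. \<exists>c. f = (\<lambda>v. c)}"
| "hp (Suc n) = {f. \<exists>f0\<in>hp n. \<exists>f1\<in>hp n. \<exists>f2\<in>hp n. f = (\<lambda>v. v 0 * f0 v + v 1 * f1 v + v 2 * f2 v)}"

lemma hp_SucI: "f0 \<in> hp n \<Longrightarrow> f1 \<in> hp n \<Longrightarrow> f2 \<in> hp n \<Longrightarrow> (\<lambda>v. v 0 * f0 v + v 1 * f1 v + v 2 * f2 v) \<in> hp (Suc n)"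
  by auto

lemma hp_SucE:
  assumes "f \<in> hp (Suc n)"
  obtains f0 f1 f2 where "f0 \<in> hp n" "f1 \<in> hp n" "f2 \<in> hp n" "f = (\<lambda>v. v 0 * f0 v + v 1 * f1 v + v 2 * f2 v)"
  using assms by auto

lemma hp_zero: "(\<lambda>v. 0) \<in> hp n"
proof (induction n)
  case (Suc n)
  from hp_SucI[OF Suc Suc Suc] show ?case by simp
qed auto

lemma hp_add: "f \<in> hp n \<Longrightarrow> g \<in> hp n \<Longrightarrow> (\<lambda>v. f v + g v) \<in> hp n"
proof (induction n arbitrary: f g)
  case (Suc n)
  obtain f0 f1 f2 where f: "f0 \<in> hp n" "f1 \<in> hp n" "f2 \<in> hp n" "f = (\<lambda>v. v 0 * f0 v + v 1 * f1 v + v 2 * f2 v)"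
    using Suc.prems(1) by (rule hp_SucE)
  obtain g0 g1 g2 where g: "g0 \<in> hp n" "g1 \<in> hp n" "g2 \<in> hp n" "g = (\<lambda>v. v 0 * g0 v + v 1 * g1 v + v 2 * g2 v)"
    using Suc.prems(2) by (rule hp_SucE)
  have "(\<lambda>v. f v + g v) = (\<lambda>v. v 0 * (f0 v + g0 v) + v 1 * (f1 v + g1 v) + v 2 * (f2 v + g2 v))"
    by (simp add: f g fun_eq_iff algebra_simps)
  then show ?case using hp_SucI[OF Suc.IH Suc.IH Suc.IH, OF f(1) g(1) f(2) g(2) f(3) g(3)] by simp
qed auto

lemma hp_scale: "f \<in> hp n \<Longrightarrow> (\<lambda>v. c * f v) \<in> hp n"
proof (induction n arbitrary: f)
  case (Suc n)
  obtain f0 f1 f2 where f: "f0 \<in> hp n" "f1 \<in> hp n" "f2 \<in> hp n" "f = (\<lambda>v. v 0 * f0 v + v 1 * f1 v + v 2 * f2 v)"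
    using Suc.prems by (rule hp_SucE)
  have "(\<lambda>v. c * f v) = (\<lambda>v. v 0 * (c * f0 v) + v 1 * (c * f1 v) + v 2 * (c * f2 v))"
    by (simp add: f fun_eq_iff algebra_simps)
  then show ?case using hp_SucI[OF Suc.IH Suc.IH Suc.IH, OF f(1) f(2) f(3)] by simp
qed auto

lemma hp_sum: "(\<And>k. k \<in> A \<Longrightarrow> f k \<in> hp n) \<Longrightarrow> (\<lambda>v. \<Sum>k\<in>A. f k v) \<in> hp n"
  by (induction A rule: infinite_finite_induct) (auto intro: hp_zero hp_add)

lemma hp_subspace: "fs.subspace (hp n)"
  unfolding fs.subspace_def using hp_zero hp_add hp_scale
  by (auto simp: zero_fun_def plus_fun_def scl_def)

lemma hp_dot_times: "f \<in> hp n \<Longrightarrow> (\<lambda>v. dot a v * f v) \<in> hp (Suc n)"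
proof -
  assume "f \<in> hp n"
  then have "(\<lambda>v. v 0 * (a 0 * f v) + v 1 * (a 1 * f v) + v 2 * (a 2 * f v)) \<in> hp (Suc n)"
    by (intro hp_SucI hp_scale)
  moreover have "(\<lambda>v. v 0 * (a 0 * f v) + v 1 * (a 1 * f v) + v 2 * (a 2 * f v)) = (\<lambda>v. dot a v * f v)"
    by (simp add: fun_eq_iff dot_eq algebra_simps)
  ultimately show ?thesis by simp
qed

lemma hp_times: "f \<in> hp m \<Longrightarrow> g \<in> hp n \<Longrightarrow> (\<lambda>v. f v * g v) \<in> hp (m + n)"
proof (induction m arbitrary: f)
  case 0
  then obtain c where "f = (\<lambda>v. c)" by auto
  then show ?case using hp_scale[OF 0(2)] by simp
next
  case (Suc m)
  obtain f0 f1 f2 where f: "f0 \<in> hp m" "f1 \<in> hp m" "f2 \<in> hp m" "f = (\<lambda>v. v 0 * f0 v + v 1 * f1 v + v 2 * f2 v)"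
    using Suc.prems(1) by (rule hp_SucE)
  have "(\<lambda>v. f v * g v) = (\<lambda>v. v 0 * (f0 v * g v) + v 1 * (f1 v * g v) + v 2 * (f2 v * g v))"
    by (simp add: f fun_eq_iff algebra_simps)
  then show ?case
    using hp_SucI[OF Suc.IH Suc.IH Suc.IH, OF f(1) Suc.prems(2) f(2) Suc.prems(2) f(3) Suc.prems(2)]
    by (simp only: add_Suc)
qed

lemma hp_dot: "dot a \<in> hp 1"
  using hp_dot_times[of "\<lambda>v. 1" 0 a] by auto

lemma hp_dot_power: "(\<lambda>v. dot a v ^ n) \<in> hp n"
proof (induction n)
  case (Suc n)
  from hp_dot_times[OF this, of a] show ?case by simp
qed auto

lemma hp_1E:
  assumes "f \<in> hp 1"
  obtains a where "f = dot a"
proof -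
  obtain c0 c1 c2 where "f = (\<lambda>v. v 0 * c0 + v 1 * c1 + v 2 * c2)" using assms by auto
  then have "f = dot (\<lambda>i. if i = 0 then c0 else if i = 1 then c1 else c2)" by (simp add: fun_eq_iff dot_eq)
  then show ?thesis using that by blast
qed

lemma hp_homogeneous: "f \<in> hp n \<Longrightarrow> f (scl c v) = c ^ n * f v"
proof (induction n arbitrary: f)
  case (Suc n)
  obtain f0 f1 f2 where f: "f0 \<in> hp n" "f1 \<in> hp n" "f2 \<in> hp n" "f = (\<lambda>v. v 0 * f0 v + v 1 * f1 v + v 2 * f2 v)"
    using Suc.prems(1) by (rule hp_SucE)
  show ?case using Suc.IH[OF f(1)] Suc.IH[OF f(2)] Suc.IH[OF f(3)] by (simp add: f(4) algebra_simps)
qed auto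

lemma hp_along_curve:
  assumes T: "\<And>i. degree (q i) \<le> m" "\<And>x i. T x i = poly (q i) x" and "f \<in> hp n"
  shows "\<exists>p. degree p \<le> m * n \<and> (\<forall>x. f (T x) = poly p x)"
  using assms(3)
proof (induction n arbitrary: f)
  case 0
  then obtain c where "f = (\<lambda>v. c)" by auto
  then show ?case by (intro exI[of _ "[:c:]"]) simp
next
  case (Suc n)
  obtain f0 f1 f2 where f: "f0 \<in> hp n" "f1 \<in> hp n" "f2 \<in> hp n" "f = (\<lambda>v. v 0 * f0 v + v 1 * f1 v + v 2 * f2 v)"
    using Suc.prems(1) by (rule hp_SucE)
  obtain p0 p1 p2 where p: "degree p0 \<le> m * n" "degree p1 \<le> m * n" "degree p2 \<le> m * n"
    "\<forall>x. f0 (T x) = poly p0 x" "\<forall>x. f1 (T x) = poly p1 x" "\<forall>x. f2 (T x) = poly p2 x"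
    using Suc.IH[OF f(1)] Suc.IH[OF f(2)] Suc.IH[OF f(3)] by blast
  show ?case
  proof (intro exI[of _ "q 0 * p0 + q 1 * p1 + q 2 * p2"] conjI allI)
    have "degree (q i * p) \<le> m * Suc n" if "degree p \<le> m * n" for i p
      using order_trans[OF degree_mult_le add_mono[OF T(1) that]] by simp
    then show "degree (q 0 * p0 + q 1 * p1 + q 2 * p2) \<le> m * Suc n"
      using p by (intro degree_add_le) blast+
    show "f (T x) = poly (q 0 * p0 + q 1 * p1 + q 2 * p2) x" for x
      unfolding f(4) p(4-6)[rule_format] by (simp add: T)
  qed
qed

text \<open>The product of the given lines, scaled to \<open>1\<close> at \<open>v\<close> and
  padded to degree \<open>n\<close> by a power of a linear form with value \<open>1\<close>
  there.\<close>

lemma hp_cover: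
  fixes v :: "3 \<Rightarrow> 'k::field"
  assumes "finite A" "card A \<le> n" "\<And>a. a \<in> A \<Longrightarrow> dot a v \<noteq> 0" "v \<noteq> 0"
  shows "\<exists>f\<in>hp n. f v = 1 \<and> (\<forall>a\<in>A. \<forall>u. dot a u = 0 \<longrightarrow> f u = 0)"
  using assms(1-3)
proof (induction A arbitrary: n rule: finite_induct)
  case empty
  obtain b where "dot b v = 1" using form_nonvanishing[OF assms(4)] .
  then show ?case using hp_dot_power[of b n] by (intro bexI[of _ "\<lambda>v. dot b v ^ n"]) auto
next
  case (insert a A)
  then obtain m where m: "n = Suc m" by (cases n) auto
  obtain f where f: "f \<in> hp m" "f v = 1" "\<forall>a\<in>A. \<forall>u. dot a u = 0 \<longrightarrow> f u = 0"
    using insert.IH[of m] insert.prems insert.hyps m by auto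
  have "(\<lambda>u. dot (scl (1 / dot a v) a) u * f u) \<in> hp n" unfolding m by (rule hp_dot_times[OF f(1)])
  then show ?case by (rule bexI[rotated]) (use insert.prems(2)[of a] f in auto)
qed

lemma hp_separate:
  fixes v :: "3 \<Rightarrow> 'k::field"
  assumes "finite S" "card S \<le> n" "v \<noteq> 0" "\<And>u. u \<in> S \<Longrightarrow> cross u v \<noteq> 0"
  shows "\<exists>f\<in>hp n. f v = 1 \<and> (\<forall>u\<in>S. f u = 0)"
proof -
  have "\<exists>a. dot a u = 0 \<and> dot a v \<noteq> 0" if "u \<in> S" for u
    using form_vanishing_nonvanishing[OF assms(4)[OF that]] by metis
  then obtain a where a: "\<And>u. u \<in> S \<Longrightarrow> dot (a u) u = 0 \<and> dot (a u) v \<noteq> 0" by metis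
  have "\<exists>f\<in>hp n. f v = 1 \<and> (\<forall>b\<in>a ` S. \<forall>u. dot b u = 0 \<longrightarrow> f u = 0)"
    by (rule hp_cover) (use a assms card_image_le[OF assms(1), of a] in auto)
  then show ?thesis using a by blast
qed

text \<open>The vectors are representatives of pairwise different points of the projective
  plane.\<close>

definition proper :: "(3 \<Rightarrow> 'k::field) set \<Rightarrow> bool"
  where "proper P \<longleftrightarrow> 0 \<notin> P \<and> (\<forall>u\<in>P. \<forall>v\<in>P. u \<noteq> v \<longrightarrow> cross u v \<noteq> 0)"

lemma proper_subset: "proper P \<Longrightarrow> Q \<subseteq> P \<Longrightarrow> proper Q"
  unfolding proper_def by blast

lemma proper_nonzero: "proper P \<Longrightarrow> v \<in> P \<Longrightarrow> v \<noteq> 0"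
  unfolding proper_def by blast

lemma proper_cross: "proper P \<Longrightarrow> u \<in> P \<Longrightarrow> v \<in> P \<Longrightarrow> u \<noteq> v \<Longrightarrow> cross u v \<noteq> 0"
  unfolding proper_def by blast


subsection \<open>Linear algebra on spaces of functions\<close>

definition res :: "'a set \<Rightarrow> ('a \<Rightarrow> 'k::zero) \<Rightarrow> 'a \<Rightarrow> 'k"
  where "res P f = (\<lambda>x. if x \<in> P then f x else 0)"

text \<open>\<open>B\<close> is a maximal subset of \<open>P\<close> on which values of elements of
  \<open>U\<close> can be prescribed freely. By maximality an element of \<open>U\<close> that
  vanishes on \<open>B\<close> vanishes on \<open>P\<close>, so the dual functions
  \<open>\<phi> b\<close> give a basis of the restrictions.\<close>

lemma information_set:
  fixes U :: "('a \<Rightarrow> 'k::field) set"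
  assumes P: "finite P" and U: "fs.subspace U"
  obtains B \<phi> where "B \<subseteq> P" "card B = fs.dim (res P ` U)"
    "\<And>b. b \<in> B \<Longrightarrow> \<phi> b \<in> U" "\<And>b x. b \<in> B \<Longrightarrow> x \<in> B \<Longrightarrow> \<phi> b x = (if x = b then 1 else 0)"
    "\<And>f x. f \<in> U \<Longrightarrow> x \<in> P \<Longrightarrow> f x = (\<Sum>b\<in>B. f b * \<phi> b x)"
proof -
  define good where "good B \<longleftrightarrow> B \<subseteq> P \<and> (\<exists>\<phi>. \<forall>b\<in>B. \<phi> b \<in> U \<and> (\<forall>x\<in>B. \<phi> b x = (if x = b then 1 else 0)))" for B
  have "good {}" by (simp add: good_def)
  moreover have "finite {B. good B}" by (rule finite_subset[OF _ finite_Pow_iff[THEN iffD2, OF P]]) (auto simp: good_def)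
  ultimately have "\<exists>B\<in>{B. good B}. \<forall>B'\<in>{B. good B}. B \<subseteq> B' \<longrightarrow> B' = B"
    by (metis finite_has_maximal empty_iff mem_Collect_eq)
  then obtain B where B: "good B" and maxB: "\<And>B'. good B' \<Longrightarrow> B \<subseteq> B' \<Longrightarrow> B' = B" by auto
  obtain \<phi> where BP: "B \<subseteq> P" and \<phi>: "\<And>b. b \<in> B \<Longrightarrow> \<phi> b \<in> U" "\<And>b x. b \<in> B \<Longrightarrow> x \<in> B \<Longrightarrow> \<phi> b x = (if x = b then 1 else 0)"
    using B unfolding good_def by blast
  have fB: "finite B" using BP P finite_subset by blast
  have zero: "f x = 0" if f: "f \<in> U" "\<And>b. b \<in> B \<Longrightarrow> f b = 0" and x: "x \<in> P" for f x
  proof (rule ccontr)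
    assume nz: "f x \<noteq> 0"
    then have xB: "x \<notin> B" using f by blast
    define e where "e = scl (1 / f x) f"
    have e: "e \<in> U" "e x = 1" "\<And>b. b \<in> B \<Longrightarrow> e b = 0"
      using f nz U by (auto simp: e_def fs.subspace_scale)
    \<comment> \<open>Elimination: the new dual function at \<open>x\<close> is subtracted from the
      old ones until they vanish at \<open>x\<close>.\<close>
    define \<phi>' where "\<phi>' b = (if b = x then e else \<phi> b - scl (\<phi> b x) e)" for b
    have "\<forall>b\<in>insert x B. \<phi>' b \<in> U \<and> (\<forall>y\<in>insert x B. \<phi>' b y = (if y = b then 1 else 0))"
    proof (intro ballI conjI)
      fix b assume b: "b \<in> insert x B"
      show "\<phi>' b \<in> U" using b e \<phi> U by (auto simp: \<phi>'_def intro!: fs.subspace_diff fs.subspace_scale)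
      fix y assume y: "y \<in> insert x B"
      show "\<phi>' b y = (if y = b then 1 else 0)"
        using b y e \<phi>(2) xB by (auto simp: \<phi>'_def)
    qed
    then have "good (insert x B)" using BP x unfolding good_def by blast
    then show False using maxB[of "insert x B"] xB by blast
  qed
  have expand: "f x = (\<Sum>b\<in>B. f b * \<phi> b x)" if f: "f \<in> U" and x: "x \<in> P" for f x
  proof -
    define g where "g = f - (\<Sum>b\<in>B. scl (f b) (\<phi> b))"
    have "g \<in> U" unfolding g_def
      by (intro fs.subspace_diff fs.subspace_sum fs.subspace_scale U f \<phi>)
    moreover have "g b = 0" if b: "b \<in> B" for b
    proof -
      have "(\<Sum>c\<in>B. f c * \<phi> c b) = (\<Sum>c\<in>B. if c = b then f b else 0)"
        by (rule sum.cong) (use \<phi>(2) b in auto)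
      then show ?thesis using b fB by (simp add: g_def sum_fun_apply)
    qed
    ultimately have "g x = 0" using zero x by blast
    then show ?thesis by (simp add: g_def sum_fun_apply)
  qed
  have "card B = fs.dim (res P ` U)"
  proof -
    let ?b = "\<lambda>b. res P (\<phi> b)"
    have inj: "inj_on ?b B"
    proof (rule inj_onI)
      fix b c assume bc: "b \<in> B" "c \<in> B" and eq: "?b b = ?b c"
      have "?b b b = ?b c b" using eq by simp
      then show "b = c" using bc BP \<phi>(2)[of b b] \<phi>(2)[of c b] by (auto simp: res_def split: if_splits)
    qed
    have "fs.dim (res P ` U) = card (?b ` B)"
    proof (rule fs.dim_unique)
      show "?b ` B \<subseteq> res P ` U" using \<phi> by auto
      show "res P ` U \<subseteq> fs.span (?b ` B)"
      proof
        fix h assume "h \<in> res P ` U"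
        then obtain f where f: "f \<in> U" "h = res P f" by auto
        have "h = (\<Sum>b\<in>B. scl (f b) (?b b))"
          using expand[OF f(1)] by (auto simp: f(2) res_def fun_eq_iff sum_fun_apply)
        also have "\<dots> \<in> fs.span (?b ` B)"
          by (intro fs.span_sum fs.span_scale fs.span_base) auto
        finally show "h \<in> fs.span (?b ` B)" .
      qed
      show "fs.independent (?b ` B)"
      proof (rule fs.independent_if_scalars_zero)
        show "finite (?b ` B)" using fB by simp
        fix u h assume s: "(\<Sum>h\<in>?b ` B. scl (u h) h) = 0" and h: "h \<in> ?b ` B"
        then obtain b where b: "b \<in> B" "h = ?b b" by auto
        have "0 = (\<Sum>h\<in>?b ` B. scl (u h) h) b" using s by simp
        also have "\<dots> = (\<Sum>c\<in>B. u (?b c) * ?b c b)"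
          by (simp add: sum.reindex[OF inj] sum_fun_apply)
        also have "\<dots> = (\<Sum>c\<in>B. if c = b then u (?b b) else 0)"
          by (rule sum.cong) (use \<phi>(2) b BP in \<open>auto simp: res_def\<close>)
        finally show "u h = 0" using b fB by simp
      qed
    qed simp
    then show ?thesis by (simp add: card_image[OF inj])
  qed
  then show ?thesis by (rule that[OF BP _ \<phi> expand])
qed

text \<open>The complement of an information set parametrises the relations \<open>c\<close>: their
  values on \<open>D\<close> are free and determine the values elsewhere. Hence
  \<open>card D\<close> is the number of independent relations.\<close>

lemma orthogonal_complement_coordinates:
  fixes U :: "('a \<Rightarrow> 'k::field) set"
  assumes P: "finite P" and U: "fs.subspace U"
  obtains D where "D \<subseteq> P" "card D + fs.dim (res P ` U) = card P"
    "\<And>\<psi>. \<exists>c. (\<forall>x\<in>D. c x = \<psi> x) \<and> (\<forall>f\<in>U. (\<Sum>x\<in>P. c x * f x) = 0)"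
    "\<And>c. (\<forall>f\<in>U. (\<Sum>x\<in>P. c x * f x) = 0) \<Longrightarrow> (\<forall>x\<in>D. c x = 0) \<Longrightarrow> (\<forall>x\<in>P. c x = 0)"
proof -
  obtain B \<phi> where BP: "B \<subseteq> P" "card B = fs.dim (res P ` U)"
    and \<phi>: "\<And>b. b \<in> B \<Longrightarrow> \<phi> b \<in> U" "\<And>b x. b \<in> B \<Longrightarrow> x \<in> B \<Longrightarrow> \<phi> b x = (if x = b then 1 else 0)"
    and ex: "\<And>f x. f \<in> U \<Longrightarrow> x \<in> P \<Longrightarrow> f x = (\<Sum>b\<in>B. f b * \<phi> b x)"
    using information_set[OF P U] by blast
  have fB: "finite B" using BP P finite_subset by blast
  have split: "(\<Sum>x\<in>P. F x) = (\<Sum>x\<in>P - B. F x) + (\<Sum>x\<in>B. F x)" for F :: "'a \<Rightarrow> 'k"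
    by (rule sum.subset_diff[OF BP(1) P])
  show ?thesis
  proof (rule that[of "P - B"])
    show "card (P - B) + fs.dim (res P ` U) = card P"
      using BP P fB card_mono[OF P BP(1)] by (simp add: card_Diff_subset)
    show "\<exists>c. (\<forall>x\<in>P - B. c x = \<psi> x) \<and> (\<forall>f\<in>U. (\<Sum>x\<in>P. c x * f x) = 0)" for \<psi>
    proof (intro exI[of _ "\<lambda>x. if x \<in> B then - (\<Sum>y\<in>P - B. \<psi> y * \<phi> x y) else \<psi> x"] conjI ballI)
      fix f assume f: "f \<in> U"
      have "(\<Sum>x\<in>P - B. \<psi> x * f x) = (\<Sum>x\<in>P - B. \<Sum>b\<in>B. \<psi> x * (f b * \<phi> b x))"
        using ex[OF f] by (intro sum.cong refl) (simp add: sum_distrib_left[symmetric])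
      also have "\<dots> = (\<Sum>b\<in>B. \<Sum>x\<in>P - B. \<psi> x * (f b * \<phi> b x))" by (rule sum.swap)
      finally show "(\<Sum>x\<in>P. (if x \<in> B then - (\<Sum>y\<in>P - B. \<psi> y * \<phi> x y) else \<psi> x) * f x) = 0"
        unfolding split by (simp add: sum_distrib_left sum_distrib_right sum_negf mult_ac)
    qed auto
    fix c assume c: "\<forall>f\<in>U. (\<Sum>x\<in>P. c x * f x) = 0" "\<forall>x\<in>P - B. c x = 0"
    have "c b = 0" if b: "b \<in> B" for b
    proof -
      have "0 = (\<Sum>x\<in>P. c x * \<phi> b x)" using c \<phi> b by simp
      also have "\<dots> = (\<Sum>x\<in>B. c x * \<phi> b x)" unfolding split using c by simp
      also have "\<dots> = (\<Sum>x\<in>B. if x = b then c b else 0)" by (rule sum.cong) (use \<phi> b in auto)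
      finally show ?thesis using b fB by simp
    qed
    then show "\<forall>x\<in>P. c x = 0" using c by blast
  qed auto
qed

lemma underdetermined_system:
  fixes M :: "'e \<Rightarrow> 'i \<Rightarrow> 'k::field"
  assumes "finite E" "finite I" "card E < card I"
  shows "\<exists>x. (\<exists>i\<in>I. x i \<noteq> 0) \<and> (\<forall>e\<in>E. (\<Sum>i\<in>I. M e i * x i) = 0)"
  using assms
proof (induction E arbitrary: I M rule: finite_induct)
  case empty
  then have "I \<noteq> {}" by auto
  then show ?case by (intro exI[of _ "\<lambda>_. 1"]) auto
next
  case (insert e E)
  show ?case
  proof (cases "\<forall>i\<in>I. M e i = 0")
    case True
    have "card E < card I" using insert.prems insert.hyps by simp
    then obtain x where "\<exists>i\<in>I. x i \<noteq> 0" "\<forall>e\<in>E. (\<Sum>i\<in>I. M e i * x i) = 0" using insert.IH[of I M] insert.prems by blast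
    then show ?thesis using True by (intro exI[of _ x]) auto
  next
    case False
    then obtain p where p: "p \<in> I" "M e p \<noteq> 0" by blast
    define M' where "M' = (\<lambda>e' i. M e' i - M e' p * M e i / M e p)"
    have "card E < card (I - {p})" using insert.prems insert.hyps p by simp
    then obtain x where x: "\<exists>i\<in>I - {p}. x i \<noteq> 0" "\<forall>e\<in>E. (\<Sum>i\<in>I - {p}. M' e i * x i) = 0"
      using insert.IH[of "I - {p}" M'] insert.prems by auto
    define y where "y = x(p := - (\<Sum>i\<in>I - {p}. M e i * x i) / M e p)"
    have split: "(\<Sum>i\<in>I. M e' i * y i) = M e' p * y p + (\<Sum>i\<in>I - {p}. M e' i * x i)" for e'
      using p insert.prems by (subst sum.remove[of I p]) (auto simp: y_def intro!: sum.cong)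
    have yp: "y p = - (\<Sum>i\<in>I - {p}. M e i * x i) / M e p" by (simp add: y_def)
    have "(\<Sum>i\<in>I. M e' i * y i) = 0" if "e' \<in> insert e E" for e'
    proof (cases "e' = e")
      case True
      then show ?thesis unfolding split yp using p by simp
    next
      case False
      then have "(\<Sum>i\<in>I - {p}. M e' i * x i) - M e' p / M e p * (\<Sum>i\<in>I - {p}. M e i * x i) = 0"
        using x(2) that by (simp add: M'_def algebra_simps sum_subtractf sum_distrib_left)
      then show ?thesis unfolding split yp by (simp add: algebra_simps)
    qed
    moreover have "\<exists>i\<in>I. y i \<noteq> 0" using x(1) by (auto simp: y_def)
    ultimately show ?thesis by blast
  qed
qed

subsection \<open>Nondegenerate forms and generic linear forms\<close>

text \<open>No basis of forms is chosen: a kernel element counts as zero once it vanishes on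
  \<open>Z\<close>. This allows the same notion for subsets of the point set.\<close>

definition nondeg :: "((3 \<Rightarrow> 'k::field) \<Rightarrow> 'k) \<Rightarrow> nat \<Rightarrow> nat \<Rightarrow> (3 \<Rightarrow> 'k) set \<Rightarrow> (3 \<Rightarrow> 'k) \<Rightarrow> bool"
  where "nondeg w e i Z l \<longleftrightarrow>
    (\<forall>f\<in>hp i. (\<forall>g\<in>hp i. (\<Sum>v\<in>Z. w v * dot l v ^ e * f v * g v) = 0) \<longrightarrow> (\<forall>v\<in>Z. f v = 0))"

text \<open>A substitute for nonempty Zariski open sets: every line through a good \<open>l\<close>
  contains finitely many bad ones. It is strong enough for finite intersections, because two good
  forms can be joined by a line.\<close>

definition generic :: "((3 \<Rightarrow> 'k::field) \<Rightarrow> bool) \<Rightarrow> bool"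
  where "generic Q \<longleftrightarrow> (\<exists>l. Q l) \<and> (\<forall>l h. Q l \<longrightarrow> finite {t. \<not> Q (l + scl t h)})"

lemma generic_conj:
  fixes Q Q' :: "(3 \<Rightarrow> 'k::field_char_0) \<Rightarrow> bool"
  assumes "generic Q" "generic Q'"
  shows "generic (\<lambda>l. Q l \<and> Q' l)"
proof -
  obtain l l' where l: "Q l" "Q' l'" using assms unfolding generic_def by blast
  have f1: "finite {t. \<not> Q (l + scl t (l' - l))}" using assms(1) l unfolding generic_def by blast
  \<comment> \<open>The same line parametrised from \<open>l'\<close>; its parameter is
    \<open>1 - t\<close>.\<close>
  have f2: "finite {t. \<not> Q' (l' + scl t (l - l'))}" using assms(2) l unfolding generic_def by blast
  have "finite ((\<lambda>t. 1 - t) ` {t. \<not> Q' (l' + scl t (l - l'))})" using f2 by blast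
  with f1 have "finite ({t. \<not> Q (l + scl t (l' - l))} \<union> (\<lambda>t. 1 - t) ` {t. \<not> Q' (l' + scl t (l - l'))})"
    by blast
  then obtain t where t: "t \<notin> {t. \<not> Q (l + scl t (l' - l))} \<union> (\<lambda>t. 1 - t) ` {t. \<not> Q' (l' + scl t (l - l'))}"
    using ex_new_if_finite[OF infinite_UNIV_char_0] by blast
  have "Q' (l' + scl (1 - t) (l - l'))"
    using t by (auto simp: image_iff)
  moreover have "l' + scl (1 - t) (l - l') = l + scl t (l' - l)"
    by (simp add: fun_eq_iff algebra_simps)
  ultimately have "Q (l + scl t (l' - l)) \<and> Q' (l + scl t (l' - l))" using t by simp
  moreover have "finite {t. \<not> (Q (l + scl t h) \<and> Q' (l + scl t h))}" if "Q l \<and> Q' l" for l h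
  proof -
    have "{t. \<not> (Q (l + scl t h) \<and> Q' (l + scl t h))} = {t. \<not> Q (l + scl t h)} \<union> {t. \<not> Q' (l + scl t h)}" by blast
    then show ?thesis using assms that unfolding generic_def by simp
  qed
  ultimately show ?thesis unfolding generic_def by blast
qed

lemma generic_ball:
  fixes Q :: "'a \<Rightarrow> (3 \<Rightarrow> 'k::field_char_0) \<Rightarrow> bool"
  assumes "finite A" "\<And>a. a \<in> A \<Longrightarrow> generic (Q a)"
  shows "generic (\<lambda>l. \<forall>a\<in>A. Q a l)"
  using assms
proof (induction A rule: finite_induct)
  case empty
  then show ?case by (simp add: generic_def)
next
  case (insert a A)
  have "generic (\<lambda>l. Q a l \<and> (\<forall>a\<in>A. Q a l))"
    by (rule generic_conj) (use insert in auto)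
  then show ?case by simp
qed

lemma generic_nonvanishing:
  fixes v :: "3 \<Rightarrow> 'k::field"
  assumes "v \<noteq> 0"
  shows "generic (\<lambda>l. dot l v \<noteq> 0)"
proof -
  obtain a where "dot a v = 1" using form_nonvanishing[OF assms] .
  moreover have "finite {t. \<not> dot (l + scl t h) v \<noteq> 0}" if "dot l v \<noteq> 0" for l h
  proof (rule finite_subset)
    show "{t. \<not> dot (l + scl t h) v \<noteq> 0} \<subseteq> {- dot l v / dot h v}"
      using that by (cases "dot h v = 0") (auto simp: dot_add_left field_simps add_eq_0_iff)
  qed simp
  ultimately show ?thesis unfolding generic_def by (intro conjI exI[of _ a]) auto
qed

text \<open>Expresses nondegeneracy as the nonvanishing of one polynomial in the coefficients of
  \<open>l\<close>, which is what makes it an open condition.\<close>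

lemma nondeg_iff_det:
  fixes b :: "nat \<Rightarrow> (3 \<Rightarrow> 'k::field) \<Rightarrow> 'k"
  assumes b: "\<And>k. k < n \<Longrightarrow> b k \<in> hp i"
    and span: "\<And>f. f \<in> hp i \<Longrightarrow> \<exists>c. \<forall>v\<in>Z. f v = (\<Sum>k<n. c k * b k v)"
    and indep: "\<And>c. (\<forall>v\<in>Z. (\<Sum>k<n. c k * b k v) = 0) \<Longrightarrow> (\<forall>k<n. c k = 0)"
  shows "nondeg w e i Z l \<longleftrightarrow> det (mat n n (\<lambda>(r, s). \<Sum>v\<in>Z. w v * dot l v ^ e * b r v * b s v)) \<noteq> 0"
    (is "_ \<longleftrightarrow> det ?G \<noteq> 0")
proof -
  have entry: "(?G *\<^sub>v x) $ r = (\<Sum>v\<in>Z. w v * dot l v ^ e * (\<Sum>k<n. x $ k * b k v) * b r v)"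
    if "x \<in> carrier_vec n" "r < n" for x r
  proof -
    have "(?G *\<^sub>v x) $ r = (\<Sum>s<n. (\<Sum>v\<in>Z. w v * dot l v ^ e * b r v * b s v) * x $ s)"
      using that by (auto simp: scalar_prod_def atLeast0LessThan intro!: sum.cong)
    also have "\<dots> = (\<Sum>s<n. \<Sum>v\<in>Z. w v * dot l v ^ e * (x $ s * b s v) * b r v)"
      by (simp add: sum_distrib_right sum_distrib_left mult_ac)
    also have "\<dots> = (\<Sum>v\<in>Z. \<Sum>s<n. w v * dot l v ^ e * (x $ s * b s v) * b r v)" by (rule sum.swap)
    also have "\<dots> = (\<Sum>v\<in>Z. w v * dot l v ^ e * (\<Sum>k<n. x $ k * b k v) * b r v)"
      by (simp add: sum_distrib_right sum_distrib_left)
    finally show ?thesis .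
  qed
  have "det ?G = 0 \<longleftrightarrow> (\<exists>x. x \<in> carrier_vec n \<and> x \<noteq> 0\<^sub>v n \<and> ?G *\<^sub>v x = 0\<^sub>v n)"
    by (rule det_0_iff_vec_prod_zero_field) simp
  also have "\<dots> \<longleftrightarrow> \<not> nondeg w e i Z l"
  proof
    assume "\<exists>x. x \<in> carrier_vec n \<and> x \<noteq> 0\<^sub>v n \<and> ?G *\<^sub>v x = 0\<^sub>v n"
    then obtain x where x: "x \<in> carrier_vec n" "x \<noteq> 0\<^sub>v n" "?G *\<^sub>v x = 0\<^sub>v n" by blast
    define f where "f = (\<lambda>v. \<Sum>k<n. x $ k * b k v)"
    have f: "f \<in> hp i" unfolding f_def by (intro hp_sum hp_scale b) auto
    have r: "(\<Sum>v\<in>Z. w v * dot l v ^ e * f v * b r v) = 0" if "r < n" for r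
      using entry[OF x(1) that] x(3) that by (simp add: f_def)
    have "(\<Sum>v\<in>Z. w v * dot l v ^ e * f v * g v) = 0" if "g \<in> hp i" for g
    proof -
      obtain c where c: "\<forall>v\<in>Z. g v = (\<Sum>k<n. c k * b k v)" using span[OF \<open>g \<in> hp i\<close>] ..
      have "(\<Sum>v\<in>Z. w v * dot l v ^ e * f v * g v) = (\<Sum>v\<in>Z. \<Sum>k<n. c k * (w v * dot l v ^ e * f v * b k v))"
        using c by (intro sum.cong refl) (simp add: sum_distrib_left mult_ac)
      also have "\<dots> = (\<Sum>k<n. c k * (\<Sum>v\<in>Z. w v * dot l v ^ e * f v * b k v))"
        by (subst sum.swap) (simp add: sum_distrib_left)
      finally show ?thesis using r by simp
    qed
    moreover have "\<not> (\<forall>v\<in>Z. f v = 0)"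
    proof
      assume "\<forall>v\<in>Z. f v = 0"
      then have "\<forall>k<n. x $ k = 0" using indep[of "\<lambda>k. x $ k"] by (simp add: f_def)
      then show False using x by (auto simp: vec_eq_iff)
    qed
    ultimately show "\<not> nondeg w e i Z l" using f unfolding nondeg_def by blast
  next
    assume "\<not> nondeg w e i Z l"
    then obtain f where f: "f \<in> hp i" "\<forall>g\<in>hp i. (\<Sum>v\<in>Z. w v * dot l v ^ e * f v * g v) = 0" "\<not> (\<forall>v\<in>Z. f v = 0)"
      unfolding nondeg_def by blast
    obtain c where c: "\<forall>v\<in>Z. f v = (\<Sum>k<n. c k * b k v)" using span[OF f(1)] ..
    define x where "x = vec n c"
    have fx: "\<forall>v\<in>Z. f v = (\<Sum>k<n. x $ k * b k v)" using c by (simp add: x_def)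
    have "x \<in> carrier_vec n" by (simp add: x_def)
    moreover have "x \<noteq> 0\<^sub>v n"
    proof
      assume "x = 0\<^sub>v n"
      then have "\<forall>v\<in>Z. f v = 0" using fx by simp
      then show False using f by simp
    qed
    moreover have "?G *\<^sub>v x = 0\<^sub>v n"
    proof (rule eq_vecI)
      fix r assume r: "r < dim_vec (0\<^sub>v n :: 'k vec)"
      have "(?G *\<^sub>v x) $ r = (\<Sum>v\<in>Z. w v * dot l v ^ e * f v * b r v)"
        using entry[OF \<open>x \<in> carrier_vec n\<close>, of r] r fx by simp
      also have "\<dots> = 0" using f(2) b r by simp
      finally show "(?G *\<^sub>v x) $ r = 0\<^sub>v n $ r" using r by simp
    qed simp
    ultimately show "\<exists>x. x \<in> carrier_vec n \<and> x \<noteq> 0\<^sub>v n \<and> ?G *\<^sub>v x = 0\<^sub>v n" by blast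
  qed
  finally show ?thesis by blast
qed

lemma poly_det:
  "poly (det A) t = det (map_mat (\<lambda>p. poly p t) (A :: 'k::comm_ring_1 poly mat))"
proof -
  interpret comm_ring_hom "\<lambda>p :: 'k poly. poly p t" by unfold_locales simp_all
  show ?thesis by simp
qed

text \<open>With a basis that does not depend on \<open>l\<close>, the Gram determinant along
  \<open>l + t k\<close> is a polynomial in \<open>t\<close>, nonzero at \<open>t = 0\<close>. One
  good form therefore makes the condition generic.\<close>

lemma generic_nondeg:
  fixes Z :: "(3 \<Rightarrow> 'k::field_char_0) set"
  assumes Z: "finite Z" and nd: "nondeg w e i Z l0"
  shows "generic (nondeg w e i Z)"
proof -
  obtain B \<phi> where B: "B \<subseteq> Z" "\<And>b. b \<in> B \<Longrightarrow> \<phi> b \<in> hp i"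
    "\<And>b x. b \<in> B \<Longrightarrow> x \<in> B \<Longrightarrow> \<phi> b x = (if x = b then 1 else 0)"
    "\<And>f x. f \<in> hp i \<Longrightarrow> x \<in> Z \<Longrightarrow> f x = (\<Sum>b\<in>B. f b * \<phi> b x)"
    by (rule information_set[OF Z hp_subspace[of i]], rule that)
  have fB: "finite B" using B Z finite_subset by blast
  define n where "n = card B"
  obtain h where h: "bij_betw h {..<n} B"
    using ex_bij_betw_nat_finite[OF fB] unfolding n_def atLeast0LessThan by (rule exE)
  have hB: "h k \<in> B" if "k < n" for k using h that by (auto simp: bij_betw_def)
  define b where "b = (\<lambda>k. \<phi> (h k))"
  have reindex: "(\<Sum>k<n. F (h k)) = (\<Sum>b\<in>B. F b)" for F :: "_ \<Rightarrow> 'k"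
    by (rule sum.reindex_bij_betw[OF h])
  have det: "nondeg w e i Z l \<longleftrightarrow> det (mat n n (\<lambda>(r, s). \<Sum>v\<in>Z. w v * dot l v ^ e * b r v * b s v)) \<noteq> 0" for l
  proof (rule nondeg_iff_det)
    show "b k \<in> hp i" if "k < n" for k using B(2) hB that by (simp add: b_def)
    show "\<exists>c. \<forall>v\<in>Z. f v = (\<Sum>k<n. c k * b k v)" if "f \<in> hp i" for f
    proof (intro exI[of _ "\<lambda>k. f (h k)"] ballI)
      fix v assume "v \<in> Z"
      then show "f v = (\<Sum>k<n. f (h k) * b k v)"
        using B(4)[OF that] reindex[of "\<lambda>x. f x * \<phi> x v"] by (simp add: b_def)
    qed
    show "\<forall>k<n. c k = 0" if c: "\<forall>v\<in>Z. (\<Sum>k<n. c k * b k v) = 0" for c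
    proof (intro allI impI)
      fix k assume k: "k < n"
      have "0 = (\<Sum>j<n. c j * b j (h k))" using c hB[OF k] B(1) by auto
      also have "\<dots> = (\<Sum>j<n. if j = k then c k else 0)"
      proof (rule sum.cong)
        fix j assume "j \<in> {..<n}"
        then have "h k = h j \<longleftrightarrow> j = k" using h k by (auto simp: bij_betw_def inj_on_def)
        then show "c j * b j (h k) = (if j = k then c k else 0)"
          using B(3)[of "h j" "h k"] hB k \<open>j \<in> {..<n}\<close> by (simp add: b_def)
      qed simp
      finally show "c k = 0" using k by simp
    qed
  qed
  have "finite {t. \<not> nondeg w e i Z (l + scl t k)}" if l: "nondeg w e i Z l" for l k
  proof -
    define G where "G = mat n n (\<lambda>(r, s). \<Sum>v\<in>Z. [:dot l v, dot k v:] ^ e * [:w v * b r v * b s v:])"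
    have G: "map_mat (\<lambda>p. poly p t) G = mat n n (\<lambda>(r, s). \<Sum>v\<in>Z. w v * dot (l + scl t k) v ^ e * b r v * b s v)" for t
      unfolding G_def by (rule eq_matI) (auto simp: poly_sum poly_power dot_add_left mult_ac intro!: sum.cong)
    have eq: "nondeg w e i Z (l + scl t k) \<longleftrightarrow> poly (det G) t \<noteq> 0" for t
      unfolding det poly_det G ..
    have "l + scl 0 k = l" by (simp add: fun_eq_iff)
    then have "poly (det G) 0 \<noteq> 0" using eq[of 0] l by simp
    then have "det G \<noteq> 0" by auto
    then show ?thesis unfolding eq by (simp add: poly_roots_finite)
  qed
  then show ?thesis using nd by (auto simp: generic_def)
qed


section \<open>Splitting off points, and points on a rational curve\<close>

text \<open>A test form that is nonzero only at \<open>y\<close> isolates a single term, so a kernel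
  element vanishes on \<open>Y\<close> and becomes a kernel element for \<open>Z\<close>.\<close>

lemma nondeg_split:
  fixes Z :: "(3 \<Rightarrow> 'k::field_char_0) set"
  assumes fin: "finite Z" "finite Y" and disj: "Z \<inter> Y = {}"
    and sep: "\<And>y. y \<in> Y \<Longrightarrow> \<exists>q\<in>hp i. q y \<noteq> 0 \<and> (\<forall>u\<in>Z \<union> Y. u \<noteq> y \<longrightarrow> q u = 0)"
    and wY: "\<And>y. y \<in> Y \<Longrightarrow> w y \<noteq> 0" and lY: "\<And>y. y \<in> Y \<Longrightarrow> dot l y \<noteq> 0"
    and nd: "nondeg w e i Z l"
  shows "nondeg w e i (Z \<union> Y) l"
  unfolding nondeg_def
proof (intro ballI impI)
  fix f v assume f: "f \<in> hp i" "\<forall>g\<in>hp i. (\<Sum>v\<in>Z \<union> Y. w v * dot l v ^ e * f v * g v) = 0" and v: "v \<in> Z \<union> Y"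
  have fY: "f y = 0" if y: "y \<in> Y" for y
  proof -
    obtain q where q: "q \<in> hp i" "q y \<noteq> 0" "\<forall>u\<in>Z \<union> Y. u \<noteq> y \<longrightarrow> q u = 0" using sep[OF y] by blast
    have "0 = (\<Sum>v\<in>Z \<union> Y. w v * dot l v ^ e * f v * q v)" using f q by simp
    also have "\<dots> = (\<Sum>v\<in>Z \<union> Y. if v = y then w y * dot l y ^ e * f y * q y else 0)"
      by (rule sum.cong) (use q in auto)
    finally show ?thesis using y fin q wY[OF y] lY[OF y] by simp
  qed
  have "(\<Sum>v\<in>Z. w v * dot l v ^ e * f v * g v) = 0" if "g \<in> hp i" for g
    using f(2) that fY by (simp add: sum.union_disjoint[OF fin disj])
  then show "f v = 0" using nd f(1) fY v unfolding nondeg_def by blast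
qed

lemma nondeg_split_ex:
  fixes Z :: "(3 \<Rightarrow> 'k::field_char_0) set"
  assumes fin: "finite Z" "finite Y" and disj: "Z \<inter> Y = {}"
    and sep: "\<And>y. y \<in> Y \<Longrightarrow> \<exists>q\<in>hp i. q y \<noteq> 0 \<and> (\<forall>u\<in>Z \<union> Y. u \<noteq> y \<longrightarrow> q u = 0)"
    and wY: "\<And>y. y \<in> Y \<Longrightarrow> w y \<noteq> 0" and Y0: "0 \<notin> Y"
    and nd: "\<exists>l. nondeg w e i Z l"
  shows "\<exists>l. nondeg w e i (Z \<union> Y) l"
proof -
  have "generic (\<lambda>l. \<forall>y\<in>Y. dot l y \<noteq> 0)"
    by (rule generic_ball[OF fin(2)], rule generic_nonvanishing) (use Y0 in auto)
  moreover obtain l0 where "nondeg w e i Z l0" using nd by (rule exE)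
  ultimately have "generic (\<lambda>l. nondeg w e i Z l \<and> (\<forall>y\<in>Y. dot l y \<noteq> 0))"
    by (intro generic_conj generic_nondeg[OF fin(1)])
  then obtain l where l: "nondeg w e i Z l" "\<forall>y\<in>Y. dot l y \<noteq> 0" unfolding generic_def by blast
  have "nondeg w e i (Z \<union> Y) l" by (rule nondeg_split) (use assms l in auto)
  then show ?thesis by (rule exI[of _ l])
qed

text \<open>The base point \<open>N\<close> is prescribed, so that two lines can later be
  parametrised from their common point. \<open>B\<close> is the point at infinity of the
  parametrisation and is chosen outside \<open>Z\<close>.\<close>

lemma line_parametrization:
  fixes Z :: "(3 \<Rightarrow> 'k::field_char_0) set"
  assumes a: "a \<noteq> 0" and N: "N \<noteq> 0" "dot a N = 0" and Z: "finite Z" "0 \<notin> Z" "\<And>z. z \<in> Z \<Longrightarrow> dot a z = 0"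
  obtains B where "dot a B = 0" "cross N B \<noteq> 0" "\<And>z. z \<in> Z \<Longrightarrow> \<exists>c x. c \<noteq> 0 \<and> z = scl c (N + scl x B)"
proof -
  obtain i where i: "N i \<noteq> 0" using N(1) by (auto simp: fun_eq_iff)
  define E :: "3 \<Rightarrow> 'k" where "E = (\<lambda>j. if j = i then 1 else 0)"
  have dE: "dot v E = v i" for v
  proof -
    have "\<forall>i. i = 0 \<or> i = 1 \<or> i = (2::3)" using UNIV_3 by blast
    then show ?thesis by (auto simp: dot_eq E_def)
  qed
  \<comment> \<open>The point of the line whose coordinate \<open>i\<close> vanishes; it differs
    from \<open>N\<close> because \<open>N i\<close> is nonzero.\<close>
  define B0 where "B0 = cross a E"
  have aB0: "dot a B0 = 0" by (simp add: B0_def)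
  have NB0: "cross N B0 \<noteq> 0"
    using i a N(2) by (simp add: B0_def cross_cross dE dot_commute[of N a] fun_eq_iff)
  have B0: "B0 \<noteq> 0" using NB0 by (auto simp: vec3_eq_iff)
  have ex: "\<exists>r s. z = scl r N + scl s B0" if z: "dot a z = 0" for z
  proof -
    define u where "u = z - scl (z i / N i) N"
    have "dot a u = 0" using z N(2) by (simp add: u_def dot_diff_right)
    moreover have "dot E u = 0" using i dE[of u] by (simp add: dot_commute[of E] u_def)
    ultimately obtain s where "u = scl s B0" using orthogonal_to_both[of a u E] B0 by (auto simp: B0_def)
    then have "z = scl (z i / N i) N + scl s B0" by (simp only: u_def diff_eq_eq add.commute)
    then show ?thesis by blast
  qed
  then have "\<forall>z. \<exists>r s. z \<in> Z \<longrightarrow> z = scl r N + scl s B0" using Z(3) by blast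
  then obtain r s where rs: "\<And>z. z \<in> Z \<Longrightarrow> z = scl (r z) N + scl (s z) B0" by metis
  \<comment> \<open>With \<open>B = B0 + c N\<close> the coefficient of \<open>N\<close> in
    \<open>z\<close> becomes \<open>r z - c * s z\<close>; avoiding these ratios keeps it nonzero.
    Where \<open>s z = 0\<close> the ratio is a dummy and the claim follows from
    \<open>z \<noteq> 0\<close>.\<close>
  have "finite ((\<lambda>z. r z / s z) ` Z)" using Z by blast
  then obtain c where c: "c \<notin> (\<lambda>z. r z / s z) ` Z" using ex_new_if_finite[OF infinite_UNIV_char_0] by blast
  define B where "B = B0 + scl c N"
  show ?thesis
  proof (rule that[of B])
    show "dot a B = 0" using aB0 N by (simp add: B_def dot_add_right)
    show "cross N B \<noteq> 0" using NB0 by (simp add: B_def cross_add_right cross_scl_right fun_eq_iff)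
    fix z assume z: "z \<in> Z"
    define m where "m = r z - c * s z"
    have "m \<noteq> 0"
    proof
      assume m: "m = 0"
      show False
      proof (cases "s z = 0")
        case True
        then have "z = 0" using m rs[OF z] by (auto simp: m_def fun_eq_iff)
        then show False using z Z by blast
      next
        case False
        then have "c = r z / s z" using m by (simp add: m_def field_simps)
        then show False using c z by blast
      qed
    qed
    moreover have "z = scl m (N + scl (s z / m) B)"
    proof
      fix j
      have "z j = r z * N j + s z * B0 j" using arg_cong[OF rs[OF z], of "\<lambda>v. v j"] by (simp only: plus_fun_apply scl_apply)
      also have "\<dots> = m * N j + s z * B j" by (simp add: B_def m_def algebra_simps)
      also have "\<dots> = scl m (N + scl (s z / m) B) j" using \<open>m \<noteq> 0\<close> by (simp add: distrib_left)
      finally show "z j = scl m (N + scl (s z / m) B) j" .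
    qed
    ultimately show "\<exists>c x. c \<noteq> 0 \<and> z = scl c (N + scl x B)" by blast
  qed
qed

lemma hp_along_line:
  assumes "f \<in> hp i"
  shows "\<exists>p. degree p \<le> i \<and> (\<forall>x. f (N + scl x B) = poly p x)"
  using hp_along_curve[of "\<lambda>j. [:N j, B j:]" 1 "\<lambda>x. N + scl x B" f i] assms by simp

lemma sum_reindex_weights:
  fixes w :: "'a \<Rightarrow> 'k::field"
  assumes "finite Z" "inj_on x Z" "\<And>z. z \<in> Z \<Longrightarrow> w z \<noteq> 0"
  obtains W where "\<And>s. s \<in> x ` Z \<Longrightarrow> W s \<noteq> 0" "\<And>F. (\<Sum>z\<in>Z. w z * F (x z)) = (\<Sum>s\<in>x ` Z. W s * F s)"
proof (rule that[of "\<lambda>s. w (inv_into Z x s)"])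
  show "w (inv_into Z x s) \<noteq> 0" if "s \<in> x ` Z" for s using assms(3) inv_into_into[OF that] by blast
  show "(\<Sum>z\<in>Z. w z * F (x z)) = (\<Sum>s\<in>x ` Z. w (inv_into Z x s) * F s)" for F
    using assms(2) by (simp add: sum.reindex)
qed

text \<open>The hypothesis says that linear forms restrict onto all polynomials of degree at most
  \<open>m\<close>, as on a line (\<open>m = 1\<close>) or a smooth conic (\<open>m = 2\<close>).
  Division by the monomial of degree \<open>m\<close> carries this over to forms of degree
  \<open>i\<close>.\<close>

lemma forms_along_curve_surj:
  fixes T :: "'k::field \<Rightarrow> 3 \<Rightarrow> 'k"
  assumes H: "\<And>p. degree p \<le> m \<Longrightarrow> \<exists>l. \<forall>x. dot l (T x) = poly p x"
    and "degree p \<le> m * i"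
  shows "\<exists>f\<in>hp i. \<forall>x. f (T x) = poly p x"
  using assms(2)
proof (induction i arbitrary: p)
  case 0
  then obtain c where "p = [:c:]" by (auto elim: degree_eq_zeroE)
  then show ?case by auto
next
  case (Suc i)
  let ?M = "monom 1 m :: 'k poly"
  define q where "q = p div ?M"
  define r where "r = p mod ?M"
  have M0: "?M \<noteq> 0" by simp
  have p: "p = ?M * q + r" by (simp add: q_def r_def)
  have r: "degree r \<le> m"
  proof (cases "r = 0")
    case False
    then show ?thesis using degree_mod_less[OF M0, of p] by (simp add: r_def degree_monom_eq)
  qed simp
  have q: "degree q \<le> m * i"
  proof (cases "q = 0")
    case False
    have "degree (?M * q) = m + degree q" using False by (simp add: degree_mult_eq degree_monom_eq)
    moreover have "?M * q = p - r" by (simp add: p)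
    moreover have "degree (p - r) \<le> m * Suc i" using Suc.prems r by (intro degree_diff_le) auto
    ultimately show ?thesis by simp
  qed simp
  obtain l where l: "\<forall>x. dot l (T x) = poly ?M x" using H[of ?M] by (auto simp: degree_monom_eq)
  obtain l' where l': "\<forall>x. dot l' (T x) = poly r x" using H[OF r] by blast
  obtain f where f: "f \<in> hp i" "\<forall>x. f (T x) = poly q x" using Suc.IH[OF q] by blast
  obtain g where g: "g \<in> hp i" "\<forall>x. g (T x) = poly 1 x" using Suc.IH[of 1] by auto
  have "(\<lambda>v. dot l v * f v + dot l' v * g v) \<in> hp (Suc i)" by (intro hp_add hp_dot_times f g)
  then show ?case by (rule bexI[rotated]) (simp add: l l' f g p)
qed

text \<open>Forms of degree \<open>i\<close> restrict onto the polynomials of degree at most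
  \<open>m * i\<close>, so the pairing is exactly the one of \<open>finite_degenerate\<close> with
  \<open>m * i\<close> and \<open>m * e\<close> in place of \<open>i\<close> and
  \<open>e\<close>.\<close>

lemma nondeg_on_rational_curve:
  fixes T :: "'k::field_char_0 \<Rightarrow> 3 \<Rightarrow> 'k"
  assumes H: "\<And>p. degree p \<le> m \<Longrightarrow> \<exists>l. \<forall>x. dot l (T x) = poly p x"
    and T: "\<And>j. degree (q j) \<le> m" "\<And>x j. T x j = poly (q j) x"
    and Z: "finite Z" "proper Z" "\<And>z. z \<in> Z \<Longrightarrow> \<exists>c x. c \<noteq> 0 \<and> z = scl c (T x)"
    and w: "\<And>z. z \<in> Z \<Longrightarrow> w z \<noteq> 0"
    and lo: "m * i + 1 \<le> card Z" and hi: "card Z \<le> m * e + m * i + 1"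
  shows "\<exists>l. nondeg w e i Z l"
proof -
  obtain c x where cx: "\<And>z. z \<in> Z \<Longrightarrow> c z \<noteq> 0 \<and> z = scl (c z) (T (x z))" using Z(3) by metis
  have inj: "inj_on x Z"
  proof (rule inj_onI, rule ccontr)
    fix u v assume uv: "u \<in> Z" "v \<in> Z" "x u = x v" "u \<noteq> v"
    have "cross u v = cross (scl (c u) (T (x u))) (scl (c v) (T (x v)))" using cx uv by metis
    also have "\<dots> = 0" using uv by (simp add: cross_scl_left cross_scl_right fun_eq_iff)
    finally show False using proper_cross[OF Z(2)] uv by blast
  qed
  \<comment> \<open>The factors \<open>l^e\<close>, \<open>f\<close> and \<open>g\<close> are
    homogeneous of total degree \<open>e + 2 i\<close>; the scaling of the representatives is
    absorbed into the weights, which stay nonzero.\<close>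
  obtain W where W: "\<And>s. s \<in> x ` Z \<Longrightarrow> W s \<noteq> 0"
    "\<And>F. (\<Sum>z\<in>Z. w z * c z ^ (e + i + i) * F (x z)) = (\<Sum>s\<in>x ` Z. W s * F s)"
    by (rule sum_reindex_weights[OF Z(1) inj, of "\<lambda>z. w z * c z ^ (e + i + i)"]) (use w cx in auto)
  have card: "card (x ` Z) = card Z" by (rule card_image[OF inj])
  define bad where "bad = {y. \<exists>f. degree f \<le> m * i \<and> f \<noteq> 0 \<and>
    (\<forall>g. degree g \<le> m * i \<longrightarrow> (\<Sum>s\<in>x ` Z. W s * (s - y) ^ (m * e) * poly f s * poly g s) = 0)}"
  have "finite bad" unfolding bad_def
    by (rule finite_degenerate) (use Z W(1) lo hi card in auto)
  then obtain y where y: "y \<notin> bad"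
    using ex_new_if_finite[OF infinite_UNIV_char_0] by blast
  obtain l where l: "\<forall>s. dot l (T s) = poly ([:-y, 1:] ^ m) s"
    using H[of "[:-y, 1:] ^ m"] by (auto simp: degree_linear_power)
  have "nondeg w e i Z l" unfolding nondeg_def
  proof (intro ballI impI)
    fix f v assume f: "f \<in> hp i" "\<forall>g\<in>hp i. (\<Sum>v\<in>Z. w v * dot l v ^ e * f v * g v) = 0" and v: "v \<in> Z"
    obtain p where p: "degree p \<le> m * i" "\<forall>s. f (T s) = poly p s"
      using hp_along_curve[of q m T, OF T f(1)] by (elim exE conjE)
    have eval: "h z = c z ^ i * poly r (x z)" if "h \<in> hp i" "\<forall>s. h (T s) = poly r s" "z \<in> Z" for h r z
      using hp_homogeneous[OF that(1), of "c z" "T (x z)"] cx[OF that(3)] that(2) by simp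
    have "(\<Sum>s\<in>x ` Z. W s * (s - y) ^ (m * e) * poly p s * poly r s) = 0" if r: "degree r \<le> m * i" for r
    proof -
      have "\<exists>g\<in>hp i. \<forall>s. g (T s) = poly r s"
        by (rule forms_along_curve_surj[of m T, OF _ r]) (rule H)
      then obtain g where g: "g \<in> hp i" "\<forall>s. g (T s) = poly r s" by blast
      have "0 = (\<Sum>v\<in>Z. w v * dot l v ^ e * f v * g v)" using f g by simp
      also have "\<dots> = (\<Sum>z\<in>Z. w z * c z ^ (e + i + i) * ((x z - y) ^ (m * e) * poly p (x z) * poly r (x z)))"
      proof (rule sum.cong)
        fix z assume z: "z \<in> Z"
        have "dot l z = c z * (x z - y) ^ m"
          using arg_cong[OF conjunct2[OF cx[OF z]], of "dot l"] l by simp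
        then show "w z * dot l z ^ e * f z * g z = w z * c z ^ (e + i + i) * ((x z - y) ^ (m * e) * poly p (x z) * poly r (x z))"
          using eval[OF f(1) p(2) z] eval[OF g z] by (simp add: power_add power_mult_distrib mult_ac flip: power_mult)
      qed simp
      also have "\<dots> = (\<Sum>s\<in>x ` Z. W s * ((s - y) ^ (m * e) * poly p s * poly r s))" by (rule W(2))
      finally show ?thesis by (simp add: mult.assoc)
    qed
    then have "y \<in> bad" if "p \<noteq> 0" using that p(1) unfolding bad_def by (intro CollectI exI[of _ p]) simp
    then have "p = 0" using y by blast
    then show "f v = 0" using eval[OF f(1) p(2) v] by simp
  qed
  then show ?thesis by (rule exI[of _ l])
qed

lemma independent_of_cross:
  assumes "cross N B \<noteq> (0 :: 3 \<Rightarrow> 'k::field)"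
  obtains C where "dot N (cross B C) \<noteq> 0"
proof -
  obtain C where "dot C (cross N B) \<noteq> 0" using assms dot_all_zero by (metis dot_commute)
  then show ?thesis using that[of C] by (metis dot_cross_rotate)
qed

lemma nondeg_on_line:
  fixes Z :: "(3 \<Rightarrow> 'k::field_char_0) set"
  assumes a: "a \<noteq> 0" and Z: "finite Z" "proper Z" "\<And>z. z \<in> Z \<Longrightarrow> dot a z = 0"
    and w: "\<And>z. z \<in> Z \<Longrightarrow> w z \<noteq> 0"
    and lo: "i + 1 \<le> card Z" and hi: "card Z \<le> e + i + 1"
  shows "\<exists>l. nondeg w e i Z l"
proof -
  obtain N where N: "N \<in> Z" using lo by fastforce
  have Z0: "0 \<notin> Z" using Z(2) by (simp add: proper_def)
  then have N0: "N \<noteq> 0" using N by blast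
  obtain B where "dot a B = 0" and B: "cross N B \<noteq> 0"
      "\<And>z. z \<in> Z \<Longrightarrow> \<exists>c x. c \<noteq> 0 \<and> z = scl c (N + scl x B)"
    by (rule line_parametrization[OF a N0 Z(3)[OF N] Z(1) Z0 Z(3)], assumption, rule that)
  obtain C where C: "dot N (cross B C) \<noteq> 0" using independent_of_cross[OF B(1)] .
  show ?thesis
  proof (rule nondeg_on_rational_curve[where m = 1 and T = "\<lambda>x. N + scl x B" and q = "\<lambda>j. [:N j, B j:]"])
    fix p :: "'k poly" assume "degree p \<le> 1"
    then have p: "p = [:coeff p 0, coeff p 1:]"
      by (intro poly_eqI) (auto simp: coeff_pCons coeff_eq_0 split: nat.split)
    obtain l where l: "dot l N = coeff p 0" "dot l B = coeff p 1" using linear_form_with_values[OF C] by blast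
    have "dot l (N + scl x B) = poly p x" for x
      by (subst p) (simp add: dot_add_right l)
    then show "\<exists>l. \<forall>x. dot l (N + scl x B) = poly p x" by blast
  next
      show "degree [:N j, B j:] \<le> 1" for j by simp
    show "(N + scl x B) j = poly [:N j, B j:] x" for x j by simp
    show "card Z \<le> 1 * e + 1 * i + 1" "1 * i + 1 \<le> card Z" using lo hi by simp_all
  qed (fact Z w B)+
qed

lemma nondeg_on_smooth_conic:
  fixes Z :: "(3 \<Rightarrow> 'k::field_char_0) set"
  assumes U: "dot U0 (cross U1 U2) \<noteq> 0"
    and Z: "finite Z" "proper Z" "\<And>z. z \<in> Z \<Longrightarrow> \<exists>c x. c \<noteq> 0 \<and> z = scl c (U0 + scl x U1 + scl (x\<^sup>2) U2)"
    and w: "\<And>z. z \<in> Z \<Longrightarrow> w z \<noteq> 0"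
    and lo: "2 * i + 1 \<le> card Z" and hi: "card Z \<le> 2 * e + 2 * i + 1"
  shows "\<exists>l. nondeg w e i Z l"
proof (rule nondeg_on_rational_curve[where m = 2 and T = "\<lambda>x. U0 + scl x U1 + scl (x\<^sup>2) U2" and q = "\<lambda>j. [:U0 j, U1 j, U2 j:]"])
  fix p :: "'k poly" assume "degree p \<le> 2"
  then have p: "p = [:coeff p 0, coeff p 1, coeff p 2:]"
    by (intro poly_eqI) (auto simp: coeff_pCons coeff_eq_0 numeral_2_eq_2 split: nat.split)
  obtain l where l: "dot l U0 = coeff p 0" "dot l U1 = coeff p 1" "dot l U2 = coeff p 2"
    using linear_form_with_values[OF U] by blast
  have "dot l (U0 + scl x U1 + scl (x\<^sup>2) U2) = poly p x" for x
    by (subst p) (simp add: dot_add_right l power2_eq_square algebra_simps)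
  then show "\<exists>l. \<forall>x. dot l (U0 + scl x U1 + scl (x\<^sup>2) U2) = poly p x" by blast
next
  show "(U0 + scl x U1 + scl (x\<^sup>2) U2) j = poly [:U0 j, U1 j, U2 j:] x" for x j
    by (simp add: power2_eq_square algebra_simps)
  show "degree [:U0 j, U1 j, U2 j:] \<le> 2" for j by simp
qed (fact Z w lo hi)+


section \<open>Points on two lines\<close>

lemma cross_multiples: "u = scl a m \<Longrightarrow> v = scl b m \<Longrightarrow> cross u v = 0"
  by (simp add: vec3_eq_iff)

lemma choose_two: "\<forall>z\<in>A. \<exists>c x. P c x z \<Longrightarrow> \<exists>c x. \<forall>z\<in>A. P (c z) (x z) z"
  by metis

text \<open>Parameter \<open>0\<close> is the common point of the two lines. The linear form is
  normalised to \<open>1\<close> there, hence \<open>1 + t * x\<close> instead of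
  \<open>x - y\<close>.\<close>

definition deg_pairing :: "('k::field \<Rightarrow> 'k) \<Rightarrow> 'k set \<Rightarrow> nat \<Rightarrow> 'k \<Rightarrow> 'k poly \<Rightarrow> 'k poly \<Rightarrow> 'k"
  where "deg_pairing W S e t f g = (\<Sum>x\<in>S. W x * (1 + t * x) ^ e * poly f x * poly g x)"

lemma deg_pairing_smult: "deg_pairing W S e t f (smult c g) = c * deg_pairing W S e t f g"
  and deg_pairing_diff: "deg_pairing W S e t (f - f') g = deg_pairing W S e t f g - deg_pairing W S e t f' g"
  and deg_pairing_diff_right: "deg_pairing W S e t f (g - h) = deg_pairing W S e t f g - deg_pairing W S e t f h"
  and deg_pairing_smult_left: "deg_pairing W S e t (smult c f) g = c * deg_pairing W S e t f g"
  and deg_pairing_zero: "deg_pairing W S e t 0 g = 0"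
  and deg_pairing_zero_right: "deg_pairing W S e t f 0 = 0"
  by (simp_all add: deg_pairing_def sum.distrib sum_subtractf sum_distrib_left algebra_simps)

text \<open>For \<open>t \<noteq> 0\<close> one has \<open>1 + t x = t (x - y)\<close> with
  \<open>y = - 1 / t\<close>. The remaining value \<open>t = 0\<close>, with \<open>y\<close> at
  infinity, is simply counted as exceptional.\<close>

lemma finite_degenerate_slope:
  fixes S :: "'k::field_char_0 set"
  assumes S: "finite S" and w: "\<And>x. x \<in> S \<Longrightarrow> W x \<noteq> 0"
    and lo: "i + 1 \<le> card S" and hi: "card S \<le> e + i + 1"
  shows "finite {t. \<exists>f. degree f \<le> i \<and> f \<noteq> 0 \<and> (\<forall>g. degree g \<le> i \<longrightarrow> deg_pairing W S e t f g = 0)}"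
    (is "finite ?A")
proof -
  define bad where "bad = {y. \<exists>f. degree f \<le> i \<and> f \<noteq> 0 \<and>
    (\<forall>g. degree g \<le> i \<longrightarrow> (\<Sum>x\<in>S. W x * (x - y) ^ e * poly f x * poly g x) = 0)}"
  have fin: "finite bad" unfolding bad_def by (rule finite_degenerate[OF S w lo hi])
  have "?A \<subseteq> {0} \<union> (\<lambda>y. - (1 / y)) ` bad"
  proof
    fix t assume "t \<in> ?A"
    then obtain f where f: "degree f \<le> i" "f \<noteq> 0" "\<And>g. degree g \<le> i \<Longrightarrow> deg_pairing W S e t f g = 0" by blast
    show "t \<in> {0} \<union> (\<lambda>y. - (1 / y)) ` bad"
    proof (cases "t = 0")
      case False
      have "(\<Sum>x\<in>S. W x * (x - (- (1 / t))) ^ e * poly f x * poly g x) = 0" if "degree g \<le> i" for g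
      proof -
        have "0 = deg_pairing W S e t f g" using f(3)[OF that] by simp
        also have "\<dots> = (\<Sum>x\<in>S. t ^ e * (W x * (x - (- (1 / t))) ^ e * poly f x * poly g x))"
          unfolding deg_pairing_def
        proof (rule sum.cong)
          fix x
          have "1 + t * x = t * (x - (- (1 / t)))" using False by (simp add: algebra_simps)
          then show "W x * (1 + t * x) ^ e * poly f x * poly g x = t ^ e * (W x * (x - - (1 / t)) ^ e * poly f x * poly g x)"
            by (simp add: power_mult_distrib)
        qed simp
        also have "\<dots> = t ^ e * (\<Sum>x\<in>S. W x * (x - (- (1 / t))) ^ e * poly f x * poly g x)" by (simp add: sum_distrib_left)
        finally show ?thesis using False by simp
      qed
      then have "- (1 / t) \<in> bad" using f unfolding bad_def by blast
      moreover have "t = - (1 / - (1 / t))" by simp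
      ultimately show ?thesis by blast
    qed simp
  qed
  then show ?thesis using fin finite_subset by blast
qed

text \<open>If \<open>f\<close> is orthogonal to all \<open>g\<close> with \<open>g(0) = 0\<close>,
  its functional is a multiple of evaluation at \<open>0\<close>. By \<open>nd\<close> such
  \<open>f\<close> form a space of dimension at most one. A nonzero one does not vanish at
  \<open>0\<close>: otherwise divide by \<open>x\<close> and apply \<open>nd'\<close>, the same
  pairing on multiples of \<open>x\<close>. So the factor is \<open>c * f(0)\<close> with one
  \<open>c\<close> for all. Writing \<open>degree f + 1 \<le> i\<close> makes \<open>nd'\<close>
  vacuous for \<open>i = 0\<close>.\<close>

lemma pairing_multiple_of_evaluation:
  fixes W :: "'k::field \<Rightarrow> 'k"
  assumes S: "finite S" "0 \<notin> S"
    and nd: "\<And>f. degree f \<le> i \<Longrightarrow> (\<And>g. degree g \<le> i \<Longrightarrow> deg_pairing W S e t f g = 0) \<Longrightarrow> f = 0"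
    and nd': "\<And>f. degree f + 1 \<le> i \<Longrightarrow> (\<And>g. degree g + 1 \<le> i \<Longrightarrow> deg_pairing (\<lambda>x. W x * x\<^sup>2) S e t f g = 0) \<Longrightarrow> f = 0"
  obtains c where "\<And>f. degree f \<le> i \<Longrightarrow> (\<And>g. degree g \<le> i \<Longrightarrow> poly g 0 = 0 \<Longrightarrow> deg_pairing W S e t f g = 0)
    \<Longrightarrow> (\<And>g. degree g \<le> i \<Longrightarrow> deg_pairing W S e t f g = c * poly f 0 * poly g 0)"
proof -
  define Q where "Q f \<longleftrightarrow> degree f \<le> i \<and> (\<forall>g. degree g \<le> i \<longrightarrow> poly g 0 = 0 \<longrightarrow> deg_pairing W S e t f g = 0)" for f
  have Q1: "deg_pairing W S e t f g = deg_pairing W S e t f 1 * poly g 0" if f: "Q f" and g: "degree g \<le> i" for f g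
  proof -
    have "degree (g - smult (poly g 0) 1) \<le> i" using g by (intro degree_diff_le) auto
    then have "deg_pairing W S e t f (g - smult (poly g 0) 1) = 0" using f unfolding Q_def by simp
    then show ?thesis unfolding deg_pairing_diff_right deg_pairing_smult by (simp add: mult.commute)
  qed
  have Q0: "f = 0" if f: "Q f" "deg_pairing W S e t f 1 = 0" for f
  proof (rule nd)
    show "degree f \<le> i" using f by (simp add: Q_def)
    show "deg_pairing W S e t f g = 0" if "degree g \<le> i" for g
      by (subst Q1[OF f(1) that]) (simp add: f(2))
  qed
  show ?thesis
  proof (cases "\<exists>f. Q f \<and> f \<noteq> 0")
    case False
    have "deg_pairing W S e t f g = 0 * poly f 0 * poly g 0" if "Q f" for f g
      using False that by (auto simp: deg_pairing_zero)
    then show ?thesis by (intro that[of 0]) (simp add: Q_def)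
  next
    case True
    then obtain h where h: "Q h" "h \<noteq> 0" by blast
    define l where "l = deg_pairing W S e t h 1"
    have l: "l \<noteq> 0" using Q0 h by (auto simp: l_def)
    have h0: "poly h 0 \<noteq> 0"
    proof
      assume "poly h 0 = 0"
      then obtain q where q: "h = pCons 0 q" by (metis pCons_cases poly_pCons mult_zero_left add.right_neutral)
      have q0: "q \<noteq> 0" using h q by auto
      have "degree q + 1 \<le> i" using h q q0 by (simp add: Q_def)
      moreover have "deg_pairing (\<lambda>x. W x * x\<^sup>2) S e t q g = 0" if g: "degree g + 1 \<le> i" for g
      proof -
        have "degree (pCons 0 g) \<le> i" using g by (auto intro: order_trans[OF degree_pCons_le])
        then have "deg_pairing W S e t h (pCons 0 g) = 0" using h unfolding Q_def by simp
        then show ?thesis by (simp add: deg_pairing_def q power2_eq_square mult_ac)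
      qed
      ultimately show False using nd'[of q] q0 by blast
    qed
    have key: "deg_pairing W S e t f g = l / poly h 0 * poly f 0 * poly g 0" if f: "Q f" and g: "degree g \<le> i" for f g
    proof -
      define m where "m = deg_pairing W S e t f 1 / l"
      have "Q (f - smult m h)"
        using f h unfolding Q_def
        by (auto simp: deg_pairing_diff deg_pairing_smult_left intro!: degree_diff_le order_trans[OF degree_smult_le])
      moreover have "deg_pairing W S e t (f - smult m h) 1 = 0"
        using l by (simp add: deg_pairing_diff deg_pairing_smult_left m_def l_def[symmetric])
      ultimately have "f - smult m h = 0" by (rule Q0)
      then have "f = smult m h" by simp
      then have "poly f 0 = m * poly h 0" by simp
      then have "l / poly h 0 * poly f 0 = deg_pairing W S e t f 1" using h0 l by (simp add: m_def)
      then show ?thesis using Q1[OF f g] by simp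
    qed
    show ?thesis by (rule that[of "l / poly h 0"], rule key) (simp_all add: Q_def)
  qed
qed

text \<open>Agreement at the common point \<open>N\<close> is the only obstruction. The constant
  term comes from a power of \<open>nu\<close>; the rest is divisible by the parameter, and the
  forms \<open>b1\<close>, \<open>b2\<close> supply that factor on one line while vanishing on the
  other.\<close>

lemma forms_on_two_lines:
  fixes N :: "3 \<Rightarrow> 'k::field"
  assumes ind: "dot N (cross B1 B2) \<noteq> 0"
    and "degree h1 \<le> i" "degree h2 \<le> i" "poly h1 0 = poly h2 0"
  shows "\<exists>G\<in>hp i. (\<forall>x. G (N + scl x B1) = poly h1 x) \<and> (\<forall>x. G (N + scl x B2) = poly h2 x)"
  using assms(2-4)
proof (induction i arbitrary: h1 h2)
  case 0
  then obtain c d where "h1 = [:c:]" "h2 = [:d:]" by (auto elim!: degree_eq_zeroE)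
  then show ?case using 0 by (intro bexI[of _ "\<lambda>v. c"]) auto
next
  case (Suc i)
  obtain p q1 where h1: "h1 = pCons p q1" by (metis pCons_cases)
  obtain p' q2 where h2: "h2 = pCons p' q2" by (metis pCons_cases)
  have p': "p' = p" using Suc.prems h1 h2 by simp
  have q: "degree q1 \<le> i" "degree q2 \<le> i"
    using Suc.prems h1 h2 by (auto simp: degree_pCons_eq_if split: if_splits)
  obtain nu where nu: "dot nu N = 1" "dot nu B1 = 0" "dot nu B2 = 0" using linear_form_with_values[OF ind] by blast
  obtain b1 where b1: "dot b1 N = 0" "dot b1 B1 = 1" "dot b1 B2 = 0" using linear_form_with_values[OF ind] by blast
  obtain b2 where b2: "dot b2 N = 0" "dot b2 B1 = 0" "dot b2 B2 = 1" using linear_form_with_values[OF ind] by blast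
  \<comment> \<open>The values on the second line do not matter, as \<open>b1\<close> vanishes
    there; a constant is the simplest choice that agrees at \<open>N\<close>.\<close>
  have "\<exists>G\<in>hp i. (\<forall>x. G (N + scl x B1) = poly q1 x) \<and> (\<forall>x. G (N + scl x B2) = poly [:poly q1 0:] x)"
    by (rule Suc.IH) (use q in simp_all)
  then obtain G1 where G1: "G1 \<in> hp i" "\<forall>x. G1 (N + scl x B1) = poly q1 x" by blast
  have "\<exists>G\<in>hp i. (\<forall>x. G (N + scl x B1) = poly [:poly q2 0:] x) \<and> (\<forall>x. G (N + scl x B2) = poly q2 x)"
    by (rule Suc.IH) (use q in simp_all)
  then obtain G2 where G2: "G2 \<in> hp i" "\<forall>x. G2 (N + scl x B2) = poly q2 x" by blast
  have "(\<lambda>v. dot b1 v * G1 v + dot b2 v * G2 v + p * dot nu v ^ Suc i) \<in> hp (Suc i)"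
    by (intro hp_add hp_dot_times hp_scale hp_dot_power G1 G2)
  moreover have "dot b1 (N + scl x B1) = x" "dot b2 (N + scl x B1) = 0" "dot nu (N + scl x B1) = 1"
    "dot b1 (N + scl x B2) = 0" "dot b2 (N + scl x B2) = x" "dot nu (N + scl x B2) = 1" for x
    by (simp_all add: nu b1 b2 dot_add_right)
  ultimately show ?case using G1(2) G2(2)
    by (intro bexI[of _ "\<lambda>v. dot b1 v * G1 v + dot b2 v * G2 v + p * dot nu v ^ Suc i"])
      (simp_all only: h1 h2 p' poly_pCons mult_zero_left add_0 add_0_right power_one mult_1_right add.commute simp_thms)
qed

text \<open>Test forms vanishing on the first line show that the second polynomial is orthogonal to
  everything zero at the common point. By \<open>pairing_multiple_of_evaluation\<close> the second
  line then contributes only \<open>c * f(N) * g(N)\<close>, and a one-variable pairing on the first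
  line remains, with \<open>c\<close> added to the weight of the common point. The upper bounds
  \<open>e + i\<close> leave room for that extra point.\<close>

lemma nondeg_on_two_lines:
  fixes Z1 Z2 :: "(3 \<Rightarrow> 'k::field_char_0) set"
  assumes a: "cross a1 a2 \<noteq> 0"
    and Z: "finite Z1" "finite Z2" "proper (Z1 \<union> Z2)"
    and Z1: "\<And>z. z \<in> Z1 \<Longrightarrow> dot a1 z = 0" and Z2: "\<And>z. z \<in> Z2 \<Longrightarrow> dot a2 z = 0 \<and> dot a1 z \<noteq> 0"
    and w: "\<And>z. z \<in> Z1 \<union> Z2 \<Longrightarrow> w z \<noteq> 0"
    and c2: "i + 1 \<le> card Z2" "card Z2 \<le> e + i"
    and c1: "i + 1 \<le> card {z\<in>Z1. dot a2 z \<noteq> 0}" "card {z\<in>Z1. dot a2 z \<noteq> 0} \<le> e + i"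
  shows "\<exists>l. nondeg w e i (Z1 \<union> Z2) l"
proof -
  define N where "N = cross a1 a2"
  define Z1' where "Z1' = {z\<in>Z1. dot a2 z \<noteq> 0}"
  define Z0 where "Z0 = {z\<in>Z1. dot a2 z = 0}"
  have N: "N \<noteq> 0" "dot a1 N = 0" "dot a2 N = 0" using a by (simp_all add: N_def)
  have a0: "a1 \<noteq> 0" "a2 \<noteq> 0" using a by (auto simp: vec3_eq_iff)
  have prp: "proper Z1'" "proper Z2" using Z(3) by (auto simp: Z1'_def elim!: proper_subset)
  have fin: "finite Z1'" "finite Z0" using Z by (auto simp: Z1'_def Z0_def)
  obtain B1 where B1: "dot a1 B1 = 0" "cross N B1 \<noteq> 0" "\<And>z. z \<in> Z1' \<Longrightarrow> \<exists>c x. c \<noteq> 0 \<and> z = scl c (N + scl x B1)"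
    by (rule line_parametrization[OF a0(1) N(1,2) fin(1)], use prp(1) in \<open>simp add: proper_def\<close>,
        use Z1 in \<open>simp add: Z1'_def\<close>, rule that)
  obtain B2 where B2: "dot a2 B2 = 0" "cross N B2 \<noteq> 0" "\<And>z. z \<in> Z2 \<Longrightarrow> \<exists>c x. c \<noteq> 0 \<and> z = scl c (N + scl x B2)"
    by (rule line_parametrization[OF a0(2) N(1,3) Z(2)], use prp(2) in \<open>simp add: proper_def\<close>,
        use Z2 in simp, rule that)
  have a1B2: "dot a1 B2 \<noteq> 0"
  proof
    assume "dot a1 B2 = 0"
    then obtain c where "B2 = scl c N" using orthogonal_to_both[of a1 B2 a2] B2(1) a by (auto simp: N_def)
    then show False using B2(2) by simp
  qed
  have ind: "dot N (cross B1 B2) \<noteq> 0"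
  proof -
    obtain c where c: "a1 = scl c (cross N B1)"
      using orthogonal_to_both[of N a1 B1] N B1 by (auto simp: dot_commute)
    have "dot a1 B2 = c * dot N (cross B1 B2)" by (subst c) (simp add: dot_eq algebra_simps)
    then show ?thesis using a1B2 by auto
  qed
  have "\<forall>z\<in>Z1'. \<exists>c x. c \<noteq> 0 \<and> z = scl c (N + scl x B1)" using B1(3) by (rule ballI)
  from choose_two[OF this] obtain k1 x1
    where "\<forall>z\<in>Z1'. k1 z \<noteq> 0 \<and> z = scl (k1 z) (N + scl (x1 z) B1)" by (elim exE)
  note kx1 = bspec[OF this]
  have "\<forall>z\<in>Z2. \<exists>c x. c \<noteq> 0 \<and> z = scl c (N + scl x B2)" using B2(3) by (rule ballI)
  from choose_two[OF this] obtain k2 x2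
    where "\<forall>z\<in>Z2. k2 z \<noteq> 0 \<and> z = scl (k2 z) (N + scl (x2 z) B2)" by (elim exE)
  note kx2 = bspec[OF this]
  have "\<forall>z\<in>Z0. \<exists>c (x :: 'k). z = scl c N"
    using orthogonal_to_both[of a1 _ a2] a Z1 by (auto simp: Z0_def N_def)
  from choose_two[OF this] obtain k0 where "\<forall>z\<in>Z0. z = scl (k0 z) N" by (elim exE)
  note k0 = bspec[OF this]
  have inj: "inj_on x Y"
    if kx: "\<And>z. z \<in> Y \<Longrightarrow> k z \<noteq> 0 \<and> z = scl (k z) (N + scl (x z) B)" and pr: "proper Y" for x k Y B
  proof (rule inj_onI, rule ccontr)
    fix u v assume uv: "u \<in> Y" "v \<in> Y" "x u = x v" "u \<noteq> v"
    have "u = scl (k u) (N + scl (x v) B)" "v = scl (k v) (N + scl (x v) B)"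
      using kx[OF uv(1)] kx[OF uv(2)] unfolding uv(3) by blast+
    then have "cross u v = 0" by (rule cross_multiples)
    then show False using proper_cross[OF pr uv(1,2,4)] by blast
  qed
  have inj1: "inj_on x1 Z1'" by (rule inj[OF kx1 prp(1)])
  have inj2: "inj_on x2 Z2" by (rule inj[OF kx2 prp(2)])
  have x1nz: "x1 z \<noteq> 0" if "z \<in> Z1'" for z
  proof
    assume "x1 z = 0"
    then have "z = scl (k1 z) N" using kx1[OF that] by simp
    then have "dot a2 z = k1 z * dot a2 N" by (metis dot_scl_right)
    then show False using that N by (simp add: Z1'_def)
  qed
  have x2nz: "x2 z \<noteq> 0" if "z \<in> Z2" for z
  proof
    assume "x2 z = 0"
    then have "z = scl (k2 z) N" using kx2[OF that] by simp
    then have "dot a1 z = k2 z * dot a1 N" by (metis dot_scl_right)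
    then show False using that N Z2 by simp
  qed
  obtain W1 where W1: "\<And>s. s \<in> x1 ` Z1' \<Longrightarrow> W1 s \<noteq> 0"
    "\<And>F. (\<Sum>z\<in>Z1'. w z * k1 z ^ (e + i + i) * F (x1 z)) = (\<Sum>s\<in>x1 ` Z1'. W1 s * F s)"
    by (rule sum_reindex_weights[OF fin(1) inj1, of "\<lambda>z. w z * k1 z ^ (e + i + i)"]) (use w kx1 in \<open>auto simp: Z1'_def\<close>)
  obtain W2 where W2: "\<And>s. s \<in> x2 ` Z2 \<Longrightarrow> W2 s \<noteq> 0"
    "\<And>F. (\<Sum>z\<in>Z2. w z * k2 z ^ (e + i + i) * F (x2 z)) = (\<Sum>s\<in>x2 ` Z2. W2 s * F s)"
    by (rule sum_reindex_weights[OF Z(2) inj2, of "\<lambda>z. w z * k2 z ^ (e + i + i)"]) (use w kx2 in auto)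
  define S1 where "S1 = x1 ` Z1'"
  define S2 where "S2 = x2 ` Z2"
  have fS: "finite S1" "finite S2" using fin Z by (simp_all add: S1_def S2_def)
  have S0: "0 \<notin> S1" "0 \<notin> S2" using x1nz x2nz by (auto simp: S1_def S2_def)
  have cS: "card S1 = card Z1'" "card S2 = card Z2" by (simp_all add: S1_def S2_def card_image inj1 inj2)
  define om where "om = (\<Sum>z\<in>Z0. w z * k0 z ^ (e + i + i))"
  define bad2 where "bad2 = {t. \<exists>f. degree f \<le> i \<and> f \<noteq> 0 \<and> (\<forall>g. degree g \<le> i \<longrightarrow> deg_pairing W2 S2 e t f g = 0)}"
  \<comment> \<open>The pairing of multiples of \<open>x\<close>, with the square moved into the
    weights; these stay nonzero as no point of \<open>Z2\<close> has parameter \<open>0\<close>. At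
    \<open>i - 1\<close> the upper bound of \<open>finite_degenerate_slope\<close> reads
    \<open>card Z2 \<le> e + i\<close>. The case \<open>i = 0\<close> is set aside because there
    \<open>i - 1\<close> would be \<open>0\<close>.\<close>
  define bad2' where "bad2' = {t. \<exists>f. degree f \<le> i - 1 \<and> f \<noteq> 0 \<and> (\<forall>g. degree g \<le> i - 1 \<longrightarrow> deg_pairing (\<lambda>x. W2 x * x\<^sup>2) S2 e t f g = 0)}"
  have "finite bad2" unfolding bad2_def
    by (rule finite_degenerate_slope) (use fS W2 c2 cS in \<open>auto simp: S2_def\<close>)
  moreover have "finite bad2'" if "i \<noteq> 0" unfolding bad2'_def
    by (rule finite_degenerate_slope) (use fS W2(1) S0 c2 cS that in \<open>auto simp: S2_def\<close>)
  ultimately have "finite (bad2 \<union> (if i = 0 then {} else bad2'))" by simp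
  then obtain u where "u \<notin> bad2 \<union> (if i = 0 then {} else bad2')"
    using ex_new_if_finite[OF infinite_UNIV_char_0] by blast
  then have u: "u \<notin> bad2" "i \<noteq> 0 \<Longrightarrow> u \<notin> bad2'" by auto
  have nd2: "f = 0" if "degree f \<le> i" "\<And>g. degree g \<le> i \<Longrightarrow> deg_pairing W2 S2 e u f g = 0" for f
    using u(1) that unfolding bad2_def by blast
  have nd2': "f = 0" if deg: "degree f + 1 \<le> i" and hyp: "\<And>g. degree g + 1 \<le> i \<Longrightarrow> deg_pairing (\<lambda>x. W2 x * x\<^sup>2) S2 e u f g = 0" for f
  proof (rule ccontr)
    assume "f \<noteq> 0"
    moreover have "i \<noteq> 0" using deg by simp
    moreover have "degree f \<le> i - 1" using deg by simp
    moreover have "deg_pairing (\<lambda>x. W2 x * x\<^sup>2) S2 e u f g = 0" if "degree g \<le> i - 1" for g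
      using that \<open>i \<noteq> 0\<close> by (intro hyp) simp
    ultimately have "u \<in> bad2'" unfolding bad2'_def by blast
    then show False using u(2) \<open>i \<noteq> 0\<close> by blast
  qed
  obtain c where c: "\<And>f g. degree f \<le> i \<Longrightarrow> (\<And>g. degree g \<le> i \<Longrightarrow> poly g 0 = 0 \<Longrightarrow> deg_pairing W2 S2 e u f g = 0)
    \<Longrightarrow> degree g \<le> i \<Longrightarrow> deg_pairing W2 S2 e u f g = c * poly f 0 * poly g 0"
    by (rule pairing_multiple_of_evaluation[OF fS(2) S0(2) nd2 nd2']) blast+
  obtain t where t: "\<And>f. degree f \<le> i \<Longrightarrow> (\<And>g. degree g \<le> i \<Longrightarrow>
      deg_pairing W1 S1 e t f g + (om + c) * poly f 0 * poly g 0 = 0) \<Longrightarrow> f = 0"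
  proof -
    \<comment> \<open>The one-variable result wants nonzero weights, so the common point is included
      only if its total weight \<open>om + c\<close> is nonzero.\<close>
    define S1' where "S1' = (if om + c = 0 then S1 else insert 0 S1)"
    define W1' where "W1' = W1(0 := om + c)"
    have eq: "deg_pairing W1' S1' e t f g = deg_pairing W1 S1 e t f g + (om + c) * poly f 0 * poly g 0" for t f g
    proof -
      have "deg_pairing W1' S1 e t f g = deg_pairing W1 S1 e t f g"
        unfolding deg_pairing_def using S0 by (intro sum.cong) (auto simp: W1'_def)
      then show ?thesis using fS S0 by (auto simp: S1'_def deg_pairing_def W1'_def)
    qed
    define bad where "bad = {t. \<exists>f. degree f \<le> i \<and> f \<noteq> 0 \<and> (\<forall>g. degree g \<le> i \<longrightarrow> deg_pairing W1' S1' e t f g = 0)}"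
    have "finite bad" unfolding bad_def
    proof (rule finite_degenerate_slope)
      show "W1' x \<noteq> 0" if "x \<in> S1'" for x
        using that W1(1) S0 by (auto simp: W1'_def S1'_def S1_def split: if_splits)
      show "finite S1'" "i + 1 \<le> card S1'" "card S1' \<le> e + i + 1"
        using fS c1 cS S0 by (auto simp: S1'_def Z1'_def)
    qed
    then obtain t where "t \<notin> bad" using ex_new_if_finite[OF infinite_UNIV_char_0] by blast
    then show ?thesis unfolding bad_def eq by (intro that[of t]) blast
  qed
  obtain l where l: "dot l N = 1" "dot l B1 = t" "dot l B2 = u" using linear_form_with_values[OF ind] by blast
  have "nondeg w e i (Z1 \<union> Z2) l" unfolding nondeg_def
  proof (intro ballI impI)
    fix f v assume f: "f \<in> hp i" "\<forall>g\<in>hp i. (\<Sum>v\<in>Z1 \<union> Z2. w v * dot l v ^ e * f v * g v) = 0" and v: "v \<in> Z1 \<union> Z2"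
    obtain p1 where p1: "degree p1 \<le> i" "\<forall>x. f (N + scl x B1) = poly p1 x" using hp_along_line[OF f(1), of N B1] by (elim exE conjE)
    obtain p2 where p2: "degree p2 \<le> i" "\<forall>x. f (N + scl x B2) = poly p2 x" using hp_along_line[OF f(1), of N B2] by (elim exE conjE)
    have N0: "N + scl 0 B = N" for B by (simp add: fun_eq_iff)
    have p0: "poly p1 0 = f N" "poly p2 0 = f N" using p1(2)[rule_format, of 0] p2(2)[rule_format, of 0] by (simp_all add: N0)
    have decomp: "Z1 \<union> Z2 = (Z0 \<union> Z1') \<union> Z2" by (auto simp: Z0_def Z1'_def)
    have disj: "Z0 \<inter> Z1' = {}" "(Z0 \<union> Z1') \<inter> Z2 = {}" using Z1 Z2 by (auto simp: Z0_def Z1'_def)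
    have pair: "deg_pairing W1 S1 e t p1 h1 + om * poly p1 0 * poly h1 0 + deg_pairing W2 S2 e u p2 h2 = 0"
      if h: "degree h1 \<le> i" "degree h2 \<le> i" "poly h1 0 = poly h2 0" for h1 h2
    proof -
      obtain g where g: "g \<in> hp i" "\<forall>x. g (N + scl x B1) = poly h1 x" "\<forall>x. g (N + scl x B2) = poly h2 x"
        using forms_on_two_lines[OF ind h] by blast
      have gN: "g N = poly h1 0" using g(2)[rule_format, of 0] by (simp add: N0)
      have ev: "h z = k ^ i * h v" if "h \<in> hp i" "z = scl k v" for h z k v
        using hp_homogeneous that by blast
      have "0 = (\<Sum>v\<in>Z1 \<union> Z2. w v * dot l v ^ e * f v * g v)" using f g by simp
      also have "\<dots> = (\<Sum>v\<in>Z0. w v * dot l v ^ e * f v * g v) + (\<Sum>v\<in>Z1'. w v * dot l v ^ e * f v * g v) + (\<Sum>v\<in>Z2. w v * dot l v ^ e * f v * g v)"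
        unfolding decomp using fin Z disj by (simp add: sum.union_disjoint)
      also have "(\<Sum>v\<in>Z0. w v * dot l v ^ e * f v * g v) = om * poly p1 0 * poly h1 0"
      proof -
        have "w z * dot l z ^ e * f z * g z = w z * k0 z ^ (e + i + i) * (poly p1 0 * poly h1 0)" if z: "z \<in> Z0" for z
        proof -
          have "dot l z = k0 z" using k0[OF z] l(1) by (metis dot_scl_right mult.right_neutral)
          then show ?thesis
            by (simp add: ev[OF f(1) k0[OF z]] ev[OF g(1) k0[OF z]] p0 gN power_add mult_ac)
        qed
        then have "(\<Sum>v\<in>Z0. w v * dot l v ^ e * f v * g v) = (\<Sum>z\<in>Z0. w z * k0 z ^ (e + i + i) * (poly p1 0 * poly h1 0))"
          by (rule sum.cong[OF refl])
        then show ?thesis by (simp only: om_def sum_distrib_right mult.assoc)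
      qed
      also have "(\<Sum>v\<in>Z1'. w v * dot l v ^ e * f v * g v) = deg_pairing W1 S1 e t p1 h1"
      proof -
        have "w z * dot l z ^ e * f z * g z = w z * k1 z ^ (e + i + i) * ((1 + t * x1 z) ^ e * poly p1 (x1 z) * poly h1 (x1 z))"
          if z: "z \<in> Z1'" for z
        proof -
          note kz = conjunct2[OF kx1[OF z]]
          have "dot l z = k1 z * (1 + t * x1 z)" using arg_cong[OF kz, of "dot l"] by (simp add: dot_add_right l mult.commute)
          then show ?thesis
            by (simp add: ev[OF f(1) kz] ev[OF g(1) kz] p1 g(2) power_add power_mult_distrib mult_ac)
        qed
        then have "(\<Sum>v\<in>Z1'. w v * dot l v ^ e * f v * g v)
          = (\<Sum>z\<in>Z1'. w z * k1 z ^ (e + i + i) * ((1 + t * x1 z) ^ e * poly p1 (x1 z) * poly h1 (x1 z)))"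
          by (rule sum.cong[OF refl])
        also have "\<dots> = (\<Sum>s\<in>x1 ` Z1'. W1 s * ((1 + t * s) ^ e * poly p1 s * poly h1 s))" by (rule W1(2))
        finally show ?thesis by (simp add: deg_pairing_def S1_def mult.assoc)
      qed
      also have "(\<Sum>v\<in>Z2. w v * dot l v ^ e * f v * g v) = deg_pairing W2 S2 e u p2 h2"
      proof -
        have "w z * dot l z ^ e * f z * g z = w z * k2 z ^ (e + i + i) * ((1 + u * x2 z) ^ e * poly p2 (x2 z) * poly h2 (x2 z))"
          if z: "z \<in> Z2" for z
        proof -
          note kz = conjunct2[OF kx2[OF z]]
          have "dot l z = k2 z * (1 + u * x2 z)" using arg_cong[OF kz, of "dot l"] by (simp add: dot_add_right l mult.commute)
          then show ?thesis
            by (simp add: ev[OF f(1) kz] ev[OF g(1) kz] p2 g(3) power_add power_mult_distrib mult_ac)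
        qed
        then have "(\<Sum>v\<in>Z2. w v * dot l v ^ e * f v * g v)
          = (\<Sum>z\<in>Z2. w z * k2 z ^ (e + i + i) * ((1 + u * x2 z) ^ e * poly p2 (x2 z) * poly h2 (x2 z)))"
          by (rule sum.cong[OF refl])
        also have "\<dots> = (\<Sum>s\<in>x2 ` Z2. W2 s * ((1 + u * s) ^ e * poly p2 s * poly h2 s))" by (rule W2(2))
        finally show ?thesis by (simp add: deg_pairing_def S2_def mult.assoc)
      qed
      finally show ?thesis by (simp add: add.commute)
    qed
    \<comment> \<open>Test forms that vanish on the first line.\<close>
    have "deg_pairing W2 S2 e u p2 g = 0" if "degree g \<le> i" "poly g 0 = 0" for g
      using pair[of 0 g] that by (simp add: deg_pairing_zero_right)
    then have c': "deg_pairing W2 S2 e u p2 g = c * poly p2 0 * poly g 0" if "degree g \<le> i" for g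
      using c[OF p2(1) _ that] by blast
    have "p1 = 0"
    proof (rule t[OF p1(1)])
      fix g :: "'k poly" assume g: "degree g \<le> i"
      show "deg_pairing W1 S1 e t p1 g + (om + c) * poly p1 0 * poly g 0 = 0"
        using pair[of g "[:poly g 0:]"] g c'[of "[:poly g 0:]"] p0 by (simp add: algebra_simps)
    qed
    moreover have "p2 = 0"
      by (rule nd2[OF p2(1)]) (use c' p0 \<open>p1 = 0\<close> in simp)
    ultimately have zero: "f N = 0" "\<And>x. f (N + scl x B1) = 0" "\<And>x. f (N + scl x B2) = 0"
      using p0 p1(2) p2(2) by simp_all
    have multiple: "f v = 0" if "v = scl k y" "f y = 0" for k y
      using hp_homogeneous[OF f(1), of k y] that by simp
    consider "v \<in> Z0" | "v \<in> Z1'" | "v \<in> Z2" using v unfolding decomp by blast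
    then show "f v = 0"
    proof cases
      case 1
      show ?thesis by (rule multiple[OF k0[OF 1] zero(1)])
    next
      case 2
      show ?thesis by (rule multiple[OF conjunct2[OF kx1[OF 2]] zero(2)])
    next
      case 3
      show ?thesis by (rule multiple[OF conjunct2[OF kx2[OF 3]] zero(3)])
    qed
  qed
  then show ?thesis by (rule exI[of _ l])
qed


subsection \<open>Separation of points and relations between their evaluations\<close>

text \<open>\<open>P\<close> imposes independent conditions on forms of degree
  \<open>n\<close>.\<close>

definition separates :: "nat \<Rightarrow> (3 \<Rightarrow> 'k::field) set \<Rightarrow> bool"
  where "separates n P \<longleftrightarrow> (\<forall>v\<in>P. \<exists>f\<in>hp n. \<forall>u\<in>P. f u = (if u = v then 1 else 0))"

lemma separates_mono:
  assumes "separates n P" "n \<le> m" "0 \<notin> P"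
  shows "separates m (P :: (3 \<Rightarrow> 'k::field) set)"
  unfolding separates_def
proof
  fix v assume v: "v \<in> P"
  obtain f where f: "f \<in> hp n" "\<forall>u\<in>P. f u = (if u = v then 1 else 0)" using assms(1) v unfolding separates_def by blast
  have "v \<noteq> 0" using v assms(3) by blast
  then obtain b where b: "dot b v = 1" by (rule form_nonvanishing)
  have "(\<lambda>u. dot b u ^ (m - n) * f u) \<in> hp (m - n + n)" by (intro hp_times hp_dot_power f)
  then show "\<exists>f\<in>hp m. \<forall>u\<in>P. f u = (if u = v then 1 else 0)"
    using assms(2) f b by (intro bexI[of _ "\<lambda>u. dot b u ^ (m - n) * f u"]) auto
qed

lemma separates_subset: "separates n P \<Longrightarrow> Q \<subseteq> P \<Longrightarrow> separates n Q"
  unfolding separates_def by (meson subset_iff)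

lemma separatesE:
  assumes "separates n P" "v \<in> P"
  obtains f where "f \<in> hp n" "f v = 1" "\<And>u. u \<in> P \<Longrightarrow> u \<noteq> v \<Longrightarrow> f u = 0"
  using assms unfolding separates_def by fastforce

lemma relation_on_separated:
  assumes "separates n S" "finite P" "S \<subseteq> P" "\<And>v. v \<in> P - S \<Longrightarrow> c v = 0"
    and "\<forall>f\<in>hp n. (\<Sum>v\<in>P. c v * f v) = (0::'k::field)"
  shows "\<forall>v\<in>P. c v = 0"
proof
  fix v assume v: "v \<in> P"
  show "c v = 0"
  proof (cases "v \<in> S")
    case True
    obtain f where f: "f \<in> hp n" "f v = 1" "\<And>u. u \<in> S \<Longrightarrow> u \<noteq> v \<Longrightarrow> f u = 0" using separatesE[OF assms(1) True] by blast
    have "0 = (\<Sum>u\<in>P. c u * f u)" using assms(5) f by simp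
    also have "\<dots> = (\<Sum>u\<in>P. if u = v then c v else 0)"
      by (rule sum.cong) (use assms(3,4) f in auto)
    finally show ?thesis using v assms(2) by simp
  qed (use assms(4) v in blast)
qed

lemma nondeg_of_separates:
  fixes P :: "(3 \<Rightarrow> 'k::field_char_0) set"
  assumes "separates i P" "finite P" "0 \<notin> P" "\<And>v. v \<in> P \<Longrightarrow> w v \<noteq> 0"
  shows "\<exists>l. nondeg w e i P l"
proof -
  have "\<exists>l. nondeg w e i ({} \<union> P) l"
  proof (rule nondeg_split_ex)
    show "\<exists>q\<in>hp i. q y \<noteq> 0 \<and> (\<forall>u\<in>{} \<union> P. u \<noteq> y \<longrightarrow> q u = 0)" if "y \<in> P" for y
      using separatesE[OF assms(1) that] by (metis Un_empty_left zero_neq_one)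
    show "\<exists>l. nondeg w e i {} l" by (simp add: nondeg_def)
  qed (use assms in auto)
  then show ?thesis by simp
qed

text \<open>This says \<open>F(l) \<noteq> 0\<close> for some \<open>l\<close>. Were the sum of
  \<open>w v * dot l v ^ d\<close> zero for all \<open>l\<close>, polarisation would replace the
  powers of \<open>l\<close> one by one by arbitrary linear factors, until every form of degree
  \<open>d\<close> is reached; a form isolating one point contradicts this.\<close>

lemma nondeg_constants:
  fixes P :: "(3 \<Rightarrow> 'k::field_char_0) set"
  assumes P: "finite P" "P \<noteq> {}" and sep: "separates d P" and w: "\<And>v. v \<in> P \<Longrightarrow> w v \<noteq> 0"
  shows "\<exists>l. nondeg w d 0 P l"
proof -
  have "\<exists>l. (\<Sum>v\<in>P. w v * dot l v ^ d) \<noteq> 0"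
  proof (rule ccontr)
    assume contra: "\<not> ?thesis"
    have pol: "(\<Sum>v\<in>P. w v * dot l v ^ m * f v) = 0" if "k + m = d" "f \<in> hp k" for k m f l
      using that
    proof (induction k arbitrary: m f l)
      case 0
      then obtain c where "f = (\<lambda>v. c)" by auto
      then show ?case using contra 0 by (simp add: sum_distrib_right[symmetric])
    next
      case (Suc k)
      have step: "(\<Sum>v\<in>P. w v * dot l v ^ m * (dot h v * g v)) = 0" if g: "g \<in> hp k" for h g
      proof -
        \<comment> \<open>Its values are the sums at \<open>l + s h\<close>, hence zero. Its
          derivative at \<open>0\<close> is \<open>m + 1\<close> times the sum with one factor
          \<open>l\<close> replaced by \<open>h\<close>.\<close>
        define E where "E = (\<Sum>v\<in>P. [:w v * g v:] * [:dot l v, dot h v:] ^ Suc m)"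
        have "poly E s = 0" for s
        proof -
          have "poly E s = (\<Sum>v\<in>P. w v * dot (l + scl s h) v ^ Suc m * g v)"
            unfolding E_def poly_sum by (rule sum.cong) (simp_all add: dot_add_left algebra_simps)
          also have "\<dots> = 0" by (rule Suc.IH) (use Suc.prems g in auto)
          finally show ?thesis .
        qed
        then have "E = 0" using poly_all_0_iff_0[of E] by blast
        then have "0 = poly (pderiv E) 0" by simp
        also have "\<dots> = (\<Sum>v\<in>P. of_nat (Suc m) * (w v * dot l v ^ m * (dot h v * g v)))"
          unfolding E_def pderiv_sum poly_sum
          by (rule sum.cong) (simp_all only: pderiv_mult pderiv_power_Suc, simp_all add: pderiv_pCons algebra_simps)
        also have "\<dots> = of_nat (Suc m) * (\<Sum>v\<in>P. w v * dot l v ^ m * (dot h v * g v))"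
          by (simp only: sum_distrib_left)
        finally have "of_nat (Suc m) * (\<Sum>v\<in>P. w v * dot l v ^ m * (dot h v * g v)) = 0" by (rule sym)
        then show ?thesis unfolding mult_eq_0_iff using of_nat_neq_0[of m, where ?'a = 'k] by blast
      qed
      obtain f0 f1 f2 where f: "f0 \<in> hp k" "f1 \<in> hp k" "f2 \<in> hp k" "f = (\<lambda>v. v 0 * f0 v + v 1 * f1 v + v 2 * f2 v)"
        using Suc.prems(2) by (rule hp_SucE)
      define E :: "3 \<Rightarrow> 3 \<Rightarrow> 'k" where "E i = (\<lambda>j. if j = i then 1 else 0)" for i
      have E: "dot (E 0) v = v 0" "dot (E 1) v = v 1" "dot (E 2) v = v 2" for v
        by (simp_all add: dot_eq E_def)
      have "(\<Sum>v\<in>P. w v * dot l v ^ m * f v) = (\<Sum>v\<in>P. w v * dot l v ^ m * (dot (E 0) v * f0 v))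
        + (\<Sum>v\<in>P. w v * dot l v ^ m * (dot (E 1) v * f1 v)) + (\<Sum>v\<in>P. w v * dot l v ^ m * (dot (E 2) v * f2 v))"
        unfolding E f(4) by (simp add: sum.distrib[symmetric] distrib_left)
      then show ?case using step f by simp
    qed
    obtain v where v: "v \<in> P" using P by blast
    obtain f where f: "f \<in> hp d" "f v = 1" "\<And>u. u \<in> P \<Longrightarrow> u \<noteq> v \<Longrightarrow> f u = 0" using separatesE[OF sep v] by blast
    have "0 = (\<Sum>u\<in>P. w u * f u)" using pol[of d 0 f] f by simp
    also have "\<dots> = (\<Sum>u\<in>P. if u = v then w v else 0)" by (rule sum.cong) (use f in auto)
    finally show False using v P w by simp
  qed
  then obtain l where l: "(\<Sum>v\<in>P. w v * dot l v ^ d) \<noteq> 0" by blast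
  have "nondeg w d 0 P l" unfolding nondeg_def
  proof (intro ballI impI)
    fix f v assume f: "f \<in> hp 0" "\<forall>g\<in>hp 0. (\<Sum>v\<in>P. w v * dot l v ^ d * f v * g v) = 0"
    obtain c where c: "f = (\<lambda>v. c)" using f(1) by auto
    have "(\<Sum>v\<in>P. w v * dot l v ^ d * f v * 1) = 0" using bspec[OF f(2), of "\<lambda>v. 1"] by auto
    then have "(\<Sum>v\<in>P. w v * dot l v ^ d) * c = 0" by (simp add: c sum_distrib_right)
    then show "f v = 0" using l c by simp
  qed
  then show ?thesis by (rule exI[of _ l])
qed

text \<open>A form of degree \<open>t\<close> restricts to a polynomial with \<open>t + 1\<close>
  coefficients, so the evaluations at \<open>t + 2\<close> points of a line satisfy a
  relation.\<close>

lemma collinear_points_bound: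
  fixes Z :: "(3 \<Rightarrow> 'k::field_char_0) set"
  assumes sep: "separates t Z" and Z: "finite Z" "0 \<notin> Z" and a: "a \<noteq> 0" "\<And>z. z \<in> Z \<Longrightarrow> dot a z = 0"
  shows "card Z \<le> t + 1"
proof (rule ccontr)
  assume big: "\<not> card Z \<le> t + 1"
  then obtain N where N: "N \<in> Z" by fastforce
  then have N0: "N \<noteq> 0" using Z by blast
  obtain B where "dot a B = 0" "cross N B \<noteq> 0" and B: "\<And>z. z \<in> Z \<Longrightarrow> \<exists>c x. c \<noteq> 0 \<and> z = scl c (N + scl x B)"
    by (rule line_parametrization[OF a(1) N0 a(2)[OF N] Z(1) Z(2) a(2)], assumption, rule that)
  have "\<forall>z\<in>Z. \<exists>c x. c \<noteq> 0 \<and> z = scl c (N + scl x B)" using B by (rule ballI)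
  from choose_two[OF this] obtain c s where "\<forall>z\<in>Z. c z \<noteq> 0 \<and> z = scl (c z) (N + scl (s z) B)" by (elim exE)
  note cs = bspec[OF this]
  have "\<exists>x. (\<exists>z\<in>Z. x z \<noteq> 0) \<and> (\<forall>k\<in>{..t}. (\<Sum>z\<in>Z. (c z ^ t * s z ^ k) * x z) = 0)"
    by (rule underdetermined_system) (use Z big in auto)
  then obtain x v where x: "v \<in> Z" "x v \<noteq> 0" "\<And>k. k \<le> t \<Longrightarrow> (\<Sum>z\<in>Z. c z ^ t * s z ^ k * x z) = 0" by auto
  obtain f where f: "f \<in> hp t" "f v = 1" "\<And>u. u \<in> Z \<Longrightarrow> u \<noteq> v \<Longrightarrow> f u = 0" using separatesE[OF sep x(1)] by blast
  obtain p where p: "degree p \<le> t" "\<forall>x. f (N + scl x B) = poly p x"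
    using hp_along_line[OF f(1), of N B] by (elim exE conjE)
  have pe: "poly p y = (\<Sum>k\<le>t. coeff p k * y ^ k)" for y
    unfolding poly_altdef using p(1) by (intro sum.mono_neutral_left) (auto simp: coeff_eq_0)
  have "x v = (\<Sum>z\<in>Z. if z = v then x v else 0)" using x(1) Z by simp
  also have "\<dots> = (\<Sum>z\<in>Z. x z * f z)" by (rule sum.cong) (use f in auto)
  also have "\<dots> = (\<Sum>z\<in>Z. \<Sum>k\<le>t. coeff p k * (c z ^ t * s z ^ k * x z))"
  proof (rule sum.cong)
    fix z assume z: "z \<in> Z"
    have "f z = c z ^ t * f (N + scl (s z) B)"
      using hp_homogeneous[OF f(1), of "c z" "N + scl (s z) B"] conjunct2[OF cs[OF z]] by metis
    then have "f z = c z ^ t * (\<Sum>k\<le>t. coeff p k * s z ^ k)" using p(2) pe by simp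
    then show "x z * f z = (\<Sum>k\<le>t. coeff p k * (c z ^ t * s z ^ k * x z))"
      by (simp add: sum_distrib_left sum_distrib_right mult_ac)
  qed simp
  also have "\<dots> = (\<Sum>k\<le>t. \<Sum>z\<in>Z. coeff p k * (c z ^ t * s z ^ k * x z))" by (rule sum.swap)
  also have "\<dots> = (\<Sum>k\<le>t. coeff p k * (\<Sum>z\<in>Z. c z ^ t * s z ^ k * x z))" by (simp only: sum_distrib_left)
  also have "\<dots> = 0" using x(3) by simp
  finally show False using x(2) by simp
qed


section \<open>A line that carries almost all points\<close>

lemma two_lines_common_point:
  assumes "cross a b \<noteq> 0" "proper (P :: (3 \<Rightarrow> 'k::field) set)" "finite P"
  shows "card {z\<in>P. dot a z = 0 \<and> dot b z = 0} \<le> 1"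
proof -
  have "u = v" if "u \<in> {z\<in>P. dot a z = 0 \<and> dot b z = 0}" "v \<in> {z\<in>P. dot a z = 0 \<and> dot b z = 0}" for u v
  proof (rule ccontr)
    assume "u \<noteq> v"
    have "\<exists>c. u = scl c (cross a b)" "\<exists>c. v = scl c (cross a b)"
      by (rule orthogonal_to_both; use that assms(1) in simp)+
    then obtain c d where "u = scl c (cross a b)" "v = scl d (cross a b)" by (elim exE)
    then have "cross u v = 0" by (rule cross_multiples)
    then show False using proper_cross[OF assms(2)] that \<open>u \<noteq> v\<close> by blast
  qed
  then show ?thesis using card_le_Suc0_iff_eq[of "{z\<in>P. dot a z = 0 \<and> dot b z = 0}"] assms(3) by simp
qed

locale weighted_points =
  fixes P :: "(3 \<Rightarrow> 'k::field_char_0) set" and w :: "(3 \<Rightarrow> 'k) \<Rightarrow> 'k" and t d :: nat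
  assumes fin: "finite P" and proper: "proper P" and weight: "\<And>v. v \<in> P \<Longrightarrow> w v \<noteq> 0"
    and sep: "separates t P" and d: "2 * t \<le> d"
begin

lemma zero_notin: "0 \<notin> P"
  using proper by (simp add: proper_def)

lemma line_bound: "a \<noteq> 0 \<Longrightarrow> Z \<subseteq> P \<Longrightarrow> (\<And>z. z \<in> Z \<Longrightarrow> dot a z = 0) \<Longrightarrow> card Z \<le> t + 1"
  by (rule collinear_points_bound[OF separates_subset[OF sep]])
    (use zero_notin fin finite_subset in auto)

lemma nondeg_large_degree: "t \<le> i \<Longrightarrow> \<exists>l. nondeg w e i P l"
  by (rule nondeg_of_separates[OF separates_mono[OF sep]]) (use zero_notin fin weight in auto)

lemma relation_times_form:
  assumes "\<forall>f\<in>hp (Suc n). (\<Sum>v\<in>P. c v * f v) = 0"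
  shows "\<forall>f\<in>hp n. (\<Sum>v\<in>P. (dot a v * c v) * f v) = 0"
proof
  fix f :: "(3 \<Rightarrow> 'k) \<Rightarrow> 'k" assume "f \<in> hp n"
  then have "(\<Sum>v\<in>P. c v * (dot a v * f v)) = 0" by (rule bspec[OF assms hp_dot_times])
  then show "(\<Sum>v\<in>P. (dot a v * c v) * f v) = 0" by (simp add: mult_ac)
qed

text \<open>If the last two first differences equal \<open>1\<close>, the relation among the evaluations in degree
  \<open>t - 1\<close> is unique up to a scalar and its products with linear forms span a plane only; hence some
  linear form annihilates it.\<close>

lemma many_points_on_line:
  assumes t: "2 \<le> t" and dims: "fs.dim (res P ` hp (t - 1)) + 1 = card P" "fs.dim (res P ` hp (t - 2)) + 2 = card P"
  obtains a where "a \<noteq> 0" "card {v\<in>P. dot a v = 0} = t + 1"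
proof -
  obtain D where D: "D \<subseteq> P" "card D + fs.dim (res P ` hp (t - 1)) = card P"
    and D1: "\<And>\<psi>. \<exists>c. (\<forall>x\<in>D. c x = \<psi> x) \<and> (\<forall>f\<in>hp (t - 1). (\<Sum>x\<in>P. c x * f x) = 0)"
    by (rule orthogonal_complement_coordinates[OF fin hp_subspace[of "t - 1"]], rule that)
  obtain D' where D': "D' \<subseteq> P" "card D' + fs.dim (res P ` hp (t - 2)) = card P"
    and D2: "\<And>c. (\<forall>f\<in>hp (t - 2). (\<Sum>x\<in>P. c x * f x) = 0) \<Longrightarrow> (\<forall>x\<in>D'. c x = 0) \<Longrightarrow> (\<forall>x\<in>P. c x = 0)"
    by (rule orthogonal_complement_coordinates[OF fin hp_subspace[of "t - 2"]], rule that)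
  obtain p where p: "D = {p}" using D dims by (metis add_right_cancel add.commute card_1_singletonE)
  obtain c where c: "c p = 1" "\<forall>f\<in>hp (t - 1). (\<Sum>x\<in>P. c x * f x) = 0" using D1[of "\<lambda>_. 1"] p by auto
  have "card D' = 2" using D' dims by simp
  then obtain d1 d2 where d12: "D' = {d1, d2}" "d1 \<noteq> d2" by (metis card_2_iff)
  \<comment> \<open>The line through the two points whose values determine the relations of degree
    \<open>t - 2\<close>. Its product with \<open>c\<close> is such a relation and zero at both,
    hence zero.\<close>
  define a where "a = cross d1 d2"
  have a0: "a \<noteq> 0" using proper_cross[OF proper] d12 D' by (simp add: a_def)
  have ac: "dot a v * c v = 0" if "v \<in> P" for v
  proof -
    have "Suc (t - 2) = t - 1" using t by simp
    then have "\<forall>f\<in>hp (t - 2). (\<Sum>v\<in>P. (dot a v * c v) * f v) = 0"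
      using relation_times_form[of "t - 2" c a] c by simp
    moreover have "\<forall>x\<in>D'. dot a x * c x = 0" by (simp add: d12 a_def)
    ultimately show ?thesis using D2[of "\<lambda>v. dot a v * c v"] that by blast
  qed
  define Z where "Z = {v\<in>P. dot a v = 0}"
  have pZ: "p \<in> Z" using ac[of p] c p D by (auto simp: Z_def)
  have "card Z \<le> t + 1" by (rule line_bound[OF a0]) (auto simp: Z_def)
  moreover have "t + 1 \<le> card Z"
  proof (rule ccontr)
    assume "\<not> t + 1 \<le> card Z"
    then have "card (Z - {p}) \<le> t - 1" using pZ by simp
    moreover have "cross u p \<noteq> 0" if "u \<in> Z - {p}" for u
      using proper_cross[OF proper] that pZ by (auto simp: Z_def)
    ultimately obtain f where f: "f \<in> hp (t - 1)" "f p = 1" "\<forall>u\<in>Z - {p}. f u = 0"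
      using hp_separate[of "Z - {p}" "t - 1" p] fin pZ zero_notin by (fastforce simp: Z_def)
    have "0 = (\<Sum>x\<in>P. c x * f x)" using c f by simp
    also have "\<dots> = (\<Sum>x\<in>P. if x = p then 1 else 0)"
      by (rule sum.cong) (use ac c f in \<open>auto simp: Z_def\<close>)
    also have "\<dots> = 1" using pZ fin by (simp add: Z_def)
    finally show False by simp
  qed
  ultimately show ?thesis using that[OF a0] by (simp add: Z_def)
qed

text \<open>A point off the line is isolated by \<open>a\<close> times a form of degree
  \<open>i - 1\<close>. The \<open>t + 1\<close> points on the line fit the bounds of
  \<open>nondeg_on_line\<close>, since \<open>i + 1 \<le> t + 1 \<le> d - i + 1\<close>.\<close>

lemma nondeg_line_plus_points:
  assumes a: "a \<noteq> 0" "card {v\<in>P. dot a v = 0} = t + 1" and i: "1 \<le> i" "i < t"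
    and Y: "\<And>y. y \<in> P \<Longrightarrow> dot a y \<noteq> 0 \<Longrightarrow> \<exists>g\<in>hp (i - 1). g y \<noteq> 0 \<and> (\<forall>u\<in>P. dot a u \<noteq> 0 \<longrightarrow> u \<noteq> y \<longrightarrow> g u = 0)"
  shows "\<exists>l. nondeg w (d - 2 * i) i P l"
proof -
  define Z where "Z = {v\<in>P. dot a v = 0}"
  have "\<exists>l. nondeg w (d - 2 * i) i (Z \<union> (P - Z)) l"
  proof (rule nondeg_split_ex)
    fix y assume y: "y \<in> P - Z"
    then obtain g where g: "g \<in> hp (i - 1)" "g y \<noteq> 0" "\<forall>u\<in>P. dot a u \<noteq> 0 \<longrightarrow> u \<noteq> y \<longrightarrow> g u = 0"
      using Y by (auto simp: Z_def)
    have "(\<lambda>v. dot a v * g v) \<in> hp (Suc (i - 1))" by (rule hp_dot_times[OF g(1)])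
    then have "(\<lambda>v. dot a v * g v) \<in> hp i" using i by simp
    then show "\<exists>q\<in>hp i. q y \<noteq> 0 \<and> (\<forall>u\<in>Z \<union> (P - Z). u \<noteq> y \<longrightarrow> q u = 0)"
      by (rule bexI[rotated]) (use g y in \<open>auto simp: Z_def\<close>)
  next
    show "\<exists>l. nondeg w (d - 2 * i) i Z l"
      by (rule nondeg_on_line[OF a(1)])
        (use fin weight proper a(2) i d in \<open>auto simp: Z_def elim: proper_subset\<close>)
  qed (use fin weight zero_notin in \<open>auto simp: Z_def\<close>)
  moreover have "Z \<union> (P - Z) = P" by (auto simp: Z_def)
  ultimately show ?thesis by simp
qed

lemma few_points_separated:
  assumes "S \<subseteq> P" "card S \<le> n + 1" "y \<in> S"
  shows "\<exists>g\<in>hp n. g y \<noteq> 0 \<and> (\<forall>u\<in>S. u \<noteq> y \<longrightarrow> g u = 0)"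
proof -
  have fS: "finite S" using assms(1) fin by (rule finite_subset)
  have "\<exists>g\<in>hp n. g y = 1 \<and> (\<forall>u\<in>S - {y}. g u = 0)"
  proof (rule hp_separate)
    show "cross u y \<noteq> 0" if "u \<in> S - {y}" for u
      using proper_cross[OF proper, of u y] that assms by blast
  qed (use assms fS zero_notin in auto)
  then obtain g where g: "g \<in> hp n" "g y = 1" "\<forall>u\<in>S - {y}. g u = 0" by blast
  then show ?thesis by (intro bexI[OF _ g(1)]) simp
qed

lemma nondeg_line_plus_one:
  assumes "a \<noteq> 0" "card {v\<in>P. dot a v = 0} = t + 1" "card P = t + 2" "1 \<le> i" "i < t"
  shows "\<exists>l. nondeg w (d - 2 * i) i P l"
proof (rule nondeg_line_plus_points[OF assms(1,2,4,5)])
  fix y assume y: "y \<in> P" "dot a y \<noteq> 0"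
  have "{v\<in>P. dot a v \<noteq> 0} = P - {v\<in>P. dot a v = 0}" by auto
  then have "card {v\<in>P. dot a v \<noteq> 0} = 1" using assms fin by (simp add: card_Diff_subset)
  then show "\<exists>g\<in>hp (i - 1). g y \<noteq> 0 \<and> (\<forall>u\<in>P. dot a u \<noteq> 0 \<longrightarrow> u \<noteq> y \<longrightarrow> g u = 0)"
    using few_points_separated[of "{v\<in>P. dot a v \<noteq> 0}" "i - 1" y] y by auto
qed

text \<open>Forms of degree \<open>i - 1\<close> separate the two further points except when
  \<open>i = 1\<close>. In that case the two points are taken as the content of a second
  line.\<close>

lemma nondeg_line_plus_two:
  assumes a: "a \<noteq> 0" "card {v\<in>P. dot a v = 0} = t + 1" "card P = t + 3" and i: "1 \<le> i" "i < t"
  shows "\<exists>l. nondeg w (d - 2 * i) i P l"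
proof -
  define Z where "Z = {v\<in>P. dot a v = 0}"
  define Y where "Y = {v\<in>P. dot a v \<noteq> 0}"
  have PY: "P = Z \<union> Y" "Z \<inter> Y = {}" by (auto simp: Z_def Y_def)
  have "Y = P - Z" by (auto simp: Z_def Y_def)
  then have cY: "card Y = 2" using a fin by (simp add: card_Diff_subset Z_def)
  show ?thesis
  proof (cases "i = 1")
    case False
    show ?thesis
    proof (rule nondeg_line_plus_points[OF a(1,2) i])
      fix y assume "y \<in> P" "dot a y \<noteq> 0"
      then show "\<exists>g\<in>hp (i - 1). g y \<noteq> 0 \<and> (\<forall>u\<in>P. dot a u \<noteq> 0 \<longrightarrow> u \<noteq> y \<longrightarrow> g u = 0)"
        using few_points_separated[of Y "i - 1" y] cY False i by (auto simp: Y_def)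
    qed
  next
    case True
    obtain y1 y2 where y: "Y = {y1, y2}" "y1 \<noteq> y2" using cY by (metis card_2_iff)
    define b where "b = cross y1 y2"
    have yP: "y1 \<in> P" "y2 \<in> P" "dot a y1 \<noteq> 0" "dot a y2 \<noteq> 0" using y by (auto simp: Y_def)
    have b0: "b \<noteq> 0" using proper_cross[OF proper] y yP by (simp add: b_def)
    have ab: "cross a b \<noteq> 0"
    proof
      assume "cross a b = 0"
      then obtain c where c: "b = scl c a" using parallel_of_cross_zero a by blast
      have "dot b y1 = 0" by (simp add: b_def)
      then show False using c yP b0 by auto
    qed
    \<comment> \<open>The first line may lose one point, the one it shares with the second
      line.\<close>
    have cz: "card {z\<in>Z. dot b z \<noteq> 0} \<le> t + 1" "t \<le> card {z\<in>Z. dot b z \<noteq> 0}"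
    proof -
      have fZ: "finite Z" using fin by (simp add: Z_def)
      have eq: "Z = {z\<in>Z. dot b z \<noteq> 0} \<union> {z\<in>P. dot a z = 0 \<and> dot b z = 0}" by (auto simp: Z_def)
      have "card Z \<le> card {z\<in>Z. dot b z \<noteq> 0} + card {z\<in>P. dot a z = 0 \<and> dot b z = 0}"
        by (subst eq) (rule card_Un_le)
      then show "t \<le> card {z\<in>Z. dot b z \<noteq> 0}"
        using two_lines_common_point[OF ab proper fin] a(2) by (simp add: Z_def)
      show "card {z\<in>Z. dot b z \<noteq> 0} \<le> t + 1"
        using card_mono[OF fZ, of "{z\<in>Z. dot b z \<noteq> 0}"] a(2) by (auto simp: Z_def)
    qed
    have "\<exists>l. nondeg w (d - 2 * i) i (Z \<union> Y) l"
    proof (rule nondeg_on_two_lines[OF ab])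
      show "i + 1 \<le> card Y" "card Y \<le> d - 2 * i + i" using cY i True d by simp_all
      show "i + 1 \<le> card {z\<in>Z. dot b z \<noteq> 0}" "card {z\<in>Z. dot b z \<noteq> 0} \<le> d - 2 * i + i" using cz i True d by simp_all
      show "dot b z = 0 \<and> dot a z \<noteq> 0" if "z \<in> Y" for z using that y yP by (auto simp: b_def)
      show "proper (Z \<union> Y)" using proper PY by simp
      show "finite Z" "finite Y" using fin by (simp_all add: Z_def Y_def)
      show "dot a z = 0" if "z \<in> Z" for z using that by (simp add: Z_def)
      show "w z \<noteq> 0" if "z \<in> Z \<union> Y" for z using that weight by (auto simp: Z_def Y_def)
    qed
    then show ?thesis using PY by simp
  qed
qed

text \<open>The three points off the line are not collinear and so have dual linear forms. Powers of
  these isolate them in degree \<open>i - 1 \<ge> 1\<close>; for \<open>i = 1\<close> they are used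
  as test forms themselves.\<close>

lemma nondeg_line_plus_three:
  assumes a: "a \<noteq> 0" "card {v\<in>P. dot a v = 0} = t + 1" "card P = t + 4" and i: "1 \<le> i" "i < t"
    and nc: "\<And>b. b \<noteq> 0 \<Longrightarrow> \<exists>v\<in>P. dot a v \<noteq> 0 \<and> dot b v \<noteq> 0"
  shows "\<exists>l. nondeg w (d - 2 * i) i P l"
proof -
  define Y where "Y = {v\<in>P. dot a v \<noteq> 0}"
  have "Y = P - {v\<in>P. dot a v = 0}" by (auto simp: Y_def)
  then have cY: "card Y = 3" using a fin by (simp add: card_Diff_subset)
  have line: "\<exists>b. dot b y \<noteq> 0 \<and> (\<forall>u\<in>Y. u \<noteq> y \<longrightarrow> dot b u = 0)" if y: "y \<in> Y" for y
  proof -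
    have "card (Y - {y}) = 2" using cY y by simp
    then obtain u v where uv: "Y - {y} = {u, v}" "u \<noteq> v" by (metis card_2_iff)
    have uvP: "u \<in> P" "v \<in> P" using uv by (auto simp: Y_def)
    have "cross u v \<noteq> 0" using proper_cross[OF proper uvP uv(2)] .
    then obtain x where x: "x \<in> P" "dot a x \<noteq> 0" "dot (cross u v) x \<noteq> 0" using nc by blast
    have "x \<in> Y" using x by (simp add: Y_def)
    then have "x = y" using x uv(1) by (metis DiffI dot_cross_self(3,4) insertE singletonD)
    then have "dot (cross u v) y \<noteq> 0" using x by simp
    moreover have "dot (cross u v) z = 0" if "z \<in> Y" "z \<noteq> y" for z
    proof -
      have "z \<in> {u, v}" using that uv(1) by blast
      then show ?thesis by auto
    qed
    ultimately show ?thesis by blast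
  qed
  show ?thesis
  proof (cases "i = 1")
    case False
    show ?thesis
    proof (rule nondeg_line_plus_points[OF a(1,2) i])
      fix y assume y: "y \<in> P" "dot a y \<noteq> 0"
      then obtain b where b: "dot b y \<noteq> 0" "\<forall>u\<in>Y. u \<noteq> y \<longrightarrow> dot b u = 0" using line[of y] by (auto simp: Y_def)
      show "\<exists>g\<in>hp (i - 1). g y \<noteq> 0 \<and> (\<forall>u\<in>P. dot a u \<noteq> 0 \<longrightarrow> u \<noteq> y \<longrightarrow> g u = 0)"
        by (rule bexI[OF _ hp_dot_power[of b "i - 1"]]) (use b False i in \<open>auto simp: Y_def\<close>)
    qed
  next
    case True
    \<comment> \<open>The equation of the line itself serves as \<open>l\<close>: since
      \<open>d - 2 > 0\<close>, the points on the line drop out. A kernel element vanishes at the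
      three others and is therefore zero.\<close>
    have "nondeg w (d - 2 * i) i P a" unfolding nondeg_def
    proof (intro ballI impI)
      fix f v assume f: "f \<in> hp i" "\<forall>g\<in>hp i. (\<Sum>v\<in>P. w v * dot a v ^ (d - 2 * i) * f v * g v) = 0" and v: "v \<in> P"
      have "f \<in> hp 1" using f(1) True by simp
      then obtain h where h: "f = dot h" by (rule hp_1E)
      have fy: "f y = 0" if y: "y \<in> Y" for y
      proof -
        obtain b where b: "dot b y \<noteq> 0" "\<forall>u\<in>Y. u \<noteq> y \<longrightarrow> dot b u = 0" using line[OF y] by blast
        have "0 = (\<Sum>v\<in>P. w v * dot a v ^ (d - 2 * i) * f v * dot b v)" using f(2) hp_dot[of b] True by simp
        also have "\<dots> = (\<Sum>v\<in>P. if v = y then w y * dot a y ^ (d - 2 * i) * f y * dot b y else 0)"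
        proof (rule sum.cong)
          fix v assume "v \<in> P"
          then show "w v * dot a v ^ (d - 2 * i) * f v * dot b v = (if v = y then w y * dot a y ^ (d - 2 * i) * f y * dot b y else 0)"
            using b i d True by (cases "v \<in> Y") (auto simp: Y_def)
        qed simp
        also have "\<dots> = w y * dot a y ^ (d - 2 * i) * f y * dot b y" using y fin by (simp add: Y_def)
        finally show ?thesis using y weight b by (auto simp: Y_def)
      qed
      have "h = 0"
      proof (rule ccontr)
        assume "h \<noteq> 0"
        then obtain u where "u \<in> P" "dot a u \<noteq> 0" "dot h u \<noteq> 0" using nc by blast
        then show False using fy[of u] h by (simp add: Y_def)
      qed
      then show "f v = 0" by (simp add: h)
    qed
    then show ?thesis by (rule exI[of _ a])
  qed
qed

end


subsection \<open>Conics\<close>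

definition mon :: "nat \<Rightarrow> (3 \<Rightarrow> 'k::field) \<Rightarrow> 'k"
  where "mon k = (if k = 0 then (\<lambda>v. v 0 * v 0) else if k = 1 then (\<lambda>v. v 1 * v 1)
    else if k = 2 then (\<lambda>v. v 2 * v 2) else if k = 3 then (\<lambda>v. v 0 * v 1)
    else if k = 4 then (\<lambda>v. v 0 * v 2) else (\<lambda>v. v 1 * v 2))"

lemma sum_less_6: "(\<Sum>k<6. f k) = f 0 + f 1 + f 2 + f 3 + f 4 + (f (5::nat) :: 'a::comm_monoid_add)"
proof -
  have eq: "{..<6::nat} = {0, 1, 2, 3, 4, 5}" by auto
  show ?thesis unfolding eq by (simp add: add.assoc)
qed

lemma less_6: "(k::nat) < 6 \<longleftrightarrow> k = 0 \<or> k = 1 \<or> k = 2 \<or> k = 3 \<or> k = 4 \<or> k = 5"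
  by auto

lemma sum_mon: "(\<Sum>k<6. c k * mon k v) = c 0 * (v 0 * v 0) + c 1 * (v 1 * v 1) + c 2 * (v 2 * v 2)
    + c 3 * (v 0 * v 1) + c 4 * (v 0 * v 2) + c 5 * (v 1 * v 2)"
  by (simp add: sum_less_6 mon_def)

lemma mon_hp: "(mon k :: (3 \<Rightarrow> 'k::field) \<Rightarrow> 'k) \<in> hp 2"
proof -
  have P: "(\<lambda>v :: 3 \<Rightarrow> 'k. v i * v j) \<in> hp 2" for i j :: 3
  proof -
    define E :: "3 \<Rightarrow> 3 \<Rightarrow> 'k" where "E i = (\<lambda>k. if k = i then 1 else 0)" for i
    have E: "dot (E i) v = v i" for v i
      by (simp add: dot_def E_def if_distrib[of "\<lambda>x. x * _"] cong: if_cong)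
    have "(\<lambda>v. dot (E i) v * dot (E j) v) \<in> hp (Suc 1)" by (rule hp_dot_times[OF hp_dot])
    then show ?thesis by (simp add: E numeral_2_eq_2)
  qed
  show ?thesis unfolding mon_def by (simp add: P)
qed

lemma hp_2E:
  fixes f :: "(3 \<Rightarrow> 'k::field) \<Rightarrow> 'k"
  assumes "f \<in> hp 2"
  obtains c where "\<And>v. f v = (\<Sum>k<6. c k * mon k v)"
proof -
  have "f \<in> hp (Suc 1)" using assms by (simp add: numeral_2_eq_2)
  then obtain f0 f1 f2 where f: "f0 \<in> hp 1" "f1 \<in> hp 1" "f2 \<in> hp 1" "f = (\<lambda>v. v 0 * f0 v + v 1 * f1 v + v 2 * f2 v)"
    by (rule hp_SucE)
  obtain a0 a1 a2 where a: "f0 = dot a0" "f1 = dot a1" "f2 = dot a2" using f hp_1E by metis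
  define c where "c k = (if k = 0 then a0 0 else if k = 1 then a1 1 else if k = 2 then a2 2
    else if k = 3 then a0 1 + a1 0 else if k = 4 then a0 2 + a2 0 else a1 2 + a2 1)" for k :: nat
  have "f v = (\<Sum>k<6. c k * mon k v)" for v
    unfolding sum_mon by (simp add: f a dot_eq c_def algebra_simps)
  then show ?thesis by (rule that)
qed

lemma mon_independent:
  fixes c :: "nat \<Rightarrow> 'k::field"
  assumes "\<And>v. (\<Sum>k<6. c k * mon k v) = 0" "k < 6"
  shows "c k = 0"
proof -
  define e where "e x y z = (\<lambda>i::3. if i = 0 then x else if i = 1 then y else z :: 'k)" for x y z
  have e: "c 0 * (x * x) + c 1 * (y * y) + c 2 * (z * z) + c 3 * (x * y) + c 4 * (x * z) + c 5 * (y * z) = 0" for x y z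
    using assms(1)[of "e x y z"] unfolding sum_mon by (simp add: e_def)
  have "c 0 = 0" "c 1 = 0" "c 2 = 0" using e[of 1 0 0] e[of 0 1 0] e[of 0 0 1] by simp_all
  moreover from this have "c 3 = 0" "c 4 = 0" "c 5 = 0" using e[of 1 1 0] e[of 1 0 1] e[of 0 1 1] by simp_all
  ultimately show ?thesis using assms(2) unfolding less_6 by auto
qed

text \<open>Vanishing on \<open>P\<close> amounts to at most five linear conditions on six
  coefficients.\<close>

lemma conic_through_points:
  fixes P :: "(3 \<Rightarrow> 'k::field) set"
  assumes P: "finite P" and dim: "fs.dim (res P ` hp 2) \<le> 5"
  obtains q where "q \<in> hp 2" "\<exists>v. q v \<noteq> 0" "\<And>v. v \<in> P \<Longrightarrow> q v = 0"
proof -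
  obtain B \<phi> where B: "B \<subseteq> P" "card B = fs.dim (res P ` (hp 2 :: ((3 \<Rightarrow> 'k) \<Rightarrow> 'k) set))"
    "\<And>b. b \<in> B \<Longrightarrow> \<phi> b \<in> hp 2"
    "\<And>b x. b \<in> B \<Longrightarrow> x \<in> B \<Longrightarrow> \<phi> b x = (if x = b then 1 else 0)"
    "\<And>f x. f \<in> hp 2 \<Longrightarrow> x \<in> P \<Longrightarrow> f x = (\<Sum>b\<in>B. f b * \<phi> b x)"
    by (rule information_set[OF P hp_subspace[of 2]], rule that)
  have "\<exists>c. (\<exists>k\<in>{..<6::nat}. c k \<noteq> 0) \<and> (\<forall>v\<in>B. (\<Sum>k<6. mon k v * c k) = 0)"
    by (rule underdetermined_system) (use B P dim finite_subset in auto)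
  then obtain c k where c: "k < 6" "c k \<noteq> 0" "\<And>v. v \<in> B \<Longrightarrow> (\<Sum>k<6. c k * mon k v) = 0"
    by (auto simp: mult.commute)
  define q where "q = (\<lambda>v. \<Sum>k<6. c k * mon k v)"
  have q: "q \<in> hp 2" unfolding q_def by (intro hp_sum hp_scale mon_hp)
  moreover have "\<exists>v. q v \<noteq> 0" using mon_independent[of c k] c unfolding q_def by blast
  moreover have "q v = 0" if "v \<in> P" for v
  proof -
    have "q b = 0" if "b \<in> B" for b using c(3)[OF that] by (simp add: q_def)
    then show ?thesis using B(5)[OF q that] by simp
  qed
  ultimately show ?thesis by (rule that)
qed

lemma no_conic_through_points:
  fixes P :: "(3 \<Rightarrow> 'k::field) set"
  assumes P: "finite P" and dim: "fs.dim (res P ` hp 2) = 6" and q: "q \<in> hp 2" "\<And>v. v \<in> P \<Longrightarrow> q v = 0"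
  shows "q v = 0"
proof -
  obtain B \<phi> where B: "B \<subseteq> P" "card B = fs.dim (res P ` (hp 2 :: ((3 \<Rightarrow> 'k) \<Rightarrow> 'k) set))"
    "\<And>b. b \<in> B \<Longrightarrow> \<phi> b \<in> hp 2"
    "\<And>b x. b \<in> B \<Longrightarrow> x \<in> B \<Longrightarrow> \<phi> b x = (if x = b then 1 else 0)"
    "\<And>f x. f \<in> hp 2 \<Longrightarrow> x \<in> P \<Longrightarrow> f x = (\<Sum>b\<in>B. f b * \<phi> b x)"
    by (rule information_set[OF P hp_subspace[of 2]], rule that)
  have fB: "finite B" using B P finite_subset by blast
  obtain c where c: "\<And>v. q v = (\<Sum>k<6. c k * mon k v)" using hp_2E[OF q(1)] by blast
  have "\<forall>b\<in>B. \<exists>m. \<forall>v. \<phi> b v = (\<Sum>k<6. m k * mon k v)"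
  proof
    fix b assume "b \<in> B"
    then obtain m where "\<And>v. \<phi> b v = (\<Sum>k<6. m k * mon k v)" using hp_2E[OF B(3)] by blast
    then show "\<exists>m. \<forall>v. \<phi> b v = (\<Sum>k<6. m k * mon k v)" by blast
  qed
  from bchoice[OF this] obtain m where "\<forall>b\<in>B. \<forall>v. \<phi> b v = (\<Sum>k<6. m b k * mon k v)" by (elim exE)
  note m = this[rule_format]
  \<comment> \<open>Seven quadrics, \<open>q\<close> under the index \<open>None\<close> and the six
    dual functions, face six monomials; a linear relation between them is forced to involve
    \<open>q\<close>.\<close>
  define M where "M = (\<lambda>k x. case x of None \<Rightarrow> c k | Some b \<Rightarrow> m b k)"
  have "\<exists>x. (\<exists>i\<in>insert None (Some ` B). x i \<noteq> 0) \<and> (\<forall>k\<in>{..<6::nat}. (\<Sum>i\<in>insert None (Some ` B). M k i * x i) = 0)"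
    by (rule underdetermined_system) (use fB B(2) dim in \<open>auto simp: card_image\<close>)
  then obtain x where x: "\<exists>i\<in>insert None (Some ` B). x i \<noteq> 0"
    "\<And>k. k < 6 \<Longrightarrow> (\<Sum>i\<in>insert None (Some ` B). M k i * x i) = 0" by auto
  have x': "c k * x None + (\<Sum>b\<in>B. m b k * x (Some b)) = 0" if "k < 6" for k
    using x(2)[OF that] fB by (simp add: M_def sum.reindex)
  have comb: "x None * q v + (\<Sum>b\<in>B. x (Some b) * \<phi> b v) = 0" for v
  proof -
    have "(\<Sum>b\<in>B. x (Some b) * \<phi> b v) = (\<Sum>b\<in>B. \<Sum>k<6. x (Some b) * m b k * mon k v)"
      using m by (intro sum.cong refl) (simp add: sum_distrib_left mult.assoc)
    also have "\<dots> = (\<Sum>k<6. \<Sum>b\<in>B. x (Some b) * m b k * mon k v)" by (rule sum.swap)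
    also have "\<dots> = (\<Sum>k<6. (\<Sum>b\<in>B. m b k * x (Some b)) * mon k v)"
      by (simp add: sum_distrib_right sum_distrib_left mult_ac)
    finally have "x None * q v + (\<Sum>b\<in>B. x (Some b) * \<phi> b v)
      = (\<Sum>k<6. (c k * x None + (\<Sum>b\<in>B. m b k * x (Some b))) * mon k v)"
      by (simp add: c sum_distrib_left sum.distrib[symmetric] algebra_simps)
    also have "\<dots> = 0"
    proof (rule sum.neutral, rule ballI)
      fix k assume "k \<in> {..<6::nat}"
      then show "(c k * x None + (\<Sum>b\<in>B. m b k * x (Some b))) * mon k v = 0"
        using x'[of k] by (simp only: lessThan_iff mult_zero_left)
    qed
    finally show ?thesis .
  qed
  have xB: "x (Some b) = 0" if b: "b \<in> B" for b
  proof -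
    have "(\<Sum>b'\<in>B. x (Some b') * \<phi> b' b) = (\<Sum>b'\<in>B. if b' = b then x (Some b) else 0)"
      by (rule sum.cong) (use B(4) b in auto)
    then show ?thesis using comb[of b] q(2)[of b] b B(1) fB by auto
  qed
  then have "x None \<noteq> 0" using x(1) by auto
  then show ?thesis using comb[of v] xB by simp
qed

lemma product_of_forms_zero:
  assumes "\<And>v. dot a v * dot b v = (0::'k::field)"
  shows "a = 0 \<or> b = 0"
proof (rule ccontr)
  assume "\<not> ?thesis"
  then obtain u v where uv: "dot a u \<noteq> 0" "dot b v \<noteq> 0" using dot_all_zero by metis
  then have "dot b u = 0" "dot a v = 0" using assms[of u] assms[of v] by auto
  then show False using assms[of "u + v"] uv by (simp add: dot_add_right)
qed

lemma hp_substitute: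
  assumes "f \<in> hp n"
  shows "(\<lambda>x. f (scl (x 0) A + scl (x 1) B + scl (x 2) C)) \<in> hp n"
  using assms
proof (induction n arbitrary: f)
  case (Suc n)
  obtain f0 f1 f2 where f: "f0 \<in> hp n" "f1 \<in> hp n" "f2 \<in> hp n" "f = (\<lambda>v. v 0 * f0 v + v 1 * f1 v + v 2 * f2 v)"
    using Suc.prems by (rule hp_SucE)
  define r where "r j = (\<lambda>i::3. if i = 0 then A j else if i = 1 then B j else C j)" for j
  have r: "dot (r j) x = (scl (x 0) A + scl (x 1) B + scl (x 2) C) j" for j x
    by (simp add: dot_eq r_def algebra_simps)
  have "(\<lambda>x. dot (r 0) x * f0 (scl (x 0) A + scl (x 1) B + scl (x 2) C) + dot (r 1) x * f1 (scl (x 0) A + scl (x 1) B + scl (x 2) C)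
    + dot (r 2) x * f2 (scl (x 0) A + scl (x 1) B + scl (x 2) C)) \<in> hp (Suc n)"
    by (intro hp_add hp_dot_times Suc.IH f)
  then show ?case unfolding r f(4) .
qed auto

lemma collinear_triple:
  assumes "b \<noteq> (0 :: 3 \<Rightarrow> 'k::field)" "dot b u = 0" "dot b v = 0" "dot b x = 0"
  shows "dot u (cross v x) = 0"
proof (rule ccontr)
  assume nz: "dot u (cross v x) \<noteq> 0"
  have "dot b y = 0" for y
    by (subst basis_expansion[OF nz, of y]) (simp add: dot_add_right assms)
  then show False using assms(1) dot_all_zero by blast
qed

lemma conic_in_coordinates:
  fixes q :: "(3 \<Rightarrow> 'k::field) \<Rightarrow> 'k"
  assumes q: "q \<in> hp 2" and D: "dot A (cross B C) \<noteq> 0" and qA: "q A = 0" and qB: "q B = 0"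
  obtains c2 c3 c4 c5 where "\<And>x y z. q (scl x A + scl y B + scl z C) = c2 * (z * z) + c3 * (x * y) + c4 * (x * z) + c5 * (y * z)"
proof -
  obtain c where c: "\<And>v. q (scl (v 0) A + scl (v 1) B + scl (v 2) C) = (\<Sum>k<6. c k * mon k v)"
    using hp_2E[OF hp_substitute[OF q, of A B C]] by blast
  define e where "e x y z = (\<lambda>i::3. if i = 0 then x else if i = 1 then y else z :: 'k)" for x y z
  have e: "q (scl x A + scl y B + scl z C) = c 0 * (x * x) + c 1 * (y * y) + c 2 * (z * z) + c 3 * (x * y) + c 4 * (x * z) + c 5 * (y * z)" for x y z
    using c[of "e x y z"] unfolding sum_mon by (simp add: e_def)
  have "scl 1 A + scl 0 B + scl 0 C = A" "scl 0 A + scl 1 B + scl 0 C = B" by (simp_all add: fun_eq_iff)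
  then have "c 0 = 0" "c 1 = 0" using e[of 1 0 0] e[of 0 1 0] qA qB by simp_all
  then show ?thesis using that[of "c 2" "c 3" "c 4" "c 5"] e by simp
qed

text \<open>With \<open>u\<close> and \<open>v\<close> as base points, the equation restricted to
  their line is a multiple of the product of the two coordinates. Both are nonzero at the third
  point, so the multiple is zero and the coordinate that cuts out the line divides
  \<open>q\<close>.\<close>

lemma line_divides_conic:
  fixes q :: "(3 \<Rightarrow> 'k::field) \<Rightarrow> 'k"
  assumes q: "q \<in> hp 2" and a: "a \<noteq> 0" "dot a u = 0" "dot a v = 0" "dot a y = 0"
    and ind: "cross u v \<noteq> 0" "cross u y \<noteq> 0" "cross v y \<noteq> 0" and z: "q u = 0" "q v = 0" "q y = 0"
  obtains b where "\<And>x. q x = dot a x * dot b x"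
proof -
  obtain C where D: "dot u (cross v C) \<noteq> 0" using independent_of_cross[OF ind(1)] .
  define D where "D = dot u (cross v C)"
  have D0: "D \<noteq> 0" using D by (simp add: D_def)
  obtain k where k: "a = scl k (cross u v)" using orthogonal_to_both[of u a v] a ind by (auto simp: dot_commute)
  have k0: "k \<noteq> 0" using k a(1) by (auto simp: vec3_eq_iff)
  define X where "X x = dot x (cross v C) / D" for x
  define Y where "Y x = dot x (cross C u) / D" for x
  define W where "W x = dot x (cross u v) / D" for x
  have expand: "x = scl (X x) u + scl (Y x) v + scl (W x) C" for x
    unfolding X_def Y_def W_def D_def by (rule basis_expansion[OF D])
  obtain c2 c3 c4 c5 where c: "\<And>x y z. q (scl x u + scl y v + scl z C) = c2 * (z * z) + c3 * (x * y) + c4 * (x * z) + c5 * (y * z)"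
    by (rule conic_in_coordinates[OF q D z(1,2)], rule that)
  have "dot y (cross u v) = 0" using a(4) k k0 by (simp add: dot_commute)
  then have Wy: "W y = 0" by (simp add: W_def)
  have ey: "y = scl (X y) u + scl (Y y) v" by (subst expand[of y]) (simp add: Wy fun_eq_iff)
  have "X y \<noteq> 0" using ind(3) by (subst (asm) ey) (auto simp: cross_add_right cross_scl_right fun_eq_iff)
  moreover have "Y y \<noteq> 0" using ind(2) by (subst (asm) ey) (auto simp: cross_add_right cross_scl_right fun_eq_iff)
  moreover have "c3 * (X y * Y y) = 0" using z(3) c[of "X y" "Y y" "W y"] expand[of y] by (simp add: Wy)
  ultimately have c3: "c3 = 0" by simp
  define b where "b = scl (1 / k) (scl (c2 / (D * D)) (cross u v) + scl (c4 / (D * D)) (cross v C) + scl (c5 / (D * D)) (cross C u))"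
  have "q x = dot a x * dot b x" for x
  proof -
    have "q x = q (scl (X x) u + scl (Y x) v + scl (W x) C)" using expand[of x] by simp
    also have "\<dots> = W x * (c2 * W x + c4 * X x + c5 * Y x)" unfolding c c3 by (simp add: algebra_simps)
    also have "\<dots> = dot a x * dot b x"
      unfolding k b_def W_def X_def Y_def dot_scl_left dot_add_left dot_commute[of x]
      using k0 D0 by (simp add: field_simps)
    finally show ?thesis .
  qed
  then show ?thesis by (rule that)
qed

lemma five_points_on_two_lines:
  assumes Z: "finite Z" "5 \<le> card Z" and q: "\<And>v. q v = dot a v * dot b v" "\<exists>v. q v \<noteq> (0::'k::field)"
    and qZ: "\<And>z. z \<in> Z \<Longrightarrow> q z = 0"
  shows "\<exists>u\<in>Z. \<exists>v\<in>Z. \<exists>x\<in>Z. u \<noteq> v \<and> u \<noteq> x \<and> v \<noteq> x \<and> dot u (cross v x) = 0"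
proof -
  have ab: "a \<noteq> 0" "b \<noteq> 0" using q by auto
  have "Z = {z\<in>Z. dot a z = 0} \<union> {z\<in>Z. dot b z = 0}" using qZ q(1) by auto
  from arg_cong[OF this, of card]
  have "card Z \<le> card {z\<in>Z. dot a z = 0} + card {z\<in>Z. dot b z = 0}"
    by (simp only: card_Un_le)
  then have "3 \<le> card {z\<in>Z. dot a z = 0} \<or> 3 \<le> card {z\<in>Z. dot b z = 0}" using Z(2) by linarith
  then obtain e where e: "e \<noteq> 0" "3 \<le> card {z\<in>Z. dot e z = 0}" using ab by blast
  obtain S where S: "S \<subseteq> {z\<in>Z. dot e z = 0}" "card S = 3" using obtain_subset_with_card_n[OF e(2)] by blast
  obtain u v x where uvx: "S = {u, v, x}" "u \<noteq> v" "u \<noteq> x" "v \<noteq> x" using S(2) by (auto simp: card_3_iff)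
  have "dot u (cross v x) = 0" by (rule collinear_triple[OF e(1)]) (use S uvx in auto)
  moreover have "u \<in> Z" "v \<in> Z" "x \<in> Z" using S uvx by auto
  ultimately show ?thesis using uvx by blast
qed

text \<open>With three points of \<open>Z\<close> as base the equation is
  \<open>c3 X Y + c4 X W + c5 Y W = 0\<close>. A zero coefficient would split it, and one of the two
  lines would contain three points of \<open>Z\<close>. Off the base points it becomes
  \<open>p + r + n = 0\<close> for \<open>p = c5 / X\<close>, \<open>r = c4 / Y\<close>,
  \<open>n = c3 / W\<close>: the standard Cremona map turns the conic into a line, whose
  parametrisation is pulled back.\<close>

lemma smooth_conic_parametrization:
  fixes Z :: "(3 \<Rightarrow> 'k::field_char_0) set"
  assumes Z: "finite Z" "5 \<le> card Z" and q: "q \<in> hp 2" "\<exists>v. q v \<noteq> 0" "\<And>z. z \<in> Z \<Longrightarrow> q z = 0"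
    and nc: "\<And>u v x. u \<in> Z \<Longrightarrow> v \<in> Z \<Longrightarrow> x \<in> Z \<Longrightarrow> u \<noteq> v \<Longrightarrow> u \<noteq> x \<Longrightarrow> v \<noteq> x \<Longrightarrow> dot u (cross v x) \<noteq> 0"
  obtains U0 U1 U2 where "dot U0 (cross U1 U2) \<noteq> 0"
    "\<And>z. z \<in> Z \<Longrightarrow> \<exists>c s. c \<noteq> 0 \<and> z = scl c (U0 + scl s U1 + scl (s\<^sup>2) U2)"
proof -
  have "3 \<le> card Z" using Z by simp
  then obtain S where S: "S \<subseteq> Z" "card S = 3" by (rule obtain_subset_with_card_n)
  obtain P0 P1 P2 where P': "S = {P0, P1, P2}" "P0 \<noteq> P1" "P0 \<noteq> P2" "P1 \<noteq> P2" using S(2) by (auto simp: card_3_iff)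
  have P: "P0 \<in> Z" "P1 \<in> Z" "P2 \<in> Z" using S P' by auto
  have D0: "dot P0 (cross P1 P2) \<noteq> 0" by (rule nc) (use P P' in auto)
  define D where "D = dot P0 (cross P1 P2)"
  have D: "D \<noteq> 0" using D0 by (simp add: D_def)
  obtain c2 c3 c4 c5 where c: "\<And>x y z. q (scl x P0 + scl y P1 + scl z P2) = c2 * (z * z) + c3 * (x * y) + c4 * (x * z) + c5 * (y * z)"
    by (rule conic_in_coordinates[OF q(1) D0 q(3)[OF P(1)] q(3)[OF P(2)]], rule that)
  have "scl 0 P0 + scl 0 P1 + scl 1 P2 = P2" by (simp add: fun_eq_iff)
  then have c2: "c2 = 0" using c[of 0 0 1] q(3)[OF P(3)] by simp
  define X where "X v = dot v (cross P1 P2) / D" for v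
  define Y where "Y v = dot v (cross P2 P0) / D" for v
  define W where "W v = dot v (cross P0 P1) / D" for v
  have expand: "v = scl (X v) P0 + scl (Y v) P1 + scl (W v) P2" for v
    unfolding X_def Y_def W_def D_def by (rule basis_expansion[OF D0])
  have qe: "q v = c3 * (X v * Y v) + c4 * (X v * W v) + c5 * (Y v * W v)" for v
    using arg_cong[OF expand[of v], of q] unfolding c c2 by simp
  have nofactor: "\<not> (\<forall>v. q v = dot a v * dot b v)" for a b
    using five_points_on_two_lines[OF Z _ q(2,3), of a b] nc by blast
  have lin: "X v = dot (scl (1 / D) (cross P1 P2)) v" "Y v = dot (scl (1 / D) (cross P2 P0)) v"
    "W v = dot (scl (1 / D) (cross P0 P1)) v" for v
    by (simp_all add: X_def Y_def W_def dot_commute[of v])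
  have c3: "c3 \<noteq> 0"
  proof
    assume "c3 = 0"
    then have "q v = dot (scl (1 / D) (cross P0 P1)) v * dot (scl c4 (scl (1 / D) (cross P1 P2)) + scl c5 (scl (1 / D) (cross P2 P0))) v" for v
      unfolding qe dot_add_left dot_scl_left[of c4] dot_scl_left[of c5] lin[symmetric] by (simp add: algebra_simps)
    then show False using nofactor by blast
  qed
  have c4: "c4 \<noteq> 0"
  proof
    assume "c4 = 0"
    then have "q v = dot (scl (1 / D) (cross P2 P0)) v * dot (scl c3 (scl (1 / D) (cross P1 P2)) + scl c5 (scl (1 / D) (cross P0 P1))) v" for v
      unfolding qe dot_add_left dot_scl_left[of c3] dot_scl_left[of c5] lin[symmetric] by (simp add: algebra_simps)
    then show False using nofactor by blast
  qed
  have c5: "c5 \<noteq> 0"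
  proof
    assume "c5 = 0"
    then have "q v = dot (scl (1 / D) (cross P1 P2)) v * dot (scl c3 (scl (1 / D) (cross P2 P0)) + scl c4 (scl (1 / D) (cross P0 P1))) v" for v
      unfolding qe dot_add_left dot_scl_left[of c3] dot_scl_left[of c4] lin[symmetric] by (simp add: algebra_simps)
    then show False using nofactor by blast
  qed
  \<comment> \<open>The values \<open>0\<close> and \<open>-1\<close> would send \<open>P1\<close>
    or \<open>P2\<close> to the parameter at infinity; the others would do so with a further point
    of \<open>Z\<close>.\<close>
  have "finite (insert 0 (insert (-1) ((\<lambda>z. (c4 * X z) / (c5 * Y z)) ` Z)))" using Z by simp
  then obtain k where k: "k \<notin> insert 0 (insert (-1) ((\<lambda>z. (c4 * X z) / (c5 * Y z)) ` Z))"
    using ex_new_if_finite[OF infinite_UNIV_char_0] by blast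
  then have k0: "k \<noteq> 0" "k \<noteq> -1" by auto
  have k1: "1 + k \<noteq> 0" using k0(2) by (metis add.commute add_eq_0_iff)
  \<comment> \<open>Coefficients of \<open>1\<close>, \<open>s\<close> and the square of
    \<open>s\<close> in \<open>c5 r n P0 + c4 p n P1 + c3 p r P2\<close>, where \<open>p\<close>,
    \<open>r\<close>, \<open>n\<close> are \<open>s\<close>, \<open>k s + 1\<close>,
    \<open>- ((1 + k) s + 1)\<close>.\<close>
  define U0 where "U0 = scl (- c5) P0"
  define U1 where "U1 = scl (- (1 + 2 * k) * c5) P0 + scl (- c4) P1 + scl c3 P2"
  define U2 where "U2 = scl (- (k * (1 + k)) * c5) P0 + scl (- (1 + k) * c4) P1 + scl (k * c3) P2"
  define T where "T s = U0 + scl s U1 + scl (s\<^sup>2) U2" for s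
  have T: "T s = scl (c5 * (k * s + 1) * (- ((1 + k) * s + 1))) P0 + scl (c4 * s * (- ((1 + k) * s + 1))) P1
    + scl (c3 * s * (k * s + 1)) P2" for s
    by (simp add: T_def U0_def U1_def U2_def fun_eq_iff power2_eq_square algebra_simps)
  show ?thesis
  proof (rule that)
    have "dot U0 (cross U1 U2) = - c3 * c4 * c5 * D"
    proof -
      have "dot U0 (cross U1 U2) = - c5 * (- c4 * (k * c3) * dot P0 (cross P1 P2) + c3 * (- (1 + k) * c4) * dot P0 (cross P2 P1))"
        by (simp add: U0_def U1_def U2_def dot_eq algebra_simps)
      moreover have "dot P0 (cross P2 P1) = - D" by (simp add: D_def dot_eq algebra_simps)
      ultimately show ?thesis by (simp add: D_def[symmetric] algebra_simps)
    qed
    then show "dot U0 (cross U1 U2) \<noteq> 0" using c3 c4 c5 D by simp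
    fix z assume z: "z \<in> Z"
    show "\<exists>c s. c \<noteq> 0 \<and> z = scl c (U0 + scl s U1 + scl (s\<^sup>2) U2)"
      unfolding T_def[symmetric]
    proof -
      consider "z = P0" | "z = P1" | "z = P2" | "z \<noteq> P0" "z \<noteq> P1" "z \<noteq> P2" by blast
      then show "\<exists>c s. c \<noteq> 0 \<and> z = scl c (T s)"
      proof cases
        case 1
        then show ?thesis using c5 by (intro exI[of _ "- 1 / c5"] exI[of _ 0]) (simp add: T fun_eq_iff)
      next
        case 2
        have "T (- (1 / k)) = scl (- c4 / (k * k)) P1"
          using k0(1) by (simp add: T fun_eq_iff field_simps)
        then show ?thesis using 2 c4 k0 by (intro exI[of _ "- (k * k) / c4"] exI[of _ "- (1 / k)"]) (simp add: fun_eq_iff)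
      next
        case 3
        have "T (- (1 / (1 + k))) = scl (- c3 / ((1 + k) * (1 + k))) P2"
          using k1 by (simp add: T fun_eq_iff field_simps)
        then show ?thesis using 3 c3 k1 by (intro exI[of _ "- ((1 + k) * (1 + k)) / c3"] exI[of _ "- (1 / (1 + k))"]) (simp add: fun_eq_iff)
      next
        case 4
        have xyz: "X z \<noteq> 0" "Y z \<noteq> 0" "W z \<noteq> 0"
          using nc[OF z P(2,3)] nc[OF z P(3,1)] nc[OF z P(1,2)] 4 P' D by (auto simp: X_def Y_def W_def)
        have zz: "c3 * (X z * Y z) + c4 * (X z * W z) + c5 * (Y z * W z) = 0" using qe[of z] q(3)[OF z] by simp
        define p where "p = c5 / X z"
        define r where "r = c4 / Y z"
        define n where "n = c3 / W z"
        have pnz: "p \<noteq> 0" "r \<noteq> 0" "n \<noteq> 0" using c3 c4 c5 xyz by (simp_all add: p_def r_def n_def)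
        have "p + r + n = (c3 * (X z * Y z) + c4 * (X z * W z) + c5 * (Y z * W z)) / (X z * Y z * W z)"
          using xyz by (simp add: p_def r_def n_def field_simps)
        then have "p + r + n = 0" using zz by simp
        then have sum0: "n = - (p + r)" by (simp only: add_eq_0_iff)
        \<comment> \<open>The scaling that turns \<open>r / m\<close> into \<open>k s + 1\<close>
          for \<open>s = p / m\<close>; the choice of \<open>k\<close> keeps it nonzero.\<close>
        define m where "m = r - k * p"
        have m: "m \<noteq> 0"
        proof
          assume "m = 0"
          then have "k = (c4 * X z) / (c5 * Y z)" using c5 xyz by (simp add: m_def p_def r_def field_simps)
          then show False using k z by blast
        qed
        define s where "s = p / m"
        have s: "k * s + 1 = r / m" "- ((1 + k) * s + 1) = n / m"
          using m by (simp_all add: s_def sum0 field_simps) (simp_all add: m_def algebra_simps)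
        define g where "g = c3 * c4 * c5 / (m * m * (X z * Y z * W z))"
        have g: "g \<noteq> 0" using c3 c4 c5 m xyz by (simp add: g_def)
        have "T s = scl (g * X z) P0 + scl (g * Y z) P1 + scl (g * W z) P2"
        proof -
          have "c5 * (r / m) * (n / m) = g * X z" "c4 * s * (n / m) = g * Y z" "c3 * s * (r / m) = g * W z"
            using xyz m by (simp_all add: g_def s_def p_def r_def n_def field_simps)
          then show ?thesis unfolding T s by simp
        qed
        also have "\<dots> = scl g (scl (X z) P0 + scl (Y z) P1 + scl (W z) P2)" by (simp add: fun_eq_iff algebra_simps)
        also have "\<dots> = scl g z" using expand[of z] by simp
        finally show ?thesis using g by (intro exI[of _ "1 / g"] exI[of _ s]) (simp add: fun_eq_iff)
      qed
    qed
  qed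
qed

text \<open>Three collinear points split the conic into two lines. As a line has at most
  \<open>t + 1\<close> of the \<open>2 t + 1\<close> points, each of the two lines keeps at least
  \<open>t\<close> points off the other, which is enough for degrees \<open>i < t\<close>. Without
  three collinear points the conic is parametrised.\<close>

lemma nondeg_on_conic:
  fixes Z :: "(3 \<Rightarrow> 'k::field_char_0) set"
  assumes Z: "finite Z" "proper Z" "card Z = 2 * t + 1" and t: "2 \<le> t"
    and w: "\<And>z. z \<in> Z \<Longrightarrow> w z \<noteq> 0" and d: "2 * t \<le> d" and i: "i < t"
    and q: "q \<in> hp 2" "\<exists>v. q v \<noteq> 0" "\<And>z. z \<in> Z \<Longrightarrow> q z = 0"
    and lines: "\<And>a. a \<noteq> 0 \<Longrightarrow> card {z\<in>Z. dot a z = 0} \<le> t + 1"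
  shows "\<exists>l. nondeg w (d - 2 * i) i Z l"
proof (cases "\<exists>u\<in>Z. \<exists>v\<in>Z. \<exists>x\<in>Z. u \<noteq> v \<and> u \<noteq> x \<and> v \<noteq> x \<and> dot u (cross v x) = 0")
  case True
  then obtain u v x where u: "u \<in> Z" "v \<in> Z" "x \<in> Z" "u \<noteq> v" "u \<noteq> x" "v \<noteq> x" "dot u (cross v x) = 0" by blast
  define a where "a = cross v x"
  have a: "a \<noteq> 0" "dot a u = 0" "dot a v = 0" "dot a x = 0"
    using proper_cross[OF Z(2) u(2,3,6)] u(7) by (simp_all add: a_def dot_commute[of u])
  obtain b where b: "\<And>v. q v = dot a v * dot b v"
    by (rule line_divides_conic[OF q(1) a proper_cross[OF Z(2) u(1,2,4)] proper_cross[OF Z(2) u(1,3,5)] proper_cross[OF Z(2) u(2,3,6)]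
      q(3)[OF u(1)] q(3)[OF u(2)] q(3)[OF u(3)]], rule that)
  have b0: "b \<noteq> 0" using q(2) b by auto
  define Z1 where "Z1 = {z\<in>Z. dot a z = 0}"
  define Z2 where "Z2 = {z\<in>Z. dot a z \<noteq> 0}"
  have Z12: "Z = Z1 \<union> Z2" "Z1 \<inter> Z2 = {}" by (auto simp: Z1_def Z2_def)
  have fin: "finite Z1" "finite Z2" using Z by (simp_all add: Z1_def Z2_def)
  have Z2b: "dot b z = 0" if "z \<in> Z2" for z using q(3)[of z] b[of z] that by (simp add: Z2_def)
  \<comment> \<open>A double line would contain all \<open>2 t + 1\<close> points, more than the
    allowed \<open>t + 1\<close>.\<close>
  have cab: "cross a b \<noteq> 0"
  proof
    assume "cross a b = 0"
    then obtain c where c: "b = scl c a" using parallel_of_cross_zero a by blast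
    then have "c \<noteq> 0" using b0 by (auto simp: vec3_eq_iff)
    then have "Z2 = {}" using Z2b c by (auto simp: Z2_def)
    then have "Z = Z1" using Z12 by simp
    then have "card Z = card Z1" by (rule arg_cong)
    moreover have "card Z1 \<le> t + 1" using lines[OF a(1)] by (simp only: Z1_def)
    ultimately show False using Z(3) t by linarith
  qed
  have "card Z = card Z1 + card Z2" unfolding Z12(1) by (rule card_Un_disjoint[OF fin Z12(2)])
  then have c2: "t \<le> card Z2" using lines[OF a(1)] Z(3) by (simp add: Z1_def)
  have "Z2 \<subseteq> {z\<in>Z. dot b z = 0}" using Z2b by (auto simp: Z2_def)
  then have "card Z2 \<le> card {z\<in>Z. dot b z = 0}" using Z(1) by (intro card_mono) auto
  then have c2': "card Z2 \<le> t + 1" using lines[OF b0] by simp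
  have "{z\<in>Z1. dot b z \<noteq> 0} = Z - {z\<in>Z. dot b z = 0}" using Z2b Z12 by (auto simp: Z1_def)
  then have "card {z\<in>Z1. dot b z \<noteq> 0} = card Z - card {z\<in>Z. dot b z = 0}" using Z(1) by (simp add: card_Diff_subset)
  then have c1: "t \<le> card {z\<in>Z1. dot b z \<noteq> 0}" using lines[OF b0] Z(3) by simp
  have "card {z\<in>Z1. dot b z \<noteq> 0} \<le> card Z1" using fin by (intro card_mono) auto
  then have c1': "card {z\<in>Z1. dot b z \<noteq> 0} \<le> t + 1" using lines[OF a(1)] by (simp add: Z1_def)
  have "\<exists>l. nondeg w (d - 2 * i) i (Z1 \<union> Z2) l"
  proof (rule nondeg_on_two_lines[OF cab fin])
    show "proper (Z1 \<union> Z2)" using Z(2) Z12(1) by simp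
    show "dot a z = 0" if "z \<in> Z1" for z using that by (simp add: Z1_def)
    show "dot b z = 0 \<and> dot a z \<noteq> 0" if "z \<in> Z2" for z using Z2b[OF that] that by (simp add: Z2_def)
    show "w z \<noteq> 0" if "z \<in> Z1 \<union> Z2" for z using that w Z12(1) by simp
    show "i + 1 \<le> card Z2" "card Z2 \<le> d - 2 * i + i" using c2 c2' i d by linarith+
    show "i + 1 \<le> card {z\<in>Z1. dot b z \<noteq> 0}" "card {z\<in>Z1. dot b z \<noteq> 0} \<le> d - 2 * i + i"
      using c1 c1' i d by linarith+
  qed
  then show ?thesis using Z12 by simp
next
  case False
  have Z5: "5 \<le> card Z" using Z(3) t by simp
  have nc: "dot u (cross v x) \<noteq> 0"
    if "u \<in> Z" "v \<in> Z" "x \<in> Z" "u \<noteq> v" "u \<noteq> x" "v \<noteq> x" for u v x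
    using False that by blast
  obtain U0 U1 U2 where U: "dot U0 (cross U1 U2) \<noteq> 0"
    "\<And>z. z \<in> Z \<Longrightarrow> \<exists>c s. c \<noteq> 0 \<and> z = scl c (U0 + scl s U1 + scl (s\<^sup>2) U2)"
    by (rule smooth_conic_parametrization[OF Z(1) Z5 q nc], assumption+, rule that)
  show ?thesis
    by (rule nondeg_on_smooth_conic[OF U(1) Z(1,2) U(2) w]) (use Z(3) i d in auto)
qed


section \<open>Relations supported on a conic\<close>

text \<open>A two-by-two matrix of linear forms with zero determinant and
  \<open>a \<noteq> 0\<close> has a proportional row or column. Otherwise there are points
  \<open>u\<close>, \<open>v\<close> on the line of \<open>a\<close> with \<open>b\<close> nonzero
  at \<open>u\<close> and \<open>a'\<close> nonzero at \<open>v\<close>; the identity fails at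
  \<open>u + v\<close>.\<close>

lemma linear_forms_proportional_syzygy:
  fixes a a' b b' :: "3 \<Rightarrow> 'k::field"
  assumes eq: "\<And>v. dot a v * dot b' v = dot b v * dot a' v" and a: "a \<noteq> 0"
  shows "(\<exists>k. b = scl k a) \<or> (\<exists>k. a' = scl k a)"
proof (rule ccontr)
  assume contra: "\<not> ?thesis"
  then have "cross a b \<noteq> 0" "cross a a' \<noteq> 0" using parallel_of_cross_zero a by blast+
  then obtain x y where x: "dot x (cross a b) \<noteq> 0" and y: "dot y (cross a a') \<noteq> 0"
    using dot_all_zero by (metis dot_commute)
  define u where "u = cross x a"
  define v where "v = cross y a"
  have u: "dot a u = 0" "dot b u \<noteq> 0" using x by (simp_all add: u_def dot_cross_rotate[of b] dot_cross_rotate[of x])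
  have v: "dot a v = 0" "dot a' v \<noteq> 0" using y by (simp_all add: v_def dot_cross_rotate[of a'] dot_cross_rotate[of y])
  have "dot a' u = 0" using eq[of u] u by simp
  moreover have "dot b v = 0" using eq[of v] v by simp
  ultimately show False using eq[of "u + v"] u v by (simp add: dot_add_right)
qed

context weighted_points
begin

text \<open>Two independent linear forms that annihilate the relation confine its support to their
  common point, and a single point is separated in every degree.\<close>

lemma relation_on_one_point:
  assumes "\<forall>f\<in>hp n. (\<Sum>v\<in>P. c v * f v) = 0" and "\<And>v. v \<in> P \<Longrightarrow> dot a v * c v = 0" "\<And>v. v \<in> P \<Longrightarrow> dot b v * c v = 0"
    and "cross a b \<noteq> 0"
  shows "\<forall>v\<in>P. c v = 0"
proof (rule relation_on_separated[OF _ fin _ _ assms(1)])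
  let ?S = "{z\<in>P. dot a z = 0 \<and> dot b z = 0}"
  show "?S \<subseteq> P" by auto
  show "c v = 0" if "v \<in> P - ?S" for v using that assms(2,3)[of v] by auto
  have one: "u = v" if "u \<in> ?S" "v \<in> ?S" for u v
    using two_lines_common_point[OF assms(4) proper fin] card_le_Suc0_iff_eq[of ?S] fin that by fastforce
  show "separates n ?S" unfolding separates_def
  proof
    fix v assume v: "v \<in> ?S"
    then have "v \<noteq> 0" using zero_notin by auto
    then obtain e where "dot e v = 1" by (rule form_nonvanishing)
    then show "\<exists>f\<in>hp n. \<forall>u\<in>?S. f u = (if u = v then 1 else 0)"
      using one[OF _ v] by (intro bexI[OF _ hp_dot_power[of e n]]) fastforce
  qed
qed

text \<open>If the last two first differences equal \<open>2\<close>, the relations in degree \<open>t - 1\<close> form a plane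
  \<open>\<langle>c, c'\<rangle>\<close> with two linear syzygies \<open>a c + a' c' = b c + b' c' = 0\<close>; both relations are supported on
  the conic \<open>a b' = b a'\<close>.\<close>

lemma relations_on_conic:
  assumes t: "2 \<le> t" and dims: "fs.dim (res P ` hp (t - 1)) + 2 = card P" "fs.dim (res P ` hp (t - 2)) + 4 = card P"
  obtains q D where "q \<in> hp 2" "\<exists>v. q v \<noteq> 0" "D \<subseteq> P" "card D = 2"
    "\<And>\<psi>. \<exists>c. (\<forall>x\<in>D. c x = \<psi> x) \<and> (\<forall>f\<in>hp (t - 1). (\<Sum>x\<in>P. c x * f x) = 0) \<and> (\<forall>v\<in>P. q v \<noteq> 0 \<longrightarrow> c v = 0)"
proof -
  obtain D where D: "D \<subseteq> P" "card D + fs.dim (res P ` hp (t - 1)) = card P"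
    and D1: "\<And>\<psi>. \<exists>c. (\<forall>x\<in>D. c x = \<psi> x) \<and> (\<forall>f\<in>hp (t - 1). (\<Sum>x\<in>P. c x * f x) = 0)"
    by (rule orthogonal_complement_coordinates[OF fin hp_subspace[of "t - 1"]], rule that)
  obtain D' where D': "D' \<subseteq> P" "card D' + fs.dim (res P ` hp (t - 2)) = card P"
    and D2: "\<And>c. (\<forall>f\<in>hp (t - 2). (\<Sum>x\<in>P. c x * f x) = 0) \<Longrightarrow> (\<forall>x\<in>D'. c x = 0) \<Longrightarrow> (\<forall>x\<in>P. c x = 0)"
    by (rule orthogonal_complement_coordinates[OF fin hp_subspace[of "t - 2"]], rule that)
  have cD: "card D = 2" "card D' = 4" using D D' dims by simp_all
  have fD': "finite D'" using D' fin finite_subset by blast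
  obtain d1 d2 where d12: "D = {d1, d2}" "d1 \<noteq> d2" using cD by (metis card_2_iff)
  obtain c where c: "c d1 = 1" "c d2 = 0" "\<forall>f\<in>hp (t - 1). (\<Sum>x\<in>P. c x * f x) = 0"
    using D1[of "\<lambda>x. if x = d1 then 1 else 0"] d12 by auto
  obtain c' where c': "c' d1 = 0" "c' d2 = 1" "\<forall>f\<in>hp (t - 1). (\<Sum>x\<in>P. c' x * f x) = 0"
    using D1[of "\<lambda>x. if x = d2 then 1 else 0"] d12 by auto
  have nontriv: "x = 0 \<and> y = 0" if "\<forall>v\<in>P. x * c v + y * c' v = 0" for x y
    using that[rule_format, of d1] that[rule_format, of d2] c c' D d12 by simp
  have comb: "\<forall>f\<in>hp (t - 1). (\<Sum>v\<in>P. (x * c v + y * c' v) * f v) = 0" for x y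
  proof
    fix f :: "(3 \<Rightarrow> 'k) \<Rightarrow> 'k" assume "f \<in> hp (t - 1)"
    then have "x * (\<Sum>v\<in>P. c v * f v) + y * (\<Sum>v\<in>P. c' v * f v) = 0" using c c' by simp
    then show "(\<Sum>v\<in>P. (x * c v + y * c' v) * f v) = 0" by (simp add: sum_distrib_left sum.distrib algebra_simps)
  qed
  have syz: "dot a v * c v + dot a' v * c' v = 0"
    if "\<forall>v\<in>D'. dot a v * c v + dot a' v * c' v = 0" "v \<in> P" for a a' v
  proof -
    have t': "t - 1 = Suc (t - 2)" using t by simp
    have "\<forall>f\<in>hp (t - 2). (\<Sum>v\<in>P. (dot a v * c v + dot a' v * c' v) * f v) = 0"
    proof
      fix f :: "(3 \<Rightarrow> 'k) \<Rightarrow> 'k" assume "f \<in> hp (t - 2)"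
      then have "(\<Sum>v\<in>P. (dot a v * c v) * f v) = 0" "(\<Sum>v\<in>P. (dot a' v * c' v) * f v) = 0"
        using relation_times_form[of "t - 2"] c(3) c'(3) unfolding t' by blast+
      then show "(\<Sum>v\<in>P. (dot a v * c v + dot a' v * c' v) * f v) = 0"
        by (simp add: sum.distrib distrib_right)
    qed
    then show ?thesis using D2[of "\<lambda>v. dot a v * c v + dot a' v * c' v"] that by blast
  qed
  \<comment> \<open>The six coefficients of a pair of linear forms, \<open>True\<close> for the
    factor of \<open>c\<close> and \<open>False\<close> for that of \<open>c'\<close>. A combination
    is a syzygy as soon as it vanishes at the four points of \<open>D'\<close>.\<close>
  define I where "I = (UNIV :: (bool \<times> 3) set)"
  have cI: "card I = 6" "finite I"
    unfolding I_def by (simp_all add: card_cartesian_product flip: UNIV_Times_UNIV)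
  define M where "M v j = (if fst j then c v else c' v) * v (snd j)" for v :: "3 \<Rightarrow> 'k" and j :: "bool \<times> 3"
  have M: "(\<Sum>j\<in>I. M v j * x j) = dot (\<lambda>i. x (True, i)) v * c v + dot (\<lambda>i. x (False, i)) v * c' v" for v x
  proof -
    have I: "I = {False, True} \<times> UNIV" by (auto simp: I_def)
    have "(\<Sum>j\<in>I. M v j * x j) = (\<Sum>o'\<in>{False, True}. \<Sum>i\<in>UNIV. M v (o', i) * x (o', i))"
      unfolding I by (subst sum.cartesian_product) (simp add: split_def)
    then show ?thesis by (simp add: M_def dot_eq sum_UNIV_3 algebra_simps)
  qed
  have "\<exists>x. (\<exists>j\<in>I. x j \<noteq> 0) \<and> (\<forall>v\<in>D'. (\<Sum>j\<in>I. M v j * x j) = 0)"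
    by (rule underdetermined_system) (use fD' cD cI in auto)
  then obtain x j where x: "x j \<noteq> 0" "\<forall>v\<in>D'. (\<Sum>j\<in>I. M v j * x j) = 0" by blast
  \<comment> \<open>A second syzygy, made independent of the first by the additional equation
    \<open>y j = 0\<close> at a coordinate with \<open>x j \<noteq> 0\<close>; five equations for
    six unknowns.\<close>
  define M' where "M' e i = (case e of None \<Rightarrow> if i = j then 1 else 0 | Some v \<Rightarrow> M v i)" for e i
  have "\<exists>y. (\<exists>i\<in>I. y i \<noteq> 0) \<and> (\<forall>e\<in>insert None (Some ` D'). (\<Sum>i\<in>I. M' e i * y i) = 0)"
    by (rule underdetermined_system) (use fD' cD cI in \<open>auto simp: card_image\<close>)
  then obtain y where y: "\<exists>i. y i \<noteq> 0" "(\<Sum>i\<in>I. M' None i * y i) = 0" "\<forall>v\<in>D'. (\<Sum>i\<in>I. M v i * y i) = 0"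
    by (auto simp: M'_def)
  have yj: "y j = 0"
  proof -
    have "(\<Sum>i\<in>I. M' None i * y i) = (\<Sum>i\<in>I. if i = j then y j else 0)"
      by (rule sum.cong) (auto simp: M'_def)
    then show ?thesis using y(2) cI by (simp add: I_def)
  qed
  define a where "a = (\<lambda>i. x (True, i))"
  define a' where "a' = (\<lambda>i. x (False, i))"
  define b where "b = (\<lambda>i. y (True, i))"
  define b' where "b' = (\<lambda>i. y (False, i))"
  have sa: "dot a v * c v + dot a' v * c' v = 0" if "v \<in> P" for v
    using syz[OF _ that] x(2) unfolding M a_def a'_def by blast
  have sb: "dot b v * c v + dot b' v * c' v = 0" if "v \<in> P" for v
    using syz[OF _ that] y(3) unfolding M b_def b'_def by blast
  have indep: "r = 0 \<and> s = 0" if r: "scl r a + scl s b = 0" "scl r a' + scl s b' = 0" for r s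
  proof -
    have rs: "r * x i + s * y i = 0" for i
    proof (cases i)
      case (Pair o' k)
      then show ?thesis using fun_cong[OF r(1), of k] fun_cong[OF r(2), of k]
        by (cases o') (simp_all add: a_def a'_def b_def b'_def)
    qed
    have r0: "r = 0" using rs[of j] x(1) yj by simp
    obtain i where "y i \<noteq> 0" using y(1) by blast
    then have "s = 0" using rs[of i] r0 by simp
    with r0 show ?thesis by blast
  qed
  define q where "q = (\<lambda>v. dot a v * dot b' v + (-1) * (dot b v * dot a' v))"
  have q: "q \<in> hp 2"
  proof -
    have "(\<lambda>v. dot e v * dot g v) \<in> hp 2" for e g :: "3 \<Rightarrow> 'k"
      using hp_dot_times[OF hp_dot[of g], of e] by (simp add: numeral_2_eq_2)
    then show ?thesis unfolding q_def by (intro hp_add hp_scale)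
  qed
  \<comment> \<open>Cramer's rule: \<open>q\<close> is the determinant of the two syzygies.\<close>
  have qc: "c v = 0 \<and> c' v = 0" if "v \<in> P" "q v \<noteq> 0" for v
  proof -
    have "q v * c v = dot b' v * (dot a v * c v + dot a' v * c' v) - dot a' v * (dot b v * c v + dot b' v * c' v)"
      by (simp add: q_def algebra_simps)
    moreover have "q v * c' v = dot a v * (dot b v * c v + dot b' v * c' v) - dot b v * (dot a v * c v + dot a' v * c' v)"
      by (simp add: q_def algebra_simps)
    ultimately have "q v * c v = 0" "q v * c' v = 0"
      unfolding sa[OF that(1)] sb[OF that(1)] by simp_all
    then show ?thesis using that(2) by simp
  qed
  \<comment> \<open>With zero determinant, either the two syzygies are proportional, against their
    independence, or a nonzero combination of \<open>c\<close> and \<open>c'\<close> is annihilated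
    by two independent linear forms, so that it lives at one point and vanishes.\<close>
  have q0: "\<exists>v. q v \<noteq> 0"
  proof (rule ccontr)
    assume "\<nexists>v. q v \<noteq> 0"
    then have "q v = 0" for v by blast
    then have eq: "dot a v * dot b' v = dot b v * dot a' v" for v by (simp add: q_def)
    show False
    proof (cases "a = 0")
      case True
      have a'0: "a' \<noteq> 0" using indep[of 1 0] True by (auto simp: fun_eq_iff)
      have "b = 0" using product_of_forms_zero[of b a'] eq True a'0 by simp
      have "cross a' b' \<noteq> 0"
      proof
        assume "cross a' b' = 0"
        then obtain k where "b' = scl k a'" using parallel_of_cross_zero a'0 by blast
        then show False using indep[of k "-1"] True \<open>b = 0\<close> by (simp add: fun_eq_iff)
      qed
      then have c'0: "\<forall>v\<in>P. c' v = 0"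
      proof (rule relation_on_one_point[OF c'(3), rotated 2])
        show "dot a' v * c' v = 0" if "v \<in> P" for v using sa[OF that] unfolding True by simp
        show "dot b' v * c' v = 0" if "v \<in> P" for v using sb[OF that] unfolding \<open>b = 0\<close> by simp
      qed
      have "d2 \<in> P" using D d12 by simp
      then have "c' d2 = 0" using c'0 by blast
      then show False using c'(2) by simp
    next
      case False
      from linear_forms_proportional_syzygy[OF eq False] show False
      proof
        assume "\<exists>k. b = scl k a"
        then obtain k where k: "b = scl k a" ..
        have "dot a v * dot (b' - scl k a') v = 0" for v
          using eq[of v] unfolding k dot_diff_left dot_scl_left by (simp add: algebra_simps)
        then have "b' - scl k a' = 0" using product_of_forms_zero[of a "b' - scl k a'"] False by simp
        then show False using indep[of k "-1"] k by (simp add: fun_eq_iff)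
      next
        assume "\<exists>k. a' = scl k a"
        then obtain k where k: "a' = scl k a" ..
        have "dot a v * dot (b' - scl k b) v = 0" for v
          using eq[of v] unfolding k dot_diff_left dot_scl_left by (simp add: algebra_simps)
        then have "b' - scl k b = 0" using product_of_forms_zero[of a "b' - scl k b"] False by simp
        then have k': "b' = scl k b" by (simp only: right_minus_eq)
        have cab: "cross a b \<noteq> 0"
        proof
          assume "cross a b = 0"
          then obtain r where "b = scl r a" using parallel_of_cross_zero False by blast
          then show False using indep[of r "-1"] k k' by (simp add: fun_eq_iff)
        qed
        have "\<forall>v\<in>P. 1 * c v + k * c' v = 0"
        proof (rule relation_on_one_point[OF comb _ _ cab])
          show "dot a v * (1 * c v + k * c' v) = 0" if "v \<in> P" for v using sa[OF that] k by (simp add: algebra_simps)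
          show "dot b v * (1 * c v + k * c' v) = 0" if "v \<in> P" for v using sb[OF that] k' by (simp add: algebra_simps)
        qed
        then show False using nontriv[of 1 k] by simp
      qed
    qed
  qed
  show ?thesis
  proof (rule that[OF q q0 D(1) cD(1)])
    fix \<psi> :: "(3 \<Rightarrow> 'k) \<Rightarrow> 'k"
    show "\<exists>c. (\<forall>x\<in>D. c x = \<psi> x) \<and> (\<forall>f\<in>hp (t - 1). (\<Sum>x\<in>P. c x * f x) = 0) \<and> (\<forall>v\<in>P. q v \<noteq> 0 \<longrightarrow> c v = 0)"
    proof (intro exI[of _ "\<lambda>v. \<psi> d1 * c v + \<psi> d2 * c' v"] conjI)
      show "\<forall>f\<in>hp (t - 1). (\<Sum>v\<in>P. (\<psi> d1 * c v + \<psi> d2 * c' v) * f v) = 0" by (rule comb)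
    qed (use c c' d12 qc in auto)
  qed
qed

end


section \<open>Counting the points on the conic\<close>

text \<open>A line through a point of \<open>A\<close> and a point of \<open>B\<close> takes care of
  both, so \<open>n\<close> lines cover up to \<open>2 n\<close> points; unpaired points get a line
  of their own.\<close>

lemma hp_cover_pairs:
  fixes v :: "3 \<Rightarrow> 'k::field"
  assumes "finite A" "finite B" "card A \<le> n" "card B \<le> n" "v \<noteq> 0" "\<And>u. u \<in> A \<union> B \<Longrightarrow> cross u v \<noteq> 0"
    and "\<And>u y. u \<in> A \<Longrightarrow> y \<in> B \<Longrightarrow> \<exists>g. dot g u = 0 \<and> dot g y = 0 \<and> dot g v \<noteq> 0"
  shows "\<exists>f\<in>hp n. f v \<noteq> 0 \<and> (\<forall>u\<in>A \<union> B. f u = 0)"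
  using assms
proof (induction n arbitrary: A B)
  case 0
  then have "A = {}" "B = {}" by auto
  then show ?case by (intro bexI[of _ "\<lambda>v. 1"]) auto
next
  case (Suc n)
  have "\<exists>A' B' g. A' \<subseteq> A \<and> B' \<subseteq> B \<and> card A' \<le> n \<and> card B' \<le> n \<and> dot g v \<noteq> 0 \<and> (\<forall>u\<in>(A \<union> B) - (A' \<union> B'). dot g u = 0)"
  proof -
    consider "A = {}" "B = {}" | u where "u \<in> A" "B = {}" | y where "A = {}" "y \<in> B" | u y where "u \<in> A" "y \<in> B" by blast
    then show ?thesis
    proof cases
      case 1
      obtain g where "dot g v = 1" using form_nonvanishing[OF Suc.prems(5)] .
      then show ?thesis using 1 by (intro exI[of _ "{}"] exI[of _ g]) auto
    next
      case (2 u)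
      obtain g where "dot g u = 0" "dot g v \<noteq> 0" using form_vanishing_nonvanishing[of u v] Suc.prems(6) 2 by blast
      then show ?thesis using 2 Suc.prems by (intro exI[of _ "A - {u}"] exI[of _ "{}"] exI[of _ g]) auto
    next
      case (3 y)
      obtain g where "dot g y = 0" "dot g v \<noteq> 0" using form_vanishing_nonvanishing[of y v] Suc.prems(6) 3 by blast
      then show ?thesis using 3 Suc.prems by (intro exI[of _ "{}"] exI[of _ "B - {y}"] exI[of _ g]) auto
    next
      case (4 u y)
      obtain g where "dot g u = 0" "dot g y = 0" "dot g v \<noteq> 0" using Suc.prems(7)[OF 4] by blast
      then show ?thesis using 4 Suc.prems(1-4) by (intro exI[of _ "A - {u}"] exI[of _ "B - {y}"] exI[of _ g]) auto
    qed
  qed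
  then obtain A' B' g where g: "A' \<subseteq> A" "B' \<subseteq> B" "card A' \<le> n" "card B' \<le> n" "dot g v \<noteq> 0"
    "\<forall>u\<in>(A \<union> B) - (A' \<union> B'). dot g u = 0" by blast
  have "\<exists>f\<in>hp n. f v \<noteq> 0 \<and> (\<forall>u\<in>A' \<union> B'. f u = 0)"
  proof (rule Suc.IH)
    show "finite A'" "finite B'" using g Suc.prems(1,2) finite_subset by blast+
    show "\<exists>g. dot g u = 0 \<and> dot g y = 0 \<and> dot g v \<noteq> 0" if "u \<in> A'" "y \<in> B'" for u y
      using Suc.prems(7)[of u y] that g(1,2) by blast
    show "cross u v \<noteq> 0" if "u \<in> A' \<union> B'" for u using Suc.prems(6)[of u] that g(1,2) by blast
  qed (use g Suc.prems(5) in auto)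
  then obtain f where f: "f \<in> hp n" "f v \<noteq> 0" "\<forall>u\<in>A' \<union> B'. f u = 0" by blast
  show ?case
    by (rule bexI[OF _ hp_dot_times[OF f(1), of g]]) (use f g in auto)
qed

context weighted_points
begin

lemma relation_vanishes_at:
  assumes rel: "\<forall>f\<in>hp n. (\<Sum>v\<in>P. c v * f v) = 0" and f: "f \<in> hp n" "f v \<noteq> 0" and v: "v \<in> P"
    and z: "\<And>u. u \<in> P \<Longrightarrow> u \<noteq> v \<Longrightarrow> c u = 0 \<or> f u = 0"
  shows "c v = 0"
proof -
  have "0 = (\<Sum>u\<in>P. c u * f u)" using rel f by simp
  also have "\<dots> = (\<Sum>u\<in>P. if u = v then c v * f v else 0)" by (rule sum.cong) (use z in auto)
  finally show ?thesis using v fin f(2) by simp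
qed

text \<open>\<open>n + 1\<close> points on a line and \<open>n\<close> points off it are independent
  in degree \<open>n\<close>. For \<open>v\<close> on the line the other \<open>n\<close> points
  there are paired with those off it; a line joining such a pair meets the given line once and
  misses \<open>v\<close>. Once the coefficients on the line are zero, only \<open>n\<close> points
  are left.\<close>

lemma relation_on_line_and_few:
  assumes rel: "\<forall>f\<in>hp n. (\<Sum>v\<in>P. c v * f v) = 0" and a: "a \<noteq> 0"
    and S1: "S1 \<subseteq> P" "card S1 \<le> n + 1" "\<And>v. v \<in> S1 \<Longrightarrow> dot a v = 0"
    and S2: "S2 \<subseteq> P" "card S2 \<le> n" "\<And>v. v \<in> S2 \<Longrightarrow> dot a v \<noteq> 0"
    and supp: "\<And>v. v \<in> P \<Longrightarrow> v \<notin> S1 \<union> S2 \<Longrightarrow> c v = 0"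
  shows "\<forall>v\<in>P. c v = 0"
proof -
  have fS: "finite S1" "finite S2" using S1 S2 fin finite_subset by blast+
  have c1: "c v = 0" if v: "v \<in> S1" for v
  proof -
    have "\<exists>f\<in>hp n. f v \<noteq> 0 \<and> (\<forall>u\<in>(S1 - {v}) \<union> S2. f u = 0)"
    proof (rule hp_cover_pairs)
      show "cross u v \<noteq> 0" if u: "u \<in> (S1 - {v}) \<union> S2" for u
      proof (rule proper_cross[OF proper])
        show "u \<in> P" "v \<in> P" using u v S1(1) S2(1) by blast+
        show "u \<noteq> v" using u v S1(3) S2(3) by blast
      qed
      show "\<exists>g. dot g u = 0 \<and> dot g y = 0 \<and> dot g v \<noteq> 0" if u: "u \<in> S1 - {v}" and y: "y \<in> S2" for u y
      proof (intro exI conjI)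
        have cuv: "cross u v \<noteq> 0" using proper_cross[OF proper, of u v] u v S1(1) by blast
        show "dot (cross u y) v \<noteq> 0"
        proof
          assume z: "dot (cross u y) v = 0"
          obtain k where k: "a = scl k (cross u v)"
            using orthogonal_to_both[of u a v] cuv S1(3)[of u] S1(3)[OF v] u by (auto simp: dot_commute)
          have "dot a y = k * dot (cross u v) y" by (simp add: k)
          also have "dot (cross u v) y = - dot (cross u y) v" by (simp add: dot_eq algebra_simps)
          finally show False using z S2(3)[OF y] by simp
        qed
      qed simp_all
      show "v \<noteq> 0" using v S1(1) zero_notin by blast
    qed (use fS S1(2) S2(2) v in auto)
    then obtain f where f: "f \<in> hp n" "f v \<noteq> 0" "\<forall>u\<in>(S1 - {v}) \<union> S2. f u = 0" by blast
    show ?thesis by (rule relation_vanishes_at[OF rel f(1,2)]) (use f(3) supp v S1(1) in blast)+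
  qed
  have c2: "c v = 0" if v: "v \<in> S2" for v
  proof -
    have "\<exists>f\<in>hp n. f v \<noteq> 0 \<and> (\<forall>u\<in>S2. u \<noteq> v \<longrightarrow> f u = 0)"
      by (rule few_points_separated) (use S2 v in auto)
    then obtain f where f: "f \<in> hp n" "f v \<noteq> 0" "\<forall>u\<in>S2. u \<noteq> v \<longrightarrow> f u = 0" by blast
    show ?thesis by (rule relation_vanishes_at[OF rel f(1,2)]) (use f(3) supp c1 v S2(1) in blast)+
  qed
  show ?thesis using c1 c2 supp by blast
qed

text \<open>The relations form a plane, so for any \<open>z\<close> some nonzero relation also
  vanishes at \<open>z\<close>. If the conic had at most \<open>2 t\<close> points, this relation
  would be supported on at most \<open>2 t - 1\<close> of them for a suitable \<open>z\<close>, and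
  those are independent in degree \<open>t - 1\<close>.\<close>

lemma many_points_on_conic:
  assumes t: "2 \<le> t" and q: "q \<in> hp 2" "\<exists>v. q v \<noteq> 0" and D: "D \<subseteq> P" "card D = 2"
    and rel: "\<And>\<psi>. \<exists>c. (\<forall>x\<in>D. c x = \<psi> x) \<and> (\<forall>f\<in>hp (t - 1). (\<Sum>x\<in>P. c x * f x) = 0) \<and> (\<forall>v\<in>P. q v \<noteq> 0 \<longrightarrow> c v = 0)"
  shows "2 * t + 1 \<le> card {v\<in>P. q v = 0}"
proof (rule ccontr)
  define Z where "Z = {v\<in>P. q v = 0}"
  have fZ: "finite Z" and ZP: "Z \<subseteq> P" using fin by (simp_all add: Z_def)
  assume "\<not> 2 * t + 1 \<le> card {v\<in>P. q v = 0}"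
  then have cZ: "card Z \<le> 2 * t" by (simp add: Z_def)
  obtain d1 d2 where d12: "D = {d1, d2}" "d1 \<noteq> d2" using D by (metis card_2_iff)
  obtain c where c: "c d1 = 1" "c d2 = 0" "\<forall>f\<in>hp (t - 1). (\<Sum>x\<in>P. c x * f x) = 0" "\<forall>v\<in>P. q v \<noteq> 0 \<longrightarrow> c v = 0"
    using rel[of "\<lambda>x. if x = d1 then 1 else 0"] d12 by auto
  obtain c' where c': "c' d1 = 0" "c' d2 = 1" "\<forall>f\<in>hp (t - 1). (\<Sum>x\<in>P. c' x * f x) = 0" "\<forall>v\<in>P. q v \<noteq> 0 \<longrightarrow> c' v = 0"
    using rel[of "\<lambda>x. if x = d2 then 1 else 0"] d12 by auto
  have d1Z: "d1 \<in> Z" using c D d12 by (auto simp: Z_def)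
  have vanish: "\<exists>c. (\<forall>f\<in>hp (t - 1). (\<Sum>x\<in>P. c x * f x) = 0) \<and> (\<forall>v\<in>P. v \<notin> Z - {z} \<longrightarrow> c v = 0) \<and> (\<exists>v\<in>P. c v \<noteq> 0)" for z
  proof -
    obtain x y where xy: "x \<noteq> 0 \<or> y \<noteq> 0" "x * c z + y * c' z = 0"
    proof (cases "c z = 0 \<and> c' z = 0")
      case True
      then show ?thesis by (intro that[of 1 0]) auto
    next
      case False
      then show ?thesis by (intro that[of "c' z" "- c z"]) auto
    qed
    define e where "e = (\<lambda>v. x * c v + y * c' v)"
    have "\<forall>f\<in>hp (t - 1). (\<Sum>v\<in>P. e v * f v) = 0"
    proof
      fix f :: "(3 \<Rightarrow> 'k) \<Rightarrow> 'k" assume "f \<in> hp (t - 1)"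
      then have "x * (\<Sum>v\<in>P. c v * f v) + y * (\<Sum>v\<in>P. c' v * f v) = 0" using c(3) c'(3) by simp
      then show "(\<Sum>v\<in>P. e v * f v) = 0" by (simp add: e_def sum_distrib_left sum.distrib algebra_simps)
    qed
    moreover have "\<forall>v\<in>P. v \<notin> Z - {z} \<longrightarrow> e v = 0"
    proof (intro ballI impI)
      fix v assume v: "v \<in> P" "v \<notin> Z - {z}"
      show "e v = 0"
      proof (cases "v = z")
        case False
        then have "q v \<noteq> 0" using v by (simp add: Z_def)
        then show ?thesis using c(4) c'(4) v by (simp add: e_def)
      qed (use xy in \<open>simp add: e_def\<close>)
    qed
    moreover have "\<exists>v\<in>P. e v \<noteq> 0"
      using xy(1)
    proof
      assume "x \<noteq> 0"
      then have "e d1 \<noteq> 0" using c c' by (simp add: e_def)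
      then show ?thesis using D d12 by auto
    next
      assume "y \<noteq> 0"
      then have "e d2 \<noteq> 0" using c c' by (simp add: e_def)
      then show ?thesis using D d12 by auto
    qed
    ultimately show ?thesis by blast
  qed
  show False
  proof (cases "\<exists>u\<in>Z. \<exists>v\<in>Z. \<exists>x\<in>Z. u \<noteq> v \<and> u \<noteq> x \<and> v \<noteq> x \<and> dot u (cross v x) = 0")
    case False
    obtain e where e: "\<forall>f\<in>hp (t - 1). (\<Sum>x\<in>P. e x * f x) = 0" "\<forall>v\<in>P. v \<notin> Z - {d1} \<longrightarrow> e v = 0" "\<exists>v\<in>P. e v \<noteq> 0"
      using vanish[of d1] by blast
    have "e v = 0" if v: "v \<in> Z - {d1}" for v
    proof -
      \<comment> \<open>At most \<open>2 (t - 1)\<close> points remain, to be cut into halves for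
        pairing. The joining lines miss \<open>v\<close> because no three points are
        collinear.\<close>
      define R where "R = Z - {d1} - {v}"
      have cR: "card R \<le> 2 * (t - 1)" using cZ d1Z v fZ t by (simp add: R_def)
      have fR: "finite R" using fZ by (simp add: R_def)
      obtain A where A: "A \<subseteq> R" "card A = min (t - 1) (card R)"
        by (rule obtain_subset_with_card_n[of "min (t - 1) (card R)" R]) auto
      have fA: "finite A" using A fR finite_subset by blast
      have "\<exists>f\<in>hp (t - 1). f v \<noteq> 0 \<and> (\<forall>u\<in>A \<union> (R - A). f u = 0)"
      proof (rule hp_cover_pairs)
        show "card (R - A) \<le> t - 1" using A fA cR by (simp add: card_Diff_subset min_def split: if_splits)
        show "cross u v \<noteq> 0" if u: "u \<in> A \<union> (R - A)" for u
        proof (rule proper_cross[OF proper])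
          have "u \<in> R" using u A by blast
          then show "u \<in> P" "v \<in> P" "u \<noteq> v" using v ZP by (auto simp: R_def)
        qed
        show "v \<noteq> 0" using v ZP zero_notin by auto
        show "\<exists>g. dot g u = 0 \<and> dot g y = 0 \<and> dot g v \<noteq> 0" if u: "u \<in> A" and y: "y \<in> R - A" for u y
        proof (intro exI conjI)
          have "u \<in> R" "y \<in> R" "u \<noteq> y" using u y A by auto
          then have "u \<in> Z" "y \<in> Z" "v \<in> Z" "v \<noteq> u" "v \<noteq> y" "u \<noteq> y" using v by (auto simp: R_def)
          then have "dot v (cross u y) \<noteq> 0" using False by blast
          then show "dot (cross u y) v \<noteq> 0" by (simp add: dot_commute)
        qed simp_all
      qed (use fA fR A in auto)
      then obtain f where f: "f \<in> hp (t - 1)" "f v \<noteq> 0" "\<forall>u\<in>A \<union> (R - A). f u = 0" by blast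
      have fz: "f u = 0" if "u \<in> Z - {d1}" "u \<noteq> v" for u
      proof -
        have "u \<in> R" using that by (simp add: R_def)
        then show ?thesis using f(3) by blast
      qed
      show ?thesis
      proof (rule relation_vanishes_at[OF e(1) f(1,2)])
        show "v \<in> P" using v ZP by blast
        show "e u = 0 \<or> f u = 0" if "u \<in> P" "u \<noteq> v" for u using fz[of u] e(2) that by blast
      qed
    qed
    then show False using e(2,3) by blast
  next
    case True
    then obtain u v x where u: "u \<in> Z" "v \<in> Z" "x \<in> Z" "u \<noteq> v" "u \<noteq> x" "v \<noteq> x" "dot u (cross v x) = 0" by blast
    have zq: "q z = 0" if "z \<in> Z" for z using that by (simp add: Z_def)
    have cr: "cross y z \<noteq> 0" if "y \<in> Z" "z \<in> Z" "y \<noteq> z" for y z using proper_cross[OF proper, of y z] that ZP by blast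
    define a where "a = cross v x"
    have a: "a \<noteq> 0" "dot a u = 0" "dot a v = 0" "dot a x = 0"
      using cr[OF u(2,3,6)] u(7) by (simp_all add: a_def dot_commute[of u])
    obtain b where b: "\<And>v. q v = dot a v * dot b v"
      by (rule line_divides_conic[OF q(1) a cr[OF u(1,2,4)] cr[OF u(1,3,5)] cr[OF u(2,3,6)] zq[OF u(1)] zq[OF u(2)] zq[OF u(3)]], rule that)
    have b0: "b \<noteq> 0" using q(2) b by auto
    have main: False
      if ab: "a \<noteq> 0" "\<And>v. q v = dot a v * dot b v" and le: "card {z\<in>Z. dot b z = 0} \<le> card {z\<in>Z. dot a z = 0}" for a b
    proof -
      define S1 where "S1 = {z\<in>Z. dot a z = 0}"
      define S2 where "S2 = {z\<in>Z. dot a z \<noteq> 0}"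
      have fS: "finite S1" "finite S2" using fZ by (simp_all add: S1_def S2_def)
      have Z12: "Z = S1 \<union> S2" "S1 \<inter> S2 = {}" by (auto simp: S1_def S2_def)
      have cS: "card S1 + card S2 \<le> 2 * t" using cZ unfolding Z12(1) card_Un_disjoint[OF fS Z12(2)] .
      have "S2 \<subseteq> {z\<in>Z. dot b z = 0}" using zq ab(2) by (auto simp: S2_def)
      then have "card S2 \<le> card {z\<in>Z. dot b z = 0}" using fZ by (intro card_mono) auto
      then have c21: "card S2 \<le> card S1" using le by (simp add: S1_def)
      have c1: "card S1 \<le> t + 1" by (rule line_bound[OF ab(1)]) (use ZP in \<open>auto simp: S1_def\<close>)
      \<comment> \<open>\<open>S1\<close> lies on the line with at least as many points. The point
        to drop is taken from \<open>S1\<close> only if it has the maximal number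
        \<open>t + 1\<close>; otherwise from \<open>S2\<close>, if there is a point in it.\<close>
      have "\<exists>z. card (S1 - {z}) \<le> t - 1 + 1 \<and> card (S2 - {z}) \<le> t - 1"
      proof (cases "card S1 = t + 1")
        case True
        then obtain z where z: "z \<in> S1" by fastforce
        then have "z \<notin> S2" using Z12(2) by blast
        then show ?thesis using True z cS t by (intro exI[of _ z]) simp
      next
        case False
        then have s1: "card S1 \<le> t" using c1 by simp
        show ?thesis
        proof (cases "S2 = {}")
          case True
          have "card (S1 - {d1}) \<le> t" using card_Diff1_le[of S1 d1] s1 by linarith
          then show ?thesis using True t by (intro exI[of _ d1]) simp
        next
          case False
          then obtain z where z: "z \<in> S2" by blast
          then have "z \<notin> S1" using Z12(2) by blast
          then show ?thesis using z s1 c21 cS t by (intro exI[of _ z]) simp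
        qed
      qed
      then obtain z where z: "card (S1 - {z}) \<le> t - 1 + 1" "card (S2 - {z}) \<le> t - 1" by blast
      obtain e where e: "\<forall>f\<in>hp (t - 1). (\<Sum>x\<in>P. e x * f x) = 0" "\<forall>v\<in>P. v \<notin> Z - {z} \<longrightarrow> e v = 0" "\<exists>v\<in>P. e v \<noteq> 0"
        using vanish[of z] by blast
      have "\<forall>v\<in>P. e v = 0"
      proof (rule relation_on_line_and_few[OF e(1) ab(1) _ z(1) _ _ z(2)])
        show "S1 - {z} \<subseteq> P" "S2 - {z} \<subseteq> P" using ZP by (auto simp: S1_def S2_def)
        show "dot a v = 0" if "v \<in> S1 - {z}" for v using that by (simp add: S1_def)
        show "dot a v \<noteq> 0" if "v \<in> S2 - {z}" for v using that by (simp add: S2_def)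
        show "e v = 0" if "v \<in> P" "v \<notin> S1 - {z} \<union> (S2 - {z})" for v
        proof -
          have "v \<notin> Z - {z}" using that(2) Z12(1) by blast
          then show ?thesis using e(2) that(1) by blast
        qed
      qed
      then show False using e(3) by blast
    qed
    show False
    proof (cases "card {z\<in>Z. dot b z = 0} \<le> card {z\<in>Z. dot a z = 0}")
      case True
      show False by (rule main[OF a(1) b True])
    next
      case False
      have b': "q v = dot b v * dot a v" for v by (simp add: b mult.commute)
      show False by (rule main[OF b0 b']) (use False in simp)
    qed
  qed
qed

end


subsection \<open>The second Hessian controls the first\<close>

lemma sum_less_3: "(\<Sum>s = 0..<3. f s) = f 0 + f 1 + (f (2::nat) :: 'a::comm_monoid_add)"
proof -
  have eq: "{0..<3::nat} = {0, 1, 2}" by auto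
  show ?thesis unfolding eq by (simp add: add.assoc)
qed

lemma less_3: "(r::nat) < 3 \<longleftrightarrow> r = 0 \<or> r = 1 \<or> r = 2"
  by auto

lemma divide_out_zero:
  fixes F :: "3 \<Rightarrow> 'k::field poly"
  assumes "F i \<noteq> 0"
  shows "\<exists>k G. (\<forall>i. F i = [:0, 1:] ^ k * G i) \<and> (\<exists>i. poly (G i) 0 \<noteq> 0)"
  using assms
proof (induction "degree (F i)" arbitrary: F rule: less_induct)
  case less
  show ?case
  proof (cases "\<exists>i. poly (F i) 0 \<noteq> 0")
    case True
    then show ?thesis by (intro exI[of _ 0] exI[of _ F]) simp
  next
    case False
    then have dv: "[:0, 1:] dvd F j" for j using poly_eq_0_iff_dvd[of "F j" 0] by simp
    have "\<forall>j. \<exists>g. F j = [:0, 1:] * g" using dv unfolding dvd_def by blast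
    from choice[OF this] obtain G where "\<forall>j. F j = [:0, 1:] * G j" by (elim exE)
    note G = spec[OF this]
    have "G i \<noteq> 0" using less.prems G[of i] by auto
    moreover from this have "degree (G i) < degree (F i)" unfolding G[of i] by (subst degree_mult_eq) auto
    ultimately obtain k H where H: "\<forall>j. G j = [:0, 1:] ^ k * H j" "\<exists>i. poly (H i) 0 \<noteq> 0"
      using less.hyps[of G] by blast
    have "\<forall>j. F j = [:0, 1:] ^ Suc k * H j"
      using G H(1) by (simp only: power_Suc mult.assoc simp_thms)
    then show ?thesis using H(2) by blast
  qed
qed

text \<open>A matrix singular at every \<open>t\<close> has zero determinant, hence a kernel vector
  over the polynomial ring. Dividing out the common power of the variable makes its value at
  \<open>0\<close> nonzero, which is where it is differentiated later.\<close>

lemma polynomial_kernel_vector: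
  fixes M :: "3 \<Rightarrow> 3 \<Rightarrow> 'k::field_char_0 poly"
  assumes sing: "\<And>t. \<exists>x. x \<noteq> 0 \<and> (\<forall>r. (\<Sum>s\<in>UNIV. poly (M r s) t * x s) = 0)"
  obtains F where "\<exists>i. poly (F i) 0 \<noteq> 0" "\<And>r. (\<Sum>s\<in>UNIV. M r s * F s) = 0"
proof -
  define A where "A = mat 3 3 (\<lambda>(r, s). M (of_nat r) (of_nat s))"
  have A: "A \<in> carrier_mat 3 3" by (simp add: A_def)
  have "poly (det A) t = 0" for t
  proof -
    obtain x where x: "x \<noteq> 0" "\<And>r. (\<Sum>s\<in>UNIV. poly (M r s) t * x s) = 0" using sing[of t] by blast
    let ?A = "map_mat (\<lambda>p. poly p t) A"
    define v where "v = vec 3 (\<lambda>s. x (of_nat s))"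
    have "v \<in> carrier_vec 3" by (simp add: v_def)
    moreover have "v \<noteq> 0\<^sub>v 3"
    proof
      assume "v = 0\<^sub>v 3"
      then have "v $ 0 = 0" "v $ 1 = 0" "v $ 2 = 0" by simp_all
      then have "x 0 = 0" "x 1 = 0" "x 2 = 0" by (simp_all add: v_def)
      then show False using x(1) by (simp add: vec3_eq_iff)
    qed
    moreover have "?A *\<^sub>v v = 0\<^sub>v 3"
    proof (rule eq_vecI)
      fix r assume "r < dim_vec (0\<^sub>v 3 :: 'k vec)"
      then have r: "r < 3" by simp
      have "(?A *\<^sub>v v) $ r = (\<Sum>s = 0..<3. poly (M (of_nat r) (of_nat s)) t * x (of_nat s))"
        using r by (auto simp: A_def v_def scalar_prod_def intro!: sum.cong)
      also have "\<dots> = 0" using x(2)[of "of_nat r"] by (simp add: sum_less_3 sum_UNIV_3)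
      finally show "(?A *\<^sub>v v) $ r = 0\<^sub>v 3 $ r" using r by simp
    qed (simp add: A_def)
    ultimately have "det ?A = 0" using det_0_iff_vec_prod_zero_field[of ?A 3] A by auto
    then show ?thesis by (simp add: poly_det)
  qed
  then have "det A = 0" using poly_all_0_iff_0[of "det A"] by blast
  then obtain v where v: "v \<in> carrier_vec 3" "v \<noteq> 0\<^sub>v 3" "A *\<^sub>v v = 0\<^sub>v 3"
    using det_0_iff_vec_prod_zero[OF A] by blast
  define F where "F i = v $ (if i = 0 then 0 else if i = 1 then 1 else 2)" for i :: 3
  have F: "F 0 = v $ 0" "F 1 = v $ 1" "F 2 = v $ 2" by (simp_all add: F_def)
  have "\<exists>i. F i \<noteq> 0"
  proof (rule ccontr)
    assume "\<nexists>i. F i \<noteq> 0"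
    then have "v $ 0 = 0" "v $ 1 = 0" "v $ 2 = 0" using F by metis+
    then have "v = 0\<^sub>v 3" using v(1) by (intro eq_vecI) (auto simp: less_3)
    then show False using v by simp
  qed
  then obtain i where i: "F i \<noteq> 0" ..
  have MF: "(\<Sum>s\<in>UNIV. M r s * F s) = 0" for r
  proof -
    have row: "(\<Sum>s = 0..<3. M (of_nat n) (of_nat s) * v $ s) = 0" if "n < 3" for n
    proof -
      have "(A *\<^sub>v v) $ n = (\<Sum>s = 0..<3. M (of_nat n) (of_nat s) * v $ s)"
        using that v(1) by (auto simp: A_def scalar_prod_def intro!: sum.cong)
      then show ?thesis using v(3) that by simp
    qed
    have "\<forall>r. (\<Sum>s\<in>UNIV. M r s * F s) = 0"
      unfolding all_3 using row[of 0] row[of 1] row[of 2] by (simp add: sum_less_3 sum_UNIV_3 F)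
    then show ?thesis by blast
  qed
  obtain k G where "(\<forall>i. F i = [:0, 1:] ^ k * G i) \<and> (\<exists>i. poly (G i) 0 \<noteq> 0)"
    using divide_out_zero[of F i, OF i] by (elim exE)
  note G = conjunct1[OF this] conjunct2[OF this]
  show ?thesis
  proof (rule that[OF G(2)])
    fix r
    have "[:0, 1:] ^ k * (\<Sum>s\<in>UNIV. M r s * G s) = (\<Sum>s\<in>UNIV. M r s * F s)"
      using G(1) by (simp add: sum_distrib_left mult_ac)
    also have "\<dots> = 0" by (rule MF)
    finally show "(\<Sum>s\<in>UNIV. M r s * G s) = 0" by simp
  qed
qed

context weighted_points
begin

text \<open>For a form \<open>f\<close> of degree \<open>d - n\<close> this is, up to a nonzero
  factor, the value at \<open>l\<close> of \<open>f\<close> acting on the power sum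
  \<open>F\<close>.\<close>

definition mixed :: "nat \<Rightarrow> (3 \<Rightarrow> 'k) \<Rightarrow> ((3 \<Rightarrow> 'k) \<Rightarrow> 'k) \<Rightarrow> 'k"
  where "mixed n l f = (\<Sum>v\<in>P. w v * dot l v ^ n * f v)"

lemma mixed_add: "mixed n l (\<lambda>v. f v + g v) = mixed n l f + mixed n l g"
  and mixed_scale: "mixed n l (\<lambda>v. c * f v) = c * mixed n l f"
  by (simp_all add: mixed_def sum.distrib sum_distrib_left algebra_simps)

lemma mixed_form: "mixed n l (\<lambda>v. dot l v * f v) = mixed (Suc n) l f"
  by (simp add: mixed_def mult_ac)

text \<open>Membership in the kernel of the first Hessian at \<open>l\<close>. Here \<open>f\<close>
  is a coefficient vector and not a function on \<open>P\<close>, so that it can vary polynomially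
  with \<open>l\<close>.\<close>

definition radical :: "(3 \<Rightarrow> 'k) \<Rightarrow> (3 \<Rightarrow> 'k) \<Rightarrow> bool"
  where "radical l f \<longleftrightarrow> (\<forall>g. mixed (d - 2) l (\<lambda>v. dot f v * dot g v) = 0)"

lemma degenerate_radical:
  assumes "\<not> nondeg w (d - 2) 1 P l"
  shows "\<exists>f. f \<noteq> 0 \<and> radical l f"
proof -
  obtain f where f: "f \<in> hp 1" "\<forall>g\<in>hp 1. (\<Sum>v\<in>P. w v * dot l v ^ (d - 2) * f v * g v) = 0" "\<not> (\<forall>v\<in>P. f v = 0)"
    using assms unfolding nondeg_def by blast
  obtain h where h: "f = dot h" using f(1) by (rule hp_1E)
  have "h \<noteq> 0" using f(3) h by auto
  moreover have "radical l h" unfolding radical_def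
  proof
    fix g
    show "mixed (d - 2) l (\<lambda>v. dot h v * dot g v) = 0"
      using bspec[OF f(2) hp_dot[of g]] unfolding mixed_def h by (simp add: mult.assoc)
  qed
  ultimately show ?thesis by blast
qed

text \<open>Along the line \<open>l + t h\<close> there is a kernel vector of the first Hessian depending polynomially on
  \<open>t\<close>; differentiating the kernel equation at \<open>t = 0\<close> yields the identities below.\<close>

lemma kernel_along_line:
  assumes degen: "\<And>l. \<exists>f. f \<noteq> 0 \<and> radical l f" and d2: "3 \<le> d"
  obtains F where "(\<lambda>i. poly (F i) 0) \<noteq> 0" "\<And>t. radical (l + scl t h) (\<lambda>i. poly (F i) t)"
    "\<And>g. of_nat (d - 2) * mixed (d - 3) l (\<lambda>v. dot h v * (dot (\<lambda>i. poly (F i) 0) v * dot g v))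
      + mixed (d - 2) l (\<lambda>v. dot (\<lambda>i. poly (pderiv (F i)) 0) v * dot g v) = 0"
proof -
  define M where "M r s = (\<Sum>v\<in>P. [:w v * v r * v s:] * [:dot l v, dot h v:] ^ (d - 2))" for r s :: 3
  have Mt: "(\<Sum>s\<in>UNIV. poly (M r s) t * x s) = mixed (d - 2) (l + scl t h) (\<lambda>v. v r * dot x v)" for r t x
  proof -
    have "poly (M r s) t = mixed (d - 2) (l + scl t h) (\<lambda>v. v r * v s)" for s
      unfolding M_def mixed_def poly_sum by (rule sum.cong) (simp_all add: dot_add_left mult_ac)
    then have "(\<Sum>s\<in>UNIV. poly (M r s) t * x s) = mixed (d - 2) (l + scl t h) (\<lambda>v. v r * (x 0 * v 0 + x 1 * v 1 + x 2 * v 2))"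
      by (simp add: sum_UNIV_3 mixed_def sum_distrib_left sum_distrib_right sum.distrib[symmetric] algebra_simps)
    then show ?thesis by (simp add: dot_eq)
  qed
  define E :: "3 \<Rightarrow> 3 \<Rightarrow> 'k" where "E r = (\<lambda>j. if j = r then 1 else 0)" for r
  have E: "dot (E r) v = v r" for r v
    by (simp add: dot_def E_def if_distrib[of "\<lambda>x. x * _"] cong: if_cong)
  obtain F where F: "\<exists>i. poly (F i) 0 \<noteq> 0" "\<And>r. (\<Sum>s\<in>UNIV. M r s * F s) = 0"
  proof (rule polynomial_kernel_vector)
    show "\<exists>x. x \<noteq> 0 \<and> (\<forall>r. (\<Sum>s\<in>UNIV. poly (M r s) t * x s) = 0)" for t
    proof -
      obtain f where f: "f \<noteq> 0" "radical (l + scl t h) f" using degen by blast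
      have "(\<Sum>s\<in>UNIV. poly (M r s) t * f s) = 0" for r
        unfolding Mt using f(2)[unfolded radical_def, rule_format, of "E r"] by (simp add: E mult.commute)
      then show ?thesis using f(1) by blast
    qed
  qed (rule that)
  have rad: "mixed (d - 2) (l + scl t h) (\<lambda>v. dot (\<lambda>i. poly (F i) t) v * dot g v) = 0" for t g
  proof -
    have r: "mixed (d - 2) (l + scl t h) (\<lambda>v. v r * dot (\<lambda>i. poly (F i) t) v) = 0" for r
      using arg_cong[OF F(2)[of r], of "\<lambda>p. poly p t"] Mt[of r t "\<lambda>i. poly (F i) t"] by (simp add: poly_sum)
    have "mixed (d - 2) (l + scl t h) (\<lambda>v. dot (\<lambda>i. poly (F i) t) v * dot g v)
      = g 0 * mixed (d - 2) (l + scl t h) (\<lambda>v. v 0 * dot (\<lambda>i. poly (F i) t) v)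
      + g 1 * mixed (d - 2) (l + scl t h) (\<lambda>v. v 1 * dot (\<lambda>i. poly (F i) t) v)
      + g 2 * mixed (d - 2) (l + scl t h) (\<lambda>v. v 2 * dot (\<lambda>i. poly (F i) t) v)"
      unfolding mixed_scale[symmetric] mixed_add[symmetric] by (simp add: dot_eq[of g] algebra_simps)
    then show ?thesis using r by simp
  qed
  show ?thesis
  proof (rule that[of F])
    show "(\<lambda>i. poly (F i) 0) \<noteq> 0" using F(1) by (auto simp: fun_eq_iff)
    show "radical (l + scl t h) (\<lambda>i. poly (F i) t)" for t unfolding radical_def using rad by blast
    fix g
    define n where "n = d - 3"
    have n: "d - 2 = Suc n" "d - 3 = n" using d2 by (simp_all add: n_def)
    \<comment> \<open>The kernel equation tested against \<open>g\<close>, as a polynomial in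
      \<open>t\<close>.\<close>
    define W where "W = (\<Sum>v\<in>P. [:dot l v, dot h v:] ^ Suc n * (smult (w v * dot g v) (smult (v 0) (F 0) + smult (v 1) (F 1) + smult (v 2) (F 2))))"
    have "poly W t = mixed (d - 2) (l + scl t h) (\<lambda>v. dot (\<lambda>i. poly (F i) t) v * dot g v)" for t
      unfolding W_def mixed_def poly_sum n by (rule sum.cong) (simp_all add: dot_add_left dot_eq[of "\<lambda>i. poly (F i) t"] algebra_simps)
    then have "W = 0" using rad poly_all_0_iff_0[of W] by simp
    then have "0 = poly (pderiv W) 0" by simp
    also have "\<dots> = (\<Sum>v\<in>P. of_nat (Suc n) * (w v * dot l v ^ n * (dot h v * (dot (\<lambda>i. poly (F i) 0) v * dot g v)))
        + w v * dot l v ^ Suc n * (dot (\<lambda>i. poly (pderiv (F i)) 0) v * dot g v))"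
      unfolding W_def pderiv_sum poly_sum
      by (rule sum.cong) (simp_all only: pderiv_mult pderiv_power_Suc, simp_all add: pderiv_pCons pderiv_smult pderiv_add dot_eq[of "\<lambda>i. poly (_ i) 0"] algebra_simps)
    also have "\<dots> = of_nat (d - 2) * mixed (d - 3) l (\<lambda>v. dot h v * (dot (\<lambda>i. poly (F i) 0) v * dot g v))
      + mixed (d - 2) l (\<lambda>v. dot (\<lambda>i. poly (pderiv (F i)) 0) v * dot g v)"
      unfolding n mixed_def by (simp only: sum.distrib sum_distrib_left)
    finally show "of_nat (d - 2) * mixed (d - 3) l (\<lambda>v. dot h v * (dot (\<lambda>i. poly (F i) 0) v * dot g v))
      + mixed (d - 2) l (\<lambda>v. dot (\<lambda>i. poly (pderiv (F i)) 0) v * dot g v) = 0" by simp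
  qed
qed

text \<open>Without \<open>Q\<close> the first Hessian is nondegenerate at generic \<open>l\<close>;
  if it degenerates everywhere on \<open>P\<close>, its kernel there is spanned by one
  \<open>f\<close>. Differentiating the kernel along lines shows that \<open>mixed\<close>
  annihilates the products of \<open>f\<close> and \<open>l\<close> with any linear form in
  \<open>stepA\<close> and \<open>stepB\<close>: first \<open>f^2\<close> against
  \<open>l^(d-3)\<close>, then \<open>f^3\<close> against \<open>l^(d-4)\<close>. So, in the second
  Hessian, \<open>f (x l + y f)\<close> is orthogonal to all quadrics but for one direction. One
  linear condition on \<open>x\<close>, \<open>y\<close> produces a kernel element there, which is
  no conic through \<open>P\<close>.\<close>

lemma hessian_of_second_hessian:
  assumes Q: "Q \<notin> Z" "P = insert Q Z" and d4: "4 \<le> d"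
    and nd0: "\<exists>l. nondeg w d 0 P l" and ndZ: "\<exists>l. nondeg w (d - 2) 1 Z l" and nd2: "\<exists>l. nondeg w (d - 4) 2 P l"
    and noconic: "\<And>q v. q \<in> hp 2 \<Longrightarrow> (\<And>v. v \<in> P \<Longrightarrow> q v = 0) \<Longrightarrow> q v = 0"
  shows "\<exists>l. nondeg w (d - 2) 1 P l"
proof (rule ccontr)
  assume "\<nexists>l. nondeg w (d - 2) 1 P l"
  then have degen: "\<exists>f. f \<noteq> 0 \<and> radical l f" for l using degenerate_radical by blast
  have d3: "3 \<le> d" using d4 by simp
  have fZ: "finite Z" using fin Q by simp
  have product_hp2: "(\<lambda>v. dot a v * dot b v) \<in> hp 2" for a b :: "3 \<Rightarrow> 'k"
    using hp_dot_times[OF hp_dot[of b], of a] by (simp add: numeral_2_eq_2)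
  have form0: "f = 0" if "\<And>v. v \<in> P \<Longrightarrow> dot f v = 0" for f
  proof -
    have "dot f v * dot f v = 0" for v by (rule noconic[OF product_hp2]) (simp add: that)
    then show ?thesis using product_of_forms_zero[of f f] by blast
  qed
  \<comment> \<open>A kernel element that vanishes at \<open>Q\<close> is a kernel element for
    \<open>Z\<close> alone; the value at \<open>Q\<close> therefore determines it.\<close>
  have rad_zero: "f = 0" if G: "nondeg w (d - 2) 1 Z l" and f: "radical l f" "dot f Q = 0" for l f
  proof (rule form0)
    have "(\<Sum>v\<in>Z. w v * dot l v ^ (d - 2) * dot f v * g v) = 0" if g: "g \<in> hp 1" for g
    proof -
      obtain a where a: "g = dot a" using g by (rule hp_1E)
      have "(\<Sum>v\<in>P. w v * dot l v ^ (d - 2) * (dot f v * dot a v)) = 0"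
        using f(1) unfolding radical_def mixed_def by blast
      then have "(\<Sum>v\<in>insert Q Z. w v * dot l v ^ (d - 2) * (dot f v * dot a v)) = 0" by (simp only: Q(2))
      then show ?thesis using f(2) Q(1) fZ by (simp add: a mult.assoc)
    qed
    then have "\<forall>v\<in>Z. dot f v = 0" using G hp_dot[of f] unfolding nondeg_def by blast
    then show "dot f v = 0" if "v \<in> P" for v using that f(2) unfolding Q(2) by blast
  qed
  have rad_unique: "\<exists>k. f' = scl k f"
    if G: "nondeg w (d - 2) 1 Z l" and f: "radical l f" "radical l f'" "f \<noteq> 0" for l f f'
  proof -
    have fQ: "dot f Q \<noteq> 0" using rad_zero[OF G f(1)] f(3) by blast
    define k where "k = dot f' Q / dot f Q"
    have "radical l (f' - scl k f)" unfolding radical_def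
    proof
      fix g
      have "mixed (d - 2) l (\<lambda>v. dot f' v * dot g v) = 0" "mixed (d - 2) l (\<lambda>v. dot f v * dot g v) = 0"
        using f(1,2) unfolding radical_def by blast+
      moreover have "mixed (d - 2) l (\<lambda>v. dot (f' - scl k f) v * dot g v)
        = mixed (d - 2) l (\<lambda>v. dot f' v * dot g v) + (- k) * mixed (d - 2) l (\<lambda>v. dot f v * dot g v)"
        unfolding mixed_scale[symmetric] mixed_add[symmetric] by (simp add: dot_diff_left algebra_simps)
      ultimately show "mixed (d - 2) l (\<lambda>v. dot (f' - scl k f) v * dot g v) = 0" by simp
    qed
    then have "f' - scl k f = 0" by (rule rad_zero[OF G]) (simp add: dot_diff_left k_def fQ)
    then show ?thesis by (intro exI[of _ k]) simp
  qed
  have rad_scl: "radical l (scl k f)" if "radical l f" for l k f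
    using that mixed_scale[of "d - 2" l k] unfolding radical_def by (simp add: mult.assoc)
  \<comment> \<open>At \<open>t = 0\<close> the kernel vector is a multiple of \<open>f\<close>.
    Testing the differentiated equation against it removes the term with the derivative.\<close>
  have stepA: "mixed (d - 3) l (\<lambda>v. dot h v * (dot f v * dot f v)) = 0"
    if G: "nondeg w (d - 2) 1 Z l" and f: "radical l f" for l h f
  proof (cases "f = 0")
    case False
    obtain F where F: "(\<lambda>i. poly (F i) 0) \<noteq> 0" "\<And>t. radical (l + scl t h) (\<lambda>i. poly (F i) t)"
      "\<And>g. of_nat (d - 2) * mixed (d - 3) l (\<lambda>v. dot h v * (dot (\<lambda>i. poly (F i) 0) v * dot g v))
        + mixed (d - 2) l (\<lambda>v. dot (\<lambda>i. poly (pderiv (F i)) 0) v * dot g v) = 0"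
      by (rule kernel_along_line[OF degen d3], rule that)
    define F0 where "F0 = (\<lambda>i. poly (F i) 0)"
    have "l + scl 0 h = l" by (simp add: fun_eq_iff)
    then have r0: "radical l F0" using F(2)[of 0] by (simp add: F0_def)
    then obtain k where k: "F0 = scl k f" using rad_unique[OF G f _ False] by blast
    have k0: "k \<noteq> 0" using F(1) k by (auto simp: F0_def[symmetric] fun_eq_iff)
    have "mixed (d - 2) l (\<lambda>v. dot (\<lambda>i. poly (pderiv (F i)) 0) v * dot F0 v) = 0"
      using spec[OF r0[unfolded radical_def], of "\<lambda>i. poly (pderiv (F i)) 0"] by (simp add: mult.commute)
    then have "of_nat (d - 2) * mixed (d - 3) l (\<lambda>v. dot h v * (dot F0 v * dot F0 v)) = 0"
      using F(3)[of F0] unfolding F0_def[symmetric] by simp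
    moreover have "of_nat (d - 2) \<noteq> (0 :: 'k)" unfolding of_nat_eq_0_iff using d3 by simp
    ultimately have "mixed (d - 3) l (\<lambda>v. dot h v * (dot F0 v * dot F0 v)) = 0"
      unfolding mult_eq_0_iff by blast
    moreover have "mixed (d - 3) l (\<lambda>v. dot h v * (dot F0 v * dot F0 v)) = k * k * mixed (d - 3) l (\<lambda>v. dot h v * (dot f v * dot f v))"
      unfolding k mixed_scale[symmetric] by (simp add: mult_ac)
    ultimately show ?thesis using k0 by simp
  qed (simp add: mixed_def)
  have stepB: "mixed (d - 4) l (\<lambda>v. dot h v * (dot f v * (dot f v * dot f v))) = 0"
    if G: "nondeg w (d - 2) 1 Z l" and f: "radical l f" "f \<noteq> 0" for l h f
  proof -
    obtain F where F: "(\<lambda>i. poly (F i) 0) \<noteq> 0" "\<And>t. radical (l + scl t f) (\<lambda>i. poly (F i) t)"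
      "\<And>g. of_nat (d - 2) * mixed (d - 3) l (\<lambda>v. dot f v * (dot (\<lambda>i. poly (F i) 0) v * dot g v))
        + mixed (d - 2) l (\<lambda>v. dot (\<lambda>i. poly (pderiv (F i)) 0) v * dot g v) = 0"
      by (rule kernel_along_line[OF degen d3, where h = f], rule that)
    define F0 where "F0 = (\<lambda>i. poly (F i) 0)"
    define F1 where "F1 = (\<lambda>i. poly (pderiv (F i)) 0)"
    have "l + scl 0 f = l" by (simp add: fun_eq_iff)
    then have r0: "radical l F0" using F(2)[of 0] by (simp add: F0_def)
    then obtain k where k: "F0 = scl k f" using rad_unique[OF G f(1) _ f(2)] by blast
    have k0: "k \<noteq> 0" using F(1) k by (auto simp: F0_def[symmetric] fun_eq_iff)
    \<comment> \<open>In direction \<open>f\<close> the first term of the differentiated equation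
      vanishes by \<open>stepA\<close>, so the derivative of the kernel vector is again in the
      kernel and a multiple of \<open>f\<close>.\<close>
    have "radical l F1" unfolding radical_def
    proof
      fix g
      have "mixed (d - 3) l (\<lambda>v. dot f v * (dot F0 v * dot g v)) = k * mixed (d - 3) l (\<lambda>v. dot g v * (dot f v * dot f v))"
        unfolding k mixed_scale[symmetric] by (simp add: mult_ac)
      then have "mixed (d - 3) l (\<lambda>v. dot f v * (dot F0 v * dot g v)) = 0" using stepA[OF G f(1)] by simp
      then show "mixed (d - 2) l (\<lambda>v. dot F1 v * dot g v) = 0"
        using F(3)[of g] unfolding F0_def[symmetric] F1_def[symmetric] by simp
    qed
    then obtain k' where k': "F1 = scl k' f" using rad_unique[OF G f(1) _ f(2)] by blast
    define n where "n = d - 4"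
    have n: "d - 3 = Suc n" "d - 4 = n" using d4 by (simp_all add: n_def)
    define L where "L v = smult (v 0) (F 0) + smult (v 1) (F 1) + smult (v 2) (F 2)" for v :: "3 \<Rightarrow> 'k"
    have L: "poly (L v) t = dot (\<lambda>i. poly (F i) t) v" for v t by (simp add: L_def dot_eq mult.commute)
    have L': "poly (pderiv (L v)) 0 = dot F1 v" for v by (simp add: L_def dot_eq F1_def pderiv_add pderiv_smult mult.commute)
    define W where "W = (\<Sum>v\<in>P. [:dot l v, dot f v:] ^ Suc n * (smult (w v * dot h v) (L v * L v)))"
    have W: "poly W t = mixed (d - 3) (l + scl t f) (\<lambda>v. dot h v * (dot (\<lambda>i. poly (F i) t) v * dot (\<lambda>i. poly (F i) t) v))" for t
      unfolding W_def mixed_def poly_sum n by (rule sum.cong) (simp_all add: dot_add_left L algebra_simps)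
    \<comment> \<open>\<open>stepA\<close> holds along the line except at the finitely many
      \<open>t\<close> where \<open>Z\<close> degenerates, and a polynomial with infinitely many
      zeros is zero.\<close>
    have "W = 0"
    proof (rule ccontr)
      assume "W \<noteq> 0"
      then have "finite {t. poly W t = 0}" by (rule poly_roots_finite)
      moreover have "finite {t. \<not> nondeg w (d - 2) 1 Z (l + scl t f)}"
        using generic_nondeg[OF fZ G] G unfolding generic_def by (elim conjE allE impE)
      ultimately have fb: "finite ({t. poly W t = 0} \<union> {t. \<not> nondeg w (d - 2) 1 Z (l + scl t f)})" by simp
      obtain t where t: "t \<notin> {t. poly W t = 0} \<union> {t. \<not> nondeg w (d - 2) 1 Z (l + scl t f)}"
        using ex_new_if_finite[OF infinite_UNIV_char_0 fb] by (rule exE)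
      then have nd: "nondeg w (d - 2) 1 Z (l + scl t f)" and nz: "poly W t \<noteq> 0" by simp_all
      have "poly W t = 0" unfolding W by (rule stepA[OF nd F(2)])
      then show False using nz by simp
    qed
    then have "0 = poly (pderiv W) 0" by simp
    also have "\<dots> = (\<Sum>v\<in>P. of_nat (Suc n) * (w v * dot l v ^ n * (dot h v * (dot f v * (dot F0 v * dot F0 v))))
        + 2 * (w v * dot l v ^ Suc n * (dot h v * (dot F0 v * dot F1 v))))"
      unfolding W_def pderiv_sum poly_sum
    proof (rule sum.cong)
      fix v
      have L0: "poly (L v) 0 = dot F0 v" by (simp add: L F0_def)
      show "poly (pderiv ([:dot l v, dot f v:] ^ Suc n * smult (w v * dot h v) (L v * L v))) 0
        = of_nat (Suc n) * (w v * dot l v ^ n * (dot h v * (dot f v * (dot F0 v * dot F0 v))))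
        + 2 * (w v * dot l v ^ Suc n * (dot h v * (dot F0 v * dot F1 v)))"
        by (simp only: pderiv_mult pderiv_power_Suc pderiv_smult poly_add poly_mult poly_smult L0 L')
          (simp add: pderiv_pCons algebra_simps)
    qed simp
    also have "\<dots> = of_nat (Suc n) * mixed n l (\<lambda>v. dot h v * (dot f v * (dot F0 v * dot F0 v)))
      + 2 * mixed (Suc n) l (\<lambda>v. dot h v * (dot F0 v * dot F1 v))"
      unfolding mixed_def by (simp only: sum.distrib sum_distrib_left)
    also have "mixed (Suc n) l (\<lambda>v. dot h v * (dot F0 v * dot F1 v)) = k * k' * mixed (d - 3) l (\<lambda>v. dot h v * (dot f v * dot f v))"
      unfolding k k' n mixed_scale[symmetric] by (simp add: mult_ac)
    also have "\<dots> = 0" using stepA[OF G f(1)] by simp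
    finally have "of_nat (Suc n) * mixed n l (\<lambda>v. dot h v * (dot f v * (dot F0 v * dot F0 v))) = 0" by simp
    then have "mixed n l (\<lambda>v. dot h v * (dot f v * (dot F0 v * dot F0 v))) = 0"
      unfolding mult_eq_0_iff using of_nat_neq_0[of n, where ?'a = 'k] by blast
    moreover have "mixed n l (\<lambda>v. dot h v * (dot f v * (dot F0 v * dot F0 v))) = k * k * mixed n l (\<lambda>v. dot h v * (dot f v * (dot f v * dot f v)))"
      unfolding k mixed_scale[symmetric] by (simp add: mult_ac)
    ultimately show ?thesis using k0 n by simp
  qed
  have "\<exists>l. nondeg w (d - 2) 1 Z l \<and> (nondeg w (d - 4) 2 P l \<and> nondeg w d 0 P l)"
  proof -
    obtain l0 l1 l2 where "nondeg w (d - 2) 1 Z l0" "nondeg w (d - 4) 2 P l1" "nondeg w d 0 P l2"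
      using nd0 ndZ nd2 by (elim exE)
    then have "generic (\<lambda>l. nondeg w (d - 2) 1 Z l \<and> (nondeg w (d - 4) 2 P l \<and> nondeg w d 0 P l))"
      by (intro generic_conj generic_nondeg fin fZ)
    then show ?thesis unfolding generic_def by (rule conjunct1)
  qed
  then obtain l where l: "nondeg w (d - 2) 1 Z l" "nondeg w (d - 4) 2 P l" "nondeg w d 0 P l" by (elim exE conjE)
  obtain f where f: "f \<noteq> 0" "radical l f" using degen by blast
  \<comment> \<open>This is \<open>F(l) \<noteq> 0\<close>. It keeps \<open>f\<close> and
    \<open>l\<close> independent, for \<open>f = c l\<close> would give \<open>c F(l) = 0\<close> by
    the kernel equation.\<close>
  have one: "mixed d l (\<lambda>v. 1) \<noteq> 0"
  proof
    assume z: "mixed d l (\<lambda>v. 1) = 0"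
    have "(\<Sum>v\<in>P. w v * dot l v ^ d * 1 * g v) = 0" if g: "g \<in> hp 0" for g
    proof -
      obtain c where "g = (\<lambda>v. c)" using g by auto
      then show ?thesis using z by (simp add: mixed_def sum_distrib_right[symmetric])
    qed
    then have c0: "\<forall>g\<in>hp 0. (\<Sum>v\<in>P. w v * dot l v ^ d * 1 * g v) = 0" by (rule ballI)
    have h0: "(\<lambda>v. 1) \<in> hp 0" by auto
    have "\<forall>v\<in>P. (1::'k) = 0" by (rule mp[OF bspec[OF l(3)[unfolded nondeg_def] h0] c0])
    moreover have "Q \<in> P" using Q(2) by blast
    ultimately show False by simp
  qed
  have S1: "mixed (d - 2) l (\<lambda>v. dot f v * dot g v) = 0" for g using f(2) unfolding radical_def by blast
  have S3: "mixed (d - 3) l (\<lambda>v. dot h v * (dot f v * dot f v)) = 0" for h by (rule stepA[OF l(1) f(2)])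
  have S4: "mixed (d - 4) l (\<lambda>v. dot h v * (dot f v * (dot f v * dot f v))) = 0" for h by (rule stepB[OF l(1) f(2,1)])
  have dd: "Suc (d - 3) = d - 2" "Suc (d - 4) = d - 3" "Suc (Suc (d - 2)) = d" using d4 by simp_all
  have l0: "l \<noteq> 0"
  proof
    assume "l = 0"
    then have "mixed d l (\<lambda>v. 1) = 0" using d4 by (simp add: mixed_def power_0_left)
    then show False using one by blast
  qed
  have lf: "cross l f \<noteq> 0"
  proof
    assume "cross l f = 0"
    then obtain c where c: "f = scl c l" using parallel_of_cross_zero l0 by blast
    have "mixed (d - 2) l (\<lambda>v. dot f v * dot l v) = c * mixed (Suc (Suc (d - 2))) l (\<lambda>v. 1)"
      unfolding c mixed_form[symmetric] mixed_scale[symmetric] by (simp add: mult_ac)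
    then have "c * mixed d l (\<lambda>v. 1) = 0" using S1[of l] unfolding dd by simp
    then have "c = 0" using one by simp
    then show False using c f(1) by (simp add: fun_eq_iff)
  qed
  \<comment> \<open>In the basis \<open>l\<close>, \<open>f\<close>, \<open>m\<close>, all products
    of \<open>f (x l + y f)\<close> with quadrics other than the square of \<open>m\<close> contain
    \<open>l^2 f\<close>, \<open>l f^2\<close> or \<open>f^3\<close>, which are already known to be
    annihilated.\<close>
  obtain m where m: "dot l (cross f m) \<noteq> 0" using independent_of_cross[OF lf] .
  define ph where "ph x y = mixed (d - 4) l (\<lambda>v. dot f v * (x * dot l v + y * dot f v) * (dot m v * dot m v))" for x y
  have prod: "\<exists>c. \<forall>x y. mixed (d - 4) l (\<lambda>v. dot f v * (x * dot l v + y * dot f v) * (dot a v * dot b v)) = c * ph x y" for a b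
  proof -
    obtain a0 a1 a2 where a: "a = scl a0 l + scl a1 f + scl a2 m" using basis_expansion[OF m, of a] by blast
    obtain b0 b1 b2 where b: "b = scl b0 l + scl b1 f + scl b2 m" using basis_expansion[OF m, of b] by blast
    have "mixed (d - 4) l (\<lambda>v. dot f v * (x * dot l v + y * dot f v) * (dot a v * dot b v)) = a2 * b2 * ph x y" for x y
    proof -
      have S1': "mixed (d - 4) l (\<lambda>v. dot l v * (dot l v * (dot f v * dot g v))) = 0" for g
        using S1[of g] dd by (simp only: mixed_form)
      have S3': "mixed (d - 4) l (\<lambda>v. dot l v * (dot h v * (dot f v * dot f v))) = 0" for h
        using S3[of h] dd by (simp only: mixed_form)
      define r where "r = scl a0 b + scl (a2 * b0) m"
      define s where "s = scl a1 b + scl (a2 * b1) m"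
      have "mixed (d - 4) l (\<lambda>v. dot f v * (x * dot l v + y * dot f v) * (dot a v * dot b v))
        = a2 * b2 * ph x y + x * mixed (d - 4) l (\<lambda>v. dot l v * (dot l v * (dot f v * dot r v)))
          + x * mixed (d - 4) l (\<lambda>v. dot l v * (dot s v * (dot f v * dot f v)))
          + y * mixed (d - 4) l (\<lambda>v. dot l v * (dot r v * (dot f v * dot f v)))
          + y * mixed (d - 4) l (\<lambda>v. dot s v * (dot f v * (dot f v * dot f v)))"
        unfolding ph_def mixed_scale[symmetric] mixed_add[symmetric]
      proof (rule arg_cong[of _ _ "mixed (d - 4) l"], rule ext)
        fix v
        have av: "dot a v = a0 * dot l v + a1 * dot f v + a2 * dot m v" by (simp add: a dot_add_left)
        have bv: "dot b v = b0 * dot l v + b1 * dot f v + b2 * dot m v" by (simp add: b dot_add_left)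
        have rs: "dot r v = a0 * dot b v + a2 * b0 * dot m v" "dot s v = a1 * dot b v + a2 * b1 * dot m v"
          by (simp_all add: r_def s_def dot_add_left)
        show "dot f v * (x * dot l v + y * dot f v) * (dot a v * dot b v)
          = a2 * b2 * (dot f v * (x * dot l v + y * dot f v) * (dot m v * dot m v))
          + x * (dot l v * (dot l v * (dot f v * dot r v))) + x * (dot l v * (dot s v * (dot f v * dot f v)))
          + y * (dot l v * (dot r v * (dot f v * dot f v))) + y * (dot s v * (dot f v * (dot f v * dot f v)))"
          unfolding rs av bv by (simp add: algebra_simps)
      qed
      then show ?thesis using S1' S3' S4 by simp
    qed
    then show ?thesis by blast
  qed
  have lin: "ph x y = x * ph 1 0 + y * ph 0 1" for x y
    unfolding ph_def mixed_scale[symmetric] mixed_add[symmetric] by (simp add: algebra_simps)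
  \<comment> \<open>One linear equation in two unknowns.\<close>
  obtain x y where xy: "x \<noteq> 0 \<or> y \<noteq> 0" "ph x y = 0"
  proof (cases "ph 1 0 = 0")
    case True
    then show ?thesis by (intro that[of 1 0]) auto
  next
    case False
    then show ?thesis by (intro that[of "ph 0 1" "- ph 1 0"]) (auto simp: lin[of "ph 0 1"] mult.commute)
  qed
  define g where "g = scl x l + scl y f"
  have gv: "dot g v = x * dot l v + y * dot f v" for v by (simp add: g_def dot_add_left)
  have ortho: "mixed (d - 4) l (\<lambda>v. dot f v * dot g v * (dot a v * dot b v)) = 0" for a b
    using prod[of a b] xy(2) unfolding gv by auto
  have pz: "\<forall>v\<in>P. dot f v * dot g v = 0"
  proof -
    have "(\<Sum>v\<in>P. w v * dot l v ^ (d - 4) * (dot f v * dot g v) * q v) = 0" if q: "q \<in> hp 2" for q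
    proof -
      obtain c where c: "\<And>v. q v = (\<Sum>k<6. c k * mon k v)" using hp_2E[OF q] by blast
      define E :: "3 \<Rightarrow> 3 \<Rightarrow> 'k" where "E i = (\<lambda>k. if k = i then 1 else 0)" for i
      have E: "dot (E i) v = v i" for v i
        by (simp add: dot_def E_def if_distrib[of "\<lambda>x. x * _"] cong: if_cong)
      have z: "mixed (d - 4) l (\<lambda>v. dot f v * dot g v * (v i * v j)) = 0" for i j
        using ortho[of "E i" "E j"] by (simp add: E)
      have "(\<Sum>v\<in>P. w v * dot l v ^ (d - 4) * (dot f v * dot g v) * q v) = mixed (d - 4) l (\<lambda>v. dot f v * dot g v * q v)"
        by (simp add: mixed_def mult.assoc)
      also have "\<dots> = c 0 * mixed (d - 4) l (\<lambda>v. dot f v * dot g v * (v 0 * v 0))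
        + c 1 * mixed (d - 4) l (\<lambda>v. dot f v * dot g v * (v 1 * v 1))
        + c 2 * mixed (d - 4) l (\<lambda>v. dot f v * dot g v * (v 2 * v 2))
        + c 3 * mixed (d - 4) l (\<lambda>v. dot f v * dot g v * (v 0 * v 1))
        + c 4 * mixed (d - 4) l (\<lambda>v. dot f v * dot g v * (v 0 * v 2))
        + c 5 * mixed (d - 4) l (\<lambda>v. dot f v * dot g v * (v 1 * v 2))"
        unfolding mixed_scale[symmetric] mixed_add[symmetric] c sum_mon
        by (rule arg_cong[of _ _ "mixed (d - 4) l"]) (simp add: algebra_simps)
      also have "\<dots> = 0" by (simp add: z)
      finally show ?thesis .
    qed
    then have c2: "\<forall>q\<in>hp 2. (\<Sum>v\<in>P. w v * dot l v ^ (d - 4) * (dot f v * dot g v) * q v) = 0" by (rule ballI)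
    show ?thesis by (rule mp[OF bspec[OF l(2)[unfolded nondeg_def] product_hp2[of f g]] c2])
  qed
  have "dot f v * dot g v = 0" for v by (rule noconic[OF product_hp2]) (rule bspec[OF pz])
  then have "g = 0" using product_of_forms_zero[of f g] f(1) by blast
  have "cross l g = scl y (cross l f)" "cross g f = scl x (cross l f)"
    unfolding g_def cross_add_right cross_scl_right cross_add_left cross_scl_left cross_self by (simp_all add: scl_def fun_eq_iff)
  moreover have "cross l g = 0" "cross g f = 0" unfolding \<open>g = 0\<close> by (simp_all add: vec3_eq_iff)
  ultimately have "scl y (cross l f) = 0" "scl x (cross l f) = 0" by simp_all
  then show False using xy(1) lf by (simp only: fs.scale_eq_0_iff) blast
qed

end


section \<open>The admissible configurations of points\<close>

context weighted_points
begin

abbreviation hdim :: "nat \<Rightarrow> nat"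
  where "hdim i \<equiv> fs.dim (res P ` hp i)"

lemma nondeg_degree_zero: "P \<noteq> {} \<Longrightarrow> \<exists>l. nondeg w (d - 2 * 0) 0 P l"
  using nondeg_constants[OF fin _ separates_mono[OF sep _ zero_notin, of d] weight] d by simp

lemma nondeg_tail_one:
  assumes t: "2 \<le> t" and dims: "hdim (t - 1) + 1 = card P" "hdim (t - 2) + 2 = card P"
    and card: "card P = t + 2 \<or> card P = t + 3 \<or> (card P = t + 4 \<and> hdim 2 = 6)" and i: "i < t"
  shows "\<exists>l. nondeg w (d - 2 * i) i P l"
proof (cases "i = 0")
  case True
  have "P \<noteq> {}" using card by auto
  then show ?thesis using nondeg_degree_zero True by simp
next
  case False
  then have i1: "1 \<le> i" by simp
  obtain a where a: "a \<noteq> 0" "card {v\<in>P. dot a v = 0} = t + 1" using many_points_on_line[OF t dims] .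
  consider "card P = t + 2" | "card P = t + 3" | "card P = t + 4" "hdim 2 = 6" using card by blast
  then show ?thesis
  proof cases
    case 1
    show ?thesis by (rule nondeg_line_plus_one[OF a 1 i1 i])
  next
    case 2
    show ?thesis by (rule nondeg_line_plus_two[OF a 2 i1 i])
  next
    case 3
    show ?thesis
    proof (rule nondeg_line_plus_three[OF a 3(1) i1 i], rule ccontr)
      fix b :: "3 \<Rightarrow> 'k" assume b: "b \<noteq> 0" and no: "\<not> (\<exists>v\<in>P. dot a v \<noteq> 0 \<and> dot b v \<noteq> 0)"
      have "(\<lambda>v. dot a v * dot b v) \<in> hp 2" using hp_dot_times[OF hp_dot[of b], of a] by (simp add: numeral_2_eq_2)
      then have "dot a v * dot b v = 0" for v
        by (rule no_conic_through_points[OF fin 3(2)]) (use no in auto)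
      then show False using product_of_forms_zero[of a b] a(1) b by blast
    qed
  qed
qed

lemma nondeg_points_on_conic:
  assumes t: "2 \<le> t" and card: "card P = 2 * t + 1" and dim: "hdim 2 = 5" and i: "i < t"
  shows "\<exists>l. nondeg w (d - 2 * i) i P l"
proof -
  have dim5: "hdim 2 \<le> 5" using dim by simp
  obtain q where q: "q \<in> hp 2" "\<exists>v. q v \<noteq> 0" "\<And>v. v \<in> P \<Longrightarrow> q v = 0"
    by (rule conic_through_points[OF fin dim5], rule that)
  have lines: "card {z\<in>P. dot a z = 0} \<le> t + 1" if "a \<noteq> 0" for a
    by (rule line_bound[OF that]) auto
  show ?thesis by (rule nondeg_on_conic[OF fin proper card t weight d i q lines])
qed

text \<open>As no conic contains \<open>P\<close>, exactly one point \<open>Q\<close> lies off the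
  conic supporting the relations. The equation of the conic times a power of a linear form isolates
  \<open>Q\<close> in all degrees from \<open>2\<close> on.\<close>

lemma nondeg_conic_plus_one:
  assumes t: "2 \<le> t" and card: "card P = 2 * t + 2" and dim: "hdim 2 = 6"
    and dims: "hdim (t - 1) + 2 = card P" "hdim (t - 2) + 4 = card P" and i: "i < t"
  shows "\<exists>l. nondeg w (d - 2 * i) i P l"
proof -
  obtain q D where q: "q \<in> hp 2" "\<exists>v. q v \<noteq> 0" and D: "D \<subseteq> P" "card D = 2"
    and rel: "\<And>\<psi>. \<exists>c. (\<forall>x\<in>D. c x = \<psi> x) \<and> (\<forall>f\<in>hp (t - 1). (\<Sum>x\<in>P. c x * f x) = 0) \<and> (\<forall>v\<in>P. q v \<noteq> 0 \<longrightarrow> c v = 0)"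
    by (rule relations_on_conic[OF t dims], rule that)
  define Z where "Z = {v\<in>P. q v = 0}"
  have big: "2 * t + 1 \<le> card Z" unfolding Z_def by (rule many_points_on_conic[OF t q D rel])
  have fZ: "finite Z" and ZP: "Z \<subseteq> P" using fin by (simp_all add: Z_def)
  obtain Q where Q: "Q \<in> P" "q Q \<noteq> 0"
    using no_conic_through_points[OF fin dim q(1)] q(2) by metis
  have QZ: "Q \<notin> Z" using Q by (simp add: Z_def)
  have "card (insert Q Z) \<le> card P" by (rule card_mono[OF fin]) (use Q ZP in auto)
  then have cZ: "card Z = 2 * t + 1" using big QZ fZ card by simp
  have PZ: "P = insert Q Z"
    by (rule card_subset_eq[OF fin, symmetric]) (use Q ZP QZ fZ cZ card in auto)
  have qZ: "q v = 0" if "v \<in> Z" for v using that by (simp add: Z_def)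
  have propZ: "proper Z" by (rule proper_subset[OF proper ZP])
  have wZ: "w v \<noteq> 0" if "v \<in> Z" for v using that ZP weight by blast
  have lines: "card {z\<in>Z. dot a z = 0} \<le> t + 1" if "a \<noteq> 0" for a
    by (rule line_bound[OF that]) (use ZP in auto)
  have conic: "\<exists>l. nondeg w (d - 2 * j) j Z l" if "j < t" for j
    by (rule nondeg_on_conic[OF fZ propZ cZ t wZ d that q qZ lines])
  have split: "\<exists>l. nondeg w (d - 2 * j) j P l" if j: "2 \<le> j" and nd: "\<exists>l. nondeg w (d - 2 * j) j Z l" for j
  proof -
    have "\<exists>l. nondeg w (d - 2 * j) j (Z \<union> {Q}) l"
    proof (rule nondeg_split_ex[OF fZ _ _ _ _ _ nd])
      have "Q \<noteq> 0" using Q zero_notin by blast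
      then obtain b where b: "dot b Q = 1" by (rule form_nonvanishing)
      have "(\<lambda>v. q v * dot b v ^ (j - 2)) \<in> hp (2 + (j - 2))" by (rule hp_times[OF q(1) hp_dot_power])
      then have h: "(\<lambda>v. q v * dot b v ^ (j - 2)) \<in> hp j" by (simp only: le_add_diff_inverse[OF j])
      show "\<exists>p\<in>hp j. p y \<noteq> 0 \<and> (\<forall>u\<in>Z \<union> {Q}. u \<noteq> y \<longrightarrow> p u = 0)" if "y \<in> {Q}" for y
        by (rule bexI[OF _ h]) (use that b Q qZ in auto)
    qed (use QZ Q weight zero_notin in auto)
    then show ?thesis using PZ by simp
  qed
  consider "i = 0" | "i = 1" | "2 \<le> i" by linarith
  then show ?thesis
  proof cases
    case 1
    have "P \<noteq> {}" using Q by blast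
    then show ?thesis using nondeg_degree_zero 1 by simp
  next
    case 3
    show ?thesis by (rule split[OF 3 conic[OF i]])
  next
    case 2
    have nP: "P \<noteq> {}" using Q by blast
    have "\<exists>l. nondeg w (d - 2) 1 P l"
    proof (rule hessian_of_second_hessian[OF QZ PZ])
      show "4 \<le> d" using t d by simp
      show "\<exists>l. nondeg w d 0 P l" using nondeg_degree_zero[OF nP] by simp
      show "\<exists>l. nondeg w (d - 2) 1 Z l" using conic[of 1] t by simp
      \<comment> \<open>For \<open>t = 2\<close> there is nothing to split: forms of degree
        \<open>2\<close> separate \<open>P\<close> already.\<close>
      show "\<exists>l. nondeg w (d - 4) 2 P l"
      proof (cases "2 < t")
        case True
        then show ?thesis using split[of 2, OF _ conic[OF True]] by simp
      next
        case False
        then show ?thesis using nondeg_large_degree[of 2] by simp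
      qed
      show "p v = 0" if "p \<in> hp 2" "\<And>v. v \<in> P \<Longrightarrow> p v = 0" for p v
        by (rule no_conic_through_points[OF fin dim that])
    qed
    then show ?thesis using 2 by simp
  qed
qed

text \<open>With \<open>t\<close> the index of the last nonzero entry of \<open>\<Delta>\<close>,
  the sums of the vectors starting with \<open>(1,2)\<close>, \<open>(1,2,2)\<close>,
  \<open>(1,2,3)\<close> and ending in ones are \<open>t + 2\<close>, \<open>t + 3\<close>,
  \<open>t + 4\<close>; those ending in twos give \<open>2 t + 1\<close> and \<open>2 t + 2\<close>.
  The other data are the Hilbert function in degree \<open>2\<close> and the two last entries as
  numbers of relations.\<close>

theorem exists_nondegenerate_form:
  assumes t: "2 \<le> t"
    and cases: "(hdim (t - 1) + 1 = card P \<and> hdim (t - 2) + 2 = card P \<and>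
        (card P = t + 2 \<or> card P = t + 3 \<or> (card P = t + 4 \<and> hdim 2 = 6)))
      \<or> (card P = 2 * t + 1 \<and> hdim 2 = 5)
      \<or> (card P = 2 * t + 2 \<and> hdim 2 = 6 \<and> hdim (t - 1) + 2 = card P \<and> hdim (t - 2) + 4 = card P)"
  shows "\<exists>l. \<forall>i. 2 * i \<le> d \<longrightarrow> nondeg w (d - 2 * i) i P l"
proof -
  have each: "\<exists>l. nondeg w (d - 2 * i) i P l" for i
  proof (cases "i < t")
    case True
    then show ?thesis
      using cases nondeg_tail_one[OF t] nondeg_points_on_conic[OF t] nondeg_conic_plus_one[OF t] by blast
  next
    case False
    then show ?thesis using nondeg_large_degree by simp
  qed
  have "generic (nondeg w (d - 2 * i) i P)" for i
  proof -
    obtain l where "nondeg w (d - 2 * i) i P l" using each[of i] by (rule exE)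
    then show ?thesis by (rule generic_nondeg[OF fin])
  qed
  then have "generic (\<lambda>l. \<forall>i\<in>{..d}. nondeg w (d - 2 * i) i P l)" by (intro generic_ball) simp_all
  then obtain l where l: "\<forall>i\<in>{..d}. nondeg w (d - 2 * i) i P l" unfolding generic_def by (elim conjE exE)
  show ?thesis
  proof (intro exI[of _ l] allI impI)
    fix i assume "2 * i \<le> d"
    then show "nondeg w (d - 2 * i) i P l" using bspec[OF l, of i] by simp
  qed
qed

end


subsection \<open>Maximal rank in terms of dimensions of function spaces\<close>

lemma finite_basis:
  fixes V :: "('a \<Rightarrow> 'k::field) set"
  assumes "V \<subseteq> fs.span C" "finite C"
  obtains B where "B \<subseteq> V" "finite B" "fs.independent B" "V \<subseteq> fs.span B" "card B = fs.dim V"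
proof -
  obtain B where B: "B \<subseteq> V" "fs.independent B" "V \<subseteq> fs.span B" "card B = fs.dim V"
    by (rule fs.basis_exists[of V], rule that)
  have "finite B" using fs.independent_span_bound[OF assms(2) B(2)] B(1) assms(1) by blast
  then show ?thesis using that B by blast
qed

text \<open>\<open>fs.dim\<close> is \<open>0\<close> on infinite-dimensional spaces; the finite
  spanning set \<open>C\<close> excludes this default.\<close>

lemma dim_mono_finite:
  fixes V W :: "('a \<Rightarrow> 'k::field) set"
  assumes "V \<subseteq> W" "W \<subseteq> fs.span C" "finite C"
  shows "fs.dim V \<le> fs.dim W"
proof -
  obtain B where B: "B \<subseteq> W" "finite B" "fs.independent B" "W \<subseteq> fs.span B" "card B = fs.dim W"
    by (rule finite_basis[OF assms(2,3)], rule that)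
  have "V \<subseteq> fs.span B" using assms(1) B(4) by blast
  then show ?thesis using fs.dim_le_card[of V B] B by simp
qed

text \<open>On \<open>U\<close> the map \<open>\<beta>\<close> factors through
  \<open>\<alpha>\<close>: preimages of a basis of the image of \<open>\<beta>\<close> stay
  independent under \<open>\<alpha>\<close>. All ranks below are compared through kernels in this
  way, without quotient spaces.\<close>

lemma dim_image_le_of_kernel:
  fixes \<alpha> :: "('a \<Rightarrow> 'k::field) \<Rightarrow> 'b \<Rightarrow> 'k" and \<beta> :: "('a \<Rightarrow> 'k) \<Rightarrow> 'c \<Rightarrow> 'k"
  assumes U: "fs.subspace U" and a: "Vector_Spaces.linear scl scl \<alpha>" and b: "Vector_Spaces.linear scl scl \<beta>"
    and ker: "\<And>f. f \<in> U \<Longrightarrow> \<alpha> f = 0 \<Longrightarrow> \<beta> f = 0"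
    and fa: "\<alpha> ` U \<subseteq> fs.span C" "finite C" and fb: "\<beta> ` U \<subseteq> fs.span C'" "finite C'"
  shows "fs.dim (\<beta> ` U) \<le> fs.dim (\<alpha> ` U)"
proof -
  interpret la: Vector_Spaces.linear scl scl \<alpha> by (rule a)
  interpret lb: Vector_Spaces.linear scl scl \<beta> by (rule b)
  obtain B where B: "B \<subseteq> \<beta> ` U" "finite B" "fs.independent B" "card B = fs.dim (\<beta> ` U)"
    by (rule finite_basis[OF fb], rule that)
  have "\<forall>y\<in>B. \<exists>f. f \<in> U \<and> \<beta> f = y" using B(1) by blast
  from bchoice[OF this] obtain s where s: "\<forall>y\<in>B. s y \<in> U \<and> \<beta> (s y) = y" by (elim exE)
  have comb: "c y = 0" if z: "(\<Sum>y\<in>B. scl (c y) (\<alpha> (s y))) = 0" and y: "y \<in> B" for c y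
  proof -
    define f where "f = (\<Sum>y\<in>B. scl (c y) (s y))"
    have "f \<in> U" unfolding f_def by (intro fs.subspace_sum fs.subspace_scale U) (use s in auto)
    moreover have "\<alpha> f = 0" using z by (simp add: f_def la.sum la.scale)
    ultimately have "\<beta> f = 0" by (rule ker)
    moreover have "\<beta> f = (\<Sum>y\<in>B. scl (c y) y)"
      unfolding f_def lb.sum lb.scale by (rule sum.cong) (use s in auto)
    ultimately have "(\<Sum>y\<in>B. scl (c y) y) = 0" by simp
    then show ?thesis using fs.independent_explicit_finite_subsets[of B] B(2,3) y by blast
  qed
  have inj: "inj_on (\<lambda>y. \<alpha> (s y)) B"
  proof (rule inj_onI)
    fix y z assume yz: "y \<in> B" "z \<in> B" "\<alpha> (s y) = \<alpha> (s z)"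
    have "s y - s z \<in> U" using s yz U by (intro fs.subspace_diff) auto
    moreover have "\<alpha> (s y - s z) = 0" using yz(3) by (simp add: la.diff)
    ultimately have "\<beta> (s y - s z) = 0" by (rule ker)
    then show "y = z" using s yz by (simp add: lb.diff)
  qed
  have ind: "fs.independent ((\<lambda>y. \<alpha> (s y)) ` B)"
  proof (rule fs.independent_if_scalars_zero)
    show "finite ((\<lambda>y. \<alpha> (s y)) ` B)" using B(2) by simp
    fix c x assume c: "(\<Sum>x\<in>(\<lambda>y. \<alpha> (s y)) ` B. scl (c x) x) = 0" and x: "x \<in> (\<lambda>y. \<alpha> (s y)) ` B"
    obtain y where y: "y \<in> B" "x = \<alpha> (s y)" using x by blast
    have "(\<Sum>y\<in>B. scl (c (\<alpha> (s y))) (\<alpha> (s y))) = 0" using c by (simp add: sum.reindex[OF inj])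
    from comb[OF this y(1)] show "c x = 0" by (simp add: y(2))
  qed
  obtain A where A: "finite A" "\<alpha> ` U \<subseteq> fs.span A" "card A = fs.dim (\<alpha> ` U)"
    by (rule finite_basis[OF fa], rule that)
  have "(\<lambda>y. \<alpha> (s y)) ` B \<subseteq> \<alpha> ` U" using s by blast
  then have sub: "(\<lambda>y. \<alpha> (s y)) ` B \<subseteq> fs.span A" using A(2) by (rule subset_trans)
  have "card ((\<lambda>y. \<alpha> (s y)) ` B) \<le> card A" using fs.independent_span_bound[OF A(1) ind sub] by (rule conjunct2)
  then show ?thesis using A(3) B(4) card_image[OF inj] by simp
qed

lemma linear_res: "Vector_Spaces.linear scl scl (res P :: ('a \<Rightarrow> 'k::field) \<Rightarrow> 'a \<Rightarrow> 'k)"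
  unfolding Vector_Spaces.linear_iff by (intro conjI fs.vector_space_axioms) (auto simp: res_def fun_eq_iff)

lemma res_span:
  assumes "finite P"
  shows "res P ` U \<subseteq> fs.span ((\<lambda>p x. if x = p then 1 else (0::'k::field)) ` P)"
proof
  fix h assume "h \<in> res P ` U"
  then obtain f where f: "h = res P f" by blast
  have "h = (\<Sum>p\<in>P. scl (f p) (\<lambda>x. if x = p then 1 else 0))"
  proof
    fix x
    have "(\<Sum>p\<in>P. f p * (if x = p then 1 else 0)) = (\<Sum>p\<in>P. if x = p then f x else 0)" by (rule sum.cong) auto
    then show "h x = (\<Sum>p\<in>P. scl (f p) (\<lambda>x. if x = p then 1 else 0)) x"
      using assms by (simp add: f res_def sum_fun_apply)
  qed
  also have "\<dots> \<in> fs.span ((\<lambda>p x. if x = p then 1 else (0::'k)) ` P)"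
    by (intro fs.span_sum fs.span_scale fs.span_base) auto
  finally show "h \<in> fs.span ((\<lambda>p x. if x = p then 1 else (0::'k)) ` P)" .
qed

locale point_functional =
  fixes P :: "(3 \<Rightarrow> 'k::field_char_0) set" and w :: "(3 \<Rightarrow> 'k) \<Rightarrow> 'k" and d :: nat
  assumes fin: "finite P"
begin

text \<open>The class of a form \<open>f\<close> of degree \<open>n\<close> in \<open>S / Ann F\<close> is determined by the functional
  \<open>g \<mapsto> (f g) \<circ> F\<close> on forms of degree \<open>d - n\<close>.\<close>

definition functional :: "nat \<Rightarrow> ((3 \<Rightarrow> 'k) \<Rightarrow> 'k) \<Rightarrow> ((3 \<Rightarrow> 'k) \<Rightarrow> 'k) \<Rightarrow> 'k"
  where "functional n f = (\<lambda>g. if n \<le> d \<and> g \<in> hp (d - n) then \<Sum>v\<in>P. w v * f v * g v else 0)"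

definition times_power :: "(3 \<Rightarrow> 'k) \<Rightarrow> nat \<Rightarrow> ((3 \<Rightarrow> 'k) \<Rightarrow> 'k) \<Rightarrow> (3 \<Rightarrow> 'k) \<Rightarrow> 'k"
  where "times_power l j f = (\<lambda>v. dot l v ^ j * f v)"

lemma linear_functional: "Vector_Spaces.linear scl scl (functional n)"
  unfolding Vector_Spaces.linear_iff
  by (intro conjI fs.vector_space_axioms)
    (auto simp: functional_def fun_eq_iff sum.distrib sum_distrib_left algebra_simps)

lemma linear_functional_times: "Vector_Spaces.linear scl scl (\<lambda>f. functional n (times_power l j f))"
  unfolding Vector_Spaces.linear_iff
  by (intro conjI fs.vector_space_axioms)
    (auto simp: functional_def times_power_def fun_eq_iff sum.distrib sum_distrib_left algebra_simps)

lemma functional_zero_iff: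
  "functional n f = 0 \<longleftrightarrow> (n \<le> d \<longrightarrow> (\<forall>g\<in>hp (d - n). (\<Sum>v\<in>P. w v * f v * g v) = 0))"
  by (auto simp: functional_def fun_eq_iff)

lemma functional_span:
  obtains C where "finite C" "\<And>U. functional n ` U \<subseteq> fs.span C"
proof (rule that)
  define c where "c v = (\<lambda>g. if n \<le> d \<and> g \<in> hp (d - n) then w v * g v else 0)" for v
  show "finite (c ` P)" using fin by simp
  fix U
  show "functional n ` U \<subseteq> fs.span (c ` P)"
  proof
    fix h assume "h \<in> functional n ` U"
    then obtain f where f: "h = functional n f" by blast
    have "h = (\<Sum>v\<in>P. scl (f v) (c v))"
      by (auto simp: f functional_def c_def fun_eq_iff sum_fun_apply mult_ac)
    also have "\<dots> \<in> fs.span (c ` P)" by (intro fs.span_sum fs.span_scale fs.span_base) auto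
    finally show "h \<in> fs.span (c ` P)" .
  qed
qed

abbreviation adim :: "nat \<Rightarrow> nat"
  where "adim n \<equiv> fs.dim (functional n ` hp n)"

abbreviation mdim :: "(3 \<Rightarrow> 'k) \<Rightarrow> nat \<Rightarrow> nat \<Rightarrow> nat"
  where "mdim l i j \<equiv> fs.dim (functional (i + j) ` times_power l j ` hp i)"

lemma times_power_hp: "f \<in> hp i \<Longrightarrow> times_power l j f \<in> hp (i + j)"
  using hp_times[OF hp_dot_power[of l j], of f i] by (simp add: times_power_def add.commute)

lemma functional_times_zero:
  assumes "functional i f = 0"
  shows "functional (i + j) (times_power l j f) = 0"
  unfolding functional_zero_iff
proof (intro impI ballI)
  fix g :: "(3 \<Rightarrow> 'k) \<Rightarrow> 'k" assume ij: "i + j \<le> d" and g: "g \<in> hp (d - (i + j))"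
  have "times_power l j g \<in> hp (d - (i + j) + j)" by (rule times_power_hp[OF g])
  then have "times_power l j g \<in> hp (d - i)" using ij by simp
  then have "(\<Sum>v\<in>P. w v * f v * times_power l j g v) = 0" using assms ij unfolding functional_zero_iff by simp
  then show "(\<Sum>v\<in>P. w v * times_power l j f v * g v) = 0" by (simp add: times_power_def mult_ac)
qed

lemma mdim_le_source: "mdim l i j \<le> adim i"
proof -
  obtain C where C: "finite C" "\<And>U. functional i ` U \<subseteq> fs.span C" by (rule functional_span[of i], rule that)
  obtain C' where C': "finite C'" "\<And>U. functional (i + j) ` U \<subseteq> fs.span C'" by (rule functional_span[of "i + j"], rule that)
  have "fs.dim ((\<lambda>f. functional (i + j) (times_power l j f)) ` hp i) \<le> fs.dim (functional i ` hp i)"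
    by (rule dim_image_le_of_kernel[OF hp_subspace linear_functional linear_functional_times _ C(2,1) _ C'(1)])
      (use functional_times_zero C'(2) in \<open>auto simp: image_image[symmetric, of "functional (i + j)" "times_power l j"]\<close>)
  then show ?thesis by (simp add: image_image)
qed

lemma mdim_le_target: "mdim l i j \<le> adim (i + j)"
proof -
  obtain C where C: "finite C" "\<And>U. functional (i + j) ` U \<subseteq> fs.span C" by (rule functional_span[of "i + j"], rule that)
  show ?thesis by (rule dim_mono_finite[OF _ C(2) C(1)]) (use times_power_hp in blast)
qed

text \<open>If \<open>l^j f\<close> pairs to zero with everything, it does so with
  \<open>l^(d - 2 i - j) g\<close>; the product is the form of \<open>nondeg\<close>, so
  \<open>f\<close> vanishes on \<open>P\<close>.\<close>

lemma mdim_injective: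
  assumes nd: "nondeg w (d - 2 * i) i P l" and ij: "2 * i + j \<le> d"
  shows "mdim l i j = adim i"
proof (rule antisym[OF mdim_le_source])
  obtain C where C: "finite C" "\<And>U. functional i ` U \<subseteq> fs.span C" by (rule functional_span[of i], rule that)
  obtain C' where C': "finite C'" "\<And>U. functional (i + j) ` U \<subseteq> fs.span C'" by (rule functional_span[of "i + j"], rule that)
  have ker: "functional i f = 0" if f: "f \<in> hp i" "functional (i + j) (times_power l j f) = 0" for f
  proof -
    have "(\<Sum>v\<in>P. w v * dot l v ^ (d - 2 * i) * f v * g v) = 0" if g: "g \<in> hp i" for g
    proof -
      have "times_power l (d - 2 * i - j) g \<in> hp (i + (d - 2 * i - j))" by (rule times_power_hp[OF g])
      then have "times_power l (d - 2 * i - j) g \<in> hp (d - (i + j))" using ij by (simp add: algebra_simps)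
      then have "(\<Sum>v\<in>P. w v * times_power l j f v * times_power l (d - 2 * i - j) g v) = 0"
        using f(2) ij unfolding functional_zero_iff by simp
      moreover have "dot l v ^ (d - 2 * i) = dot l v ^ j * dot l v ^ (d - 2 * i - j)" for v
        using ij by (simp add: power_add[symmetric])
      ultimately show ?thesis by (simp add: times_power_def mult_ac)
    qed
    then have "\<forall>v\<in>P. f v = 0" using nd f(1) unfolding nondeg_def by blast
    then show ?thesis unfolding functional_zero_iff by simp
  qed
  have "fs.dim (functional i ` hp i) \<le> fs.dim ((\<lambda>f. functional (i + j) (times_power l j f)) ` hp i)"
    by (rule dim_image_le_of_kernel[OF hp_subspace linear_functional_times linear_functional ker _ C'(1) C(2,1)])
      (use C'(2) in \<open>auto simp: image_image[symmetric, of "functional (i + j)" "times_power l j"]\<close>)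
  then show "adim i \<le> mdim l i j" by (simp add: image_image)
qed

text \<open>The pairing between degrees \<open>n\<close> and \<open>d - n\<close> is perfect: an
  element of degree \<open>d - n\<close> is determined by its pairings with representatives of a
  basis in degree \<open>n\<close>.\<close>

lemma adim_duality:
  assumes "n \<le> d"
  shows "adim (d - n) \<le> adim n"
proof -
  obtain C where C: "finite C" "\<And>U. functional n ` U \<subseteq> fs.span C" by (rule functional_span[of n], rule that)
  obtain C' where C': "finite C'" "\<And>U. functional (d - n) ` U \<subseteq> fs.span C'" by (rule functional_span[of "d - n"], rule that)
  obtain B where B: "B \<subseteq> functional n ` hp n" "finite B" "functional n ` hp n \<subseteq> fs.span B" "card B = adim n"
    by (rule finite_basis[OF C(2) C(1), of "hp n"], rule that)
  define s where "s h = (SOME g. g \<in> hp n \<and> functional n g = h)" for h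
  define \<alpha> where "\<alpha> f = (\<lambda>h. if h \<in> B then \<Sum>v\<in>P. w v * f v * s h v else 0)" for f :: "(3 \<Rightarrow> 'k) \<Rightarrow> 'k"
  have s: "s h \<in> hp n" "functional n (s h) = h" if "h \<in> B" for h
  proof -
    have "\<exists>g. g \<in> hp n \<and> functional n g = h" using B(1) that by blast
    from someI_ex[OF this] show "s h \<in> hp n" "functional n (s h) = h" unfolding s_def by blast+
  qed
  have lin: "Vector_Spaces.linear scl scl \<alpha>"
    unfolding Vector_Spaces.linear_iff by (intro conjI fs.vector_space_axioms)
      (auto simp: \<alpha>_def fun_eq_iff sum.distrib sum_distrib_left algebra_simps)
  have spanB: "\<alpha> ` U \<subseteq> fs.span ((\<lambda>p x. if x = p then 1 else 0) ` B)" for U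
  proof -
    have "\<alpha> f = res B (\<alpha> f)" for f by (simp add: \<alpha>_def res_def fun_eq_iff)
    then have "\<alpha> ` U \<subseteq> res B ` (\<alpha> ` U)" by blast
    then show ?thesis using res_span[OF B(2), of "\<alpha> ` U"] by blast
  qed
  have finB: "finite ((\<lambda>p x. if x = p then 1 else (0::'k)) ` B)" using B(2) by simp
  have ker: "functional (d - n) f = 0" if f: "f \<in> hp (d - n)" "\<alpha> f = 0" for f
  proof -
    have evB: "h f = 0" if "h \<in> B" for h
    proof -
      have "h f = functional n (s h) f" using s[OF that] by simp
      also have "\<dots> = (\<Sum>v\<in>P. w v * f v * s h v)" using f(1) assms by (simp add: functional_def mult_ac)
      also have "\<dots> = 0" using fun_cong[OF f(2), of h] that by (simp add: \<alpha>_def)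
      finally show ?thesis .
    qed
    have "h f = 0" if "h \<in> fs.span B" for h
      using that by (induction rule: fs.span_induct_alt) (auto simp: evB)
    then have *: "functional n g f = 0" if "g \<in> hp n" for g using B(3) that by blast
    show ?thesis unfolding functional_zero_iff
    proof (intro impI ballI)
      fix g :: "(3 \<Rightarrow> 'k) \<Rightarrow> 'k" assume "g \<in> hp (d - (d - n))"
      then have g: "g \<in> hp n" using assms by simp
      show "(\<Sum>v\<in>P. w v * f v * g v) = 0" using *[OF g] f(1) assms by (simp add: functional_def mult_ac)
    qed
  qed
  have "adim (d - n) \<le> fs.dim (\<alpha> ` hp (d - n))"
    by (rule dim_image_le_of_kernel[OF hp_subspace lin linear_functional ker spanB finB C'(2) C'(1)])
  also have "\<dots> \<le> card ((\<lambda>p x. if x = p then 1 else (0::'k)) ` B)"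
    by (rule fs.dim_le_card[OF spanB]) (use B(2) in simp)
  also have "\<dots> \<le> card B" by (rule card_image_le[OF B(2)])
  finally show ?thesis using B(4) by simp
qed

text \<open>Below the middle, nondegeneracy gives injectivity. Beyond it, the map is onto because
  already its precomposition with a power of \<open>l\<close> starting in the dual degree is; for
  \<open>i + j > d\<close> the target is zero.\<close>

theorem maximal_rank:
  assumes nd: "\<And>i. 2 * i \<le> d \<Longrightarrow> nondeg w (d - 2 * i) i P l"
  shows "mdim l i j = min (adim i) (adim (i + j))"
proof -
  consider "2 * i + j \<le> d" | "d < 2 * i + j" "i + j \<le> d" | "d < i + j" by linarith
  then show ?thesis
  proof cases
    case 1
    then have "mdim l i j = adim i" using mdim_injective[OF nd] by simp
    then show ?thesis using mdim_le_target[of i j l] by simp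
  next
    case 2
    \<comment> \<open>The degree dual to the target. Multiplication by \<open>l^(k + j)\<close> from
      there is injective between spaces of equal dimension and passes through degree
      \<open>i\<close>.\<close>
    define i' where "i' = d - (i + j)"
    define k where "k = i - i'"
    have ik: "i = i' + k" "2 * i' + (k + j) = d" "i' + (k + j) = i + j" "2 * i' \<le> d"
      using 2 by (auto simp: i'_def k_def)
    obtain C where C: "finite C" "\<And>U. functional (i + j) ` U \<subseteq> fs.span C" by (rule functional_span[of "i + j"], rule that)
    have "adim (i + j) \<le> adim i'" using adim_duality[of i'] 2 by (simp add: i'_def)
    also have "\<dots> = mdim l i' (k + j)" using mdim_injective[OF nd[OF ik(4)], of "k + j"] ik(2) by simp
    also have "\<dots> \<le> mdim l i j"
    proof -
      have "times_power l (k + j) f \<in> times_power l j ` hp i" if "f \<in> hp i'" for f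
      proof (rule image_eqI)
        show "times_power l (k + j) f = times_power l j (times_power l k f)"
          by (simp add: times_power_def power_add mult_ac fun_eq_iff)
        show "times_power l k f \<in> hp i" unfolding ik(1) by (rule times_power_hp[OF that])
      qed
      then have "functional (i' + (k + j)) ` times_power l (k + j) ` hp i' \<subseteq> functional (i + j) ` times_power l j ` hp i"
        unfolding ik(3) by blast
      then show ?thesis by (rule dim_mono_finite[OF _ C(2) C(1)])
    qed
    finally show ?thesis using mdim_le_source[of i j l] mdim_le_target[of i j l] by simp
  next
    case 3
    have "functional (i + j) f = 0" for f using 3 by (simp add: functional_zero_iff)
    then have sub: "functional (i + j) ` U \<subseteq> fs.span {}" for U by (auto simp: fs.span_empty)
    have "fs.dim (functional (i + j) ` U) = 0" for U using fs.dim_le_card[OF sub] by simp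
    then show ?thesis by simp
  qed
qed

text \<open>Since forms of degree \<open>d - i\<close> separate the points and no weight vanishes,
  the functional of \<open>f\<close> determines the values of \<open>f\<close> on \<open>P\<close>.
  In such degrees the algebra has the Hilbert function of the point set.\<close>

lemma adim_eq_hdim:
  assumes sep: "separates (d - i) P" and i: "i \<le> d" and w: "\<And>v. v \<in> P \<Longrightarrow> w v \<noteq> 0"
  shows "adim i = fs.dim (res P ` hp i)"
proof -
  obtain C where C: "finite C" "\<And>U. functional i ` U \<subseteq> fs.span C" by (rule functional_span[of i], rule that)
  have eq: "functional i f = 0 \<longleftrightarrow> res P f = 0" for f
  proof
    assume "functional i f = 0"
    then have "\<forall>g\<in>hp (d - i). (\<Sum>v\<in>P. (w v * f v) * g v) = 0" using i by (simp add: functional_zero_iff)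
    then have "\<forall>v\<in>P. w v * f v = 0" by (intro relation_on_separated[OF sep fin]) auto
    then show "res P f = 0" using w by (auto simp: res_def fun_eq_iff)
  next
    assume "res P f = 0"
    then have "\<forall>v\<in>P. f v = 0" by (auto simp: res_def fun_eq_iff split: if_splits)
    then show "functional i f = 0" by (simp add: functional_zero_iff)
  qed
  have fP: "finite ((\<lambda>p x. if x = p then 1 else (0::'k)) ` P)" using fin by simp
  show ?thesis
  proof (rule antisym)
    show "adim i \<le> fs.dim (res P ` hp i)"
      by (rule dim_image_le_of_kernel[OF hp_subspace linear_res linear_functional _ res_span[OF fin] fP C(2) C(1)])
        (simp only: eq)
    show "fs.dim (res P ` hp i) \<le> adim i"
      by (rule dim_image_le_of_kernel[OF hp_subspace linear_functional linear_res _ C(2) C(1) res_span[OF fin] fP])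
        (simp only: eq)
  qed
qed

end


subsection \<open>Polynomials, evaluation and differentiation\<close>

lemma poly_sum_of_terms: "f = (\<Sum>a\<in>Poly_Mapping.keys f. Poly_Mapping.single a (Poly_Mapping.lookup f a))"
proof (rule poly_mapping_eqI)
  fix b
  have "(\<Sum>a\<in>Poly_Mapping.keys f. Poly_Mapping.lookup (Poly_Mapping.single a (Poly_Mapping.lookup f a)) b)
    = (\<Sum>a\<in>Poly_Mapping.keys f. if a = b then Poly_Mapping.lookup f a else 0)"
    by (rule sum.cong) (auto simp: lookup_single when_def)
  then show "Poly_Mapping.lookup f b = Poly_Mapping.lookup (\<Sum>a\<in>Poly_Mapping.keys f. Poly_Mapping.single a (Poly_Mapping.lookup f a)) b"
    by (simp add: lookup_sum in_keys_iff)
qed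

lemma poly_induct_on:
  fixes f :: "'a \<Rightarrow>\<^sub>0 'b::comm_monoid_add"
  assumes keys: "\<And>a. a \<in> Poly_Mapping.keys f \<Longrightarrow> Q a" and zero: "P 0"
    and single: "\<And>a c. Q a \<Longrightarrow> P (Poly_Mapping.single a c)" and add: "\<And>f g. P f \<Longrightarrow> P g \<Longrightarrow> P (f + g)"
  shows "P f"
proof -
  have "P (\<Sum>a\<in>A. Poly_Mapping.single a (Poly_Mapping.lookup f a))" if "finite A" "\<forall>a\<in>A. Q a" for A
    using that by (induction A rule: finite_induct) (auto intro: zero single add)
  then show ?thesis using keys by (subst poly_sum_of_terms) auto
qed

lemma poly_induct [case_names zero single add]:
  fixes f :: "'a \<Rightarrow>\<^sub>0 'b::comm_monoid_add"
  assumes "P 0" "\<And>a c. P (Poly_Mapping.single a c)" "\<And>f g. P f \<Longrightarrow> P g \<Longrightarrow> P (f + g)"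
  shows "P f"
  by (rule poly_induct_on[where Q = "\<lambda>_. True"]) (use assms in auto)

definition expo_eval :: "expo \<Rightarrow> (3 \<Rightarrow> 'k::field) \<Rightarrow> 'k"
  where "expo_eval a v = (\<Prod>i\<in>UNIV. v i ^ Poly_Mapping.lookup a i)"

lemma expo_eval_zero [simp]: "expo_eval 0 v = 1" by (simp add: expo_eval_def)

lemma expo_eval_add: "expo_eval (a + b) v = expo_eval a v * expo_eval b v"
  by (simp add: expo_eval_def lookup_add power_add prod.distrib)

lemma eval_poly_superset:
  assumes "finite A" "Poly_Mapping.keys f \<subseteq> A"
  shows "eval_poly f v = (\<Sum>a\<in>A. Poly_Mapping.lookup f a * expo_eval a v)"
  unfolding eval_poly_def expo_eval_def using assms by (intro sum.mono_neutral_left) (auto simp: in_keys_iff)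

lemma eval_poly_add: "eval_poly (f + g) v = eval_poly f v + eval_poly g v"
proof -
  let ?A = "Poly_Mapping.keys f \<union> Poly_Mapping.keys g"
  have "eval_poly h v = (\<Sum>a\<in>?A. Poly_Mapping.lookup h a * expo_eval a v)" if "h \<in> {f, g, f + g}" for h
    by (rule eval_poly_superset) (use that keys_add[of f g] in auto)
  then show ?thesis by (simp add: lookup_add distrib_right sum.distrib)
qed

lemma eval_poly_single: "eval_poly (Poly_Mapping.single a c) v = c * expo_eval a v"
  by (subst eval_poly_superset[of "{a}"]) auto

lemma eval_poly_zero [simp]: "eval_poly 0 v = 0" by (simp add: eval_poly_def)

lemma eval_poly_times: "eval_poly (f * g) v = eval_poly f v * eval_poly g v"
proof (induction f rule: poly_induct)
  case (single a c)
  show ?case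
    by (induction g rule: poly_induct) (simp_all add: eval_poly_single mult_single expo_eval_add eval_poly_add algebra_simps)
qed (simp_all add: eval_poly_add algebra_simps)

lemma eval_poly_const [simp]: "eval_poly (const c) v = c"
  by (simp add: const_def eval_poly_single)

lemma eval_poly_one [simp]: "eval_poly 1 v = 1"
  using eval_poly_single[of 0 1 v] by simp

lemma eval_poly_power: "eval_poly (f ^ n) v = eval_poly f v ^ n"
  by (induction n) (simp_all add: eval_poly_times)

lemma expo_eval_unit: "expo_eval (Poly_Mapping.single i 1) v = v i"
proof -
  have "expo_eval (Poly_Mapping.single i 1) v = (\<Prod>j\<in>UNIV. if j = i then v j else 1)"
    unfolding expo_eval_def by (rule prod.cong) (auto simp: lookup_single when_def)
  then show ?thesis by simp
qed

lemma eval_poly_var [simp]: "eval_poly (var i) v = v i"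
  unfolding var_def by (simp only: eval_poly_single expo_eval_unit mult_1)

lemma eval_poly_dual [simp]: "eval_poly (dual_linear_form a) v = dot a v"
  by (simp add: dual_linear_form_def sum_UNIV_3 eval_poly_add eval_poly_times dot_eq)

lemma const_add: "const (a + b) = const a + const b" by (simp add: const_def single_add)

lemma const_uminus: "const (- a) = - const a" by (simp add: const_def single_uminus)

lemma const_mult: "const (a * b) = const a * const b" by (simp add: const_def mult_single)

lemma const_zero [simp]: "const 0 = 0" by (simp add: const_def)

lemma const_one [simp]: "const 1 = 1" by (simp add: const_def)

lemma const_sum: "const (\<Sum>i\<in>A. f i) = (\<Sum>i\<in>A. const (f i))"
  by (induction A rule: infinite_finite_induct) (simp_all add: const_add)

lemma const_eq_zero: "const c = 0 \<Longrightarrow> c = 0"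
  using eval_poly_const[of c "\<lambda>_. 0"] by simp

lemma expo_deg_add: "expo_deg (a + b) = expo_deg a + expo_deg b"
  by (simp add: expo_deg_def lookup_add sum.distrib)

lemma expo_deg_eq: "expo_deg a = Poly_Mapping.lookup a 0 + Poly_Mapping.lookup a 1 + Poly_Mapping.lookup a 2"
  by (simp add: expo_deg_def sum_UNIV_3)

lemma expo_deg_unit: "expo_deg (Poly_Mapping.single i 1) = 1"
proof -
  have "expo_deg (Poly_Mapping.single i 1) = (\<Sum>j\<in>UNIV. if j = i then 1 else 0)"
    unfolding expo_deg_def by (rule sum.cong) (auto simp: lookup_single when_def)
  then show ?thesis by simp
qed

lemma forms_zero [simp]: "0 \<in> forms n" by (simp add: forms_def)

lemma forms_add: "f \<in> forms n \<Longrightarrow> g \<in> forms n \<Longrightarrow> f + g \<in> forms n"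
  using keys_add[of f g] by (auto simp: forms_def)

lemma forms_sum: "(\<And>i. i \<in> A \<Longrightarrow> f i \<in> forms n) \<Longrightarrow> (\<Sum>i\<in>A. f i) \<in> forms n"
  by (induction A rule: infinite_finite_induct) (auto intro: forms_add)

lemma forms_single: "expo_deg a = n \<Longrightarrow> Poly_Mapping.single a c \<in> forms n"
  by (auto simp: forms_def split: if_splits)

lemma forms_times: "f \<in> forms m \<Longrightarrow> g \<in> forms n \<Longrightarrow> f * g \<in> forms (m + n)"
  using keys_mult[of f g] by (force simp: forms_def expo_deg_add)

lemma forms_const: "const c \<in> forms 0"
  unfolding const_def by (rule forms_single) (simp add: expo_deg_def)

lemma forms_scale: "f \<in> forms n \<Longrightarrow> const c * f \<in> forms n"
  using forms_times[OF forms_const] by fastforce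

lemma forms_var: "var i \<in> forms 1"
  unfolding var_def by (rule forms_single[OF expo_deg_unit])

lemma forms_dual: "dual_linear_form a \<in> forms 1"
  unfolding dual_linear_form_def by (intro forms_sum forms_scale forms_var)

lemma forms_power: "f \<in> forms m \<Longrightarrow> f ^ n \<in> forms (m * n)"
proof (induction n)
  case 0
  then show ?case using forms_const[of 1] by simp
next
  case (Suc n)
  then show ?case using forms_times[of f m "f ^ n" "m * n"] by simp
qed

lemma forms_dual_power: "dual_linear_form a ^ n \<in> forms n"
  using forms_power[OF forms_dual, of a n] by simp

lemma forms_induct [consumes 1, case_names zero single add]:
  assumes "f \<in> forms n" and "P 0" and "\<And>a c. expo_deg a = n \<Longrightarrow> P (Poly_Mapping.single a c)"
    and "\<And>f g. P f \<Longrightarrow> P g \<Longrightarrow> P (f + g)"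
  shows "P f"
  by (rule poly_induct_on[where Q = "\<lambda>a. expo_deg a = n"]) (use assms in \<open>auto simp: forms_def\<close>)

lemma expo_eval_hp: "(expo_eval a :: (3 \<Rightarrow> 'k::field) \<Rightarrow> 'k) \<in> hp (expo_deg a)"
proof -
  have c: "(\<lambda>v. v i ^ n :: 'k) \<in> hp n" for i :: 3 and n
  proof -
    define e :: "3 \<Rightarrow> 'k" where "e j = (if j = i then 1 else 0)" for j
    have "dot e v = v i" for v
    proof -
      have "dot e v = (\<Sum>j\<in>UNIV. if j = i then v j else 0)"
        unfolding dot_def e_def by (rule sum.cong) auto
      then show ?thesis by simp
    qed
    then show ?thesis using hp_dot_power[of e n] by simp
  qed
  have "(\<lambda>v. v 0 ^ Poly_Mapping.lookup a 0 * v 1 ^ Poly_Mapping.lookup a 1 * v 2 ^ Poly_Mapping.lookup a 2 :: 'k) \<in> hp (expo_deg a)"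
    unfolding expo_deg_eq by (intro hp_times c)
  moreover have "expo_eval a = (\<lambda>v :: 3 \<Rightarrow> 'k. v 0 ^ Poly_Mapping.lookup a 0 * v 1 ^ Poly_Mapping.lookup a 1 * v 2 ^ Poly_Mapping.lookup a 2)"
    by (rule ext) (simp add: expo_eval_def prod_UNIV_3)
  ultimately show ?thesis by (simp only:)
qed

lemma eval_poly_hp: "(f :: 'k::field poly3) \<in> forms n \<Longrightarrow> eval_poly f \<in> hp n"
proof (induction rule: forms_induct)
  case zero
  have "eval_poly (0 :: 'k poly3) = (\<lambda>v. 0)" by (rule ext) simp
  then show ?case using hp_zero by simp
next
  case (single a c)
  have "eval_poly (Poly_Mapping.single a c) = (\<lambda>v. c * expo_eval a v)" by (rule ext) (rule eval_poly_single)
  then show ?case using hp_scale[OF expo_eval_hp, of c a] single by simp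
next
  case (add f g)
  have "eval_poly (f + g) = (\<lambda>v. eval_poly f v + eval_poly g v)" by (rule ext) (rule eval_poly_add)
  then show ?case using hp_add add by simp
qed

lemma hp_eval_poly: "g \<in> hp n \<Longrightarrow> \<exists>f\<in>forms n. g = eval_poly f"
proof (induction n arbitrary: g)
  case 0
  then obtain c where "g = (\<lambda>v. c)" by auto
  then show ?case by (intro bexI[OF _ forms_const[of c]]) auto
next
  case (Suc n)
  obtain g0 g1 g2 where g: "g0 \<in> hp n" "g1 \<in> hp n" "g2 \<in> hp n" "g = (\<lambda>v. v 0 * g0 v + v 1 * g1 v + v 2 * g2 v)"
    using Suc.prems by auto
  from Suc.IH[OF g(1)] Suc.IH[OF g(2)] Suc.IH[OF g(3)] obtain f0 f1 f2 where
    f: "f0 \<in> forms n" "f1 \<in> forms n" "f2 \<in> forms n" "g0 = eval_poly f0" "g1 = eval_poly f1" "g2 = eval_poly f2"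
    by (elim bexE) (rule that)
  have "var 0 * f0 + var 1 * f1 + var 2 * f2 \<in> forms (Suc n)"
    using forms_times[OF forms_var] f(1-3) by (intro forms_add) fastforce+
  moreover have "g = eval_poly (var 0 * f0 + var 1 * f1 + var 2 * f2)"
    by (rule ext) (simp add: g(4) f(4-6) eval_poly_add eval_poly_times)
  ultimately show ?case by blast
qed

lemma eval_forms: "eval_poly ` forms n = hp n"
  using eval_poly_hp hp_eval_poly by blast

lemma eval_poly_homogeneous: "f \<in> forms n \<Longrightarrow> eval_poly f (\<lambda>i. c * v i) = c ^ n * eval_poly f v"
  using hp_homogeneous[OF eval_poly_hp, of f n c v] by (simp add: scl_def)

lemma partial_deriv_superset:
  assumes "finite A" "Poly_Mapping.keys f \<subseteq> A"
  shows "partial_deriv i f = (\<Sum>a\<in>A. Poly_Mapping.single (a - Poly_Mapping.single i 1)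
    (of_nat (Poly_Mapping.lookup a i) * Poly_Mapping.lookup f a))"
  unfolding partial_deriv_def using assms by (intro sum.mono_neutral_left) (auto simp: in_keys_iff)

lemma partial_deriv_add: "partial_deriv i (f + g) = partial_deriv i f + partial_deriv i g"
proof -
  let ?A = "Poly_Mapping.keys f \<union> Poly_Mapping.keys g"
  have "partial_deriv i h = (\<Sum>a\<in>?A. Poly_Mapping.single (a - Poly_Mapping.single i 1)
    (of_nat (Poly_Mapping.lookup a i) * Poly_Mapping.lookup h a))" if "h \<in> {f, g, f + g}" for h
    by (rule partial_deriv_superset) (use that keys_add[of f g] in auto)
  then show ?thesis by (simp add: lookup_add distrib_left single_add sum.distrib)
qed

lemma partial_deriv_zero [simp]: "partial_deriv i 0 = 0" by (simp add: partial_deriv_def)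

lemma partial_deriv_sum: "partial_deriv i (\<Sum>x\<in>A. f x) = (\<Sum>x\<in>A. partial_deriv i (f x))"
  by (induction A rule: infinite_finite_induct) (simp_all add: partial_deriv_add)

lemma partial_deriv_single:
  "partial_deriv i (Poly_Mapping.single a c) = Poly_Mapping.single (a - Poly_Mapping.single i 1) (of_nat (Poly_Mapping.lookup a i) * c)"
  by (subst partial_deriv_superset[of "{a}"]) auto

lemma minus_unit_add:
  fixes a b :: expo
  assumes "Poly_Mapping.lookup a i > 0"
  shows "(a + b) - Poly_Mapping.single i 1 = (a - Poly_Mapping.single i 1) + b"
  by (rule poly_mapping_eqI) (use assms in \<open>auto simp: lookup_add lookup_minus lookup_single when_def\<close>)

lemma partial_deriv_times: "partial_deriv i (f * g) = partial_deriv i f * g + f * partial_deriv i g"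
proof (induction f rule: poly_induct)
  case (single a c)
  show ?case
  proof (induction g rule: poly_induct)
    case (single b e)
    let ?u = "Poly_Mapping.single i (1::nat)" and ?m = "Poly_Mapping.lookup a i" and ?n = "Poly_Mapping.lookup b i"
    \<comment> \<open>For \<open>?m = 0\<close> the subtraction of exponents truncates, but then the
      coefficient is zero; likewise for \<open>?n\<close> below.\<close>
    have "Poly_Mapping.single (a + b - ?u) (of_nat ?m * c * e) = Poly_Mapping.single (a - ?u + b) (of_nat ?m * c * e)"
      using minus_unit_add[of a i b] by (cases "?m = 0") auto
    moreover have "Poly_Mapping.single (a + b - ?u) (c * (of_nat ?n * e)) = Poly_Mapping.single (a + (b - ?u)) (c * (of_nat ?n * e))"
      using minus_unit_add[of b i a] by (cases "?n = 0") (auto simp: add.commute)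
    moreover have "of_nat (?m + ?n) * (c * e) = of_nat ?m * c * e + c * (of_nat ?n * e)" by (simp add: algebra_simps)
    ultimately show ?case by (simp add: mult_single partial_deriv_single lookup_add single_add)
  qed (simp_all add: partial_deriv_add algebra_simps)
qed (simp_all add: partial_deriv_add algebra_simps)

lemma partial_deriv_const [simp]: "partial_deriv i (const c) = 0"
  by (simp add: const_def partial_deriv_single)

lemma partial_deriv_var: "partial_deriv i (var j) = (if i = j then 1 else 0)"
  unfolding var_def partial_deriv_single by (simp add: lookup_single when_def)

lemma partial_deriv_dual: "partial_deriv i (dual_linear_form a) = const (a i)"
proof -
  have "partial_deriv i (dual_linear_form a) = (\<Sum>j\<in>UNIV. if j = i then const (a j) else 0)"
    unfolding dual_linear_form_def partial_deriv_sum
    by (rule sum.cong) (auto simp: partial_deriv_times partial_deriv_var)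
  then show ?thesis by simp
qed

lemma partial_deriv_dual_power:
  "partial_deriv i (const c * dual_linear_form a ^ m) = const (c * of_nat m * a i) * dual_linear_form a ^ (m - 1)"
proof -
  have p: "partial_deriv i (dual_linear_form a ^ m) = const (of_nat m * a i) * dual_linear_form a ^ (m - 1)"
  proof (induction m)
    case 0
    show ?case using partial_deriv_const[of i 1] by simp
  next
    case (Suc m)
    show ?case
    proof (cases m)
      case 0
      then show ?thesis using partial_deriv_dual[of i a] by simp
    next
      case (Suc k)
      have "partial_deriv i (dual_linear_form a ^ Suc m) = const (a i) * dual_linear_form a ^ m
        + dual_linear_form a * (const (of_nat m * a i) * dual_linear_form a ^ (m - 1))"
        by (simp add: partial_deriv_times partial_deriv_dual Suc.IH)
      also have "\<dots> = (const (a i) + const (of_nat m * a i)) * dual_linear_form a ^ m"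
        using Suc by (simp add: algebra_simps)
      also have "const (a i) + const (of_nat m * a i) = const (of_nat (Suc m) * a i)"
        by (simp add: const_add[symmetric] algebra_simps)
      finally show ?thesis by simp
    qed
  qed
  show ?thesis by (simp add: partial_deriv_times p const_mult mult_ac)
qed

lemma lookup_partial_deriv:
  "Poly_Mapping.lookup (partial_deriv i f) a
    = of_nat (Poly_Mapping.lookup a i + 1) * Poly_Mapping.lookup f (a + Poly_Mapping.single i 1)"
proof (induction f rule: poly_induct)
  case (single b c)
  let ?u = "Poly_Mapping.single i (1::nat)"
  show ?case
  proof (cases "b = a + ?u")
    case True
    then have "b - ?u = a" "Poly_Mapping.lookup b i = Poly_Mapping.lookup a i + 1" by (simp_all add: lookup_add)
    then show ?thesis using True by (simp add: partial_deriv_single)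
  next
    case False
    have "b - ?u = a \<Longrightarrow> Poly_Mapping.lookup b i = 0"
    proof (rule ccontr)
      assume h: "b - ?u = a" "Poly_Mapping.lookup b i \<noteq> 0"
      have "b = (b - ?u) + ?u"
        by (rule poly_mapping_eqI) (use h(2) in \<open>auto simp: lookup_add lookup_minus lookup_single when_def\<close>)
      then show False using False h(1) by simp
    qed
    then show ?thesis using False by (auto simp: partial_deriv_single lookup_single when_def)
  qed
qed (simp_all add: partial_deriv_add lookup_add algebra_simps)

lemma zero_of_partials_zero:
  fixes f :: "'k::field_char_0 poly3"
  assumes f: "f \<in> forms (Suc n)" and z: "\<And>i. partial_deriv i f = 0"
  shows "f = 0"
proof (rule poly_mapping_eqI, rule ccontr)
  fix a assume "Poly_Mapping.lookup f a \<noteq> Poly_Mapping.lookup 0 a"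
  then have nz: "Poly_Mapping.lookup f a \<noteq> 0" by simp
  then have "expo_deg a = Suc n" using f by (auto simp: forms_def in_keys_iff)
  then obtain i where i: "Poly_Mapping.lookup a i > 0" unfolding expo_deg_eq by fastforce
  let ?u = "Poly_Mapping.single i (1::nat)"
  have a: "(a - ?u) + ?u = a"
    by (rule poly_mapping_eqI) (use i in \<open>auto simp: lookup_add lookup_minus lookup_single when_def\<close>)
  have "0 = of_nat (Poly_Mapping.lookup (a - ?u) i + 1) * Poly_Mapping.lookup f a"
    using lookup_partial_deriv[of i f "a - ?u"] z[of i] unfolding a by simp
  moreover have "of_nat (Poly_Mapping.lookup (a - ?u) i + 1) \<noteq> (0::'k)" by (simp only: Suc_eq_plus1[symmetric] of_nat_neq_0 not_False_eq_True)
  ultimately show False using nz by (metis no_zero_divisors)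
qed

text \<open>The partial derivatives of the power sum are power sums for the functionals
  \<open>g \<mapsto> c (x_i g)\<close> up to a factor, so the induction hypothesis kills them; in
  characteristic zero a form of positive degree without derivatives is zero.\<close>

lemma power_sum_zero:
  fixes P :: "(3 \<Rightarrow> 'k::field_char_0) set"
  assumes "\<And>g. g \<in> hp m \<Longrightarrow> (\<Sum>v\<in>P. c v * g v) = 0"
  shows "(\<Sum>v\<in>P. const (c v) * dual_linear_form v ^ m) = 0"
  using assms
proof (induction m arbitrary: c)
  case 0
  have "(\<Sum>v\<in>P. c v * 1) = 0" by (rule 0) auto
  then show ?case by (simp add: const_sum[symmetric])
next
  case (Suc m)
  show ?case
  proof (rule zero_of_partials_zero)
    show "(\<Sum>v\<in>P. const (c v) * dual_linear_form v ^ Suc m) \<in> forms (Suc m)"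
      by (intro forms_sum forms_scale forms_dual_power)
    fix i
    have "(\<Sum>v\<in>P. const (c v * of_nat (Suc m) * v i) * dual_linear_form v ^ m) = 0"
    proof (rule Suc.IH)
      fix g :: "(3 \<Rightarrow> 'k) \<Rightarrow> 'k" assume g: "g \<in> hp m"
      obtain f where f: "f \<in> forms m" "g = eval_poly f" using hp_eval_poly[OF g] by (elim bexE)
      have "var i * f \<in> forms (1 + m)" by (rule forms_times[OF forms_var f(1)])
      then have "eval_poly (var i * f) \<in> hp (Suc m)" unfolding plus_1_eq_Suc by (rule eval_poly_hp)
      from Suc.prems[OF this] have "(\<Sum>v\<in>P. c v * (v i * g v)) = 0" by (simp add: eval_poly_times f(2))
      then have "of_nat (Suc m) * (\<Sum>v\<in>P. c v * (v i * g v)) = 0" by simp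
      then show "(\<Sum>v\<in>P. c v * of_nat (Suc m) * v i * g v) = 0"
        by (simp only: sum_distrib_left mult_ac)
    qed
    then show "partial_deriv i (\<Sum>v\<in>P. const (c v) * dual_linear_form v ^ Suc m) = 0"
      unfolding partial_deriv_sum partial_deriv_dual_power by simp
  qed
qed

definition deriv_mon :: "expo \<Rightarrow> 'k::field poly3 \<Rightarrow> 'k poly3"
  where "deriv_mon a F = (partial_deriv 0 ^^ Poly_Mapping.lookup a 0)
           ((partial_deriv 1 ^^ Poly_Mapping.lookup a 1)
             ((partial_deriv 2 ^^ Poly_Mapping.lookup a 2) F))"

lemma iterated_partial_add: "(partial_deriv i ^^ n) (f + g) = (partial_deriv i ^^ n) f + (partial_deriv i ^^ n) g"
  by (induction n) (simp_all add: partial_deriv_add)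

lemma deriv_mon_add: "deriv_mon a (F + G) = deriv_mon a F + deriv_mon a G"
  by (simp add: deriv_mon_def iterated_partial_add)

lemma diff_action_superset:
  assumes "finite A" "Poly_Mapping.keys g \<subseteq> A"
  shows "diff_action g F = (\<Sum>a\<in>A. const (Poly_Mapping.lookup g a) * deriv_mon a F)"
  unfolding diff_action_def deriv_mon_def using assms by (intro sum.mono_neutral_left) (auto simp: in_keys_iff)

lemma diff_action_add_left: "diff_action (f + g) F = diff_action f F + diff_action g F"
proof -
  let ?A = "Poly_Mapping.keys f \<union> Poly_Mapping.keys g"
  have "diff_action h F = (\<Sum>a\<in>?A. const (Poly_Mapping.lookup h a) * deriv_mon a F)" if "h \<in> {f, g, f + g}" for h
    by (rule diff_action_superset) (use that keys_add[of f g] in auto)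
  then show ?thesis by (simp add: lookup_add const_add distrib_right sum.distrib)
qed

lemma diff_action_zero_left [simp]: "diff_action 0 F = 0" by (simp add: diff_action_def)

lemma diff_action_single: "diff_action (Poly_Mapping.single a c) F = const c * deriv_mon a F"
  by (subst diff_action_superset[of "{a}"]) auto

lemma diff_action_add_right: "diff_action g (F + G) = diff_action g F + diff_action g G"
  by (simp add: diff_action_superset[of "Poly_Mapping.keys g"] deriv_mon_add distrib_left sum.distrib)

lemma diff_action_zero_right [simp]: "diff_action g 0 = 0"
proof -
  have "diff_action g 0 + diff_action g 0 = diff_action g 0 + 0"
    by (simp only: diff_action_add_right[symmetric] add_0_right)
  then show ?thesis by (simp only: add_left_cancel)
qed

lemma diff_action_sum_right: "diff_action g (\<Sum>x\<in>A. F x) = (\<Sum>x\<in>A. diff_action g (F x))"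
  by (induction A rule: infinite_finite_induct) (simp_all add: diff_action_add_right)

text \<open>The falling factorial. For \<open>k > m\<close> truncated subtraction contributes a
  factor \<open>0\<close>, which matches the vanishing of derivatives of order above
  \<open>m\<close>.\<close>

definition falling :: "nat \<Rightarrow> nat \<Rightarrow> nat"
  where "falling m k = (\<Prod>j<k. m - j)"

lemma falling_add: "falling m (j + k) = falling m j * falling (m - j) k"
  by (induction k) (simp_all add: falling_def mult_ac)

lemma falling_zero: "m < k \<Longrightarrow> falling m k = 0"
  unfolding falling_def by (rule prod_zero) auto

lemma falling_pos: "k \<le> m \<Longrightarrow> falling m k > 0"
  unfolding falling_def by (rule prod_pos) auto

lemma iterated_partial_dual_power:
  "(partial_deriv i ^^ k) (const c * dual_linear_form a ^ m) = const (c * of_nat (falling m k) * a i ^ k) * dual_linear_form a ^ (m - k)"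
proof (induction k)
  case 0
  show ?case by (simp add: falling_def)
next
  case (Suc k)
  have "falling m (Suc k) = falling m k * (m - k)" by (simp add: falling_def mult.commute)
  then show ?case
    unfolding funpow.simps comp_apply Suc.IH partial_deriv_dual_power by (simp add: mult_ac)
qed

lemma deriv_mon_dual_power:
  "deriv_mon b (const c * dual_linear_form a ^ m)
    = const (c * of_nat (falling m (expo_deg b)) * expo_eval b a) * dual_linear_form a ^ (m - expo_deg b)"
proof -
  let ?l = "Poly_Mapping.lookup b"
  have "expo_deg b = ?l 2 + (?l 1 + ?l 0)" by (simp add: expo_deg_eq)
  then show ?thesis
    unfolding deriv_mon_def iterated_partial_dual_power
    by (simp add: falling_add expo_eval_def prod_UNIV_3 mult_ac add.assoc)
qed

lemma diff_action_dual_power: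
  assumes "f \<in> forms n"
  shows "diff_action f (const c * dual_linear_form a ^ m)
    = const (c * of_nat (falling m n) * eval_poly f a) * dual_linear_form a ^ (m - n)"
  using assms
  by (induction rule: forms_induct)
    (simp_all add: diff_action_single deriv_mon_dual_power eval_poly_single diff_action_add_left eval_poly_add
      const_mult const_add algebra_simps)

text \<open>The module law is needed only for sums of powers of linear forms, and there every
  monomial derivative is explicit.\<close>

lemma diff_action_times_dual_power:
  "diff_action (g * f) (const e * dual_linear_form v ^ m) = diff_action g (diff_action f (const e * dual_linear_form v ^ m))"
proof (induction f rule: poly_induct)
  case (single a c)
  show ?case
  proof (induction g rule: poly_induct)
    case (single b c')
    show ?case
      unfolding mult_single diff_action_single deriv_mon_dual_power mult.assoc[symmetric] const_mult[symmetric]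
        expo_eval_add add.commute[of b a] expo_deg_add falling_add
      by (simp add: mult_ac)
  qed (simp_all add: diff_action_add_left algebra_simps)
qed (simp_all add: diff_action_add_left diff_action_add_right algebra_simps)


subsection \<open>Dimensions in graded quotients\<close>

abbreviation coset :: "'k::field poly3 set \<Rightarrow> 'k poly3 \<Rightarrow> 'k poly3 set"
  where "coset I f \<equiv> I +>\<^bsub>S_ring\<^esub> f"

lemma ring_S: "ring (S_ring :: 'k::field poly3 ring)"
  by (rule cring.axioms(1)[OF cring_class])

lemma coset_eq_iff: "ideal I S_ring \<Longrightarrow> coset I f = coset I g \<longleftrightarrow> f - g \<in> I"
  using ring.quotient_eq_iff_same_a_r_cos[OF ring_S, of I f g] by (simp add: class_simps)

lemma subfield_const: "subfield (range (const :: 'k::field \<Rightarrow> 'k poly3)) S_ring"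
proof (rule ring.subfield_iff(1)[OF ring_S])
  let ?R = "S_ring\<lparr>carrier := range (const :: 'k \<Rightarrow> 'k poly3)\<rparr>"
  have "subring (range (const :: 'k \<Rightarrow> 'k poly3)) S_ring"
  proof (rule ring.subringI[OF ring_S])
    show "\<one>\<^bsub>S_ring\<^esub> \<in> range (const :: 'k \<Rightarrow> 'k poly3)" unfolding one_class by (rule range_eqI[of _ _ 1]) simp
  qed (auto simp: cring_class_ops_def class_simps[unfolded cring_class_ops_def] const_uminus[symmetric] const_add[symmetric] const_mult[symmetric])
  then have "subcring (range (const :: 'k \<Rightarrow> 'k poly3)) S_ring" by (rule cring.subcringI'[OF cring_class])
  moreover have "range (const :: 'k \<Rightarrow> 'k poly3) \<subseteq> carrier S_ring" by (simp add: cring_class_ops_def)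
  ultimately have "cring ?R" using ring.subcring_iff[OF ring_S] by blast
  then show "field ?R"
  proof (rule cring.cring_fieldI2)
    have "(0 :: 'k poly3) \<noteq> 1" by simp
    then show "\<zero>\<^bsub>?R\<^esub> \<noteq> \<one>\<^bsub>?R\<^esub>" by (simp add: class_simps)
    fix a assume a: "a \<in> carrier ?R" "a \<noteq> \<zero>\<^bsub>?R\<^esub>"
    then obtain c where c: "a = const c" by auto
    then have "c \<noteq> 0" using a(2) by (auto simp: class_simps)
    then have "a * const (inverse c) = 1" by (simp add: c const_mult[symmetric])
    then show "\<exists>b\<in>carrier ?R. a \<otimes>\<^bsub>?R\<^esub> b = \<one>\<^bsub>?R\<^esub>"
      by (intro bexI[of _ "const (inverse c)"]) (simp_all add: class_simps)
  qed
qed (simp add: cring_class_ops_def)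

locale graded_quotient =
  fixes I :: "'k::field poly3 set"
  assumes ideal: "ideal I S_ring" and proper_ideal: "1 \<notin> I"
begin

lemma coset_hom: "ring_hom_ring S_ring (quot_alg I) (coset I)"
  unfolding quot_alg_def by (rule ideal.rcos_ring_hom_ring[OF ideal])

sublocale h: ring_hom_ring S_ring "quot_alg I" "coset I"
  by (rule coset_hom)

lemma coset_add: "coset I (f + g) = coset I f \<oplus>\<^bsub>quot_alg I\<^esub> coset I g"
  using h.hom_add[of f g] by (simp add: class_simps)

lemma coset_mult: "coset I (f * g) = coset I f \<otimes>\<^bsub>quot_alg I\<^esub> coset I g"
  using h.hom_mult[of f g] by (simp add: class_simps)

lemma coset_zero: "coset I 0 = \<zero>\<^bsub>quot_alg I\<^esub>"
  using h.hom_zero by (simp add: class_simps)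

lemma coset_one: "coset I 1 = \<one>\<^bsub>quot_alg I\<^esub>"
  using h.hom_one by (simp add: class_simps)

lemma coset_power: "coset I (f ^ n) = coset I f [^]\<^bsub>quot_alg I\<^esub> n"
  by (induction n) (simp_all add: coset_one coset_mult power_Suc2 del: power_Suc)

lemma coset_carrier: "coset I f \<in> carrier (quot_alg I)"
  using h.hom_closed[of f] by (simp add: class_simps)

lemma subfield_scalars: "subfield (quot_scalars I) (quot_alg I)"
proof -
  have "\<one>\<^bsub>quot_alg I\<^esub> \<noteq> \<zero>\<^bsub>quot_alg I\<^esub>"
    using proper_ideal coset_eq_iff[OF ideal, of 1 0] by (simp add: coset_one[symmetric] coset_zero[symmetric])
  from h.img_is_subfield(2)[OF subfield_const this] show ?thesis
    by (simp add: quot_scalars_def image_image)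
qed

text \<open>On \<open>M\<close> the map \<open>\<theta>\<close> is linear with kernel
  \<open>I\<close>, so cosets and images correspond. \<open>dimension\<close> is generated by
  successive line extensions; each of them is matched with one new element of the independent set
  \<open>B\<close>. \<open>M\<close> is kept general to cover both graded pieces and their multiples
  by powers of \<open>l\<close>.\<close>

lemma dimension_coset_image:
  fixes \<theta> :: "'k poly3 \<Rightarrow> 'b \<Rightarrow> 'k"
  assumes add: "\<And>f g. \<theta> (f + g) = \<theta> f + \<theta> g" and scale: "\<And>c f. \<theta> (const c * f) = scl c (\<theta> f)"
    and M_add: "\<And>f g. f \<in> M \<Longrightarrow> g \<in> M \<Longrightarrow> f + g \<in> M" and M_scale: "\<And>c f. f \<in> M \<Longrightarrow> const c * f \<in> M"
    and M_zero: "0 \<in> M"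
    and ker: "\<And>f. f \<in> M \<Longrightarrow> f \<in> I \<longleftrightarrow> \<theta> f = 0"
    and fin: "finite B" and ind: "fs.independent B" and sub: "B \<subseteq> \<theta> ` M"
  shows "h.S.dimension (card B) (quot_scalars I) (coset I ` {f \<in> M. \<theta> f \<in> fs.span B})"
  using fin ind sub
proof (induction B rule: finite_induct)
  case empty
  have eq: "coset I ` {f \<in> M. \<theta> f \<in> fs.span {}} = {\<zero>\<^bsub>quot_alg I\<^esub>}"
  proof -
    let ?N = "{f \<in> M. \<theta> f \<in> fs.span {}}"
    have "\<theta> 0 = 0" using scale[of 0 0] by (simp add: fun_eq_iff)
    then have z: "0 \<in> ?N" using M_zero by simp
    have c: "coset I f = coset I 0" if "f \<in> ?N" for f
      using that ker[of f] by (simp add: coset_eq_iff[OF ideal] fs.span_empty)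
    show ?thesis
    proof (intro equalityI subsetI)
      fix u assume "u \<in> coset I ` ?N"
      then obtain f where "f \<in> ?N" "u = coset I f" by (elim imageE) (rule that)
      then show "u \<in> {\<zero>\<^bsub>quot_alg I\<^esub>}" using c[of f] by (simp only: coset_zero singleton_iff)
    next
      fix u assume "u \<in> {\<zero>\<^bsub>quot_alg I\<^esub>}"
      then have "u = coset I 0" by (simp only: coset_zero singleton_iff)
      then show "u \<in> coset I ` ?N" by (rule image_eqI[OF _ z])
    qed
  qed
  have "h.S.dimension 0 (quot_scalars I) {\<zero>\<^bsub>quot_alg I\<^esub>}" by (rule h.S.dimension.intros(1))
  then show ?case unfolding card.empty eq by assumption
next
  case (insert b B)
  obtain f0 where f0: "f0 \<in> M" "\<theta> f0 = b" using insert.prems(2) by blast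
  have minus: "f - const c * f0 \<in> M" "\<theta> (f - const c * f0) = \<theta> f - scl c b" if "f \<in> M" for f c
  proof -
    have e: "f - const c * f0 = f + const (- c) * f0"
      by (simp add: const_uminus)
    show "f - const c * f0 \<in> M" unfolding e by (rule M_add[OF that M_scale[OF f0(1)]])
    show "\<theta> (f - const c * f0) = \<theta> f - scl c b" unfolding e add scale f0(2) by (simp add: fun_eq_iff)
  qed
  let ?E = "coset I ` {f \<in> M. \<theta> f \<in> fs.span B}"
  have bB: "b \<notin> fs.span B" "fs.independent B"
    using insert.prems(1) unfolding fs.independent_insert if_not_P[OF insert.hyps(2)] by blast+
  have IH: "h.S.dimension (card B) (quot_scalars I) ?E" by (rule insert.IH[OF bB(2)]) (use insert.prems(2) in blast)
  have "coset I f0 \<notin> ?E"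
  proof
    assume "coset I f0 \<in> ?E"
    then obtain f where f: "f \<in> M" "\<theta> f \<in> fs.span B" "coset I f = coset I f0" by auto
    have "f - const 1 * f0 \<in> I" using f(3) by (simp add: coset_eq_iff[OF ideal])
    then have "\<theta> f - scl 1 b = 0" using ker[OF minus(1)[OF f(1), of 1]] minus(2)[OF f(1), of 1] by simp
    then have "\<theta> f = b" by (simp add: fun_eq_iff)
    then show False using f(2) bB(1) by simp
  qed
  from h.S.dimension.intros(2)[OF coset_carrier this IH]
  have "h.S.dimension (Suc (card B)) (quot_scalars I) (h.S.line_extension (quot_scalars I) (coset I f0) ?E)" .
  moreover have "h.S.line_extension (quot_scalars I) (coset I f0) ?E = coset I ` {f \<in> M. \<theta> f \<in> fs.span (insert b B)}"
  proof (intro equalityI subsetI)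
    fix u assume "u \<in> h.S.line_extension (quot_scalars I) (coset I f0) ?E"
    then obtain k v where kv: "k \<in> quot_scalars I" "v \<in> ?E" "u = k \<otimes>\<^bsub>quot_alg I\<^esub> coset I f0 \<oplus>\<^bsub>quot_alg I\<^esub> v"
      unfolding h.S.line_extension_mem_iff by (elim bexE) (rule that)
    from kv(1) obtain c where c: "k = coset I (const c)" unfolding quot_scalars_def by (elim imageE) (rule that)
    from kv(2) obtain f where f: "f \<in> M" "\<theta> f \<in> fs.span B" "v = coset I f" by auto
    have "\<theta> (const c * f0 + f) - scl c b = \<theta> f" by (simp add: add scale f0(2) fun_eq_iff)
    then have "\<theta> (const c * f0 + f) \<in> fs.span (insert b B)" unfolding fs.span_insert using f(2)
      by (intro CollectI exI[of _ c]) simp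
    moreover have "const c * f0 + f \<in> M" by (rule M_add[OF M_scale[OF f0(1)] f(1)])
    moreover have "u = coset I (const c * f0 + f)" unfolding kv(3) c f(3) coset_add coset_mult ..
    ultimately show "u \<in> coset I ` {f \<in> M. \<theta> f \<in> fs.span (insert b B)}"
      by (intro image_eqI[of _ _ "const c * f0 + f"] CollectI conjI)
  next
    fix u assume "u \<in> coset I ` {f \<in> M. \<theta> f \<in> fs.span (insert b B)}"
    then obtain g where g: "g \<in> M" "\<theta> g \<in> fs.span (insert b B)" "u = coset I g" by auto
    from g(2) obtain c where c: "\<theta> g - scl c b \<in> fs.span B" unfolding fs.span_insert by (elim CollectE exE) (rule that)
    have "coset I (g - const c * f0) \<in> ?E"
      by (intro imageI CollectI conjI) (use minus[OF g(1), of c] c in auto)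
    moreover have "u = coset I (const c) \<otimes>\<^bsub>quot_alg I\<^esub> coset I f0 \<oplus>\<^bsub>quot_alg I\<^esub> coset I (g - const c * f0)"
      unfolding coset_mult[symmetric] coset_add[symmetric] by (simp add: g(3))
    ultimately show "u \<in> h.S.line_extension (quot_scalars I) (coset I f0) ?E"
      unfolding h.S.line_extension_mem_iff by (intro bexI) (auto simp: quot_scalars_def)
  qed
  ultimately show ?case by (simp only: card_insert_disjoint[OF insert.hyps])
qed

lemma dim_coset_image:
  fixes \<theta> :: "'k poly3 \<Rightarrow> 'b \<Rightarrow> 'k"
  assumes add: "\<And>f g. \<theta> (f + g) = \<theta> f + \<theta> g" and scale: "\<And>c f. \<theta> (const c * f) = scl c (\<theta> f)"
    and M_add: "\<And>f g. f \<in> M \<Longrightarrow> g \<in> M \<Longrightarrow> f + g \<in> M" and M_scale: "\<And>c f. f \<in> M \<Longrightarrow> const c * f \<in> M"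
    and M_zero: "0 \<in> M"
    and ker: "\<And>f. f \<in> M \<Longrightarrow> f \<in> I \<longleftrightarrow> \<theta> f = 0"
    and sp: "\<theta> ` M \<subseteq> fs.span C" "finite C"
  shows "ring.dim (quot_alg I) (quot_scalars I) (coset I ` M) = fs.dim (\<theta> ` M)"
proof -
  obtain B where B: "B \<subseteq> \<theta> ` M" "finite B" "fs.independent B" "\<theta> ` M \<subseteq> fs.span B" "card B = fs.dim (\<theta> ` M)"
    by (rule finite_basis[OF sp], rule that)
  have dimB: "h.S.dimension (card B) (quot_scalars I) (coset I ` {f \<in> M. \<theta> f \<in> fs.span B})"
    by (rule dimension_coset_image[OF add scale M_add M_scale M_zero ker B(2,3,1)])
  have eq: "{f \<in> M. \<theta> f \<in> fs.span B} = M"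
  proof (intro equalityI subsetI)
    fix f assume f: "f \<in> M"
    then have "\<theta> f \<in> fs.span B" by (intro subsetD[OF B(4)] imageI)
    with f show "f \<in> {f \<in> M. \<theta> f \<in> fs.span B}" by (intro CollectI conjI)
  qed (elim CollectE conjE)
  from h.S.dimI[OF subfield_scalars dimB[unfolded eq]] show ?thesis using B(5) unfolding over_def by (rule trans)
qed

end

lemma ideal_of_closed:
  fixes I :: "'k::field poly3 set"
  assumes "0 \<in> I" "\<And>f g. f \<in> I \<Longrightarrow> g \<in> I \<Longrightarrow> f + g \<in> I" "\<And>f g. f \<in> I \<Longrightarrow> g * f \<in> I"
  shows "ideal I S_ring"
proof (rule idealI)
  show "ring (S_ring :: 'k poly3 ring)" by (rule ring_S)
  have neg: "- f \<in> I" if "f \<in> I" for f using assms(3)[OF that, of "- 1"] by simp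
  show "subgroup I (add_monoid S_ring)"
  proof (rule group.subgroupI)
    show "group (add_monoid (S_ring :: 'k poly3 ring))" by (rule abelian_group.a_group[OF ring.is_abelian_group[OF ring_S]])
    fix a assume "a \<in> I"
    then show "inv\<^bsub>add_monoid S_ring\<^esub> a \<in> I" using neg uminus_class[of a] by (simp add: a_inv_def)
  qed (use assms in \<open>auto simp: class_simps\<close>)
qed (use assms(3) in \<open>auto simp: class_simps mult.commute\<close>)


subsection \<open>The annihilator of a sum of powers and the ideal of a point set\<close>

locale power_sum = point_functional P w d
  for P :: "(3 \<Rightarrow> 'k::field_char_0) set" and w :: "(3 \<Rightarrow> 'k) \<Rightarrow> 'k" and d :: nat +
  fixes F :: "'k poly3"
  assumes F: "F = (\<Sum>v\<in>P. const (w v) * dual_linear_form v ^ d)" and nonzero: "F \<noteq> 0"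
begin

lemma diff_action_F:
  assumes "f \<in> forms n"
  shows "diff_action f F = (\<Sum>v\<in>P. const (w v * of_nat (falling d n) * eval_poly f v) * dual_linear_form v ^ (d - n))"
  unfolding F diff_action_sum_right diff_action_dual_power[OF assms] ..

text \<open>\<open>f\<close> turns \<open>F\<close> into a power sum of degree \<open>d - n\<close>
  with coefficients proportional to \<open>w v * f(v)\<close>. If the functional is zero, so is this
  power sum; conversely, acting on it with a form of degree \<open>d - n\<close> recovers the
  functional up to factorials, which are nonzero in characteristic zero.\<close>

lemma Ann_iff:
  assumes f: "f \<in> forms n"
  shows "f \<in> Ann F \<longleftrightarrow> functional n (eval_poly f) = 0"
proof (cases "n \<le> d")
  case False
  then have "diff_action f F = 0" unfolding diff_action_F[OF f] by (simp add: falling_zero)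
  then show ?thesis using False unfolding Ann_def functional_zero_iff by simp
next
  case n: True
  define c where "c v = w v * of_nat (falling d n) * eval_poly f v" for v
  have nz: "of_nat (falling d n) \<noteq> (0::'k)" "of_nat (falling (d - n) (d - n)) \<noteq> (0::'k)"
    using falling_pos[OF n] falling_pos[of "d - n" "d - n"] by simp_all
  have c: "(\<Sum>v\<in>P. c v * g v) = of_nat (falling d n) * (\<Sum>v\<in>P. w v * eval_poly f v * g v)" for g
    unfolding sum_distrib_left c_def by (rule sum.cong) (simp_all only: mult_ac)
  have act: "diff_action f F = (\<Sum>v\<in>P. const (c v) * dual_linear_form v ^ (d - n))"
    unfolding diff_action_F[OF f] c_def ..
  show ?thesis
  proof
    assume "functional n (eval_poly f) = 0"
    then have "\<And>g. g \<in> hp (d - n) \<Longrightarrow> (\<Sum>v\<in>P. c v * g v) = 0" unfolding c functional_zero_iff using n by simp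
    then have "diff_action f F = 0" unfolding act by (rule power_sum_zero)
    then show "f \<in> Ann F" by (simp add: Ann_def)
  next
    assume "f \<in> Ann F"
    then have z: "(\<Sum>v\<in>P. const (c v) * dual_linear_form v ^ (d - n)) = 0" unfolding Ann_def act[symmetric] by simp
    have "(\<Sum>v\<in>P. w v * eval_poly f v * g v) = 0" if g: "g \<in> hp (d - n)" for g
    proof -
      obtain g' where g': "g' \<in> forms (d - n)" "g = eval_poly g'" using hp_eval_poly[OF g] by (elim bexE)
      let ?k = "of_nat (falling (d - n) (d - n)) :: 'k"
      have "0 = diff_action g' (\<Sum>v\<in>P. const (c v) * dual_linear_form v ^ (d - n))" unfolding z by simp
      also have "\<dots> = const (\<Sum>v\<in>P. c v * ?k * g v)"
        unfolding diff_action_sum_right diff_action_dual_power[OF g'(1)] const_sum g'(2) by simp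
      finally have "(\<Sum>v\<in>P. c v * ?k * g v) = 0" by (rule const_eq_zero[OF sym])
      moreover have "(\<Sum>v\<in>P. c v * ?k * g v) = ?k * (\<Sum>v\<in>P. c v * g v)"
        unfolding sum_distrib_left by (rule sum.cong) (simp_all only: mult_ac)
      ultimately have "?k * (of_nat (falling d n) * (\<Sum>v\<in>P. w v * eval_poly f v * g v)) = 0" by (simp only: c)
      then show ?thesis unfolding mult_eq_0_iff using nz by blast
    qed
    then show "functional n (eval_poly f) = 0" unfolding functional_zero_iff by blast
  qed
qed

lemma ideal_Ann: "ideal (Ann F) S_ring"
proof (rule ideal_of_closed)
  have m: "diff_action (g * f) F = diff_action g (diff_action f F)" for f g
    unfolding F diff_action_sum_right diff_action_times_dual_power ..
  show "0 \<in> Ann F" by (simp add: Ann_def)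
  show "f + g \<in> Ann F" if "f \<in> Ann F" "g \<in> Ann F" for f g
    using that by (simp add: Ann_def diff_action_add_left)
  show "g * f \<in> Ann F" if "f \<in> Ann F" for f g
    using that by (simp add: Ann_def m)
qed

lemma one_notin_Ann: "1 \<notin> Ann F"
proof -
  have "diff_action 1 F = F"
    using diff_action_single[of 0 1 F] by (simp add: deriv_mon_def)
  then show ?thesis using nonzero by (simp add: Ann_def)
qed

sublocale graded_quotient "Ann F"
  by (rule graded_quotient.intro[OF ideal_Ann one_notin_Ann])

lemma functional_eval_add:
  "functional n (eval_poly (f + g)) = functional n (eval_poly f) + functional n (eval_poly g)"
  by (auto simp: functional_def fun_eq_iff eval_poly_add sum.distrib algebra_simps)

lemma functional_eval_scale: "functional n (eval_poly (const c * f)) = scl c (functional n (eval_poly f))"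
  by (auto simp: functional_def fun_eq_iff eval_poly_times sum_distrib_left mult_ac)

lemma hilbert_Ann: "ring.dim (quot_alg (Ann F)) (quot_scalars (Ann F)) (quot_piece (Ann F) n) = adim n"
proof -
  obtain C where C: "finite C" "\<And>U. functional n ` U \<subseteq> fs.span C" by (rule functional_span[of n], rule that)
  have im: "(\<lambda>f. functional n (eval_poly f)) ` forms n = functional n ` hp n"
    unfolding eval_forms[symmetric] image_image ..
  have "ring.dim (quot_alg (Ann F)) (quot_scalars (Ann F)) (coset (Ann F) ` forms n)
      = fs.dim ((\<lambda>f. functional n (eval_poly f)) ` forms n)"
    by (rule dim_coset_image[OF functional_eval_add functional_eval_scale forms_add forms_scale forms_zero Ann_iff
          C(2)[of "hp n", folded im] C(1)])
  then show ?thesis unfolding im quot_piece_def .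
qed

lemma dim_multiplication:
  "ring.dim (quot_alg (Ann F)) (quot_scalars (Ann F))
    ((\<lambda>a. (coset (Ann F) (dual_linear_form l) [^]\<^bsub>quot_alg (Ann F)\<^esub> j) \<otimes>\<^bsub>quot_alg (Ann F)\<^esub> a) ` quot_piece (Ann F) i)
   = mdim l i j"
proof -
  let ?L = "dual_linear_form l ^ j"
  let ?M = "(\<lambda>f. ?L * f) ` forms i"
  obtain C where C: "finite C" "\<And>U. functional (i + j) ` U \<subseteq> fs.span C" by (rule functional_span[of "i + j"], rule that)
  have ev: "eval_poly (?L * f) = times_power l j (eval_poly f)" for f
    by (rule ext) (simp add: eval_poly_times eval_poly_power times_power_def)
  have im: "(\<lambda>f. functional (i + j) (eval_poly f)) ` ?M = functional (i + j) ` times_power l j ` hp i"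
    unfolding eval_forms[symmetric] image_image ev ..
  have Mf: "f \<in> forms (i + j)" if "f \<in> ?M" for f
  proof -
    from \<open>f \<in> ?M\<close> obtain g where g: "g \<in> forms i" "f = ?L * g" by (elim imageE) (rule that)
    then show ?thesis using forms_times[OF forms_dual_power g(1), of l j] by (simp add: add.commute)
  qed
  have "ring.dim (quot_alg (Ann F)) (quot_scalars (Ann F)) (coset (Ann F) ` ?M)
      = fs.dim ((\<lambda>f. functional (i + j) (eval_poly f)) ` ?M)"
  proof (rule dim_coset_image[OF functional_eval_add functional_eval_scale _ _ _ _ C(2)[of "times_power l j ` hp i", folded im] C(1)])
    fix f g assume "f \<in> ?M" "g \<in> ?M"
    then obtain f' g' where "f' \<in> forms i" "g' \<in> forms i" "f = ?L * f'" "g = ?L * g'" by (elim imageE) (rule that)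
    then show "f + g \<in> ?M" by (intro image_eqI[of _ _ "f' + g'"]) (auto intro: forms_add simp: distrib_left)
  next
    fix c f assume "f \<in> ?M"
    then obtain f' where "f' \<in> forms i" "f = ?L * f'" by (elim imageE) (rule that)
    then show "const c * f \<in> ?M" by (intro image_eqI[of _ _ "const c * f'"] forms_scale) (simp_all only: mult_ac)
  next
    show "0 \<in> ?M" by (rule image_eqI[of _ _ 0]) simp_all
  next
    fix f assume "f \<in> ?M"
    then show "f \<in> Ann F \<longleftrightarrow> functional (i + j) (eval_poly f) = 0" by (rule Ann_iff[OF Mf])
  qed
  moreover have "(\<lambda>a. (coset (Ann F) (dual_linear_form l) [^]\<^bsub>quot_alg (Ann F)\<^esub> j) \<otimes>\<^bsub>quot_alg (Ann F)\<^esub> a) ` quot_piece (Ann F) i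
      = coset (Ann F) ` ?M"
    unfolding quot_piece_def image_image coset_mult coset_power ..
  ultimately show ?thesis unfolding im by simp
qed

theorem strong_Lefschetz_of_nondegenerate_form:
  assumes "\<And>i. 2 * i \<le> d \<Longrightarrow> nondeg w (d - 2 * i) i P l"
  shows "strong_Lefschetz (quot_alg (Ann F)) (quot_scalars (Ann F)) (quot_piece (Ann F))"
  unfolding strong_Lefschetz_def
proof (rule bexI[of _ "coset (Ann F) (dual_linear_form l)"])
  show "coset (Ann F) (dual_linear_form l) \<in> quot_piece (Ann F) 1"
    unfolding quot_piece_def by (rule imageI[OF forms_dual])
qed (intro allI, unfold dim_multiplication hilbert_Ann, rule maximal_rank[OF assms])

end

text \<open>The ideal lies between its generating forms and the set \<open>?J\<close> of all
  polynomials vanishing on \<open>V\<close>. A form in \<open>?J\<close> is itself a generator by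
  homogeneity, so membership of forms is decided by values on \<open>V\<close> alone.\<close>

lemma hilbert_vanishing_ideal:
  fixes V :: "(3 \<Rightarrow> 'k::field) set"
  assumes V: "finite V" "V \<noteq> {}"
  shows "hilbert_fun (vanishing_ideal (proj_point ` V)) n = fs.dim (res V ` hp n)"
proof -
  let ?G = "{f :: 'k poly3. (\<exists>n. f \<in> forms n) \<and> (\<forall>P\<in>proj_point ` V. \<forall>v\<in>P. eval_poly f v = 0)}"
  let ?J = "{f :: 'k poly3. \<forall>v\<in>V. eval_poly f v = 0}"
  have carr: "?G \<subseteq> carrier S_ring" by (simp add: cring_class_ops_def)
  have "ideal ?J S_ring"
    by (rule ideal_of_closed) (auto simp: eval_poly_add eval_poly_times)
  moreover have "?G \<subseteq> ?J"
  proof (intro subsetI CollectI ballI)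
    fix f v assume f: "f \<in> ?G" and v: "v \<in> V"
    have "v \<in> proj_point v" unfolding proj_point_def by (intro CollectI exI[of _ 1]) simp
    then show "eval_poly f v = 0" using f v by auto
  qed
  ultimately have sub: "vanishing_ideal (proj_point ` V) \<subseteq> ?J"
    unfolding vanishing_ideal_def by (rule ring.genideal_minimal[OF ring_S])
  have mem: "f \<in> vanishing_ideal (proj_point ` V) \<longleftrightarrow> res V (eval_poly f) = 0" if f: "f \<in> forms n" for f
  proof
    assume "f \<in> vanishing_ideal (proj_point ` V)"
    then have "f \<in> ?J" using sub by blast
    then show "res V (eval_poly f) = 0" by (auto simp: res_def fun_eq_iff)
  next
    assume z: "res V (eval_poly f) = 0"
    have v: "eval_poly f v = 0" if "v \<in> V" for v using fun_cong[OF z, of v] that by (simp add: res_def)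
    have "f \<in> ?G" using f v by (auto simp: proj_point_def eval_poly_homogeneous)
    then show "f \<in> vanishing_ideal (proj_point ` V)"
      unfolding vanishing_ideal_def using ring.genideal_self[OF ring_S carr] by blast
  qed
  interpret graded_quotient "vanishing_ideal (proj_point ` V)"
  proof (rule graded_quotient.intro)
    show "ideal (vanishing_ideal (proj_point ` V)) S_ring"
      unfolding vanishing_ideal_def by (rule ring.genideal_ideal[OF ring_S carr])
    show "1 \<notin> vanishing_ideal (proj_point ` V)" using sub V(2) by auto
  qed
  have im: "(\<lambda>f. res V (eval_poly f)) ` forms n = res V ` hp n"
    unfolding eval_forms[symmetric] image_image ..
  have fV: "finite ((\<lambda>p x. if x = p then 1 else (0::'k)) ` V)" using V(1) by simp
  have "ring.dim (quot_alg (vanishing_ideal (proj_point ` V))) (quot_scalars (vanishing_ideal (proj_point ` V)))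
      (coset (vanishing_ideal (proj_point ` V)) ` forms n) = fs.dim ((\<lambda>f. res V (eval_poly f)) ` forms n)"
  proof (rule dim_coset_image[OF _ _ forms_add forms_scale forms_zero mem res_span[OF V(1), of "hp n", folded im] fV])
    show "res V (eval_poly (f + g)) = res V (eval_poly f) + res V (eval_poly g)" for f g
      by (simp add: res_def fun_eq_iff eval_poly_add)
    show "res V (eval_poly (const c * f)) = scl c (res V (eval_poly f))" for c f
      by (simp add: res_def fun_eq_iff eval_poly_times)
  qed
  then show ?thesis unfolding im hilbert_fun_def quot_piece_def .
qed

lemma dim_eq_card_iff_separates:
  fixes P :: "(3 \<Rightarrow> 'k::field) set"
  assumes "finite P"
  shows "fs.dim (res P ` hp n) = card P \<longleftrightarrow> separates n P"
proof -
  obtain B \<phi> where B: "B \<subseteq> P" "card B = fs.dim (res P ` hp n)"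
    and \<phi>: "\<And>b. b \<in> B \<Longrightarrow> \<phi> b \<in> hp n" "\<And>b x. b \<in> B \<Longrightarrow> x \<in> B \<Longrightarrow> \<phi> b x = (if x = b then 1 else 0)"
    and ex: "\<And>f x. f \<in> hp n \<Longrightarrow> x \<in> P \<Longrightarrow> f x = (\<Sum>b\<in>B. f b * \<phi> b x)"
    by (rule information_set[OF assms hp_subspace[of n]], rule that)
  show ?thesis
  proof
    assume "fs.dim (res P ` hp n) = card P"
    then have "B = P" using card_subset_eq[OF assms B(1)] B(2) by simp
    then show "separates n P" unfolding separates_def using \<phi> by (intro ballI) (rule bexI[of _ "\<phi> _"], auto)
  next
    assume s: "separates n P"
    have "P \<subseteq> B"
    proof (rule subsetI, rule ccontr)
      fix v assume v: "v \<in> P" "v \<notin> B"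
      obtain f where f: "f \<in> hp n" "f v = 1" "\<And>u. u \<in> P \<Longrightarrow> u \<noteq> v \<Longrightarrow> f u = 0"
        by (rule separatesE[OF s v(1)], rule that)
      have "f v = (\<Sum>b\<in>B. f b * \<phi> b v)" by (rule ex[OF f(1) v(1)])
      also have "\<dots> = 0" by (rule sum.neutral) (use f(3) v(2) B(1) in auto)
      finally show False using f(2) by simp
    qed
    then have "B = P" using B(1) by (rule equalityI[rotated])
    then show "fs.dim (res P ` hp n) = card P" using B(2) by simp
  qed
qed

lemma proper_points:
  assumes "\<forall>i\<in>I. p i \<noteq> (\<lambda>_. 0::'k::field)" "inj_on (\<lambda>i. proj_point (p i)) I"
  shows "proper (p ` I)"
  unfolding proper_def
proof (intro conjI ballI impI)
  show "0 \<notin> p ` I" using assms(1) by (auto simp: zero_fun_def)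
  fix u v assume "u \<in> p ` I" "v \<in> p ` I" and uv: "u \<noteq> v"
  then obtain i j where ij: "i \<in> I" "j \<in> I" "u = p i" "v = p j" by auto
  show "cross u v \<noteq> 0"
  proof
    assume "cross u v = 0"
    moreover have "u \<noteq> 0" using assms(1) ij by (auto simp: zero_fun_def)
    ultimately obtain c where c: "v = scl c u" using parallel_of_cross_zero by blast
    have c0: "c \<noteq> 0"
    proof
      assume "c = 0"
      then have "p j = (\<lambda>_. 0)" using c ij(4) by (simp add: scl_def)
      then show False using assms(1) ij(2) by blast
    qed
    have "proj_point v \<subseteq> proj_point u"
    proof
      fix x assume "x \<in> proj_point v"
      then obtain e where "e \<noteq> 0" "x = (\<lambda>i. e * v i)" unfolding proj_point_def by auto
      then show "x \<in> proj_point u" unfolding proj_point_def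
        by (intro CollectI exI[of _ "e * c"]) (simp add: c c0 mult.assoc)
    qed
    moreover have "proj_point u \<subseteq> proj_point v"
    proof
      fix x assume "x \<in> proj_point u"
      then obtain e where "e \<noteq> 0" "x = (\<lambda>i. e * u i)" unfolding proj_point_def by auto
      then show "x \<in> proj_point v" unfolding proj_point_def
        by (intro CollectI exI[of _ "e / c"]) (simp add: c c0)
    qed
    ultimately have "proj_point (p i) = proj_point (p j)" unfolding ij(3,4) by (rule equalityI[rotated])
    then have "i = j" using inj_onD[OF assms(2)] ij(1,2) by blast
    then show False using uv ij by simp
  qed
qed

text \<open>\<open>tau\<close> is a least element and needs a witness: degree \<open>card V\<close>
  suffices, with one line for each point to be avoided.\<close>

lemma separates_tau:
  fixes V :: "(3 \<Rightarrow> 'k::field) set"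
  assumes V: "finite V" "V \<noteq> {}" "proper V" and inj: "inj_on proj_point V"
  shows "separates (tau (proj_point ` V)) V"
proof -
  have "separates (card V) V" unfolding separates_def
  proof
    fix v assume v: "v \<in> V"
    have "\<exists>f\<in>hp (card V). f v = 1 \<and> (\<forall>u\<in>V - {v}. f u = 0)"
    proof (rule hp_separate)
      show "finite (V - {v})" "card (V - {v}) \<le> card V" using V(1) by (simp_all add: card_mono)
      show "v \<noteq> 0" by (rule proper_nonzero[OF V(3) v])
      show "cross u v \<noteq> 0" if "u \<in> V - {v}" for u by (rule proper_cross[OF V(3) _ v]) (use that in auto)
    qed
    then obtain f where f: "f \<in> hp (card V)" "f v = 1" "\<forall>u\<in>V - {v}. f u = 0" by (elim bexE conjE)
    then show "\<exists>f\<in>hp (card V). \<forall>u\<in>V. f u = (if u = v then 1 else 0)" by (intro bexI[of _ f]) auto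
  qed
  then have "hilbert_fun (vanishing_ideal (proj_point ` V)) (card V) = card (proj_point ` V)"
    by (simp add: hilbert_vanishing_ideal[OF V(1,2)] dim_eq_card_iff_separates[OF V(1)] card_image[OF inj])
  then have "hilbert_fun (vanishing_ideal (proj_point ` V)) (tau (proj_point ` V)) = card (proj_point ` V)"
    unfolding tau_def by (rule LeastI)
  then show ?thesis
    by (simp add: hilbert_vanishing_ideal[OF V(1,2)] dim_eq_card_iff_separates[OF V(1)] card_image[OF inj])
qed

subsection \<open>Reading off the Hilbert function\<close>

lemma nth_of_strip_while:
  assumes "strip_while (\<lambda>x. x = 0) (map D [0..<N]) = (v :: 'a::zero list)"
  shows "length v \<le> N" "i < length v \<Longrightarrow> D i = v ! i" "length v \<le> i \<Longrightarrow> i < N \<Longrightarrow> D i = 0"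
proof -
  obtain z where z: "\<forall>x\<in>set z. x = 0" and app: "map D [0..<N] = v @ z"
    by (rule split_strip_while_append[of "\<lambda>x. x = 0" "map D [0..<N]"]) (use assms that in blast)
  have len: "N = length v + length z" using arg_cong[OF app, of length] by simp
  then show "length v \<le> N" by simp
  have nth: "D i = (v @ z) ! i" if "i < N" for i using that arg_cong[OF app, of "\<lambda>xs. xs ! i"] by simp
  show "i < length v \<Longrightarrow> D i = v ! i" using nth[of i] len by (simp add: nth_append)
  assume i: "length v \<le> i" "i < N"
  then have "D i = z ! (i - length v)" using nth[of i] by (simp add: nth_append)
  moreover have "z ! (i - length v) \<in> set z" using i len by simp
  ultimately show "D i = 0" using z by simp
qed

lemma first_diff_Suc: "int (h (Suc n)) = int (h n) + first_diff h (Suc n)"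
  by (simp add: first_diff_def)

lemma hilbert_profile:
  assumes strip: "strip_while (\<lambda>x. x = 0) (map (first_diff h) [0..<N]) = pre @ replicate m c"
    and pre: "length pre = Suc k"
  shows "k + m < N"
    and "i \<le> k \<Longrightarrow> first_diff h i = pre ! i"
    and "j \<le> m \<Longrightarrow> int (h (k + j)) = int (h k) + c * int j"
    and "k + m \<le> i \<Longrightarrow> i < N \<Longrightarrow> h i = h (k + m)"
proof -
  note v = nth_of_strip_while[OF strip]
  show "k + m < N" using v(1) pre by simp
  show "i \<le> k \<Longrightarrow> first_diff h i = pre ! i" using v(2)[of i] pre by (simp add: nth_append)
  show "j \<le> m \<Longrightarrow> int (h (k + j)) = int (h k) + c * int j"
  proof (induction j)
    case (Suc j)
    have "first_diff h (Suc (k + j)) = c" using v(2)[of "Suc (k + j)"] pre Suc.prems by (simp add: nth_append)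
    then show ?case using Suc first_diff_Suc[of h "k + j"] by (simp add: algebra_simps)
  qed simp
  show "k + m \<le> i \<Longrightarrow> i < N \<Longrightarrow> h i = h (k + m)"
  proof (induction i rule: dec_induct)
    case (step i)
    have "first_diff h (Suc i) = 0" using v(3)[of "Suc i"] pre step by simp
    then show ?case using step first_diff_Suc[of h i] by simp
  qed simp
qed


theorem corollary4p8:
  fixes s d :: nat
    and p :: "nat \<Rightarrow> 3 \<Rightarrow> 'k::field_char_0"
    and \<alpha> :: "nat \<Rightarrow> 'k"
    and X :: "(3 \<Rightarrow> 'k) set set"
    and F :: "'k poly3"
  assumes points: "\<forall>i\<in>{1..s}. p i \<noteq> (\<lambda>_. 0)"
    and distinct_points: "inj_on (\<lambda>i. proj_point (p i)) {1..s}"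
    and X: "X = (\<lambda>i. proj_point (p i)) ` {1..s}"
    and F: "F = (\<Sum>i=1..s. const (\<alpha> i) * dual_linear_form (p i) ^ d)"
    and F_nonzero: "F \<noteq> 0"
    and d: "d \<ge> 2 * tau X"
    and Delta: "\<exists>m\<ge>2.
      strip_while (\<lambda>x. x = 0) (map (first_diff (hilbert_fun (Ann F))) [0..<d div 2 + 1])
        \<in> {[1, 2] @ replicate m 1,
            [1, 2, 2] @ replicate m 1,
            [1, 2, 3] @ replicate m 1,
            [1] @ replicate m 2,
            [1, 2, 3] @ replicate m 2}"
  shows "strong_Lefschetz (quot_alg (Ann F)) (quot_scalars (Ann F)) (quot_piece (Ann F))"
proof -
  define J where "J = {i \<in> {1..s}. \<alpha> i \<noteq> 0}"
  define V where "V = p ` {1..s}"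
  define P where "P = p ` J"
  define w where "w v = \<alpha> (the_inv_into {1..s} p v)" for v
  have inj_p: "inj_on p {1..s}"
    by (rule inj_on_imageI2[of proj_point]) (use distinct_points in \<open>simp add: comp_def\<close>)
  have w_p: "w (p i) = \<alpha> i" if "i \<in> {1..s}" for i
    unfolding w_def by (simp only: the_inv_into_f_f[OF inj_p that])
  have PV: "P \<subseteq> V" unfolding P_def V_def J_def by auto
  have fin_V: "finite V" unfolding V_def by simp
  have fin_P: "finite P" using finite_subset[OF PV fin_V] .
  have proper_V: "proper V" unfolding V_def by (rule proper_points[OF points distinct_points])
  have proper_P: "proper P" by (rule proper_subset[OF proper_V PV])
  have zero_P: "0 \<notin> P" using proper_P by (simp add: proper_def)
  have w_nz: "w v \<noteq> 0" if "v \<in> P" for v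
    using that w_p unfolding P_def J_def by auto
  have F_P: "F = (\<Sum>v\<in>P. const (w v) * dual_linear_form v ^ d)"
  proof -
    have "F = (\<Sum>i\<in>J. const (\<alpha> i) * dual_linear_form (p i) ^ d)"
      unfolding F by (rule sum.mono_neutral_right) (auto simp: J_def)
    also have "\<dots> = (\<Sum>i\<in>J. const (w (p i)) * dual_linear_form (p i) ^ d)"
      by (rule sum.cong) (simp_all add: J_def w_p)
    also have "\<dots> = (\<Sum>v\<in>P. const (w v) * dual_linear_form v ^ d)"
      unfolding P_def by (subst sum.reindex) (auto simp: J_def intro: inj_on_subset[OF inj_p])
    finally show ?thesis .
  qed
  have V_ne: "V \<noteq> {}"
  proof
    assume "V = {}"
    then have "P = {}" using PV by blast
    then show False using F_P F_nonzero by simp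
  qed
  have inj_V: "inj_on proj_point V"
    unfolding V_def by (rule inj_on_imageI) (use distinct_points in \<open>simp add: comp_def\<close>)
  have X_V: "X = proj_point ` V" unfolding X V_def image_image ..
  have sep: "separates (tau X) P"
    unfolding X_V by (rule separates_subset[OF separates_tau[OF fin_V V_ne proper_V inj_V] PV])
  interpret ps: power_sum P w d F
    by (rule power_sum.intro[OF point_functional.intro[OF fin_P] power_sum_axioms.intro[OF F_P F_nonzero]])
  define h where "h = hilbert_fun (Ann F)"
  define g where "g i = fs.dim (res P ` hp i)" for i
  \<comment> \<open>Here \<open>d - i \<ge> tau X\<close>, so forms of the complementary degree
    separate \<open>P\<close>.\<close>
  have h_g: "h i = g i" if "i \<le> d div 2" for i
  proof -
    have "separates (d - i) P" by (rule separates_mono[OF sep _ zero_P]) (use that d in linarith)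
    from ps.adim_eq_hdim[OF this _ w_nz] that show ?thesis
      unfolding h_def g_def hilbert_fun_def ps.hilbert_Ann by simp
  qed
  have tau_d: "tau X \<le> d div 2" using d by simp
  have finish: ?thesis
    if t: "2 \<le> t" "2 * t \<le> d" "g t = card P"
      and "(g (t - 1) + 1 = card P \<and> g (t - 2) + 2 = card P \<and>
          (card P = t + 2 \<or> card P = t + 3 \<or> (card P = t + 4 \<and> g 2 = 6)))
        \<or> (card P = 2 * t + 1 \<and> g 2 = 5)
        \<or> (card P = 2 * t + 2 \<and> g 2 = 6 \<and> g (t - 1) + 2 = card P \<and> g (t - 2) + 4 = card P)" for t
  proof -
    have "separates t P" using t(3) unfolding g_def dim_eq_card_iff_separates[OF fin_P] .
    then have "weighted_points P w t d" by (intro weighted_points.intro fin_P proper_P w_nz t(2))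
    from weighted_points.exists_nondegenerate_form[OF this t(1) that(4)[unfolded g_def]]
    obtain l where "\<forall>i. 2 * i \<le> d \<longrightarrow> nondeg w (d - 2 * i) i P l" by (elim exE)
    then show ?thesis by (intro ps.strong_Lefschetz_of_nondegenerate_form) blast
  qed
  obtain m where m: "2 \<le> m" and
    shape: "strip_while (\<lambda>x. x = 0) (map (first_diff h) [0..<d div 2 + 1])
        \<in> {[1, 2] @ replicate m 1, [1, 2, 2] @ replicate m 1, [1, 2, 3] @ replicate m 1,
            [1] @ replicate m 2, [1, 2, 3] @ replicate m 2}"
    using Delta unfolding h_def by (elim exE conjE)
  have profile: "2 * (k + m) \<le> d" "g (k + m) = card P" "int (card P) = int (h k) + c * int m"
      "int (g (k + m - 1)) + c = int (card P)" "int (g (k + m - 2)) + 2 * c = int (card P)"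
      "\<And>i. i \<le> k \<Longrightarrow> first_diff h i = pre ! i" "g 2 = h 2" "int (h (k + 2)) = int (h k) + c * 2"
    if strip: "strip_while (\<lambda>x. x = 0) (map (first_diff h) [0..<d div 2 + 1]) = pre @ replicate m c"
      and k: "length pre = Suc k" for pre k c
  proof -
    note hp = hilbert_profile[OF strip k]
    have km: "k + m \<le> d div 2" using hp(1) by simp
    show "2 * (k + m) \<le> d" using km by presburger
    \<comment> \<open>\<open>P\<close> may be smaller than the given point set and be separated
      before degree \<open>tau X\<close>. If \<open>k + m \<le> tau X\<close>, the zero differences
      up to \<open>d div 2\<close> carry the value at \<open>tau X\<close> back to
      \<open>k + m\<close>; otherwise separation passes on to the higher degree.\<close>
    show card: "g (k + m) = card P"
    proof (cases "k + m \<le> tau X")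
      case True
      have "h (tau X) = h (k + m)" by (rule hp(4)[OF True]) (use tau_d in simp)
      then have "g (k + m) = g (tau X)" using h_g[OF km] h_g[OF tau_d] by simp
      also have "\<dots> = card P" unfolding g_def using sep by (simp only: dim_eq_card_iff_separates[OF fin_P])
      finally show ?thesis .
    next
      case False
      then have "separates (k + m) P" by (intro separates_mono[OF sep _ zero_P]) simp
      then show ?thesis unfolding g_def by (simp only: dim_eq_card_iff_separates[OF fin_P])
    qed
    have val: "int (g (k + j)) = int (h k) + c * int j" if j: "j \<le> m" for j
      using hp(3)[OF j] h_g[of "k + j"] j km by simp
    show *: "int (card P) = int (h k) + c * int m" using val[of m] card by simp
    have e: "k + m - 1 = k + (m - 1)" "k + m - 2 = k + (m - 2)" "int (m - 1) = int m - 1" "int (m - 2) = int m - 2"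
      using m by auto
    show "int (g (k + m - 1)) + c = int (card P)" "int (g (k + m - 2)) + 2 * c = int (card P)"
      unfolding e(1,2) * using val[of "m - 1"] val[of "m - 2"] unfolding e(3,4) by (simp_all add: algebra_simps)
    show "first_diff h i = pre ! i" if i: "i \<le> k" for i by (rule hp(2)[OF i])
    show "g 2 = h 2" using h_g[of 2] km m by simp
    show "int (h (k + 2)) = int (h k) + c * 2" using hp(3)[OF m] by simp
  qed
  have h0: "int (h 0) = first_diff h 0" by (simp add: first_diff_def)
  have h1: "int (h 1) = int (h 0) + first_diff h 1" using first_diff_Suc[of h 0] by simp
  have h2: "int (h 2) = int (h 1) + first_diff h 2"
    using first_diff_Suc[of h 1] by (simp only: Suc_1)
  from shape consider
    (a) "strip_while (\<lambda>x. x = 0) (map (first_diff h) [0..<d div 2 + 1]) = [1, 2] @ replicate m 1"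
    | (b) "strip_while (\<lambda>x. x = 0) (map (first_diff h) [0..<d div 2 + 1]) = [1, 2, 2] @ replicate m 1"
    | (c) "strip_while (\<lambda>x. x = 0) (map (first_diff h) [0..<d div 2 + 1]) = [1, 2, 3] @ replicate m 1"
    | (d) "strip_while (\<lambda>x. x = 0) (map (first_diff h) [0..<d div 2 + 1]) = [1] @ replicate m 2"
    | (e) "strip_while (\<lambda>x. x = 0) (map (first_diff h) [0..<d div 2 + 1]) = [1, 2, 3] @ replicate m 2"
    unfolding insert_iff empty_iff by argo
  then show ?thesis
  proof cases
    case a
    have "int (h 1) = 3" using h0 h1 profile(6)[OF a, of 1 0] profile(6)[OF a, of 1 1] by simp
    then show ?thesis
      using profile(1-5)[OF a, of 1] m by (intro finish[of "1 + m"]) auto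
  next
    case b
    have "int (h 2) = 5"
      using h0 h1 h2 profile(6)[OF b, of 2 0] profile(6)[OF b, of 2 1] profile(6)[OF b, of 2 2] by simp
    then show ?thesis
      using profile(1-5)[OF b, of 2] m by (intro finish[of "2 + m"]) auto
  next
    case c
    have "int (h 2) = 6"
      using h0 h1 h2 profile(6)[OF c, of 2 0] profile(6)[OF c, of 2 1] profile(6)[OF c, of 2 2] by simp
    then show ?thesis
      using profile(1-5,7)[OF c, of 2] m by (intro finish[of "2 + m"]) auto
  next
    case d
    have "int (h 0) = 1" using h0 profile(6)[OF d, of 0 0] by simp
    \<comment> \<open>Degree \<open>2\<close> lies in the constant stretch because
      \<open>m \<ge> 2\<close>; the value is \<open>5\<close>, so a conic passes through
      \<open>P\<close>.\<close>
    moreover have "int (h 2) = int (h 0) + 2 * 2" using profile(8)[OF d, of 0, unfolded add_0] by simp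
    ultimately show ?thesis
      using profile(1-5,7)[OF d, of 0] m by (intro finish[of "0 + m"]) auto
  next
    case e
    have "int (h 2) = 6"
      using h0 h1 h2 profile(6)[OF e, of 2 0] profile(6)[OF e, of 2 1] profile(6)[OF e, of 2 2] by simp
    then show ?thesis
      using profile(1-5,7)[OF e, of 2] m by (intro finish[of "2 + m"]) auto
  qed
qed

end
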